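(* If $\mathcal{A}$ is a filtered dg-category and $Tw(\mathcal{A})$ is its filtered pre-triangulated completion, then the degree-$0$ cohomology category $H^0(Tw(\mathcal{A}))$ is a triangulated persistence category.
   Context: Fix a field $k$. FILTERED DG-CATEGORIES. A filtered cochain complex is a triple $(X,\partial,\ell)$ with $(X,\partial)$ a cochain complex over $k$ and $\ell:X\to\mathbb R\cup\{-\infty\}$ such that $\ell(\lambda a+b)\le\max\{\ell(a),\ell(b)\}$ for $\lambda\in k\setminus\{0\}$, $\ell(a)=-\infty$ iff $a=0$, $\ell(\partial a)\le\ell(a)$; $X^{\le r}=\{\ell\le r\}$. Tensor products carry $\ell(a\otimes b)=\ell(a)+\ell(b)$ and the usual differential. A filtered dg-category $\mathcal A$ is a preadditive category whose hom-sets are filtered cochain complexes $(\mathrm{Hom}_{\mathcal A}(A,B),\partial,\ell_{AB})$, identities being closed with $\ell(\mathbb 1_A)=0$, such that composition $\mathrm{Hom}(B,C)\otimes \mathrm{Hom}(A,B)\to \mathrm{Hom}(A,C)$ is a filtered chain map ($\ell(g\circ f)\le\ell(g)+\ell(f)$ and the Leibniz rule holds; it is thus compatible with the inclusions of filtration levels). Sign conventions are those of Bondal–Kapranov. SHIFT COMPLETION. $\Sigma\mathcal A$ has objects $\Sigma^rA[d]$, $A\in\mathrm{Obj}(\mathcal A)$, $r\in\mathbb R$, $d\in\mathbb Z$ (with $\Sigma^0A=A$, $\Sigma^s\Sigma^rA=\Sigma^{r+s}A$, $A[0]=A$, $A[d_1][d_2]=A[d_1+d_2]$, $(\Sigma^rA)[d]=\Sigma^r(A[d])$).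 $\mathrm{Hom}(\Sigma^rA[d_A],\Sigma^sB[d_B])$ is the cochain complex $\mathrm{Hom}_{\mathcal A}(A,B)$ with degrees shifted by $d_B-d_A$ (an element of degree $i$ in $\mathrm{Hom}_{\mathcal A}(A,B)$ gets degree $i+d_B-d_A$) and filtration function $\ell_{AB}+s-r$. TWISTED COMPLEXES AND $Tw(\mathcal A)$. A filtered (one-sided) twisted complex is a pair $A=\left(\bigoplus_{i=1}^n\Sigma^{r_i}A_i[d_i],\,q=(q_{ij})_{1\le i,j\le n}\right)$ where $q_{ij}\in \mathrm{Hom}_{\Sigma\mathcal A}(\Sigma^{r_j}A_j[d_j],\Sigma^{r_i}A_i[d_i])$ has degree $1$, $q_{ij}=0$ for $i\ge j$, $d_{\mathrm{Hom}}q_{ij}+\sum_k q_{ik}\circ q_{kj}=0$, and each $q_{ij}$ has filtration level $\le 0$. The filtered pre-triangulated completion $Tw(\mathcal A)$ has these as objects; a morphism from $(\bigoplus\Sigma^{r_j}A_j[d_j],q)$ to $(\bigoplus\Sigma^{r'_i}A'_i[d'_i],q')$ is a matrix $f=(f_{ij})$ with $f_{ij}\in\mathrm{Hom}_{\Sigma\mathcal A}(\Sigma^{r_j}A_j[d_j],\Sigma^{r'_i}A'_i[d'_i])$; the differential is $d(f)=(d_{\mathrm{Hom}}f_{ij})+q'f-(-1)^lfq$ when the $f_{ij}$ have degree $l$; composition is matrix multiplication; the filtration function is $\ell(f)=\max_{i,j}\ell(f_{ij})$. $Tw(\mathcal A)$ is a filtered dg-category. COHOMOLOGY CATEGORY.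 $H^0(Tw(\mathcal A))$ has the same objects as $Tw(\mathcal A)$ and $\mathrm{Mor}^r(A,B)=H^0(\mathrm{Hom}^{\le r}_{Tw(\mathcal A)}(A,B))$, with structure maps $i_{r,s}$ induced by inclusions $\mathrm{Hom}^{\le r}\subset\mathrm{Hom}^{\le s}$. Its shift functor is induced by $\Sigma^r$ acting on objects by adding $r$ to all the shifts $r_i$ and identically on (matrices of) morphisms, with natural transformations $(\eta_{r,s})_A:\Sigma^rA\to\Sigma^sA$ induced by the identity of $A$. TRIANGULATED PERSISTENCE CATEGORIES. A persistence category $\mathcal C$ is a category in which, for all objects $A,B$, there are $k$-vector spaces $\mathrm{Mor}^r(A,B)$, $r\in\mathbb R$ (morphisms of shift $r$), and linear structure maps $i_{r,s}:\mathrm{Mor}^r(A,B)\to \mathrm{Mor}^s(A,B)$ for $r\le s$ with $i_{r,r}=\mathrm{id}$, $i_{s,t}\circ i_{r,s}=i_{r,t}$, such that $\mathrm{Hom}_{\mathcal C}(A,B)=\{(f,r): f\in \mathrm{Mor}^r(A,B)\}$, $\mathbb 1_A\in\mathrm{Mor}^0(A,A)$, and composition restricts to bilinear maps $\mathrm{Mor}^r(A,B)\times \mathrm{Mor}^s(B,C)\to \mathrm{Mor}^{r+s}(A,C)$ with $i_{s,s'}(g)\circ i_{r,r'}(f)=i_{r+s,r'+s'}(g\circ f)$. $\mathcal C_0$ is the category with the same objects and morphisms $\mathrm{Mor}^0$. $K$ is $r$-acyclic if $i_{0,r}(\mathbb 1_K)=0$. A persistence endofunctor is a functor preserving shifts of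 morphisms, linear on each $\mathrm{Mor}^r$ and commuting with the $i_{r,s}$. A shift functor $\Sigma$ is a family of persistence endofunctors $\Sigma^r$ ($r\in\mathbb R$) with $\Sigma^0=\mathrm{id}$, $\Sigma^r\Sigma^s=\Sigma^{r+s}$, together with natural transformations $\eta_{r,s}:\Sigma^r\to\Sigma^s$ with components in $\mathrm{Mor}^{s-r}(\Sigma^rA,\Sigma^sA)$, such that $\eta_{r,r}=\mathbb 1$, $\eta_{s,t}\circ\eta_{r,s}=\eta_{r,t}$, $\Sigma^r((\eta_{s,s'})_A)=(\eta_{r+s,r+s'})_A=(\eta_{s,s'})_{\Sigma^rA}$. For $r\ge0$, $\eta^A_r=i_{-r,0}((\eta_{r,0})_A)\in\mathrm{Mor}^0(\Sigma^rA,A)$. A triangulated persistence category is a persistence category $\mathcal C$ with a shift functor $\Sigma$ such that: (i) $\mathcal C_0$ is triangulated with translation automorphism $T$, and for $r\le0$ the canonical maps give $\mathrm{Mor}^r(A\oplus B,C)=\mathrm{Mor}^r(A,C)\oplus \mathrm{Mor}^r(B,C)$ compatibly with the $i_{r,s}$, $r\le s\le0$, and similarly in the second variable; (ii) each $\Sigma^r$ restricts to a triangulated (in particular additive) endofunctor of $\mathcal C_0$, commuting with $T$, and the $\eta_{r,s}$ are compatible with the additive structure on $\mathcal C_0$; (iii) for all $r\ge0$ and all $A$, $\eta_r^A$ embeds into an exact triangle $\Sigma^rA\xrightarrow{\eta_r^A} A\to K\to T\Sigma^rA$ of $\mathcal C_0$ with $K$ $r$-acyclic. *)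

theory Defs
  imports "HOL-Library.Extended_Real" "HOL-Algebra.AbelCoset" "HOL-Algebra.Module"
begin

section \<open>Linear algebra\<close>

text \<open>Vector spaces over a field \<open>K\<close> are modules in the sense of the locale
  \<^locale>\<open>module\<close>. The fields \<^const>\<open>monoid.mult\<close> and \<^const>\<open>monoid.one\<close> that the record
  type \<^typ>\<open>('k, 'm) module\<close> inherits from rings play no role.\<close>

definition linear_map ::
  "('k, 'e) ring_scheme \<Rightarrow> ('k, 'm, 'c) module_scheme \<Rightarrow> ('k, 'n, 'd) module_scheme \<Rightarrow> ('m \<Rightarrow> 'n) \<Rightarrow> bool"
  where
  "linear_map K M N f \<longleftrightarrow>
     f \<in> carrier M \<rightarrow> carrier N \<and>
     (\<forall>x\<in>carrier M. \<forall>y\<in>carrier M. f (x \<oplus>\<^bsub>M\<^esub> y) = f x \<oplus>\<^bsub>N\<^esub> f y) \<and>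
     (\<forall>a\<in>carrier K. \<forall>x\<in>carrier M. f (a \<odot>\<^bsub>M\<^esub> x) = a \<odot>\<^bsub>N\<^esub> f x)"

text \<open>\<open>alt_sign M l x\<close> is \<open>(- 1)\<^sup>l x\<close>.\<close>

definition alt_sign :: "('m, 'c) ring_scheme \<Rightarrow> int \<Rightarrow> 'm \<Rightarrow> 'm" where
  "alt_sign M l x = (if even l then x else \<ominus>\<^bsub>M\<^esub> x)"


section \<open>Filtered cochain complexes and filtered dg-categories\<close>

text \<open>A complex is given by its homogeneous parts; the differential and the filtration function
  take the degree of their argument as a parameter, because nothing forces the carriers of
  different degrees to be disjoint. The value \<open>\<infinity>\<close> of \<^typ>\<open>ereal\<close> is excluded for \<open>flev\<close>.\<close>

record ('k, 'm) fcomplex =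
  gpart :: "int \<Rightarrow> ('k, 'm) module"
  bdry  :: "int \<Rightarrow> 'm \<Rightarrow> 'm"
  flev  :: "int \<Rightarrow> 'm \<Rightarrow> ereal"

locale filtered_complex = field K for K (structure) +
  fixes X :: "('a, 'm, 'z) fcomplex_scheme"
  assumes gpart_module: "module K (gpart X i)"
    and bdry_linear: "linear_map K (gpart X i) (gpart X (i + 1)) (bdry X i)"
    and bdry_bdry: "x \<in> carrier (gpart X i) \<Longrightarrow>
      bdry X (i + 1) (bdry X i x) = \<zero>\<^bsub>gpart X (i + 1 + 1)\<^esub>"
    and flev_finite: "x \<in> carrier (gpart X i) \<Longrightarrow> flev X i x \<noteq> \<infinity>"
    and flev_eq_minf: "x \<in> carrier (gpart X i) \<Longrightarrow>
      flev X i x = -\<infinity> \<longleftrightarrow> x = \<zero>\<^bsub>gpart X i\<^esub>"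
    and flev_lincomb: "\<lbrakk>a \<in> carrier K - {\<zero>}; x \<in> carrier (gpart X i); y \<in> carrier (gpart X i)\<rbrakk> \<Longrightarrow>
      flev X i (a \<odot>\<^bsub>gpart X i\<^esub> x \<oplus>\<^bsub>gpart X i\<^esub> y) \<le> max (flev X i x) (flev X i y)"
    and flev_bdry: "x \<in> carrier (gpart X i) \<Longrightarrow> flev X (i + 1) (bdry X i x) \<le> flev X i x"

text \<open>\<open>dgcomp A X Y Z j i g f\<close> is the composite of \<open>f : X \<rightarrow> Y\<close> of degree \<open>i\<close> and
  \<open>g : Y \<rightarrow> Z\<close> of degree \<open>j\<close>.\<close>

record ('o, 'k, 'm) fdg_category =
  dgobj  :: "'o set"
  dghom  :: "'o \<Rightarrow> 'o \<Rightarrow> ('k, 'm) fcomplex"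
  dgcomp :: "'o \<Rightarrow> 'o \<Rightarrow> 'o \<Rightarrow> int \<Rightarrow> int \<Rightarrow> 'm \<Rightarrow> 'm \<Rightarrow> 'm"
  dgid   :: "'o \<Rightarrow> 'm"

locale filtered_dg_category = field K for K (structure) +
  fixes A :: "('o, 'a, 'm, 'z) fdg_category_scheme"
  assumes dghom_complex: "\<lbrakk>X \<in> dgobj A; Y \<in> dgobj A\<rbrakk> \<Longrightarrow> filtered_complex K (dghom A X Y)"
    and dgid_closed: "X \<in> dgobj A \<Longrightarrow> dgid A X \<in> carrier (gpart (dghom A X X) 0)"
    and bdry_dgid: "X \<in> dgobj A \<Longrightarrow> bdry (dghom A X X) 0 (dgid A X) = \<zero>\<^bsub>gpart (dghom A X X) 1\<^esub>"
    and flev_dgid: "X \<in> dgobj A \<Longrightarrow> flev (dghom A X X) 0 (dgid A X) = 0"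
    and dgcomp_linear_right:
      "\<lbrakk>X \<in> dgobj A; Y \<in> dgobj A; Z \<in> dgobj A; g \<in> carrier (gpart (dghom A Y Z) j)\<rbrakk> \<Longrightarrow>
       linear_map K (gpart (dghom A X Y) i) (gpart (dghom A X Z) (j + i)) (\<lambda>f. dgcomp A X Y Z j i g f)"
    and dgcomp_linear_left:
      "\<lbrakk>X \<in> dgobj A; Y \<in> dgobj A; Z \<in> dgobj A; f \<in> carrier (gpart (dghom A X Y) i)\<rbrakk> \<Longrightarrow>
       linear_map K (gpart (dghom A Y Z) j) (gpart (dghom A X Z) (j + i)) (\<lambda>g. dgcomp A X Y Z j i g f)"
    and dgcomp_assoc:
      "\<lbrakk>W \<in> dgobj A; X \<in> dgobj A; Y \<in> dgobj A; Z \<in> dgobj A;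
        f \<in> carrier (gpart (dghom A W X) i); g \<in> carrier (gpart (dghom A X Y) j);
        h \<in> carrier (gpart (dghom A Y Z) l)\<rbrakk> \<Longrightarrow>
       dgcomp A W X Z (l + j) i (dgcomp A X Y Z l j h g) f
         = dgcomp A W Y Z l (j + i) h (dgcomp A W X Y j i g f)"
    and dgcomp_id_left:
      "\<lbrakk>X \<in> dgobj A; Y \<in> dgobj A; f \<in> carrier (gpart (dghom A X Y) i)\<rbrakk> \<Longrightarrow>
       dgcomp A X Y Y 0 i (dgid A Y) f = f"
    and dgcomp_id_right:
      "\<lbrakk>X \<in> dgobj A; Y \<in> dgobj A; f \<in> carrier (gpart (dghom A X Y) i)\<rbrakk> \<Longrightarrow>
       dgcomp A X X Y i 0 f (dgid A X) = f"
    and leibniz: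
      "\<lbrakk>X \<in> dgobj A; Y \<in> dgobj A; Z \<in> dgobj A;
        f \<in> carrier (gpart (dghom A X Y) i); g \<in> carrier (gpart (dghom A Y Z) j)\<rbrakk> \<Longrightarrow>
       bdry (dghom A X Z) (j + i) (dgcomp A X Y Z j i g f)
         = dgcomp A X Y Z (j + 1) i (bdry (dghom A Y Z) j g) f
           \<oplus>\<^bsub>gpart (dghom A X Z) (j + i + 1)\<^esub>
           alt_sign (gpart (dghom A X Z) (j + i + 1)) j
             (dgcomp A X Y Z j (i + 1) g (bdry (dghom A X Y) i f))"
    and flev_dgcomp:
      "\<lbrakk>X \<in> dgobj A; Y \<in> dgobj A; Z \<in> dgobj A;
        f \<in> carrier (gpart (dghom A X Y) i); g \<in> carrier (gpart (dghom A Y Z) j)\<rbrakk> \<Longrightarrow>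
       flev (dghom A X Z) (j + i) (dgcomp A X Y Z j i g f)
         \<le> flev (dghom A Y Z) j g + flev (dghom A X Y) i f"


section \<open>The shift completion\<close>

text \<open>\<open>Shift r X d\<close> is the formal object \<open>\<Sigma>\<^sup>r X[d]\<close>.\<close>

datatype 'o shifted = Shift (rshift: real) (base: 'o) (dshift: int)

definition add_shift :: "real \<Rightarrow> 'o shifted \<Rightarrow> 'o shifted" where
  "add_shift t S = Shift (rshift S + t) (base S) (dshift S)"

text \<open>Composition is that of the given category, without signs. The differential on the
  morphisms from \<open>\<Sigma>\<^sup>r X[d]\<close> to \<open>\<Sigma>\<^sup>s Y[e]\<close> is \<open>(- 1)\<^sup>e\<close> times the original one, as in
  Bondal and Kapranov: with unsigned composition the Leibniz rule for the shifted degrees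
  forces this sign, once the differential is unchanged for \<open>d = e = 0\<close>.\<close>

definition shift_completion ::
  "('o, 'k, 'm) fdg_category \<Rightarrow> ('o shifted, 'k, 'm) fdg_category" where
  "shift_completion A = \<lparr>
     dgobj = {S. base S \<in> dgobj A},
     dghom = (\<lambda>S T.
       let H = dghom A (base S) (base T); e = dshift T - dshift S in
       \<lparr> gpart = (\<lambda>i. gpart H (i - e)),
         bdry = (\<lambda>i f. alt_sign (gpart H (i - e + 1)) (dshift T) (bdry H (i - e) f)),
         flev = (\<lambda>i f. flev H (i - e) f + ereal (rshift T - rshift S)) \<rparr>),
     dgcomp = (\<lambda>S T U j i g f.
       dgcomp A (base S) (base T) (base U)
         (j - (dshift U - dshift T)) (i - (dshift T - dshift S)) g f),
     dgid = (\<lambda>S. dgid A (base S)) \<rparr>"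


section \<open>Twisted complexes\<close>

text \<open>The \<open>n\<close> summands are indexed by \<open>0, \<dots>, n - 1\<close>; \<open>n = 0\<close> gives the zero object.
  Matrices are functions of the index pair (row, column) that take the value
  \<^const>\<open>undefined\<close> outside the index range, so that equal matrices are equal functions.\<close>

record ('o, 'm) twisted =
  summands :: "'o shifted list"
  tmat :: "nat \<times> nat \<Rightarrow> 'm"

abbreviation nsum :: "('o, 'm) twisted \<Rightarrow> nat" where
  "nsum X \<equiv> length (summands X)"

abbreviation smd :: "('o, 'm) twisted \<Rightarrow> nat \<Rightarrow> 'o shifted" where
  "smd X i \<equiv> summands X ! i"

abbreviation shom ::
  "('o, 'k, 'm) fdg_category \<Rightarrow> 'o shifted \<Rightarrow> 'o shifted \<Rightarrow> ('k, 'm) fcomplex" where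
  "shom A \<equiv> dghom (shift_completion A)"

abbreviation scomp ::
  "('o, 'k, 'm) fdg_category \<Rightarrow> 'o shifted \<Rightarrow> 'o shifted \<Rightarrow> 'o shifted \<Rightarrow> int \<Rightarrow> int \<Rightarrow> 'm \<Rightarrow> 'm \<Rightarrow> 'm" where
  "scomp A \<equiv> dgcomp (shift_completion A)"

text \<open>The index pairs and the entry spaces of matrices from \<open>X\<close> to \<open>Y\<close>; the entry \<open>(i, j)\<close>
  is a morphism from the summand \<open>j\<close> of \<open>X\<close> to the summand \<open>i\<close> of \<open>Y\<close>.\<close>

abbreviation mat_indices :: "('o, 'm) twisted \<Rightarrow> ('o, 'm) twisted \<Rightarrow> (nat \<times> nat) set" where
  "mat_indices X Y \<equiv> {..<nsum Y} \<times> {..<nsum X}"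

abbreviation entry_complex ::
  "('o, 'k, 'm) fdg_category \<Rightarrow> ('o, 'm) twisted \<Rightarrow> ('o, 'm) twisted \<Rightarrow> nat \<times> nat \<Rightarrow> ('k, 'm) fcomplex" where
  "entry_complex A X Y p \<equiv> shom A (smd X (snd p)) (smd Y (fst p))"

definition mat_module ::
  "('o, 'k, 'm) fdg_category \<Rightarrow> ('o, 'm) twisted \<Rightarrow> ('o, 'm) twisted \<Rightarrow> int \<Rightarrow> ('k, nat \<times> nat \<Rightarrow> 'm) module"
  where
  "mat_module A X Y l = \<lparr>
     carrier = (\<Pi>\<^sub>E p \<in> mat_indices X Y. carrier (gpart (entry_complex A X Y p) l)),
     mult = undefined, one = undefined,
     zero = (\<lambda>p \<in> mat_indices X Y. \<zero>\<^bsub>gpart (entry_complex A X Y p) l\<^esub>),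
     add = (\<lambda>f g. \<lambda>p \<in> mat_indices X Y. f p \<oplus>\<^bsub>gpart (entry_complex A X Y p) l\<^esub> g p),
     smult = (\<lambda>a f. \<lambda>p \<in> mat_indices X Y. a \<odot>\<^bsub>gpart (entry_complex A X Y p) l\<^esub> f p) \<rparr>"

definition mat_comp ::
  "('o, 'k, 'm) fdg_category \<Rightarrow> ('o, 'm) twisted \<Rightarrow> ('o, 'm) twisted \<Rightarrow> ('o, 'm) twisted \<Rightarrow>
    int \<Rightarrow> int \<Rightarrow> (nat \<times> nat \<Rightarrow> 'm) \<Rightarrow> (nat \<times> nat \<Rightarrow> 'm) \<Rightarrow> (nat \<times> nat \<Rightarrow> 'm)"
  where
  "mat_comp A X Y Z m l g f = (\<lambda>(i, j) \<in> mat_indices X Z.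
     \<Oplus>\<^bsub>gpart (entry_complex A X Z (i, j)) (m + l)\<^esub> k \<in> {..<nsum Y}.
       scomp A (smd X j) (smd Y k) (smd Z i) m l (g (i, k)) (f (k, j)))"

definition mat_bdry ::
  "('o, 'k, 'm) fdg_category \<Rightarrow> ('o, 'm) twisted \<Rightarrow> ('o, 'm) twisted \<Rightarrow> int \<Rightarrow>
    (nat \<times> nat \<Rightarrow> 'm) \<Rightarrow> (nat \<times> nat \<Rightarrow> 'm)"
  where
  "mat_bdry A X Y l f = (\<lambda>p \<in> mat_indices X Y. bdry (entry_complex A X Y p) l (f p))"

definition twisted_complex :: "('o, 'k, 'm) fdg_category \<Rightarrow> ('o, 'm) twisted \<Rightarrow> bool" where
  "twisted_complex A X \<longleftrightarrow>
     set (summands X) \<subseteq> dgobj (shift_completion A) \<and>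
     tmat X \<in> carrier (mat_module A X X 1) \<and>
     (\<forall>i<nsum X. \<forall>j<nsum X. j \<le> i \<longrightarrow> tmat X (i, j) = \<zero>\<^bsub>gpart (entry_complex A X X (i, j)) 1\<^esub>) \<and>
     mat_bdry A X X 1 (tmat X) \<oplus>\<^bsub>mat_module A X X 2\<^esub> mat_comp A X X X 1 1 (tmat X) (tmat X)
       = \<zero>\<^bsub>mat_module A X X 2\<^esub> \<and>
     (\<forall>p\<in>mat_indices X X. flev (entry_complex A X X p) 1 (tmat X p) \<le> 0)"

text \<open>In \<open>flev\<close>, the supremum is a maximum over a finite set, and \<open>-\<infinity>\<close> for matrices without
  entries.\<close>

definition Tw ::
  "('o, 'k, 'm) fdg_category \<Rightarrow> (('o, 'm) twisted, 'k, nat \<times> nat \<Rightarrow> 'm) fdg_category" where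
  "Tw A = \<lparr>
     dgobj = {X. twisted_complex A X},
     dghom = (\<lambda>X Y.
       \<lparr> gpart = mat_module A X Y,
         bdry = (\<lambda>l f.
           mat_bdry A X Y l f
           \<oplus>\<^bsub>mat_module A X Y (l + 1)\<^esub> mat_comp A X Y Y 1 l (tmat Y) f
           \<ominus>\<^bsub>mat_module A X Y (l + 1)\<^esub>
             alt_sign (mat_module A X Y (l + 1)) l (mat_comp A X X Y l 1 f (tmat X))),
         flev = (\<lambda>l f. SUP p \<in> mat_indices X Y. flev (entry_complex A X Y p) l (f p)) \<rparr>),
     dgcomp = mat_comp A,
     dgid = (\<lambda>X. \<lambda>(i, j) \<in> mat_indices X X.
       if i = j then dgid (shift_completion A) (smd X i)
       else \<zero>\<^bsub>gpart (entry_complex A X X (i, j)) 0\<^esub>) \<rparr>"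

definition Tw_shift :: "real \<Rightarrow> ('o, 'm) twisted \<Rightarrow> ('o, 'm) twisted" where
  "Tw_shift t X = \<lparr> summands = map (add_shift t) (summands X), tmat = tmat X \<rparr>"


section \<open>Persistence categories\<close>

text \<open>\<open>pmor C r X Y\<close> is \<open>Mor\<^sup>r(X, Y)\<close>, \<open>pstr C r s X Y\<close> is the structure map \<open>i\<^sub>r\<^sub>,\<^sub>s\<close> on it, and
  \<open>pcomp C X Y Z s r g f\<close> is the composite of \<open>f\<close> in \<open>Mor\<^sup>r(X, Y)\<close> and \<open>g\<close> in
  \<open>Mor\<^sup>s(Y, Z)\<close>. A morphism of the underlying category is a pair \<open>(f, r)\<close> with \<open>f\<close> in
  \<open>Mor\<^sup>r(X, Y)\<close>; the locale states its category laws shift by shift.\<close>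

record ('o, 'k, 'm) pcategory =
  pobj  :: "'o set"
  pmor  :: "real \<Rightarrow> 'o \<Rightarrow> 'o \<Rightarrow> ('k, 'm) module"
  pstr  :: "real \<Rightarrow> real \<Rightarrow> 'o \<Rightarrow> 'o \<Rightarrow> 'm \<Rightarrow> 'm"
  pcomp :: "'o \<Rightarrow> 'o \<Rightarrow> 'o \<Rightarrow> real \<Rightarrow> real \<Rightarrow> 'm \<Rightarrow> 'm \<Rightarrow> 'm"
  pid   :: "'o \<Rightarrow> 'm"

locale persistence_category = field K for K (structure) +
  fixes C :: "('o, 'a, 'm, 'z) pcategory_scheme"
  assumes pmor_module: "\<lbrakk>X \<in> pobj C; Y \<in> pobj C\<rbrakk> \<Longrightarrow> module K (pmor C r X Y)"
    and pstr_linear: "\<lbrakk>X \<in> pobj C; Y \<in> pobj C; r \<le> s\<rbrakk> \<Longrightarrow>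
      linear_map K (pmor C r X Y) (pmor C s X Y) (pstr C r s X Y)"
    and pstr_refl: "\<lbrakk>X \<in> pobj C; Y \<in> pobj C; f \<in> carrier (pmor C r X Y)\<rbrakk> \<Longrightarrow>
      pstr C r r X Y f = f"
    and pstr_trans: "\<lbrakk>X \<in> pobj C; Y \<in> pobj C; r \<le> s; s \<le> t; f \<in> carrier (pmor C r X Y)\<rbrakk> \<Longrightarrow>
      pstr C s t X Y (pstr C r s X Y f) = pstr C r t X Y f"
    and pid_closed: "X \<in> pobj C \<Longrightarrow> pid C X \<in> carrier (pmor C 0 X X)"
    and pcomp_linear_right:
      "\<lbrakk>X \<in> pobj C; Y \<in> pobj C; Z \<in> pobj C; g \<in> carrier (pmor C s Y Z)\<rbrakk> \<Longrightarrow>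
       linear_map K (pmor C r X Y) (pmor C (s + r) X Z) (\<lambda>f. pcomp C X Y Z s r g f)"
    and pcomp_linear_left:
      "\<lbrakk>X \<in> pobj C; Y \<in> pobj C; Z \<in> pobj C; f \<in> carrier (pmor C r X Y)\<rbrakk> \<Longrightarrow>
       linear_map K (pmor C s Y Z) (pmor C (s + r) X Z) (\<lambda>g. pcomp C X Y Z s r g f)"
    and pcomp_assoc:
      "\<lbrakk>W \<in> pobj C; X \<in> pobj C; Y \<in> pobj C; Z \<in> pobj C;
        f \<in> carrier (pmor C r W X); g \<in> carrier (pmor C s X Y); h \<in> carrier (pmor C t Y Z)\<rbrakk> \<Longrightarrow>
       pcomp C W X Z (t + s) r (pcomp C X Y Z t s h g) f
         = pcomp C W Y Z t (s + r) h (pcomp C W X Y s r g f)"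
    and pcomp_id_left:
      "\<lbrakk>X \<in> pobj C; Y \<in> pobj C; f \<in> carrier (pmor C r X Y)\<rbrakk> \<Longrightarrow> pcomp C X Y Y 0 r (pid C Y) f = f"
    and pcomp_id_right:
      "\<lbrakk>X \<in> pobj C; Y \<in> pobj C; f \<in> carrier (pmor C r X Y)\<rbrakk> \<Longrightarrow> pcomp C X X Y r 0 f (pid C X) = f"
    and pcomp_pstr:
      "\<lbrakk>X \<in> pobj C; Y \<in> pobj C; Z \<in> pobj C; r \<le> r'; s \<le> s';
        f \<in> carrier (pmor C r X Y); g \<in> carrier (pmor C s Y Z)\<rbrakk> \<Longrightarrow>
       pcomp C X Y Z s' r' (pstr C s s' Y Z g) (pstr C r r' X Y f)
         = pstr C (s + r) (s' + r') X Z (pcomp C X Y Z s r g f)"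

definition acyclic_object :: "('o, 'k, 'm, 'z) pcategory_scheme \<Rightarrow> real \<Rightarrow> 'o \<Rightarrow> bool" where
  "acyclic_object C r X \<longleftrightarrow> pstr C 0 r X X (pid C X) = \<zero>\<^bsub>pmor C r X X\<^esub>"

text \<open>\<open>F\<close> acts on objects, and \<open>G r X Y\<close> is its action on \<open>Mor\<^sup>r(X, Y)\<close>.\<close>

definition persistence_endofunctor ::
  "('k, 'e) ring_scheme \<Rightarrow> ('o, 'k, 'm, 'z) pcategory_scheme \<Rightarrow> ('o \<Rightarrow> 'o) \<Rightarrow>
    (real \<Rightarrow> 'o \<Rightarrow> 'o \<Rightarrow> 'm \<Rightarrow> 'm) \<Rightarrow> bool"
  where
  "persistence_endofunctor K C F G \<longleftrightarrow>
     F \<in> pobj C \<rightarrow> pobj C \<and>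
     (\<forall>r. \<forall>X\<in>pobj C. \<forall>Y\<in>pobj C. linear_map K (pmor C r X Y) (pmor C r (F X) (F Y)) (G r X Y)) \<and>
     (\<forall>X\<in>pobj C. G 0 X X (pid C X) = pid C (F X)) \<and>
     (\<forall>r s. \<forall>X\<in>pobj C. \<forall>Y\<in>pobj C. \<forall>Z\<in>pobj C.
       \<forall>f\<in>carrier (pmor C r X Y). \<forall>g\<in>carrier (pmor C s Y Z).
         G (s + r) X Z (pcomp C X Y Z s r g f) = pcomp C (F X) (F Y) (F Z) s r (G s Y Z g) (G r X Y f)) \<and>
     (\<forall>r s. \<forall>X\<in>pobj C. \<forall>Y\<in>pobj C. r \<le> s \<longrightarrow>
       (\<forall>f\<in>carrier (pmor C r X Y). G s X Y (pstr C r s X Y f) = pstr C r s (F X) (F Y) (G r X Y f)))"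

text \<open>\<open>shobj S t\<close> and \<open>shmor S t r X Y\<close> are the actions of \<open>\<Sigma>\<^sup>t\<close> on objects and on
  \<open>Mor\<^sup>r(X, Y)\<close>; \<open>sheta S r s X\<close> is the component of \<open>\<eta>\<^sub>r\<^sub>,\<^sub>s\<close> at \<open>X\<close>.\<close>

record ('o, 'm) pshift =
  shobj :: "real \<Rightarrow> 'o \<Rightarrow> 'o"
  shmor :: "real \<Rightarrow> real \<Rightarrow> 'o \<Rightarrow> 'o \<Rightarrow> 'm \<Rightarrow> 'm"
  sheta :: "real \<Rightarrow> real \<Rightarrow> 'o \<Rightarrow> 'm"

locale shifted_persistence_category = persistence_category K C
  for K (structure) and C :: "('o, 'a, 'm, 'z) pcategory_scheme" +
  fixes S :: "('o, 'm, 'y) pshift_scheme"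
  assumes shift_endofunctor: "persistence_endofunctor K C (shobj S t) (shmor S t)"
    and shobj_zero: "X \<in> pobj C \<Longrightarrow> shobj S 0 X = X"
    and shmor_zero: "\<lbrakk>X \<in> pobj C; Y \<in> pobj C; f \<in> carrier (pmor C r X Y)\<rbrakk> \<Longrightarrow> shmor S 0 r X Y f = f"
    and shobj_add: "X \<in> pobj C \<Longrightarrow> shobj S t (shobj S u X) = shobj S (t + u) X"
    and shmor_add: "\<lbrakk>X \<in> pobj C; Y \<in> pobj C; f \<in> carrier (pmor C r X Y)\<rbrakk> \<Longrightarrow>
      shmor S t r (shobj S u X) (shobj S u Y) (shmor S u r X Y f) = shmor S (t + u) r X Y f"
    and sheta_closed: "X \<in> pobj C \<Longrightarrow>
      sheta S r s X \<in> carrier (pmor C (s - r) (shobj S r X) (shobj S s X))"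
    and sheta_natural: "\<lbrakk>X \<in> pobj C; Y \<in> pobj C; f \<in> carrier (pmor C t X Y)\<rbrakk> \<Longrightarrow>
      pcomp C (shobj S r X) (shobj S r Y) (shobj S s Y) (s - r) t (sheta S r s Y) (shmor S r t X Y f)
        = pcomp C (shobj S r X) (shobj S s X) (shobj S s Y) t (s - r) (shmor S s t X Y f) (sheta S r s X)"
    and sheta_refl: "X \<in> pobj C \<Longrightarrow> sheta S r r X = pid C (shobj S r X)"
    and sheta_trans: "X \<in> pobj C \<Longrightarrow>
      pcomp C (shobj S r X) (shobj S s X) (shobj S t X) (t - s) (s - r) (sheta S s t X) (sheta S r s X)
        = sheta S r t X"
    and shmor_sheta: "X \<in> pobj C \<Longrightarrow>
      shmor S r (s' - s) (shobj S s X) (shobj S s' X) (sheta S s s' X) = sheta S (r + s) (r + s') X"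
    and sheta_shobj: "X \<in> pobj C \<Longrightarrow> sheta S s s' (shobj S r X) = sheta S (r + s) (r + s') X"

text \<open>\<open>\<eta>\<^sub>r\<^sup>X : \<Sigma>\<^sup>r X \<rightarrow> X\<close> in \<open>Mor\<^sup>0\<close>, for \<open>r \<ge> 0\<close>.\<close>

definition eta_obj ::
  "('o, 'k, 'm, 'z) pcategory_scheme \<Rightarrow> ('o, 'm, 'y) pshift_scheme \<Rightarrow> real \<Rightarrow> 'o \<Rightarrow> 'm" where
  "eta_obj C S r X = pstr C (- r) 0 (shobj S r X) X (sheta S r 0 X)"


section \<open>Triangulated categories\<close>

record ('o, 'm, 'h) precategory =
  cobj  :: "'o set"
  chom  :: "'o \<Rightarrow> 'o \<Rightarrow> ('m, 'h) ring_scheme"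
  ccomp :: "'o \<Rightarrow> 'o \<Rightarrow> 'o \<Rightarrow> 'm \<Rightarrow> 'm \<Rightarrow> 'm"
  cid   :: "'o \<Rightarrow> 'm"

text \<open>\<open>chom D X Y\<close> is used as an abelian group, and \<open>ccomp D X Y Z g f\<close> is the composite of
  \<open>f : X \<rightarrow> Y\<close> and \<open>g : Y \<rightarrow> Z\<close>.\<close>

locale preadditive_category =
  fixes D :: "('o, 'm, 'h) precategory"
  assumes chom_group: "\<lbrakk>X \<in> cobj D; Y \<in> cobj D\<rbrakk> \<Longrightarrow> abelian_group (chom D X Y)"
    and cid_closed: "X \<in> cobj D \<Longrightarrow> cid D X \<in> carrier (chom D X X)"
    and ccomp_closed:
      "\<lbrakk>X \<in> cobj D; Y \<in> cobj D; Z \<in> cobj D; f \<in> carrier (chom D X Y); g \<in> carrier (chom D Y Z)\<rbrakk> \<Longrightarrow>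
       ccomp D X Y Z g f \<in> carrier (chom D X Z)"
    and ccomp_add_right:
      "\<lbrakk>X \<in> cobj D; Y \<in> cobj D; Z \<in> cobj D;
        f \<in> carrier (chom D X Y); f' \<in> carrier (chom D X Y); g \<in> carrier (chom D Y Z)\<rbrakk> \<Longrightarrow>
       ccomp D X Y Z g (f \<oplus>\<^bsub>chom D X Y\<^esub> f') = ccomp D X Y Z g f \<oplus>\<^bsub>chom D X Z\<^esub> ccomp D X Y Z g f'"
    and ccomp_add_left:
      "\<lbrakk>X \<in> cobj D; Y \<in> cobj D; Z \<in> cobj D;
        f \<in> carrier (chom D X Y); g \<in> carrier (chom D Y Z); g' \<in> carrier (chom D Y Z)\<rbrakk> \<Longrightarrow>
       ccomp D X Y Z (g \<oplus>\<^bsub>chom D Y Z\<^esub> g') f = ccomp D X Y Z g f \<oplus>\<^bsub>chom D X Z\<^esub> ccomp D X Y Z g' f"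
    and ccomp_assoc:
      "\<lbrakk>W \<in> cobj D; X \<in> cobj D; Y \<in> cobj D; Z \<in> cobj D;
        f \<in> carrier (chom D W X); g \<in> carrier (chom D X Y); h \<in> carrier (chom D Y Z)\<rbrakk> \<Longrightarrow>
       ccomp D W X Z (ccomp D X Y Z h g) f = ccomp D W Y Z h (ccomp D W X Y g f)"
    and ccomp_id_left:
      "\<lbrakk>X \<in> cobj D; Y \<in> cobj D; f \<in> carrier (chom D X Y)\<rbrakk> \<Longrightarrow> ccomp D X Y Y (cid D Y) f = f"
    and ccomp_id_right:
      "\<lbrakk>X \<in> cobj D; Y \<in> cobj D; f \<in> carrier (chom D X Y)\<rbrakk> \<Longrightarrow> ccomp D X X Y f (cid D X) = f"

definition zero_object :: "('o, 'm, 'h) precategory \<Rightarrow> 'o \<Rightarrow> bool" where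
  "zero_object D Z \<longleftrightarrow> Z \<in> cobj D \<and>
     (\<forall>X\<in>cobj D. carrier (chom D X Z) = {\<zero>\<^bsub>chom D X Z\<^esub>} \<and> carrier (chom D Z X) = {\<zero>\<^bsub>chom D Z X\<^esub>})"

definition isomorphism :: "('o, 'm, 'h) precategory \<Rightarrow> 'o \<Rightarrow> 'o \<Rightarrow> 'm \<Rightarrow> bool" where
  "isomorphism D X Y f \<longleftrightarrow> f \<in> carrier (chom D X Y) \<and>
     (\<exists>g\<in>carrier (chom D Y X). ccomp D X Y X g f = cid D X \<and> ccomp D Y X Y f g = cid D Y)"

text \<open>\<open>P\<close> is a direct sum of \<open>X\<close> and \<open>Y\<close>, with injections \<open>jX\<close>, \<open>jY\<close> and
  projections \<open>pX\<close>, \<open>pY\<close>.\<close>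

definition biproduct ::
  "('o, 'm, 'h) precategory \<Rightarrow> 'o \<Rightarrow> 'o \<Rightarrow> 'o \<Rightarrow> 'm \<Rightarrow> 'm \<Rightarrow> 'm \<Rightarrow> 'm \<Rightarrow> bool" where
  "biproduct D X Y P jX jY pX pY \<longleftrightarrow>
     X \<in> cobj D \<and> Y \<in> cobj D \<and> P \<in> cobj D \<and>
     jX \<in> carrier (chom D X P) \<and> jY \<in> carrier (chom D Y P) \<and>
     pX \<in> carrier (chom D P X) \<and> pY \<in> carrier (chom D P Y) \<and>
     ccomp D X P X pX jX = cid D X \<and> ccomp D Y P Y pY jY = cid D Y \<and>
     ccomp D X P Y pY jX = \<zero>\<^bsub>chom D X Y\<^esub> \<and> ccomp D Y P X pX jY = \<zero>\<^bsub>chom D Y X\<^esub> \<and>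
     ccomp D P X P jX pX \<oplus>\<^bsub>chom D P P\<^esub> ccomp D P Y P jY pY = cid D P"

locale additive_category = preadditive_category D for D :: "('o, 'm, 'h) precategory" +
  assumes zero_object_exists: "\<exists>Z. zero_object D Z"
    and biproduct_exists: "\<lbrakk>X \<in> cobj D; Y \<in> cobj D\<rbrakk> \<Longrightarrow> \<exists>P jX jY pX pY. biproduct D X Y P jX jY pX pY"

text \<open>\<open>T\<close> and \<open>TM\<close> are the translation automorphism on objects and on morphisms.
  \<open>ET X Y Z u v w\<close> means that \<open>X \<rightarrow> Y \<rightarrow> Z \<rightarrow> T X\<close>, with maps \<open>u\<close>, \<open>v\<close>, \<open>w\<close>, is an
  exact triangle.\<close>

locale triangulated_category = additive_category D
  for D :: "('o, 'm, 'h) precategory" +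
  fixes T :: "'o \<Rightarrow> 'o"
    and TM :: "'o \<Rightarrow> 'o \<Rightarrow> 'm \<Rightarrow> 'm"
    and ET :: "'o \<Rightarrow> 'o \<Rightarrow> 'o \<Rightarrow> 'm \<Rightarrow> 'm \<Rightarrow> 'm \<Rightarrow> bool"
  assumes T_bij: "bij_betw T (cobj D) (cobj D)"
    and TM_bij: "\<lbrakk>X \<in> cobj D; Y \<in> cobj D\<rbrakk> \<Longrightarrow>
      bij_betw (TM X Y) (carrier (chom D X Y)) (carrier (chom D (T X) (T Y)))"
    and TM_add: "\<lbrakk>X \<in> cobj D; Y \<in> cobj D; f \<in> carrier (chom D X Y); f' \<in> carrier (chom D X Y)\<rbrakk> \<Longrightarrow>
      TM X Y (f \<oplus>\<^bsub>chom D X Y\<^esub> f') = TM X Y f \<oplus>\<^bsub>chom D (T X) (T Y)\<^esub> TM X Y f'"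
    and TM_id: "X \<in> cobj D \<Longrightarrow> TM X X (cid D X) = cid D (T X)"
    and TM_comp: "\<lbrakk>X \<in> cobj D; Y \<in> cobj D; Z \<in> cobj D;
        f \<in> carrier (chom D X Y); g \<in> carrier (chom D Y Z)\<rbrakk> \<Longrightarrow>
      TM X Z (ccomp D X Y Z g f) = ccomp D (T X) (T Y) (T Z) (TM Y Z g) (TM X Y f)"
    and ET_typed: "ET X Y Z u v w \<Longrightarrow>
      X \<in> cobj D \<and> Y \<in> cobj D \<and> Z \<in> cobj D \<and>
      u \<in> carrier (chom D X Y) \<and> v \<in> carrier (chom D Y Z) \<and> w \<in> carrier (chom D Z (T X))"
    and TR1_iso:
      "\<lbrakk>ET X Y Z u v w;
        X' \<in> cobj D; Y' \<in> cobj D; Z' \<in> cobj D;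
        u' \<in> carrier (chom D X' Y'); v' \<in> carrier (chom D Y' Z'); w' \<in> carrier (chom D Z' (T X'));
        isomorphism D X X' a; isomorphism D Y Y' b; isomorphism D Z Z' c;
        ccomp D X Y Y' b u = ccomp D X X' Y' u' a;
        ccomp D Y Z Z' c v = ccomp D Y Y' Z' v' b;
        ccomp D Z (T X) (T X') (TM X X' a) w = ccomp D Z Z' (T X') w' c\<rbrakk> \<Longrightarrow>
       ET X' Y' Z' u' v' w'"
    and TR1_id: "\<lbrakk>X \<in> cobj D; zero_object D Z\<rbrakk> \<Longrightarrow>
      ET X X Z (cid D X) \<zero>\<^bsub>chom D X Z\<^esub> \<zero>\<^bsub>chom D Z (T X)\<^esub>"
    and TR1_cone: "\<lbrakk>X \<in> cobj D; Y \<in> cobj D; u \<in> carrier (chom D X Y)\<rbrakk> \<Longrightarrow>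
      \<exists>Z v w. ET X Y Z u v w"
    and TR2: "\<lbrakk>X \<in> cobj D; Y \<in> cobj D; Z \<in> cobj D;
        u \<in> carrier (chom D X Y); v \<in> carrier (chom D Y Z); w \<in> carrier (chom D Z (T X))\<rbrakk> \<Longrightarrow>
      ET X Y Z u v w \<longleftrightarrow> ET Y Z (T X) v w (\<ominus>\<^bsub>chom D (T X) (T Y)\<^esub> TM X Y u)"
    and TR3:
      "\<lbrakk>ET X Y Z u v w; ET X' Y' Z' u' v' w';
        a \<in> carrier (chom D X X'); b \<in> carrier (chom D Y Y');
        ccomp D X Y Y' b u = ccomp D X X' Y' u' a\<rbrakk> \<Longrightarrow>
       \<exists>c\<in>carrier (chom D Z Z').
         ccomp D Y Z Z' c v = ccomp D Y Y' Z' v' b \<and>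
         ccomp D Z (T X) (T X') (TM X X' a) w = ccomp D Z Z' (T X') w' c"
    and TR4:
      "\<lbrakk>ET X Y Z' u i i'; ET Y Z X' v j j'; ET X Z Y' (ccomp D X Y Z v u) k k'\<rbrakk> \<Longrightarrow>
       \<exists>f\<in>carrier (chom D Z' Y'). \<exists>g\<in>carrier (chom D Y' X').
         ET Z' Y' X' f g (ccomp D X' (T Y) (T Z') (TM Y Z' i) j') \<and>
         ccomp D Y Z' Y' f i = ccomp D Y Z Y' k v \<and>
         ccomp D Z' Y' (T X) k' f = i' \<and>
         ccomp D Z Y' X' g k = j \<and>
         ccomp D Y' X' (T Y) j' g = ccomp D Y' (T X) (T Y) (TM X Y u) k'"


section \<open>Triangulated persistence categories\<close>

definition zero_level ::
  "('o, 'k, 'm, 'z) pcategory_scheme \<Rightarrow> ('o, 'm, ('k, 'm, unit) module_ext) precategory" where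
  "zero_level C = \<lparr> cobj = pobj C, chom = pmor C 0,
     ccomp = (\<lambda>X Y Z g f. pcomp C X Y Z 0 0 g f), cid = pid C \<rparr>"

locale tpc_structure = shifted_persistence_category K C S +
    triangulated_category "zero_level C" T TM ET
  for K :: "('a, 'e) ring_scheme" (structure)
    and C :: "('o, 'a, 'm, 'z) pcategory_scheme"
    and S :: "('o, 'm, 'y) pshift_scheme"
    and T :: "'o \<Rightarrow> 'o"
    and TM :: "'o \<Rightarrow> 'o \<Rightarrow> 'm \<Rightarrow> 'm"
    and ET :: "'o \<Rightarrow> 'o \<Rightarrow> 'o \<Rightarrow> 'm \<Rightarrow> 'm \<Rightarrow> 'm \<Rightarrow> bool" +
  assumes pmor_sum_left:
      "\<lbrakk>biproduct (zero_level C) X Y P jX jY pX pY; Z \<in> pobj C; r \<le> 0\<rbrakk> \<Longrightarrow>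
       bij_betw (\<lambda>h. (pcomp C X P Z r 0 h jX, pcomp C Y P Z r 0 h jY))
         (carrier (pmor C r P Z)) (carrier (pmor C r X Z) \<times> carrier (pmor C r Y Z))"
    and pmor_sum_left_pstr:
      "\<lbrakk>biproduct (zero_level C) X Y P jX jY pX pY; Z \<in> pobj C; r \<le> s; s \<le> 0;
        h \<in> carrier (pmor C r P Z)\<rbrakk> \<Longrightarrow>
       pcomp C X P Z s 0 (pstr C r s P Z h) jX = pstr C r s X Z (pcomp C X P Z r 0 h jX) \<and>
       pcomp C Y P Z s 0 (pstr C r s P Z h) jY = pstr C r s Y Z (pcomp C Y P Z r 0 h jY)"
    and pmor_sum_right:
      "\<lbrakk>biproduct (zero_level C) X Y P jX jY pX pY; Z \<in> pobj C; r \<le> 0\<rbrakk> \<Longrightarrow>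
       bij_betw (\<lambda>h. (pcomp C Z P X 0 r pX h, pcomp C Z P Y 0 r pY h))
         (carrier (pmor C r Z P)) (carrier (pmor C r Z X) \<times> carrier (pmor C r Z Y))"
    and pmor_sum_right_pstr:
      "\<lbrakk>biproduct (zero_level C) X Y P jX jY pX pY; Z \<in> pobj C; r \<le> s; s \<le> 0;
        h \<in> carrier (pmor C r Z P)\<rbrakk> \<Longrightarrow>
       pcomp C Z P X 0 s pX (pstr C r s Z P h) = pstr C r s Z X (pcomp C Z P X 0 r pX h) \<and>
       pcomp C Z P Y 0 s pY (pstr C r s Z P h) = pstr C r s Z Y (pcomp C Z P Y 0 r pY h)"
    and shift_translation_obj: "X \<in> pobj C \<Longrightarrow> shobj S t (T X) = T (shobj S t X)"
    and shift_translation_mor: "\<lbrakk>X \<in> pobj C; Y \<in> pobj C; f \<in> carrier (pmor C 0 X Y)\<rbrakk> \<Longrightarrow>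
      shmor S t 0 (T X) (T Y) (TM X Y f) = TM (shobj S t X) (shobj S t Y) (shmor S t 0 X Y f)"
    and shift_exact: "ET X Y Z u v w \<Longrightarrow>
      ET (shobj S t X) (shobj S t Y) (shobj S t Z)
         (shmor S t 0 X Y u) (shmor S t 0 Y Z v) (shmor S t 0 Z (T X) w)"
    and shift_biproduct: "biproduct (zero_level C) X Y P jX jY pX pY \<Longrightarrow>
      biproduct (zero_level C) (shobj S t X) (shobj S t Y) (shobj S t P)
        (shmor S t 0 X P jX) (shmor S t 0 Y P jY) (shmor S t 0 P X pX) (shmor S t 0 P Y pY)"
    and sheta_sum: "biproduct (zero_level C) X Y P jX jY pX pY \<Longrightarrow>
      sheta S r s P =
        pcomp C (shobj S r P) (shobj S s X) (shobj S s P) 0 (s - r) (shmor S s 0 X P jX)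
          (pcomp C (shobj S r P) (shobj S r X) (shobj S s X) (s - r) 0 (sheta S r s X) (shmor S r 0 P X pX))
        \<oplus>\<^bsub>pmor C (s - r) (shobj S r P) (shobj S s P)\<^esub>
        pcomp C (shobj S r P) (shobj S s Y) (shobj S s P) 0 (s - r) (shmor S s 0 Y P jY)
          (pcomp C (shobj S r P) (shobj S r Y) (shobj S s Y) (s - r) 0 (sheta S r s Y) (shmor S r 0 P Y pY))"
    and eta_triangle: "\<lbrakk>X \<in> pobj C; r \<ge> 0\<rbrakk> \<Longrightarrow>
      \<exists>Z v w. ET (shobj S r X) X Z (eta_obj C S r X) v w \<and> acyclic_object C r Z"

definition triangulated_persistence_category ::
  "('k, 'e) ring_scheme \<Rightarrow> ('o, 'k, 'm, 'z) pcategory_scheme \<Rightarrow> ('o, 'm, 'y) pshift_scheme \<Rightarrow> bool" where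
  "triangulated_persistence_category K C S \<longleftrightarrow> (\<exists>T TM ET. tpc_structure K C S T TM ET)"


section \<open>Degree zero cohomology\<close>

definition cocycles :: "('k, 'm, 'z) fcomplex_scheme \<Rightarrow> real \<Rightarrow> 'm set" where
  "cocycles X r = {z \<in> carrier (gpart X 0). flev X 0 z \<le> ereal r \<and> bdry X 0 z = \<zero>\<^bsub>gpart X 1\<^esub>}"

definition coboundaries :: "('k, 'm, 'z) fcomplex_scheme \<Rightarrow> real \<Rightarrow> 'm set" where
  "coboundaries X r = bdry X (- 1) ` {h \<in> carrier (gpart X (- 1)). flev X (- 1) h \<le> ereal r}"

definition cclass :: "('k, 'm, 'z) fcomplex_scheme \<Rightarrow> real \<Rightarrow> 'm \<Rightarrow> 'm set" where
  "cclass X r z = coboundaries X r +>\<^bsub>gpart X 0\<^esub> z"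

text \<open>\<open>H0_module X r\<close> is \<open>H\<^sup>0(X\<^sup>\<le>\<^sup>r)\<close>. Operations on classes are unions over representatives,
  in the style of the quotients in HOL-Algebra.\<close>

definition H0_module :: "('k, 'm, 'z) fcomplex_scheme \<Rightarrow> real \<Rightarrow> ('k, 'm set) module" where
  "H0_module X r = \<lparr>
     carrier = cclass X r ` cocycles X r,
     mult = undefined, one = undefined,
     zero = coboundaries X r,
     add = (\<lambda>U V. U <+>\<^bsub>gpart X 0\<^esub> V),
     smult = (\<lambda>a U. \<Union>x\<in>U. cclass X r (a \<odot>\<^bsub>gpart X 0\<^esub> x)) \<rparr>"

definition H0 :: "('o, 'k, 'm, 'z) fdg_category_scheme \<Rightarrow> ('o, 'k, 'm set) pcategory" where
  "H0 D = \<lparr>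
     pobj = dgobj D,
     pmor = (\<lambda>r X Y. H0_module (dghom D X Y) r),
     pstr = (\<lambda>r s X Y U. \<Union>x\<in>U. cclass (dghom D X Y) s x),
     pcomp = (\<lambda>X Y Z s r V U. \<Union>g\<in>V. \<Union>f\<in>U. cclass (dghom D X Z) (s + r) (dgcomp D X Y Z 0 0 g f)),
     pid = (\<lambda>X. cclass (dghom D X X) 0 (dgid D X)) \<rparr>"

text \<open>The shift functor on \<open>H0 (Tw A)\<close>. The identity matrix of \<open>X\<close> is used as a morphism
  \<open>\<Sigma>\<^sup>r X \<rightarrow> \<Sigma>\<^sup>s X\<close>, where its filtration level is at most \<open>s - r\<close>.\<close>

definition H0_Tw_shift ::
  "('o, 'k, 'm) fdg_category \<Rightarrow> (('o, 'm) twisted, (nat \<times> nat \<Rightarrow> 'm) set) pshift" where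
  "H0_Tw_shift A = \<lparr>
     shobj = Tw_shift,
     shmor = (\<lambda>t r X Y U. U),
     sheta = (\<lambda>r s X. cclass (dghom (Tw A) (Tw_shift r X) (Tw_shift s X)) (s - r) (dgid (Tw A) X)) \<rparr>"

end

theory Submission imports Defs begin

text \<open>
  A twisted complex carries a matrix \<open>q\<close> of degree \<open>1\<close> with \<open>\<delta> q + q q = 0\<close>. Matrices over the shift
  completion form a dg-category with levels (\<open>level_dg_matrices\<close>), and adding the graded commutator with
  such elements to the differential keeps all dg-axioms (\<open>level_dg_twisted\<close>); the levels survive because
  \<open>q\<close> has level at most \<open>0\<close>. This gives the dg-category \<open>Tw A\<close>.

  In any dg-category with levels, the cocycles of degree \<open>0\<close> and level at most \<open>r\<close>, modulo coboundaries of
  elements of level at most \<open>r\<close>, form a persistence category (\<open>persistence_category_H0\<close>). Homotopies have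
  to respect the level throughout, so a triangulation of the part of shift \<open>0\<close> needs contracting data of
  level at most \<open>0\<close>. A \<open>cone\<close> of \<open>u : X \<rightarrow> Y\<close> is therefore described by maps \<open>i : Y \<rightarrow> C\<close>, \<open>p : C \<rightarrow> X\<close>,
  \<open>j : X \<rightarrow> C\<close>, \<open>s : C \<rightarrow> Y\<close> of level at most \<open>0\<close> which split \<open>C\<close> as a graded object, together with their
  differentials. All homotopies in the axioms of a triangulated category are then explicit polynomials in
  these maps, and each axiom becomes an identity of noncommutative polynomials (\<open>cone_map\<close>, \<open>cone_factor\<close>,
  \<open>cone_rotate\<close>, \<open>cone_octahedron\<close>). What remains is formal: a class of standard triangles with these
  properties generates a triangulation (\<open>triangulated\<close>).

  A shift \<open>\<Sigma>\<^sup>r\<close> changes the levels of a hom-complex and nothing else. So \<open>\<eta> : \<Sigma>\<^sup>r X \<rightarrow> X\<close>, given by the identity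
  of \<open>X\<close>, has the inverse \<open>w\<close>, again given by the identity, but of level \<open>r\<close> instead of \<open>-r\<close>. For \<open>r \<ge> 0\<close> the
  cone of \<open>\<eta>\<close> is contracted by \<open>j w s\<close>, of level at most \<open>r\<close>; it is \<open>r\<close>-acyclic (\<open>eta_triangle_H0\<close>).

  Finally \<open>Tw A\<close> has cones of cocycles of level at most \<open>0\<close>, namely block triangular matrices
  (\<open>cone_complex_twisted\<close>). An element of degree \<open>l\<close> becomes one of degree \<open>l + d\<close> when its target is shifted
  by \<open>d\<close>, so the cone contains a copy of \<open>X\<close> shifted by \<open>-1\<close>, and the translation is the shift by \<open>-1\<close>.
\<close>

section \<open>Arrows of graded preadditive categories\<close>

text \<open>Composition in the definitions carries three objects and two degrees. Packing these into
  the arrow makes composition binary, so that identities between composites can be proved by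
  rewriting, with typing conditions that the simplifier computes from \<open>src\<close>, \<open>tgt\<close> and \<open>deg\<close>.\<close>

datatype ('o, 'd, 'm) arr = Arr (src: 'o) (tgt: 'o) (deg: 'd) (elt: 'm)

text \<open>The degrees are integers for dg-categories and real numbers (the shifts) for persistence
  categories.\<close>

locale graded_category =
  fixes Ob :: "'o set"
    and hm :: "'o \<Rightarrow> 'o \<Rightarrow> 'd::comm_monoid_add \<Rightarrow> ('m, 'h) ring_scheme"
    and cmp :: "'o \<Rightarrow> 'o \<Rightarrow> 'o \<Rightarrow> 'd \<Rightarrow> 'd \<Rightarrow> 'm \<Rightarrow> 'm \<Rightarrow> 'm"
    and idn :: "'o \<Rightarrow> 'm"
  assumes hm_group: "\<lbrakk>X \<in> Ob; Y \<in> Ob\<rbrakk> \<Longrightarrow> abelian_group (hm X Y i)"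
    and idn_closed: "X \<in> Ob \<Longrightarrow> idn X \<in> carrier (hm X X 0)"
    and cmp_closed:
      "\<lbrakk>X \<in> Ob; Y \<in> Ob; Z \<in> Ob; f \<in> carrier (hm X Y i); g \<in> carrier (hm Y Z j)\<rbrakk> \<Longrightarrow>
       cmp X Y Z j i g f \<in> carrier (hm X Z (j + i))"
    and cmp_add_right:
      "\<lbrakk>X \<in> Ob; Y \<in> Ob; Z \<in> Ob;
        f \<in> carrier (hm X Y i); f' \<in> carrier (hm X Y i); g \<in> carrier (hm Y Z j)\<rbrakk> \<Longrightarrow>
       cmp X Y Z j i g (f \<oplus>\<^bsub>hm X Y i\<^esub> f')
         = cmp X Y Z j i g f \<oplus>\<^bsub>hm X Z (j + i)\<^esub> cmp X Y Z j i g f'"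
    and cmp_add_left:
      "\<lbrakk>X \<in> Ob; Y \<in> Ob; Z \<in> Ob;
        f \<in> carrier (hm X Y i); g \<in> carrier (hm Y Z j); g' \<in> carrier (hm Y Z j)\<rbrakk> \<Longrightarrow>
       cmp X Y Z j i (g \<oplus>\<^bsub>hm Y Z j\<^esub> g') f
         = cmp X Y Z j i g f \<oplus>\<^bsub>hm X Z (j + i)\<^esub> cmp X Y Z j i g' f"
    and cmp_assoc:
      "\<lbrakk>W \<in> Ob; X \<in> Ob; Y \<in> Ob; Z \<in> Ob;
        f \<in> carrier (hm W X i); g \<in> carrier (hm X Y j); h \<in> carrier (hm Y Z l)\<rbrakk> \<Longrightarrow>
       cmp W X Z (l + j) i (cmp X Y Z l j h g) f = cmp W Y Z l (j + i) h (cmp W X Y j i g f)"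
    and cmp_idn_left:
      "\<lbrakk>X \<in> Ob; Y \<in> Ob; f \<in> carrier (hm X Y i)\<rbrakk> \<Longrightarrow> cmp X Y Y 0 i (idn Y) f = f"
    and cmp_idn_right:
      "\<lbrakk>X \<in> Ob; Y \<in> Ob; f \<in> carrier (hm X Y i)\<rbrakk> \<Longrightarrow> cmp X X Y i 0 f (idn X) = f"
begin

definition arrow :: "('o, 'd, 'm) arr \<Rightarrow> bool" where
  "arrow f \<longleftrightarrow> src f \<in> Ob \<and> tgt f \<in> Ob \<and> elt f \<in> carrier (hm (src f) (tgt f) (deg f))"

definition acomp :: "('o, 'd, 'm) arr \<Rightarrow> ('o, 'd, 'm) arr \<Rightarrow> ('o, 'd, 'm) arr" (infixr "\<cdot>" 75) where
  "g \<cdot> f = Arr (src f) (tgt g) (deg g + deg f)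
     (cmp (src f) (tgt f) (tgt g) (deg g) (deg f) (elt g) (elt f))"

definition aadd :: "('o, 'd, 'm) arr \<Rightarrow> ('o, 'd, 'm) arr \<Rightarrow> ('o, 'd, 'm) arr" (infixr "\<^bold>+" 65) where
  "f \<^bold>+ g = Arr (src f) (tgt f) (deg f) (elt f \<oplus>\<^bsub>hm (src f) (tgt f) (deg f)\<^esub> elt g)"

definition aneg :: "('o, 'd, 'm) arr \<Rightarrow> ('o, 'd, 'm) arr" ("\<^bold>- _" [80] 80) where
  "\<^bold>- f = Arr (src f) (tgt f) (deg f) (\<ominus>\<^bsub>hm (src f) (tgt f) (deg f)\<^esub> elt f)"

definition azero :: "'o \<Rightarrow> 'o \<Rightarrow> 'd \<Rightarrow> ('o, 'd, 'm) arr" where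
  "azero X Y i = Arr X Y i \<zero>\<^bsub>hm X Y i\<^esub>"

definition aid :: "'o \<Rightarrow> ('o, 'd, 'm) arr" where
  "aid X = Arr X X 0 (idn X)"

lemma arr_dom [simp]:
  "src (g \<cdot> f) = src f" "tgt (g \<cdot> f) = tgt g" "deg (g \<cdot> f) = deg g + deg f"
  "src (f \<^bold>+ g) = src f" "tgt (f \<^bold>+ g) = tgt f" "deg (f \<^bold>+ g) = deg f"
  "src (\<^bold>- f) = src f" "tgt (\<^bold>- f) = tgt f" "deg (\<^bold>- f) = deg f"
  "src (azero X Y i) = X" "tgt (azero X Y i) = Y" "deg (azero X Y i) = i"
  "src (aid X) = X" "tgt (aid X) = X" "deg (aid X) = 0"
  by (simp_all add: acomp_def aadd_def aneg_def azero_def aid_def)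

lemma arrow_ends: "arrow f \<Longrightarrow> src f \<in> Ob" "arrow f \<Longrightarrow> tgt f \<in> Ob"
  by (simp_all add: arrow_def)

lemma arrow_Arr: "arrow (Arr X Y i x) \<longleftrightarrow> X \<in> Ob \<and> Y \<in> Ob \<and> x \<in> carrier (hm X Y i)"
  by (simp add: arrow_def)

lemma arrow_intros [simp]:
  "\<lbrakk>arrow g; arrow f; src g = tgt f\<rbrakk> \<Longrightarrow> arrow (g \<cdot> f)"
  "\<lbrakk>arrow f; arrow g; src f = src g; tgt f = tgt g; deg f = deg g\<rbrakk> \<Longrightarrow> arrow (f \<^bold>+ g)"
  "arrow f \<Longrightarrow> arrow (\<^bold>- f)"
  "\<lbrakk>X \<in> Ob; Y \<in> Ob\<rbrakk> \<Longrightarrow> arrow (azero X Y i)"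
  "X \<in> Ob \<Longrightarrow> arrow (aid X)"
proof -
  have M: "abelian_monoid (hm X Y i)" if "X \<in> Ob" "Y \<in> Ob" for X Y i
    using hm_group[OF that, of i] by (simp add: abelian_group_def)
  show "arrow (g \<cdot> f)" if "arrow g" "arrow f" "src g = tgt f"
    using that cmp_closed[of "src f" "tgt f" "tgt g" "elt f" "deg f" "elt g" "deg g"]
    by (simp add: arrow_def acomp_def)
  show "arrow (f \<^bold>+ g)" if "arrow f" "arrow g" "src f = src g" "tgt f = tgt g" "deg f = deg g"
    using that abelian_monoid.a_closed[OF M] by (simp add: arrow_def aadd_def)
  show "arrow (\<^bold>- f)" if "arrow f"
    using that abelian_group.a_inv_closed[OF hm_group] by (simp add: arrow_def aneg_def)
  show "arrow (azero X Y i)" if "X \<in> Ob" "Y \<in> Ob"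
    using that abelian_monoid.zero_closed[OF M] by (simp add: arrow_def azero_def)
  show "arrow (aid X)" if "X \<in> Ob"
    using that idn_closed by (simp add: arrow_def aid_def)
qed

lemma acomp_assoc [simp]:
  assumes "arrow f" "arrow g" "arrow h" "src g = tgt f" "src h = tgt g"
  shows "(h \<cdot> g) \<cdot> f = h \<cdot> (g \<cdot> f)"
  using assms cmp_assoc[of "src f" "tgt f" "tgt g" "tgt h" "elt f" "deg f" "elt g" "deg g" "elt h" "deg h"]
  by (simp add: arrow_def acomp_def add.assoc)

lemma acomp_id [simp]:
  "\<lbrakk>arrow f; src f = X\<rbrakk> \<Longrightarrow> f \<cdot> aid X = f"
  "\<lbrakk>arrow f; tgt f = X\<rbrakk> \<Longrightarrow> aid X \<cdot> f = f"
  using cmp_idn_left[of "src f" "tgt f" "elt f" "deg f"] cmp_idn_right[of "src f" "tgt f" "elt f" "deg f"]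
  by (auto simp: arrow_def acomp_def aid_def arr.expand)

lemma acomp_add [simp]:
  "\<lbrakk>arrow g; arrow f; arrow f'; src g = tgt f; src f = src f'; tgt f = tgt f'; deg f = deg f'\<rbrakk> \<Longrightarrow>
     g \<cdot> (f \<^bold>+ f') = g \<cdot> f \<^bold>+ g \<cdot> f'"
  "\<lbrakk>arrow g; arrow f; arrow g'; src g = tgt f; src g = src g'; tgt g = tgt g'; deg g = deg g'\<rbrakk> \<Longrightarrow>
     (g \<^bold>+ g') \<cdot> f = g \<cdot> f \<^bold>+ g' \<cdot> f"
  using cmp_add_right[of "src f" "tgt f" "tgt g" "elt f" "deg f" "elt f'" "elt g" "deg g"]
    cmp_add_left[of "src f" "tgt f" "tgt g" "elt f" "deg f" "elt g" "deg g" "elt g'"]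
  by (simp_all add: arrow_def acomp_def aadd_def)

lemma aadd_assoc [simp]:
  assumes "arrow f" "arrow g" "arrow h" "src f = src g" "tgt f = tgt g" "deg f = deg g"
    "src g = src h" "tgt g = tgt h" "deg g = deg h"
  shows "(f \<^bold>+ g) \<^bold>+ h = f \<^bold>+ (g \<^bold>+ h)"
proof -
  interpret G: abelian_group "hm (src h) (tgt h) (deg h)" using assms by (simp add: hm_group arrow_def)
  show ?thesis using assms by (auto simp: arrow_def aadd_def G.a_assoc)
qed

lemma aadd_comm:
  assumes "arrow f" "arrow g" "src f = src g" "tgt f = tgt g" "deg f = deg g"
  shows "f \<^bold>+ g = g \<^bold>+ f"
proof -
  interpret G: abelian_group "hm (src g) (tgt g) (deg g)" using assms by (simp add: hm_group arrow_def)
  show ?thesis using assms by (auto simp: arrow_def aadd_def G.a_comm)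
qed

lemma aadd_left_comm:
  assumes "arrow f" "arrow g" "arrow h" "src f = src g" "tgt f = tgt g" "deg f = deg g"
    "src g = src h" "tgt g = tgt h" "deg g = deg h"
  shows "f \<^bold>+ (g \<^bold>+ h) = g \<^bold>+ (f \<^bold>+ h)"
proof -
  interpret G: abelian_group "hm (src h) (tgt h) (deg h)" using assms by (simp add: hm_group arrow_def)
  show ?thesis using assms by (auto simp: arrow_def aadd_def G.a_lcomm)
qed

lemmas aadd_ac = aadd_comm aadd_left_comm

lemma aadd_zero [simp]:
  "\<lbrakk>arrow f; src f = X; tgt f = Y; deg f = i\<rbrakk> \<Longrightarrow> f \<^bold>+ azero X Y i = f"
  "\<lbrakk>arrow f; src f = X; tgt f = Y; deg f = i\<rbrakk> \<Longrightarrow> azero X Y i \<^bold>+ f = f"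
proof -
  assume f: "arrow f" "src f = X" "tgt f = Y" "deg f = i"
  interpret G: abelian_group "hm X Y i" using f by (auto simp: hm_group arrow_def)
  show "f \<^bold>+ azero X Y i = f" "azero X Y i \<^bold>+ f = f"
    using f by (auto simp: arrow_def aadd_def azero_def arr.expand)
qed

lemma aadd_neg [simp]:
  "\<lbrakk>arrow f\<rbrakk> \<Longrightarrow> f \<^bold>+ \<^bold>- f = azero (src f) (tgt f) (deg f)"
  "\<lbrakk>arrow f\<rbrakk> \<Longrightarrow> \<^bold>- f \<^bold>+ f = azero (src f) (tgt f) (deg f)"
  "\<lbrakk>arrow f\<rbrakk> \<Longrightarrow> \<^bold>- \<^bold>- f = f"
proof -
  assume f: "arrow f"
  interpret G: abelian_group "hm (src f) (tgt f) (deg f)" using f by (auto simp: hm_group arrow_def)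
  show "f \<^bold>+ \<^bold>- f = azero (src f) (tgt f) (deg f)" "\<^bold>- f \<^bold>+ f = azero (src f) (tgt f) (deg f)"
    "\<^bold>- \<^bold>- f = f"
    using f by (auto simp: arrow_def aadd_def azero_def aneg_def arr.expand G.l_neg G.r_neg)
qed

lemma aadd_neg_cancel [simp]:
  assumes "arrow f" "arrow g" "src f = src g" "tgt f = tgt g" "deg f = deg g"
  shows "f \<^bold>+ (\<^bold>- f \<^bold>+ g) = g" "\<^bold>- f \<^bold>+ (f \<^bold>+ g) = g"
  using assms aadd_assoc[of f "\<^bold>- f" g] aadd_assoc[of "\<^bold>- f" f g] by simp_all

declare arrow_ends [simp]

lemma aneg_unique:
  assumes "arrow f" "arrow g" "src f = src g" "tgt f = tgt g" "deg f = deg g"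
    "f \<^bold>+ g = azero (src f) (tgt f) (deg f)"
  shows "g = \<^bold>- f"
proof -
  have "g = \<^bold>- f \<^bold>+ (f \<^bold>+ g)" by (rule aadd_neg_cancel(2)[symmetric]) (use assms in auto)
  also have "\<dots> = \<^bold>- f" unfolding assms(6) using assms by (intro aadd_zero) auto
  finally show ?thesis .
qed

lemma aneg_zero [simp]: "\<lbrakk>X \<in> Ob; Y \<in> Ob\<rbrakk> \<Longrightarrow> \<^bold>- azero X Y i = azero X Y i"
  by (rule aneg_unique[symmetric]) auto

lemma aneg_add [simp]:
  assumes "arrow f" "arrow g" "src f = src g" "tgt f = tgt g" "deg f = deg g"
  shows "\<^bold>- (f \<^bold>+ g) = \<^bold>- f \<^bold>+ \<^bold>- g"
proof (rule aneg_unique[symmetric])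
  have "(f \<^bold>+ g) \<^bold>+ \<^bold>- f \<^bold>+ \<^bold>- g = f \<^bold>+ (g \<^bold>+ (\<^bold>- f \<^bold>+ \<^bold>- g))" using assms by simp
  also have "g \<^bold>+ (\<^bold>- f \<^bold>+ \<^bold>- g) = \<^bold>- f"
    using assms by (simp add: aadd_left_comm[of g "\<^bold>- f" "\<^bold>- g"])
  finally show "(f \<^bold>+ g) \<^bold>+ \<^bold>- f \<^bold>+ \<^bold>- g = azero (src (f \<^bold>+ g)) (tgt (f \<^bold>+ g)) (deg (f \<^bold>+ g))"
    using assms by simp
qed (use assms in simp_all)

lemma aadd_left_cancel:
  assumes "arrow f" "arrow g" "src f = src g" "tgt f = tgt g" "deg f = deg g"
    "arrow h" "src f = src h" "tgt f = tgt h" "deg f = deg h"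
    "f \<^bold>+ g = f \<^bold>+ h"
  shows "g = h"
proof -
  have "g = \<^bold>- f \<^bold>+ (f \<^bold>+ g)" by (rule aadd_neg_cancel(2)[symmetric]) (use assms in auto)
  also have "\<dots> = h" unfolding assms(10) by (rule aadd_neg_cancel(2)) (use assms in auto)
  finally show ?thesis .
qed

lemma acomp_zero [simp]:
  "\<lbrakk>arrow f; src f = Y; X \<in> Ob\<rbrakk> \<Longrightarrow> f \<cdot> azero X Y i = azero X (tgt f) (deg f + i)"
  "\<lbrakk>arrow f; tgt f = Y; Z \<in> Ob\<rbrakk> \<Longrightarrow> azero Y Z j \<cdot> f = azero (src f) Z (j + deg f)"
proof -
  assume f: "arrow f" "src f = Y" "X \<in> Ob"
  have Y: "Y \<in> Ob" using f by auto
  let ?z = "azero X Y i"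
  have "f \<cdot> ?z \<^bold>+ f \<cdot> ?z = f \<cdot> (?z \<^bold>+ ?z)" using f Y by (subst acomp_add) auto
  then have "f \<cdot> ?z \<^bold>+ f \<cdot> ?z = f \<cdot> ?z \<^bold>+ azero X (tgt f) (deg f + i)" using f Y by simp
  from this show "f \<cdot> ?z = azero X (tgt f) (deg f + i)"
    by (rule aadd_left_cancel[rotated 9]) (use f Y in auto)
next
  assume f: "arrow f" "tgt f = Y" "Z \<in> Ob"
  have Y: "Y \<in> Ob" using f by auto
  let ?z = "azero Y Z j"
  have "?z \<cdot> f \<^bold>+ ?z \<cdot> f = (?z \<^bold>+ ?z) \<cdot> f" using f Y by (subst acomp_add) auto
  then have "?z \<cdot> f \<^bold>+ ?z \<cdot> f = ?z \<cdot> f \<^bold>+ azero (src f) Z (j + deg f)" using f Y by simp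
  then show "?z \<cdot> f = azero (src f) Z (j + deg f)"
    by (rule aadd_left_cancel[rotated 9]) (use f Y in auto)
qed

lemma acomp_neg [simp]:
  "\<lbrakk>arrow f; arrow g; src g = tgt f\<rbrakk> \<Longrightarrow> g \<cdot> \<^bold>- f = \<^bold>- (g \<cdot> f)"
  "\<lbrakk>arrow f; arrow g; src g = tgt f\<rbrakk> \<Longrightarrow> (\<^bold>- g) \<cdot> f = \<^bold>- (g \<cdot> f)"
proof -
  assume a: "arrow f" "arrow g" "src g = tgt f"
  have "g \<cdot> f \<^bold>+ g \<cdot> \<^bold>- f = g \<cdot> (f \<^bold>+ \<^bold>- f)"
    using a by (simp only: acomp_add arr_dom arrow_intros simp_thms)
  then show "g \<cdot> \<^bold>- f = \<^bold>- (g \<cdot> f)" using a by (intro aneg_unique) simp_all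
  have "g \<cdot> f \<^bold>+ (\<^bold>- g) \<cdot> f = (g \<^bold>+ \<^bold>- g) \<cdot> f"
    using a by (simp only: acomp_add arr_dom arrow_intros simp_thms)
  then show "(\<^bold>- g) \<cdot> f = \<^bold>- (g \<cdot> f)" using a by (intro aneg_unique) simp_all
qed

lemma move_neg:
  assumes "arrow f" "arrow g" "arrow h" "src f = src g" "tgt f = tgt g" "deg f = deg g"
    "src g = src h" "tgt g = tgt h" "deg g = deg h"
  shows "f \<^bold>+ \<^bold>- g = h \<longleftrightarrow> f = h \<^bold>+ g"
proof
  assume e: "f \<^bold>+ \<^bold>- g = h"
  have "f = f \<^bold>+ (\<^bold>- g \<^bold>+ g)" using assms by simp
  also have "\<dots> = (f \<^bold>+ \<^bold>- g) \<^bold>+ g" by (rule aadd_assoc[symmetric]) (use assms in auto)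
  finally show "f = h \<^bold>+ g" unfolding e .
next
  assume e: "f = h \<^bold>+ g"
  have "(h \<^bold>+ g) \<^bold>+ \<^bold>- g = h \<^bold>+ (g \<^bold>+ \<^bold>- g)" by (rule aadd_assoc) (use assms in auto)
  also have "\<dots> = h" using assms(2,3,7,8,9) by simp
  finally show "f \<^bold>+ \<^bold>- g = h" unfolding e .
qed

lemma precomp: "g \<cdot> f = h \<Longrightarrow> \<lbrakk>arrow x; arrow f; arrow g; src f = tgt x; src g = tgt f\<rbrakk> \<Longrightarrow> g \<cdot> f \<cdot> x = h \<cdot> x"
  by (metis acomp_assoc)

text \<open>Cancellation of an arrow against its negative across up to three summands. Together with
  reassociation this settles the sums that occur below without sorting their summands.\<close>

lemma aadd_cancel1 [simp]:
  assumes "arrow f" "arrow g"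
    "src f = src g" "tgt f = tgt g" "deg f = deg g"
  shows "f \<^bold>+ (g \<^bold>+ \<^bold>- f) = g"
    "\<^bold>- f \<^bold>+ (g \<^bold>+ f) = g"
  by (rule trans[OF aadd_left_comm]; use assms in auto)+

lemma aadd_cancel2 [simp]:
  assumes "arrow f" "arrow g" "arrow x"
    "src f = src g" "tgt f = tgt g" "deg f = deg g" "src f = src x" "tgt f = tgt x" "deg f = deg x"
  shows "f \<^bold>+ (g \<^bold>+ (\<^bold>- f \<^bold>+ x)) = g \<^bold>+ x"
    "\<^bold>- f \<^bold>+ (g \<^bold>+ (f \<^bold>+ x)) = g \<^bold>+ x"
  by (rule trans[OF aadd_left_comm]; use assms in auto)+

lemma aadd_cancel3 [simp]:
  assumes "arrow f" "arrow g" "arrow h"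
    "src f = src g" "tgt f = tgt g" "deg f = deg g" "src f = src h" "tgt f = tgt h" "deg f = deg h"
  shows "f \<^bold>+ (g \<^bold>+ (h \<^bold>+ \<^bold>- f)) = g \<^bold>+ h"
    "\<^bold>- f \<^bold>+ (g \<^bold>+ (h \<^bold>+ f)) = g \<^bold>+ h"
  by (rule trans[OF aadd_left_comm]; use assms in auto)+

lemma aadd_cancel4 [simp]:
  assumes "arrow f" "arrow g" "arrow h" "arrow x"
    "src f = src g" "tgt f = tgt g" "deg f = deg g" "src f = src h" "tgt f = tgt h" "deg f = deg h" "src f = src x" "tgt f = tgt x" "deg f = deg x"
  shows "f \<^bold>+ (g \<^bold>+ (h \<^bold>+ (\<^bold>- f \<^bold>+ x))) = g \<^bold>+ h \<^bold>+ x"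
    "\<^bold>- f \<^bold>+ (g \<^bold>+ (h \<^bold>+ (f \<^bold>+ x))) = g \<^bold>+ h \<^bold>+ x"
  by (rule trans[OF aadd_left_comm]; use assms in auto)+

lemma aadd_cancel5 [simp]:
  assumes "arrow f" "arrow g" "arrow h" "arrow k"
    "src f = src g" "tgt f = tgt g" "deg f = deg g" "src f = src h" "tgt f = tgt h" "deg f = deg h" "src f = src k" "tgt f = tgt k" "deg f = deg k"
  shows "f \<^bold>+ (g \<^bold>+ (h \<^bold>+ (k \<^bold>+ \<^bold>- f))) = g \<^bold>+ h \<^bold>+ k"
    "\<^bold>- f \<^bold>+ (g \<^bold>+ (h \<^bold>+ (k \<^bold>+ f))) = g \<^bold>+ h \<^bold>+ k"
  by (rule trans[OF aadd_left_comm]; use assms in auto)+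

lemma aadd_cancel6 [simp]:
  assumes "arrow f" "arrow g" "arrow h" "arrow k" "arrow x"
    "src f = src g" "tgt f = tgt g" "deg f = deg g" "src f = src h" "tgt f = tgt h" "deg f = deg h" "src f = src k" "tgt f = tgt k" "deg f = deg k" "src f = src x" "tgt f = tgt x" "deg f = deg x"
  shows "f \<^bold>+ (g \<^bold>+ (h \<^bold>+ (k \<^bold>+ (\<^bold>- f \<^bold>+ x)))) = g \<^bold>+ h \<^bold>+ k \<^bold>+ x"
    "\<^bold>- f \<^bold>+ (g \<^bold>+ (h \<^bold>+ (k \<^bold>+ (f \<^bold>+ x)))) = g \<^bold>+ h \<^bold>+ k \<^bold>+ x"
  by (rule trans[OF aadd_left_comm]; use assms in auto)+

end

section \<open>Level dg-categories\<close>

text \<open>The operations are parameters, so that both the plain and the twisted differential on matrices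
  are instances. The level of an identity is only bounded above: it is \<open>-\<infinity>\<close> for a zero object.\<close>

locale level_dg = field K + graded_category Ob hm cmp idn
  for K :: "('a, 'e) ring_scheme" (structure)
    and Ob :: "'o set"
    and hm :: "'o \<Rightarrow> 'o \<Rightarrow> int \<Rightarrow> ('a, 'm) module"
    and cmp :: "'o \<Rightarrow> 'o \<Rightarrow> 'o \<Rightarrow> int \<Rightarrow> int \<Rightarrow> 'm \<Rightarrow> 'm \<Rightarrow> 'm"
    and idn :: "'o \<Rightarrow> 'm" +
  fixes bd :: "'o \<Rightarrow> 'o \<Rightarrow> int \<Rightarrow> 'm \<Rightarrow> 'm"
    and lev :: "'o \<Rightarrow> 'o \<Rightarrow> int \<Rightarrow> 'm \<Rightarrow> ereal"
  assumes hm_module: "\<lbrakk>X \<in> Ob; Y \<in> Ob\<rbrakk> \<Longrightarrow> module K (hm X Y i)"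
    and cmp_smult_right:
      "\<lbrakk>X \<in> Ob; Y \<in> Ob; Z \<in> Ob; a \<in> carrier K; f \<in> carrier (hm X Y i); g \<in> carrier (hm Y Z j)\<rbrakk> \<Longrightarrow>
       cmp X Y Z j i g (a \<odot>\<^bsub>hm X Y i\<^esub> f) = a \<odot>\<^bsub>hm X Z (j + i)\<^esub> cmp X Y Z j i g f"
    and cmp_smult_left:
      "\<lbrakk>X \<in> Ob; Y \<in> Ob; Z \<in> Ob; a \<in> carrier K; f \<in> carrier (hm X Y i); g \<in> carrier (hm Y Z j)\<rbrakk> \<Longrightarrow>
       cmp X Y Z j i (a \<odot>\<^bsub>hm Y Z j\<^esub> g) f = a \<odot>\<^bsub>hm X Z (j + i)\<^esub> cmp X Y Z j i g f"
    and bd_linear: "\<lbrakk>X \<in> Ob; Y \<in> Ob\<rbrakk> \<Longrightarrow> linear_map K (hm X Y i) (hm X Y (i + 1)) (bd X Y i)"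
    and bd_bd: "\<lbrakk>X \<in> Ob; Y \<in> Ob; f \<in> carrier (hm X Y i)\<rbrakk> \<Longrightarrow>
      bd X Y (i + 1) (bd X Y i f) = \<zero>\<^bsub>hm X Y (i + 1 + 1)\<^esub>"
    and bd_idn: "X \<in> Ob \<Longrightarrow> bd X X 0 (idn X) = \<zero>\<^bsub>hm X X 1\<^esub>"
    and bd_cmp:
      "\<lbrakk>X \<in> Ob; Y \<in> Ob; Z \<in> Ob; f \<in> carrier (hm X Y i); g \<in> carrier (hm Y Z j)\<rbrakk> \<Longrightarrow>
       bd X Z (j + i) (cmp X Y Z j i g f)
         = cmp X Y Z (j + 1) i (bd Y Z j g) f
           \<oplus>\<^bsub>hm X Z (j + i + 1)\<^esub> alt_sign (hm X Z (j + i + 1)) j (cmp X Y Z j (i + 1) g (bd X Y i f))"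
    and lev_zero: "\<lbrakk>X \<in> Ob; Y \<in> Ob\<rbrakk> \<Longrightarrow> lev X Y i \<zero>\<^bsub>hm X Y i\<^esub> = -\<infinity>"
    and lev_lincomb:
      "\<lbrakk>X \<in> Ob; Y \<in> Ob; a \<in> carrier K - {\<zero>}; f \<in> carrier (hm X Y i); g \<in> carrier (hm X Y i)\<rbrakk> \<Longrightarrow>
       lev X Y i (a \<odot>\<^bsub>hm X Y i\<^esub> f \<oplus>\<^bsub>hm X Y i\<^esub> g) \<le> max (lev X Y i f) (lev X Y i g)"
    and lev_bd: "\<lbrakk>X \<in> Ob; Y \<in> Ob; f \<in> carrier (hm X Y i)\<rbrakk> \<Longrightarrow> lev X Y (i + 1) (bd X Y i f) \<le> lev X Y i f"
    and lev_cmp: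
      "\<lbrakk>X \<in> Ob; Y \<in> Ob; Z \<in> Ob; f \<in> carrier (hm X Y i); g \<in> carrier (hm Y Z j)\<rbrakk> \<Longrightarrow>
       lev X Z (j + i) (cmp X Y Z j i g f) \<le> lev Y Z j g + lev X Y i f"
    and lev_idn: "X \<in> Ob \<Longrightarrow> lev X X 0 (idn X) \<le> 0"
begin

definition asmult :: "'a \<Rightarrow> ('o, int, 'm) arr \<Rightarrow> ('o, int, 'm) arr" (infixr "\<^bold>*" 75) where
  "a \<^bold>* f = Arr (src f) (tgt f) (deg f) (a \<odot>\<^bsub>hm (src f) (tgt f) (deg f)\<^esub> elt f)"

definition abd :: "('o, int, 'm) arr \<Rightarrow> ('o, int, 'm) arr" ("\<delta>") where
  "\<delta> f = Arr (src f) (tgt f) (deg f + 1) (bd (src f) (tgt f) (deg f) (elt f))"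

definition level :: "('o, int, 'm) arr \<Rightarrow> ereal" where
  "level f = lev (src f) (tgt f) (deg f) (elt f)"

definition asign :: "int \<Rightarrow> ('o, int, 'm) arr \<Rightarrow> ('o, int, 'm) arr" where
  "asign l f = (if even l then f else \<^bold>- f)"

lemma asmult_dom [simp]:
  "src (a \<^bold>* f) = src f" "tgt (a \<^bold>* f) = tgt f" "deg (a \<^bold>* f) = deg f"
  by (simp_all add: asmult_def)

lemma abd_dom [simp]: "src (\<delta> f) = src f" "tgt (\<delta> f) = tgt f" "deg (\<delta> f) = deg f + 1"
  by (simp_all add: abd_def)

lemma asign_dom [simp]:
  "src (asign l f) = src f" "tgt (asign l f) = tgt f" "deg (asign l f) = deg f"
  by (simp_all add: asign_def)

lemma arrow_asmult [simp]: "\<lbrakk>arrow f; a \<in> carrier K\<rbrakk> \<Longrightarrow> arrow (a \<^bold>* f)"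
  by (simp add: arrow_def asmult_def module.smult_closed[OF hm_module] del: arrow_ends)

lemma arrow_abd [simp]: "arrow f \<Longrightarrow> arrow (\<delta> f)"
  using bd_linear[of "src f" "tgt f" "deg f"]
  by (auto simp: arrow_def abd_def linear_map_def simp del: arrow_ends)

lemma arrow_asign [simp]: "arrow f \<Longrightarrow> arrow (asign l f)"
  by (simp add: asign_def)

lemma acomp_smult [simp]:
  assumes "arrow f" "arrow g" "src g = tgt f" "a \<in> carrier K"
  shows "g \<cdot> a \<^bold>* f = a \<^bold>* (g \<cdot> f)" "(a \<^bold>* g) \<cdot> f = a \<^bold>* (g \<cdot> f)"
  using assms cmp_smult_right[of "src f" "tgt f" "tgt g" a "elt f" "deg f" "elt g" "deg g"]
    cmp_smult_left[of "src f" "tgt f" "tgt g" a "elt f" "deg f" "elt g" "deg g"]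
  by (simp_all add: arrow_def acomp_def asmult_def del: arrow_ends)

lemma asmult_add [simp]:
  assumes "arrow f" "arrow g" "src f = src g" "tgt f = tgt g" "deg f = deg g" "a \<in> carrier K"
  shows "a \<^bold>* (f \<^bold>+ g) = a \<^bold>* f \<^bold>+ a \<^bold>* g"
proof -
  interpret M: module K "hm (src g) (tgt g) (deg g)" using assms by (simp add: hm_module)
  show ?thesis using assms by (simp add: arrow_def aadd_def asmult_def M.smult_r_distr del: arrow_ends)
qed

lemma asmult_neg [simp]:
  assumes "arrow f" "a \<in> carrier K"
  shows "a \<^bold>* \<^bold>- f = \<^bold>- (a \<^bold>* f)"
proof -
  interpret M: module K "hm (src f) (tgt f) (deg f)" using assms by (simp add: hm_module)
  show ?thesis using assms by (simp add: arrow_def aneg_def asmult_def M.smult_r_minus del: arrow_ends)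
qed

lemma asmult_zero [simp]: "\<lbrakk>X \<in> Ob; Y \<in> Ob; a \<in> carrier K\<rbrakk> \<Longrightarrow> a \<^bold>* azero X Y i = azero X Y i"
  by (simp add: azero_def asmult_def module.smult_r_null[OF hm_module])

lemma asmult_one [simp]: "arrow f \<Longrightarrow> \<one> \<^bold>* f = f"
  by (simp add: arrow_def asmult_def arr.expand module.smult_one[OF hm_module] del: arrow_ends)

lemma asmult_null [simp]: "arrow f \<Longrightarrow> \<zero> \<^bold>* f = azero (src f) (tgt f) (deg f)"
  by (simp add: arrow_def asmult_def azero_def module.smult_l_null[OF hm_module] del: arrow_ends)

lemma asmult_assoc: "\<lbrakk>arrow f; a \<in> carrier K; b \<in> carrier K\<rbrakk> \<Longrightarrow> (a \<otimes> b) \<^bold>* f = a \<^bold>* b \<^bold>* f"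
  by (simp add: arrow_def asmult_def module.smult_assoc1[OF hm_module] del: arrow_ends)

lemma asmult_l_distr: "\<lbrakk>arrow f; a \<in> carrier K; b \<in> carrier K\<rbrakk> \<Longrightarrow> (a \<oplus> b) \<^bold>* f = a \<^bold>* f \<^bold>+ b \<^bold>* f"
  by (simp add: arrow_def asmult_def aadd_def module.smult_l_distr[OF hm_module] del: arrow_ends)

lemma aneg_smult: "arrow f \<Longrightarrow> \<^bold>- f = (\<ominus> \<one>) \<^bold>* f"
proof -
  assume f: "arrow f"
  then interpret M: module K "hm (src f) (tgt f) (deg f)" by (simp add: hm_module)
  show ?thesis using f by (simp add: arrow_def aneg_def asmult_def M.smult_l_minus del: arrow_ends)
qed

lemma abd_add [simp]:
  assumes "arrow f" "arrow g" "src f = src g" "tgt f = tgt g" "deg f = deg g"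
  shows "\<delta> (f \<^bold>+ g) = \<delta> f \<^bold>+ \<delta> g"
  using bd_linear[of "src g" "tgt g" "deg g"] assms
  by (simp add: linear_map_def arrow_def abd_def aadd_def del: arrow_ends)

lemma abd_smult [simp]: "\<lbrakk>arrow f; a \<in> carrier K\<rbrakk> \<Longrightarrow> \<delta> (a \<^bold>* f) = a \<^bold>* \<delta> f"
  using bd_linear[of "src f" "tgt f" "deg f"]
  by (simp add: linear_map_def arrow_def abd_def asmult_def del: arrow_ends)

lemma abd_neg [simp]: "arrow f \<Longrightarrow> \<delta> (\<^bold>- f) = \<^bold>- \<delta> f"
  by (simp add: aneg_smult)

lemma abd_sign [simp]: "arrow f \<Longrightarrow> \<delta> (asign l f) = asign l (\<delta> f)"
  by (simp add: asign_def)

lemma abd_zero [simp]: "\<lbrakk>X \<in> Ob; Y \<in> Ob\<rbrakk> \<Longrightarrow> \<delta> (azero X Y i) = azero X Y (i + 1)"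
  using abd_smult[of "azero X Y i" \<zero>] by simp

lemma abd_abd [simp]: "arrow f \<Longrightarrow> \<delta> (\<delta> f) = azero (src f) (tgt f) (deg f + 2)"
  using bd_bd[of "src f" "tgt f" "elt f" "deg f"] by (simp add: abd_def arrow_def azero_def add.commute del: arrow_ends)

lemma abd_id [simp]: "X \<in> Ob \<Longrightarrow> \<delta> (aid X) = azero X X 1"
  by (simp add: abd_def aid_def azero_def bd_idn)

lemma abd_comp [simp]:
  assumes "arrow f" "arrow g" "src g = tgt f"
  shows "\<delta> (g \<cdot> f) = \<delta> g \<cdot> f \<^bold>+ asign (deg g) (g \<cdot> \<delta> f)"
  using assms bd_cmp[of "src f" "tgt f" "tgt g" "elt f" "deg f" "elt g" "deg g"]
  by (simp add: abd_def arrow_def acomp_def aadd_def asign_def alt_sign_def aneg_def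
      add.assoc add.commute add.left_commute del: arrow_ends)

lemma asign_simps [simp]:
  "even l \<Longrightarrow> asign l f = f"
  "odd l \<Longrightarrow> asign l f = \<^bold>- f"
  by (simp_all add: asign_def)

lemma level_azero [simp]: "\<lbrakk>X \<in> Ob; Y \<in> Ob\<rbrakk> \<Longrightarrow> level (azero X Y i) = -\<infinity>"
  by (simp add: level_def azero_def lev_zero)

lemma level_lincomb:
  assumes "arrow f" "arrow g" "src f = src g" "tgt f = tgt g" "deg f = deg g" "a \<in> carrier K" "a \<noteq> \<zero>"
  shows "level (a \<^bold>* f \<^bold>+ g) \<le> max (level f) (level g)"
  using lev_lincomb[of "src g" "tgt g" a "elt f" "deg g" "elt g"] assms
  by (simp add: level_def aadd_def asmult_def arrow_def del: arrow_ends)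

lemma level_add:
  assumes "arrow f" "arrow g" "src f = src g" "tgt f = tgt g" "deg f = deg g" "level f \<le> r" "level g \<le> r"
  shows "level (f \<^bold>+ g) \<le> r"
  using order_trans[OF level_lincomb[of f g \<one>], of r] assms by simp

lemma level_smult:
  assumes "arrow f" "a \<in> carrier K" "level f \<le> r"
  shows "level (a \<^bold>* f) \<le> r"
proof (cases "a = \<zero>")
  case False
  then show ?thesis
    using order_trans[OF level_lincomb[of f "azero (src f) (tgt f) (deg f)" a], of r] assms by simp
qed (use assms in simp)

lemma level_neg: "\<lbrakk>arrow f; level f \<le> r\<rbrakk> \<Longrightarrow> level (\<^bold>- f) \<le> r"
  by (simp add: aneg_smult level_smult)

lemma level_sign: "\<lbrakk>arrow f; level f \<le> r\<rbrakk> \<Longrightarrow> level (asign l f) \<le> r"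
  by (simp add: asign_def level_neg)

lemma level_abd: "\<lbrakk>arrow f; level f \<le> r\<rbrakk> \<Longrightarrow> level (\<delta> f) \<le> r"
  using order_trans[OF lev_bd[of "src f" "tgt f" "elt f" "deg f"]]
  by (simp add: level_def abd_def arrow_def del: arrow_ends)

lemma level_comp_add:
  assumes "arrow f" "arrow g" "src g = tgt f"
  shows "level (g \<cdot> f) \<le> level g + level f"
  using lev_cmp[of "src f" "tgt f" "tgt g" "elt f" "deg f" "elt g" "deg g"] assms
  by (simp add: level_def acomp_def arrow_def del: arrow_ends)

lemma level_comp_sum:
  assumes "arrow f" "arrow g" "src g = tgt f" "level g \<le> ereal s" "level f \<le> ereal r"
  shows "level (g \<cdot> f) \<le> ereal (s + r)"
  using order_trans[OF level_comp_add add_mono] assms by fastforce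

lemma level_comp:
  assumes "arrow f" "arrow g" "src g = tgt f" "level g \<le> 0" "level f \<le> 0"
  shows "level (g \<cdot> f) \<le> 0"
  using level_comp_sum[of f g 0 0] assms by (simp add: zero_ereal_def)

lemma level_id: "X \<in> Ob \<Longrightarrow> level (aid X) \<le> 0"
  by (simp add: level_def aid_def lev_idn)

end

section \<open>Twisting the differential by Maurer-Cartan elements\<close>

context level_dg begin

definition twisted_bd ::
  "('o \<Rightarrow> 'm) \<Rightarrow> 'o \<Rightarrow> 'o \<Rightarrow> int \<Rightarrow> 'm \<Rightarrow> 'm" where
  "twisted_bd q X Y l f = bd X Y l f \<oplus>\<^bsub>hm X Y (l + 1)\<^esub> cmp X Y Y 1 l (q Y) f
     \<ominus>\<^bsub>hm X Y (l + 1)\<^esub> alt_sign (hm X Y (l + 1)) l (cmp X X Y l 1 f (q X))"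

text \<open>The square of the twisted differential is the commutator with the Maurer-Cartan expressions
  \<open>\<delta> q + q q\<close> of source and target, which vanish; all other terms cancel in pairs.\<close>

lemma level_dg_twisted:
  assumes sub: "Ob' \<subseteq> Ob"
    and q: "\<And>X. X \<in> Ob' \<Longrightarrow> q X \<in> carrier (hm X X 1)"
    and q_level: "\<And>X. X \<in> Ob' \<Longrightarrow> level (Arr X X 1 (q X)) \<le> 0"
    and MC: "\<And>X. X \<in> Ob' \<Longrightarrow> \<delta> (Arr X X 1 (q X)) \<^bold>+ Arr X X 1 (q X) \<cdot> Arr X X 1 (q X) = azero X X 2"
  shows "level_dg K Ob' hm cmp idn (twisted_bd q) lev"
proof -
  define Q where "Q X = Arr X X (1::int) (q X)" for X
  have Q_dom [simp]: "src (Q X) = X" "tgt (Q X) = X" "deg (Q X) = 1" for X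
    by (simp_all add: Q_def)
  have Ob [simp]: "X \<in> Ob" if "X \<in> Ob'" for X using sub that by auto
  have Q [simp]: "arrow (Q X)" if "X \<in> Ob'" for X
    using that q[OF that] by (simp add: Q_def arrow_Arr)
  have QQ: "Q X \<cdot> Q X = \<^bold>- \<delta> (Q X)" if "X \<in> Ob'" for X
    using that MC[OF that] by (intro aneg_unique) (simp_all add: Q_def[symmetric])
  have QQ' [simp]: "Q X \<cdot> Q X = \<^bold>- \<delta> (Q X)" "\<lbrakk>arrow f; tgt f = X\<rbrakk> \<Longrightarrow> Q X \<cdot> Q X \<cdot> f = \<^bold>- (\<delta> (Q X) \<cdot> f)"
    if "X \<in> Ob'" for X f
    using that QQ[OF that] acomp_assoc[of f "Q X" "Q X"] by simp_all
  define D where "D f = \<delta> f \<^bold>+ Q (tgt f) \<cdot> f \<^bold>+ asign (deg f + 1) (f \<cdot> Q (src f))" for f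
  have D_dom [simp]: "src (D f) = src f" "tgt (D f) = tgt f" "deg (D f) = deg f + 1" for f
    by (simp_all add: D_def)
  let ?ar = "\<lambda>f. arrow f \<and> src f \<in> Ob' \<and> tgt f \<in> Ob'"
  have D [simp]: "arrow (D f)" if "?ar f" for f
    using that by (simp add: D_def add.commute)
  have elt_D: "twisted_bd q X Y i f = elt (D (Arr X Y i f))"
    if "X \<in> Ob'" "Y \<in> Ob'" "f \<in> carrier (hm X Y i)" for X Y i f
  proof -
    interpret G: abelian_group "hm X Y (1 + i)" using that by (simp add: hm_group)
    have "cmp X Y Y 1 i (q Y) f \<in> carrier (hm X Y (i + 1))"
      using cmp_closed[of X Y Y f i "q Y" 1] that q by (simp add: add.commute)
    moreover have "cmp X X Y i 1 f (q X) \<in> carrier (hm X Y (i + 1))"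
      using cmp_closed[of X X Y "q X" 1 f i] that q by (simp add: add.commute)
    moreover have "bd X Y i f \<in> carrier (hm X Y (i + 1))"
      using bd_linear[of X Y i] that by (auto simp: linear_map_def)
    ultimately show ?thesis
      by (simp add: D_def twisted_bd_def abd_def aadd_def acomp_def Q_def asign_def alt_sign_def aneg_def
          a_minus_def add.commute G.a_assoc)
  qed
  have Arr_D: "Arr X Y (i + 1) (twisted_bd q X Y i f) = D (Arr X Y i f)"
    if "X \<in> Ob'" "Y \<in> Ob'" "f \<in> carrier (hm X Y i)" for X Y i f
    using that by (simp add: elt_D arr.expand)
  have D_add: "D (f \<^bold>+ g) = D f \<^bold>+ D g"
    if "?ar f" "?ar g" "src f = src g" "tgt f = tgt g" "deg f = deg g" for f g
    using that by (cases "even (deg f)") (simp_all add: D_def add.commute aadd_ac)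
  have D_smult: "D (a \<^bold>* f) = a \<^bold>* D f" if "?ar f" "a \<in> carrier K" for f a
    using that by (cases "even (deg f)") (simp_all add: D_def add.commute)
  have D_D: "D (D f) = azero (src f) (tgt f) (deg f + 1 + 1)" if "?ar f" for f
    using that by (cases "even (deg f)") (simp_all add: D_def add.commute)
  have D_comp: "D (g \<cdot> f) = D g \<cdot> f \<^bold>+ asign (deg g) (g \<cdot> D f)"
    if "?ar f" "?ar g" "src g = tgt f" for f g
    using that
    by (cases "even (deg f)"; cases "even (deg g)")
      (simp_all add: D_def add.commute add.left_commute aadd_left_comm)
  have gc: "graded_category Ob' hm cmp idn"
    by (intro graded_category.intro)
      (auto intro: hm_group idn_closed cmp_closed cmp_add_right cmp_add_left cmp_assoc cmp_idn_left cmp_idn_right)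
  show ?thesis
  proof (intro level_dg.intro level_dg_axioms.intro gc field_axioms)
    fix X Y i assume XY: "X \<in> Ob'" "Y \<in> Ob'"
    have add: "twisted_bd q X Y i (f \<oplus>\<^bsub>hm X Y i\<^esub> g)
        = twisted_bd q X Y i f \<oplus>\<^bsub>hm X Y (i + 1)\<^esub> twisted_bd q X Y i g"
      if "f \<in> carrier (hm X Y i)" "g \<in> carrier (hm X Y i)" for f g
      using arg_cong[OF D_add[of "Arr X Y i f" "Arr X Y i g"], of elt] XY that
      by (simp add: arrow_Arr elt_D aadd_def abelian_monoid.a_closed[OF abelian_group.axioms(1)[OF hm_group]])
    have smult: "twisted_bd q X Y i (a \<odot>\<^bsub>hm X Y i\<^esub> f) = a \<odot>\<^bsub>hm X Y (i + 1)\<^esub> twisted_bd q X Y i f"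
      if "f \<in> carrier (hm X Y i)" "a \<in> carrier K" for f a
      using arg_cong[OF D_smult[of "Arr X Y i f" a], of elt] XY that
      by (simp add: arrow_Arr elt_D asmult_def module.smult_closed[OF hm_module])
    have closed: "twisted_bd q X Y i f \<in> carrier (hm X Y (i + 1))" if "f \<in> carrier (hm X Y i)" for f
      using D[of "Arr X Y i f"] XY that by (simp add: arrow_Arr elt_D arrow_def del: D)
    show "linear_map K (hm X Y i) (hm X Y (i + 1)) (twisted_bd q X Y i)"
      using add smult closed by (auto simp: linear_map_def)
    fix f assume f: "f \<in> carrier (hm X Y i)"
    show "twisted_bd q X Y (i + 1) (twisted_bd q X Y i f) = \<zero>\<^bsub>hm X Y (i + 1 + 1)\<^esub>"
      using arg_cong[OF D_D[of "Arr X Y i f"], of elt] XY f closed[OF f]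
      by (simp add: arrow_Arr elt_D[of X Y _ "i + 1"] Arr_D azero_def)
    have "level (D (Arr X Y i f)) \<le> level (Arr X Y i f)"
    proof -
      have "level (Q Y \<cdot> Arr X Y i f) \<le> level (Arr X Y i f)" "level (Arr X Y i f \<cdot> Q X) \<le> level (Arr X Y i f)"
        using level_comp_add[of "Arr X Y i f" "Q Y"] level_comp_add[of "Q X" "Arr X Y i f"]
          add_right_mono[OF q_level[OF XY(2)], of "level (Arr X Y i f)"]
          add_left_mono[OF q_level[OF XY(1)], of "level (Arr X Y i f)"] XY f
        by (auto simp: arrow_Arr Q_def[symmetric] intro: order_trans)
      then show ?thesis
        using XY f unfolding D_def
        by (intro level_add level_sign level_abd) (auto simp: arrow_Arr)
    qed
    then show "lev X Y (i + 1) (twisted_bd q X Y i f) \<le> lev X Y i f"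
      using XY f by (simp add: level_def elt_D)
  next
    fix X assume "X \<in> Ob'"
    then show "twisted_bd q X X 0 (idn X) = \<zero>\<^bsub>hm X X 1\<^esub>"
      using elt_D[of X X "idn X" 0] idn_closed[of X]
      by (simp add: D_def aid_def[symmetric]) (simp add: azero_def)
  next
    fix X Y Z f g i j
    assume XYZ: "X \<in> Ob'" "Y \<in> Ob'" "Z \<in> Ob'" and f: "f \<in> carrier (hm X Y i)" and g: "g \<in> carrier (hm Y Z j)"
    have e: "Arr X Z (j + i) (cmp X Y Z j i g f) = Arr Y Z j g \<cdot> Arr X Y i f"
      by (simp add: acomp_def)
    have "twisted_bd q X Z (j + i) (cmp X Y Z j i g f)
        = elt (D (Arr Y Z j g) \<cdot> Arr X Y i f \<^bold>+ asign j (Arr Y Z j g \<cdot> D (Arr X Y i f)))"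
      using D_comp[of "Arr X Y i f" "Arr Y Z j g"] XYZ f g elt_D[of X Z "cmp X Y Z j i g f" "j + i"]
      by (simp add: e arrow_Arr cmp_closed)
    then show "twisted_bd q X Z (j + i) (cmp X Y Z j i g f)
        = cmp X Y Z (j + 1) i (twisted_bd q Y Z j g) f
          \<oplus>\<^bsub>hm X Z (j + i + 1)\<^esub> alt_sign (hm X Z (j + i + 1)) j (cmp X Y Z j (i + 1) g (twisted_bd q X Y i f))"
      using XYZ f g
      by (simp add: aadd_def acomp_def elt_D asign_def alt_sign_def aneg_def
          add.assoc add.commute add.left_commute)
  qed (auto intro: hm_module cmp_smult_right cmp_smult_left lev_zero lev_lincomb lev_cmp lev_idn)
qed

end

section \<open>Degree zero cohomology as a persistence category\<close>

locale level_dg_category =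
  level_dg K "dgobj D" "\<lambda>X Y. gpart (dghom D X Y)" "dgcomp D" "dgid D"
    "\<lambda>X Y. bdry (dghom D X Y)" "\<lambda>X Y. flev (dghom D X Y)"
  for K :: "('a, 'e) ring_scheme" (structure) and D :: "('o, 'a, 'm) fdg_category"
begin

notation acomp (infixr "\<cdot>" 75) and aadd (infixr "\<^bold>+" 65) and aneg ("\<^bold>- _" [80] 80)
  and asmult (infixr "\<^bold>*" 75) and abd ("\<delta>")

abbreviation Ob :: "'o set" where "Ob \<equiv> dgobj D"

definition cocycle :: "real \<Rightarrow> ('o, int, 'm) arr \<Rightarrow> bool" where
  "cocycle r f \<longleftrightarrow> arrow f \<and> deg f = 0 \<and> level f \<le> ereal r \<and> \<delta> f = azero (src f) (tgt f) 1"

definition homotopic :: "real \<Rightarrow> ('o, int, 'm) arr \<Rightarrow> ('o, int, 'm) arr \<Rightarrow> bool" where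
  "homotopic r f g \<longleftrightarrow> (\<exists>h. arrow h \<and> src h = src f \<and> tgt h = tgt f \<and> deg h = -1 \<and>
     level h \<le> ereal r \<and> g = f \<^bold>+ \<delta> h)"

definition cls :: "real \<Rightarrow> ('o, int, 'm) arr \<Rightarrow> 'm set" where
  "cls r f = cclass (dghom D (src f) (tgt f)) r (elt f)"

lemma cocycleD [simp]:
  "cocycle r f \<Longrightarrow> arrow f" "cocycle r f \<Longrightarrow> deg f = 0" "cocycle r f \<Longrightarrow> level f \<le> ereal r"
  "cocycle r f \<Longrightarrow> \<delta> f = azero (src f) (tgt f) 1"
  by (simp_all add: cocycle_def)

lemma cocycleI:
  "\<lbrakk>arrow f; deg f = 0; level f \<le> ereal r; \<delta> f = azero (src f) (tgt f) 1\<rbrakk> \<Longrightarrow> cocycle r f"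
  by (simp add: cocycle_def del: cocycleD)

lemma cocycle_mono: "\<lbrakk>cocycle r f; r \<le> s\<rbrakk> \<Longrightarrow> cocycle s f"
  by (rule cocycleI) (auto intro: order_trans[OF cocycleD(3)])

lemma cocycle_add:
  "\<lbrakk>cocycle r f; cocycle r g; src f = src g; tgt f = tgt g\<rbrakk> \<Longrightarrow> cocycle r (f \<^bold>+ g)"
  by (rule cocycleI) (auto intro!: level_add)

lemma cocycle_smult: "\<lbrakk>cocycle r f; a \<in> carrier K\<rbrakk> \<Longrightarrow> cocycle r (a \<^bold>* f)"
  by (rule cocycleI) (auto intro!: level_smult)

lemma cocycle_neg: "cocycle r f \<Longrightarrow> cocycle r (\<^bold>- f)"
  by (rule cocycleI) (auto intro!: level_neg)

lemma cocycle_comp: "\<lbrakk>cocycle r f; cocycle s g; src g = tgt f\<rbrakk> \<Longrightarrow> cocycle (s + r) (g \<cdot> f)"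
  using level_comp_sum[of f g s r] by (intro cocycleI) auto

lemma cocycle_comp0: "\<lbrakk>cocycle 0 f; cocycle 0 g; src g = tgt f\<rbrakk> \<Longrightarrow> cocycle 0 (g \<cdot> f)"
  using cocycle_comp[of 0 f 0 g] by simp

lemma cocycle_zero: "\<lbrakk>X \<in> Ob; Y \<in> Ob\<rbrakk> \<Longrightarrow> cocycle r (azero X Y 0)"
  by (rule cocycleI) auto

lemma cocycle_id: "X \<in> Ob \<Longrightarrow> cocycle 0 (aid X)"
  using level_id[of X] by (intro cocycleI) (simp_all add: zero_ereal_def)

lemma homotopic_typed:
  assumes "homotopic r f g" "arrow f" "deg f = 0"
  shows "arrow g" "src g = src f" "tgt g = tgt f" "deg g = 0"
  using assms by (auto simp: homotopic_def)

lemma homotopic_cocycle: "\<lbrakk>homotopic r f g; cocycle r f\<rbrakk> \<Longrightarrow> cocycle r g"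
  by (auto simp: homotopic_def intro!: cocycleI level_add level_abd)

lemma homotopic_refl: "\<lbrakk>arrow f; deg f = 0\<rbrakk> \<Longrightarrow> homotopic r f f"
  unfolding homotopic_def by (rule exI[of _ "azero (src f) (tgt f) (-1)"]) simp

lemma homotopic_sym:
  assumes "homotopic r f g" "arrow f" "deg f = 0"
  shows "homotopic r g f"
proof -
  obtain h where h: "arrow h" "src h = src f" "tgt h = tgt f" "deg h = -1" "level h \<le> ereal r"
    and g: "g = f \<^bold>+ \<delta> h" using assms(1) unfolding homotopic_def by auto
  show ?thesis unfolding homotopic_def
    by (rule exI[of _ "\<^bold>- h"]) (use h assms in \<open>simp add: g level_neg\<close>)
qed

lemma homotopic_trans:
  assumes "homotopic r f g" "homotopic r g k" "arrow f" "deg f = 0"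
  shows "homotopic r f k"
proof -
  obtain h where h: "arrow h" "src h = src f" "tgt h = tgt f" "deg h = -1" "level h \<le> ereal r"
    and g: "g = f \<^bold>+ \<delta> h" using assms(1) unfolding homotopic_def by auto
  obtain h' where h': "arrow h'" "src h' = src g" "tgt h' = tgt g" "deg h' = -1" "level h' \<le> ereal r"
    and k: "k = g \<^bold>+ \<delta> h'" using assms(2) unfolding homotopic_def by auto
  show ?thesis unfolding homotopic_def
    by (rule exI[of _ "h \<^bold>+ h'"]) (use h h' assms in \<open>simp add: g k level_add\<close>)
qed

lemma homotopic_mono: "\<lbrakk>homotopic r f g; r \<le> s\<rbrakk> \<Longrightarrow> homotopic s f g"
  unfolding homotopic_def by (elim exE conjE, rule exI) (auto intro: order_trans)

lemma homotopic_add: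
  assumes "homotopic r f f'" "homotopic r g g'" "arrow f" "arrow g"
    "deg f = 0" "deg g = 0" "src f = src g" "tgt f = tgt g"
  shows "homotopic r (f \<^bold>+ g) (f' \<^bold>+ g')"
proof -
  obtain h where h: "arrow h" "src h = src f" "tgt h = tgt f" "deg h = -1" "level h \<le> ereal r"
    and f': "f' = f \<^bold>+ \<delta> h" using assms(1) unfolding homotopic_def by auto
  obtain k where k: "arrow k" "src k = src g" "tgt k = tgt g" "deg k = -1" "level k \<le> ereal r"
    and g': "g' = g \<^bold>+ \<delta> k" using assms(2) unfolding homotopic_def by auto
  show ?thesis unfolding homotopic_def
    by (rule exI[of _ "h \<^bold>+ k"]) (use h k assms in \<open>simp add: f' g' level_add aadd_left_comm[of "\<delta> h" g]\<close>)
qed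

lemma homotopic_smult:
  assumes "homotopic r f f'" "arrow f" "deg f = 0" "a \<in> carrier K"
  shows "homotopic r (a \<^bold>* f) (a \<^bold>* f')"
proof -
  obtain h where h: "arrow h" "src h = src f" "tgt h = tgt f" "deg h = -1" "level h \<le> ereal r"
    and f': "f' = f \<^bold>+ \<delta> h" using assms(1) unfolding homotopic_def by auto
  show ?thesis unfolding homotopic_def
    by (rule exI[of _ "a \<^bold>* h"]) (use h assms in \<open>simp add: f' level_smult\<close>)
qed

lemma homotopic_comp:
  assumes "homotopic r f f'" "homotopic s g g'" "cocycle r f" "cocycle s g" "src g = tgt f"
  shows "homotopic (s + r) (g \<cdot> f) (g' \<cdot> f')"
proof -
  obtain h where h: "arrow h" "src h = src f" "tgt h = tgt f" "deg h = -1" "level h \<le> ereal r"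
    and f': "f' = f \<^bold>+ \<delta> h" using assms(1) unfolding homotopic_def by auto
  obtain k where k: "arrow k" "src k = src g" "tgt k = tgt g" "deg k = -1" "level k \<le> ereal s"
    and g': "g' = g \<^bold>+ \<delta> k" using assms(2) unfolding homotopic_def by auto
  note f = cocycleD[OF assms(3)] note g = cocycleD[OF assms(4)]
  have "homotopic (s + r) (g \<cdot> f) (g \<cdot> f')" unfolding homotopic_def
    by (rule exI[of _ "g \<cdot> h"]) (use h f g assms(5) in \<open>simp add: f' level_comp_sum\<close>)
  moreover have "cocycle r f'" using homotopic_cocycle assms(1,3) .
  note f'' = cocycleD[OF this] homotopic_typed[OF assms(1) f(1,2)]
  have "homotopic (s + r) (g \<cdot> f') (g' \<cdot> f')" unfolding homotopic_def
    by (rule exI[of _ "k \<cdot> f'"]) (use k f f'' g assms(5) in \<open>simp add: g' level_comp_sum\<close>)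
  ultimately show ?thesis
    by (rule homotopic_trans) (use f g assms(5) in simp_all)
qed

lemma cls_eq_homotopic:
  assumes f: "arrow f" "deg f = 0"
  shows "cls r f = elt ` {g. homotopic r f g}"
proof (intro equalityI subsetI)
  let ?X = "src f" and ?Y = "tgt f"
  fix x assume "x \<in> cls r f"
  then obtain y where y: "y \<in> carrier (gpart (dghom D ?X ?Y) (-1))" "flev (dghom D ?X ?Y) (-1) y \<le> ereal r"
    and x: "x = bdry (dghom D ?X ?Y) (-1) y \<oplus>\<^bsub>gpart (dghom D ?X ?Y) 0\<^esub> elt f"
    by (auto simp: cls_def cclass_def coboundaries_def a_r_coset_def r_coset_def)
  define h where "h = Arr ?X ?Y (-1 :: int) y"
  have h: "arrow h" "src h = ?X" "tgt h = ?Y" "deg h = -1" "level h \<le> ereal r"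
    using y f by (simp_all add: h_def arrow_Arr level_def)
  have "x = elt (\<delta> h \<^bold>+ f)" by (simp add: x h_def abd_def aadd_def)
  also have "\<delta> h \<^bold>+ f = f \<^bold>+ \<delta> h" using h f by (intro aadd_comm) simp_all
  finally show "x \<in> elt ` {g. homotopic r f g}" using h by (auto simp: homotopic_def)
next
  let ?X = "src f" and ?Y = "tgt f"
  fix x assume "x \<in> elt ` {g. homotopic r f g}"
  then obtain h where h: "arrow h" "src h = ?X" "tgt h = ?Y" "deg h = -1" "level h \<le> ereal r"
    and x: "x = elt (f \<^bold>+ \<delta> h)" by (auto simp: homotopic_def)
  have "f \<^bold>+ \<delta> h = \<delta> h \<^bold>+ f" using h f by (intro aadd_comm) simp_all
  moreover have "elt h \<in> carrier (gpart (dghom D ?X ?Y) (-1))" "flev (dghom D ?X ?Y) (-1) (elt h) \<le> ereal r"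
    using h by (auto simp: arrow_def level_def simp del: arrow_ends)
  ultimately show "x \<in> cls r f" using h(2,3,4) x
    by (auto simp: cls_def cclass_def coboundaries_def a_r_coset_def r_coset_def abd_def aadd_def)
qed

lemma cls_self: "\<lbrakk>arrow f; deg f = 0\<rbrakk> \<Longrightarrow> elt f \<in> cls r f"
  by (auto simp: cls_eq_homotopic intro: homotopic_refl)

lemma cls_eqI:
  assumes "homotopic r f g" "arrow f" "deg f = 0"
  shows "cls r f = cls r g"
proof -
  have "homotopic r f k \<longleftrightarrow> homotopic r g k" for k
    using assms homotopic_typed[OF assms] homotopic_sym homotopic_trans by blast
  then show ?thesis using homotopic_typed[OF assms] assms by (simp add: cls_eq_homotopic)
qed

lemma cls_eq_iff:
  assumes "arrow f" "deg f = 0" "arrow g" "deg g = 0" "src f = src g" "tgt f = tgt g"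
  shows "cls r f = cls r g \<longleftrightarrow> homotopic r f g"
proof
  assume "cls r f = cls r g"
  then have "elt g \<in> cls r f" using cls_self assms by simp
  then obtain k where k: "homotopic r f k" "elt g = elt k" using assms by (auto simp: cls_eq_homotopic)
  then have "k = g" using homotopic_typed[OF k(1)] assms by (auto intro: arr.expand)
  then show "homotopic r f g" using k by simp
qed (use assms cls_eqI in blast)

text \<open>Operations on classes are unions over representatives; they are unions of equal sets.\<close>

lemma Union_cls:
  assumes "arrow f" "deg f = 0" "\<And>g. homotopic r f g \<Longrightarrow> F (elt g) = c"
  shows "(\<Union>x\<in>cls r f. F x) = c"
  using assms homotopic_refl[of f r] by (auto simp: cls_eq_homotopic)

abbreviation Mor :: "real \<Rightarrow> 'o \<Rightarrow> 'o \<Rightarrow> ('a, 'm set) module" where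
  "Mor r X Y \<equiv> pmor (H0 D) r X Y"

lemma H0_simps [simp]:
  "pobj (H0 D) = Ob" "pid (H0 D) X = cls 0 (aid X)"
  by (simp_all add: H0_def cls_def aid_def)

lemma Mor_carrier: "\<lbrakk>X \<in> Ob; Y \<in> Ob\<rbrakk> \<Longrightarrow> carrier (Mor r X Y) = cls r ` {f. cocycle r f \<and> src f = X \<and> tgt f = Y}"
proof -
  assume XY: "X \<in> Ob" "Y \<in> Ob"
  have "z \<in> cocycles (dghom D X Y) r \<longleftrightarrow> cocycle r (Arr X Y 0 z)" for z
    using XY by (simp add: cocycles_def cocycle_def arrow_Arr level_def abd_def azero_def del: cocycleD)
  moreover have "cls r (Arr X Y 0 z) = cclass (dghom D X Y) r z" for z by (simp add: cls_def)
  moreover have "cls r f = cclass (dghom D X Y) r (elt f) \<and> Arr X Y 0 (elt f) = f"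
    if "cocycle r f" "src f = X" "tgt f = Y" for f
    using that by (auto simp: cls_def intro: arr.expand)
  ultimately show ?thesis unfolding H0_def H0_module_def
    by (simp add: image_def set_eq_iff) (metis arr.sel(1,2))
qed

lemma cls_in_Mor [simp]: "\<lbrakk>cocycle r f; src f = X; tgt f = Y\<rbrakk> \<Longrightarrow> cls r f \<in> carrier (Mor r X Y)"
  by (auto simp: Mor_carrier)

lemma MorE:
  assumes "U \<in> carrier (Mor r X Y)" "X \<in> Ob" "Y \<in> Ob"
  obtains f where "cocycle r f" "src f = X" "tgt f = Y" "U = cls r f"
  using assms by (auto simp: Mor_carrier)

lemma Mor_zero: "\<lbrakk>X \<in> Ob; Y \<in> Ob\<rbrakk> \<Longrightarrow> \<zero>\<^bsub>Mor r X Y\<^esub> = cls r (azero X Y 0)"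
proof -
  assume XY: "X \<in> Ob" "Y \<in> Ob"
  interpret G: abelian_group "gpart (dghom D X Y) 0" using XY by (rule hm_group)
  have "b \<in> carrier (gpart (dghom D X Y) 0)" if "b \<in> coboundaries (dghom D X Y) r" for b
    using that bd_linear[OF XY, of "-1"] by (auto simp: coboundaries_def linear_map_def)
  then show ?thesis
    by (force simp: H0_def H0_module_def cls_def cclass_def azero_def a_r_coset_def r_coset_def)
qed

lemma Mor_add:
  assumes "cocycle r f" "cocycle r g" "src f = X" "tgt f = Y" "src g = X" "tgt g = Y"
  shows "cls r f \<oplus>\<^bsub>Mor r X Y\<^esub> cls r g = cls r (f \<^bold>+ g)"
proof -
  have "cls r f \<oplus>\<^bsub>Mor r X Y\<^esub> cls r g = {elt (f' \<^bold>+ g') | f' g'. homotopic r f f' \<and> homotopic r g g'}"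
  proof -
    have "elt f' \<oplus>\<^bsub>gpart (dghom D X Y) 0\<^esub> elt g' = elt (f' \<^bold>+ g')" if "homotopic r f f'" for f' g'
      using homotopic_typed[OF that] assms by (simp add: aadd_def)
    then show ?thesis using assms
      by (force simp: H0_def H0_module_def set_add_def set_mult_def cls_eq_homotopic)
  qed
  also have "\<dots> = cls r (f \<^bold>+ g)"
  proof
    show "{elt (f' \<^bold>+ g') | f' g'. homotopic r f f' \<and> homotopic r g g'} \<subseteq> cls r (f \<^bold>+ g)"
      using homotopic_add assms by (fastforce simp: cls_eq_homotopic)
    have "\<exists>f' g'. k = f' \<^bold>+ g' \<and> homotopic r f f' \<and> homotopic r g g'" if fgk: "homotopic r (f \<^bold>+ g) k" for k
    proof -
      obtain h where h: "arrow h" "src h = src f" "tgt h = tgt f" "deg h = -1" "level h \<le> ereal r"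
        and k: "k = (f \<^bold>+ g) \<^bold>+ \<delta> h" using fgk unfolding homotopic_def by auto
      have "homotopic r g (g \<^bold>+ \<delta> h)" unfolding homotopic_def using h assms by auto
      moreover have "k = f \<^bold>+ (g \<^bold>+ \<delta> h)" using k h assms by simp
      ultimately show ?thesis using homotopic_refl[of f r] assms by auto
    qed
    then show "cls r (f \<^bold>+ g) \<subseteq> {elt (f' \<^bold>+ g') | f' g'. homotopic r f f' \<and> homotopic r g g'}"
      using assms by (fastforce simp: cls_eq_homotopic)
  qed
  finally show ?thesis .
qed

lemma Mor_smult:
  assumes "cocycle r f" "src f = X" "tgt f = Y" "a \<in> carrier K"
  shows "a \<odot>\<^bsub>Mor r X Y\<^esub> cls r f = cls r (a \<^bold>* f)"
proof -
  have "cclass (dghom D X Y) r (a \<odot>\<^bsub>gpart (dghom D X Y) 0\<^esub> elt g) = cls r (a \<^bold>* f)" if "homotopic r f g" for g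
  proof -
    have "cls r (a \<^bold>* g) = cls r (a \<^bold>* f)"
      using homotopic_smult[OF that] assms cls_eqI[of r "a \<^bold>* f" "a \<^bold>* g"] by simp
    then show ?thesis using homotopic_typed[OF that] assms by (simp add: cls_def asmult_def)
  qed
  then have "(\<Union>x\<in>cls r f. cclass (dghom D X Y) r (a \<odot>\<^bsub>gpart (dghom D X Y) 0\<^esub> x)) = cls r (a \<^bold>* f)"
    using assms by - (rule Union_cls, auto)
  then show ?thesis by (simp add: H0_def H0_module_def)
qed

lemma pstr_cls:
  assumes "cocycle r f" "src f = X" "tgt f = Y" "r \<le> s"
  shows "pstr (H0 D) r s X Y (cls r f) = cls s f"
proof -
  have "cclass (dghom D X Y) s (elt g) = cls s f" if "homotopic r f g" for g
    using cls_eqI[OF homotopic_mono[OF that assms(4)]] homotopic_typed[OF that] assms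
    by (simp add: cls_def)
  then have "(\<Union>x\<in>cls r f. cclass (dghom D X Y) s x) = cls s f"
    using assms by - (rule Union_cls, auto)
  then show ?thesis by (simp add: H0_def)
qed

lemma pcomp_cls:
  assumes "cocycle r f" "cocycle s g" "src f = X" "tgt f = Y" "src g = Y" "tgt g = Z"
  shows "pcomp (H0 D) X Y Z s r (cls s g) (cls r f) = cls (s + r) (g \<cdot> f)"
proof -
  have "cclass (dghom D X Z) (s + r) (dgcomp D X Y Z 0 0 (elt g') (elt f')) = cls (s + r) (g \<cdot> f)"
    if f': "homotopic r f f'" and g': "homotopic s g g'" for f' g'
  proof -
    have "cls (s + r) (g \<cdot> f) = cls (s + r) (g' \<cdot> f')"
      using cls_eqI[OF homotopic_comp[OF f' g']] assms by simp
    then show ?thesis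
      using homotopic_typed[OF f'] homotopic_typed[OF g'] assms by (simp add: cls_def acomp_def)
  qed
  then have "(\<Union>y\<in>cls r f. cclass (dghom D X Z) (s + r) (dgcomp D X Y Z 0 0 (elt g') y)) = cls (s + r) (g \<cdot> f)"
    if "homotopic s g g'" for g'
    using that assms by - (rule Union_cls, auto)
  then have "(\<Union>x\<in>cls s g. \<Union>y\<in>cls r f. cclass (dghom D X Z) (s + r) (dgcomp D X Y Z 0 0 x y)) = cls (s + r) (g \<cdot> f)"
    using assms by - (rule Union_cls, auto)
  then show ?thesis by (simp add: H0_def)
qed

lemma Mor_group: "\<lbrakk>X \<in> Ob; Y \<in> Ob\<rbrakk> \<Longrightarrow> abelian_group (Mor r X Y)"
proof (rule abelian_groupI)
  assume XY: "X \<in> Ob" "Y \<in> Ob"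
  note E = MorE[OF _ XY]
  show "\<zero>\<^bsub>Mor r X Y\<^esub> \<in> carrier (Mor r X Y)"
    using XY by (simp add: Mor_zero cocycle_zero)
  fix U assume U: "U \<in> carrier (Mor r X Y)"
  then obtain f where f: "cocycle r f" "src f = X" "tgt f = Y" "U = cls r f" by (rule E)
  show "\<zero>\<^bsub>Mor r X Y\<^esub> \<oplus>\<^bsub>Mor r X Y\<^esub> U = U"
    using f XY by (simp add: Mor_zero Mor_add cocycle_zero)
  show "\<exists>V\<in>carrier (Mor r X Y). V \<oplus>\<^bsub>Mor r X Y\<^esub> U = \<zero>\<^bsub>Mor r X Y\<^esub>"
    by (rule bexI[of _ "cls r (\<^bold>- f)"]) (use f XY in \<open>simp_all add: Mor_add Mor_zero cocycle_neg\<close>)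
  fix V assume "V \<in> carrier (Mor r X Y)"
  then obtain g where g: "cocycle r g" "src g = X" "tgt g = Y" "V = cls r g" by (rule E)
  show "U \<oplus>\<^bsub>Mor r X Y\<^esub> V \<in> carrier (Mor r X Y)"
    using f g by (simp add: Mor_add cocycle_add)
  show "U \<oplus>\<^bsub>Mor r X Y\<^esub> V = V \<oplus>\<^bsub>Mor r X Y\<^esub> U"
    using f g aadd_comm[of f g] by (simp add: Mor_add)
  fix W assume "W \<in> carrier (Mor r X Y)"
  then obtain h where h: "cocycle r h" "src h = X" "tgt h = Y" "W = cls r h" by (rule E)
  show "U \<oplus>\<^bsub>Mor r X Y\<^esub> V \<oplus>\<^bsub>Mor r X Y\<^esub> W = U \<oplus>\<^bsub>Mor r X Y\<^esub> (V \<oplus>\<^bsub>Mor r X Y\<^esub> W)"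
    using f g h by (simp add: Mor_add cocycle_add)
qed

lemma Mor_module: "\<lbrakk>X \<in> Ob; Y \<in> Ob\<rbrakk> \<Longrightarrow> module K (Mor r X Y)"
proof (rule moduleI[OF is_cring Mor_group])
  assume XY: "X \<in> Ob" "Y \<in> Ob"
  note E = MorE[OF _ XY]
  fix U assume U: "U \<in> carrier (Mor r X Y)"
  then obtain f where f: "cocycle r f" "src f = X" "tgt f = Y" "U = cls r f" by (rule E)
  show "\<one> \<odot>\<^bsub>Mor r X Y\<^esub> U = U" using f by (simp add: Mor_smult)
  fix a assume a: "a \<in> carrier K"
  show "a \<odot>\<^bsub>Mor r X Y\<^esub> U \<in> carrier (Mor r X Y)" using f a by (simp add: Mor_smult cocycle_smult)
  { fix b assume b: "b \<in> carrier K"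
    show "(a \<otimes> b) \<odot>\<^bsub>Mor r X Y\<^esub> U = a \<odot>\<^bsub>Mor r X Y\<^esub> (b \<odot>\<^bsub>Mor r X Y\<^esub> U)"
      using f a b by (simp add: Mor_smult cocycle_smult asmult_assoc)
    show "(a \<oplus> b) \<odot>\<^bsub>Mor r X Y\<^esub> U = a \<odot>\<^bsub>Mor r X Y\<^esub> U \<oplus>\<^bsub>Mor r X Y\<^esub> b \<odot>\<^bsub>Mor r X Y\<^esub> U"
      using f a b by (simp add: Mor_smult Mor_add cocycle_smult asmult_l_distr) }
  fix V assume "V \<in> carrier (Mor r X Y)"
  then obtain g where g: "cocycle r g" "src g = X" "tgt g = Y" "V = cls r g" by (rule E)
  show "a \<odot>\<^bsub>Mor r X Y\<^esub> (U \<oplus>\<^bsub>Mor r X Y\<^esub> V) = a \<odot>\<^bsub>Mor r X Y\<^esub> U \<oplus>\<^bsub>Mor r X Y\<^esub> a \<odot>\<^bsub>Mor r X Y\<^esub> V"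
    using f g a by (simp add: Mor_smult Mor_add cocycle_add cocycle_smult)
qed

lemma H0_graded_category: "graded_category Ob (\<lambda>X Y r. Mor r X Y) (pcomp (H0 D)) (pid (H0 D))"
proof (rule graded_category.intro)
  show "abelian_group (Mor r X Y)" if "X \<in> Ob" "Y \<in> Ob" for X Y r using that by (rule Mor_group)
  show "pid (H0 D) X \<in> carrier (Mor 0 X X)" if "X \<in> Ob" for X using that by (simp add: cocycle_id)
next
  fix X Y Z f g r s
  assume XYZ: "X \<in> Ob" "Y \<in> Ob" "Z \<in> Ob" and "f \<in> carrier (Mor r X Y)" "g \<in> carrier (Mor s Y Z)"
  then show "pcomp (H0 D) X Y Z s r g f \<in> carrier (Mor (s + r) X Z)"
    by (auto simp: pcomp_cls cocycle_comp elim!: MorE)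
next
  fix X Y Z f f' g r s
  assume XYZ: "X \<in> Ob" "Y \<in> Ob" "Z \<in> Ob"
    and "f \<in> carrier (Mor r X Y)" "f' \<in> carrier (Mor r X Y)" "g \<in> carrier (Mor s Y Z)"
  then show "pcomp (H0 D) X Y Z s r g (f \<oplus>\<^bsub>Mor r X Y\<^esub> f')
      = pcomp (H0 D) X Y Z s r g f \<oplus>\<^bsub>Mor (s + r) X Z\<^esub> pcomp (H0 D) X Y Z s r g f'"
    by (auto simp: pcomp_cls Mor_add cocycle_add cocycle_comp elim!: MorE)
next
  fix X Y Z f g g' r s
  assume XYZ: "X \<in> Ob" "Y \<in> Ob" "Z \<in> Ob"
    and "f \<in> carrier (Mor r X Y)" "g \<in> carrier (Mor s Y Z)" "g' \<in> carrier (Mor s Y Z)"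
  then show "pcomp (H0 D) X Y Z s r (g \<oplus>\<^bsub>Mor s Y Z\<^esub> g') f
      = pcomp (H0 D) X Y Z s r g f \<oplus>\<^bsub>Mor (s + r) X Z\<^esub> pcomp (H0 D) X Y Z s r g' f"
    by (auto simp: pcomp_cls Mor_add cocycle_add cocycle_comp elim!: MorE)
next
  fix W X Y Z f g h r s t
  assume XYZ: "W \<in> Ob" "X \<in> Ob" "Y \<in> Ob" "Z \<in> Ob"
    and "f \<in> carrier (Mor r W X)" "g \<in> carrier (Mor s X Y)" "h \<in> carrier (Mor t Y Z)"
  then show "pcomp (H0 D) W X Z (t + s) r (pcomp (H0 D) X Y Z t s h g) f
      = pcomp (H0 D) W Y Z t (s + r) h (pcomp (H0 D) W X Y s r g f)"
    by (auto simp: pcomp_cls cocycle_comp add.assoc elim!: MorE)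
next
  fix X Y f r
  assume XY: "X \<in> Ob" "Y \<in> Ob" and f: "f \<in> carrier (Mor r X Y)"
  from f obtain a where a: "cocycle r a" "src a = X" "tgt a = Y" "f = cls r a" using XY by (rule MorE)
  show "pcomp (H0 D) X Y Y 0 r (pid (H0 D) Y) f = f"
    using a XY by (simp add: pcomp_cls cocycle_id)
  show "pcomp (H0 D) X X Y r 0 f (pid (H0 D) X) = f"
    using a XY by (simp add: pcomp_cls cocycle_id)
qed

sublocale H: graded_category Ob "\<lambda>X Y r. Mor r X Y" "pcomp (H0 D)" "pid (H0 D)"
  by (rule H0_graded_category)

notation H.acomp (infixr "\<circ>\<^sub>H" 75) and H.aadd (infixr "+\<^sub>H" 65) and H.aneg ("-\<^sub>H _" [80] 80)

definition hcl :: "real \<Rightarrow> ('o, int, 'm) arr \<Rightarrow> ('o, real, 'm set) arr" where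
  "hcl r f = Arr (src f) (tgt f) r (cls r f)"

lemma hcl_dom [simp]: "src (hcl r f) = src f" "tgt (hcl r f) = tgt f" "deg (hcl r f) = r" "elt (hcl r f) = cls r f"
  by (simp_all add: hcl_def)

lemma arrow_hcl [simp]: "cocycle r f \<Longrightarrow> H.arrow (hcl r f)"
  by (simp add: H.arrow_def)

lemma hclE:
  assumes "H.arrow a"
  obtains f where "cocycle (deg a) f" "src f = src a" "tgt f = tgt a" "a = hcl (deg a) f"
proof -
  have "elt a \<in> carrier (Mor (deg a) (src a) (tgt a))" "src a \<in> Ob" "tgt a \<in> Ob"
    using assms by (simp_all add: H.arrow_def del: H.arrow_ends)
  then obtain f where "cocycle (deg a) f" "src f = src a" "tgt f = tgt a" "elt a = cls (deg a) f"
    by (rule MorE)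
  then show ?thesis by (intro that[of f]) (auto intro: arr.expand)
qed

lemma hcl_comp: "\<lbrakk>cocycle r f; cocycle s g; src g = tgt f\<rbrakk> \<Longrightarrow> hcl s g \<circ>\<^sub>H hcl r f = hcl (s + r) (g \<cdot> f)"
  by (simp add: H.acomp_def hcl_def pcomp_cls)

lemma hcl_comp0 [simp]: "\<lbrakk>cocycle 0 f; cocycle 0 g; src g = tgt f\<rbrakk> \<Longrightarrow> hcl 0 g \<circ>\<^sub>H hcl 0 f = hcl 0 (g \<cdot> f)"
  by (simp add: hcl_comp)

lemma hcl_add: "\<lbrakk>cocycle r f; cocycle r g; src f = src g; tgt f = tgt g\<rbrakk> \<Longrightarrow> hcl r f +\<^sub>H hcl r g = hcl r (f \<^bold>+ g)"
  by (simp add: H.aadd_def hcl_def Mor_add)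

lemma hcl_zero: "\<lbrakk>X \<in> Ob; Y \<in> Ob\<rbrakk> \<Longrightarrow> hcl r (azero X Y 0) = H.azero X Y r"
  by (simp add: H.azero_def hcl_def Mor_zero)

lemma hcl_neg: "cocycle r f \<Longrightarrow> hcl r (\<^bold>- f) = -\<^sub>H hcl r f"
  by (rule H.aneg_unique) (simp_all add: hcl_add cocycle_neg hcl_zero)

lemma hcl_id: "hcl 0 (aid X) = H.aid X"
  by (simp add: H.aid_def hcl_def)

lemma hcl_eqI:
  assumes "cocycle r f" "arrow h" "src h = src f" "tgt h = tgt f" "deg h = -1" "level h \<le> ereal r"
    "g = f \<^bold>+ \<delta> h"
  shows "hcl r f = hcl r g"
proof -
  have "homotopic r f g" using assms by (auto simp: homotopic_def)
  then show ?thesis using assms cls_eqI[of r f g] by (simp add: hcl_def)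
qed

lemma hcl_eqD:
  assumes "hcl r f = hcl r g" "cocycle r f" "cocycle r g"
  obtains h where "arrow h" "src h = src f" "tgt h = tgt f" "deg h = -1" "level h \<le> ereal r"
    "g = f \<^bold>+ \<delta> h"
proof -
  have "src f = src g" "tgt f = tgt g" "cls r f = cls r g" using assms by (simp_all add: hcl_def)
  then have "homotopic r f g" using cls_eq_iff assms cocycleD by metis
  then show ?thesis using that by (auto simp: homotopic_def)
qed

theorem persistence_category_H0: "persistence_category K (H0 D)"
proof (intro persistence_category.intro persistence_category_axioms.intro field_axioms)
  show "module K (Mor r X Y)" if "X \<in> pobj (H0 D)" "Y \<in> pobj (H0 D)" for X Y r
    using that by (simp add: Mor_module)
next
  fix X Y and r s :: real assume "X \<in> pobj (H0 D)" "Y \<in> pobj (H0 D)" "r \<le> s"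
  then have *: "X \<in> Ob" "Y \<in> Ob" "r \<le> s" by simp_all
  have m: "cocycle s f" if "cocycle r f" for f using that *(3) by (rule cocycle_mono)
  show "linear_map K (Mor r X Y) (Mor s X Y) (pstr (H0 D) r s X Y)"
    unfolding linear_map_def using *
    by (auto simp: pstr_cls Mor_add Mor_smult cocycle_add cocycle_smult m elim!: MorE)
next
  fix X Y r f assume *: "X \<in> pobj (H0 D)" "Y \<in> pobj (H0 D)" "f \<in> carrier (Mor r X Y)"
  then show "pstr (H0 D) r r X Y f = f" by (auto simp: pstr_cls elim!: MorE)
  show "pcomp (H0 D) X Y Y 0 r (pid (H0 D) Y) f = f" "pcomp (H0 D) X X Y r 0 f (pid (H0 D) X) = f"
    using * H.cmp_idn_left H.cmp_idn_right by auto
next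
  fix X Y f and r s t :: real
  assume "X \<in> pobj (H0 D)" "Y \<in> pobj (H0 D)" "r \<le> s" "s \<le> t" "f \<in> carrier (Mor r X Y)"
  then show "pstr (H0 D) s t X Y (pstr (H0 D) r s X Y f) = pstr (H0 D) r t X Y f"
    using cocycle_mono[of r _ s] by (auto simp: pstr_cls elim!: MorE)
next
  show "pid (H0 D) X \<in> carrier (Mor 0 X X)" if "X \<in> pobj (H0 D)" for X
    using that H.idn_closed by simp
next
  fix X Y Z g and r s :: real
  assume "X \<in> pobj (H0 D)" "Y \<in> pobj (H0 D)" "Z \<in> pobj (H0 D)"
  then have *: "X \<in> Ob" "Y \<in> Ob" "Z \<in> Ob" by simp_all
  have "pcomp (H0 D) X Y Z s r g (a \<odot>\<^bsub>Mor r X Y\<^esub> f) = a \<odot>\<^bsub>Mor (s + r) X Z\<^esub> pcomp (H0 D) X Y Z s r g f"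
    "pcomp (H0 D) X Y Z s r (a \<odot>\<^bsub>Mor s Y Z\<^esub> g) f = a \<odot>\<^bsub>Mor (s + r) X Z\<^esub> pcomp (H0 D) X Y Z s r g f"
    if "g \<in> carrier (Mor s Y Z)" "f \<in> carrier (Mor r X Y)" "a \<in> carrier K" for f g a
    using * that by (auto simp: pcomp_cls Mor_smult cocycle_smult cocycle_comp elim!: MorE)
  note smult = this
  show "linear_map K (Mor r X Y) (Mor (s + r) X Z) (\<lambda>f. pcomp (H0 D) X Y Z s r g f)"
    if "g \<in> carrier (Mor s Y Z)"
    unfolding linear_map_def using * that smult by (auto simp: H.cmp_closed H.cmp_add_right)
  show "linear_map K (Mor s Y Z) (Mor (s + r) X Z) (\<lambda>g. pcomp (H0 D) X Y Z s r g f)"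
    if "f \<in> carrier (Mor r X Y)" for f
    unfolding linear_map_def using * that smult by (auto simp: H.cmp_closed H.cmp_add_left)
next
  fix W X Y Z f g h and r s t :: real
  assume "W \<in> pobj (H0 D)" "X \<in> pobj (H0 D)" "Y \<in> pobj (H0 D)" "Z \<in> pobj (H0 D)"
    "f \<in> carrier (Mor r W X)" "g \<in> carrier (Mor s X Y)" "h \<in> carrier (Mor t Y Z)"
  then show "pcomp (H0 D) W X Z (t + s) r (pcomp (H0 D) X Y Z t s h g) f
    = pcomp (H0 D) W Y Z t (s + r) h (pcomp (H0 D) W X Y s r g f)"
    by (simp add: H.cmp_assoc)
next
  fix X Y Z f g and r r' s s' :: real
  assume "X \<in> pobj (H0 D)" "Y \<in> pobj (H0 D)" "Z \<in> pobj (H0 D)" and le: "r \<le> r'" "s \<le> s'"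
    and fg: "f \<in> carrier (Mor r X Y)" "g \<in> carrier (Mor s Y Z)"
  then have *: "X \<in> Ob" "Y \<in> Ob" "Z \<in> Ob" by simp_all
  from fg(1) obtain a where a: "cocycle r a" "src a = X" "tgt a = Y" "f = cls r a" using *(1,2) by (rule MorE)
  from fg(2) obtain b where b: "cocycle s b" "src b = Y" "tgt b = Z" "g = cls s b" using *(2,3) by (rule MorE)
  show "pcomp (H0 D) X Y Z s' r' (pstr (H0 D) s s' Y Z g) (pstr (H0 D) r r' X Y f)
    = pstr (H0 D) (s + r) (s' + r') X Z (pcomp (H0 D) X Y Z s r g f)"
    using a b le cocycle_mono[OF a(1) le(1)] cocycle_mono[OF b(1) le(2)]
    by (simp add: pstr_cls pcomp_cls cocycle_comp)
qed

end

section \<open>Triangulated categories from standard triangles\<close>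

context graded_category begin

text \<open>For a persistence category, graded by the shifts of its morphisms, this is the category of morphisms
  of shift zero.\<close>

definition degree_zero :: "('o, 'm, 'h) precategory" where
  "degree_zero = \<lparr> cobj = Ob, chom = (\<lambda>X Y. hm X Y 0), ccomp = (\<lambda>X Y Z g f. cmp X Y Z 0 0 g f), cid = idn \<rparr>"

definition amor :: "'o \<Rightarrow> 'o \<Rightarrow> ('o, 'd, 'm) arr \<Rightarrow> bool" where
  "amor X Y f \<longleftrightarrow> arrow f \<and> src f = X \<and> tgt f = Y \<and> deg f = 0"

definition aiso :: "'o \<Rightarrow> 'o \<Rightarrow> ('o, 'd, 'm) arr \<Rightarrow> bool" where
  "aiso X Y f \<longleftrightarrow> amor X Y f \<and> (\<exists>g. amor Y X g \<and> g \<cdot> f = aid X \<and> f \<cdot> g = aid Y)"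

lemma amorD: "amor X Y f \<Longrightarrow> arrow f" "amor X Y f \<Longrightarrow> src f = X" "amor X Y f \<Longrightarrow> tgt f = Y"
  "amor X Y f \<Longrightarrow> deg f = 0" "amor X Y f \<Longrightarrow> X \<in> Ob" "amor X Y f \<Longrightarrow> Y \<in> Ob"
  by (auto simp: amor_def)

lemma amor_comp: "\<lbrakk>amor X Y f; amor Y Z g\<rbrakk> \<Longrightarrow> amor X Z (g \<cdot> f)"
  by (simp add: amor_def)

lemma amor_neg: "amor X Y f \<Longrightarrow> amor X Y (\<^bold>- f)"
  by (simp add: amor_def)

lemma amor_id: "X \<in> Ob \<Longrightarrow> amor X X (aid X)"
  by (simp add: amor_def)

lemma amor_zero: "\<lbrakk>X \<in> Ob; Y \<in> Ob\<rbrakk> \<Longrightarrow> amor X Y (azero X Y 0)"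
  by (simp add: amor_def)

lemma aisoE:
  assumes "aiso X Y f"
  obtains g where "amor X Y f" "amor Y X g" "aiso Y X g" "g \<cdot> f = aid X" "f \<cdot> g = aid Y"
  using assms by (auto simp: aiso_def)

lemma aisoI: "\<lbrakk>amor X Y f; amor Y X g; g \<cdot> f = aid X; f \<cdot> g = aid Y\<rbrakk> \<Longrightarrow> aiso X Y f"
  by (auto simp: aiso_def)

lemma aiso_mor: "aiso X Y f \<Longrightarrow> amor X Y f"
  by (simp add: aiso_def)

lemma aiso_id: "X \<in> Ob \<Longrightarrow> aiso X X (aid X)"
  by (rule aisoI[of _ _ _ "aid X"]) (simp_all add: amor_id)

lemma id_left: "amor X Y f \<Longrightarrow> aid Y \<cdot> f = f" and id_right: "amor X Y f \<Longrightarrow> f \<cdot> aid X = f"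
  by (simp_all add: amor_def)

lemma aiso_comp:
  assumes "aiso X Y f" "aiso Y Z g"
  shows "aiso X Z (g \<cdot> f)"
proof -
  obtain f' where f: "amor X Y f" "amor Y X f'" "f' \<cdot> f = aid X" "f \<cdot> f' = aid Y"
    using assms(1) by (rule aisoE)
  obtain g' where g: "amor Y Z g" "amor Z Y g'" "g' \<cdot> g = aid Y" "g \<cdot> g' = aid Z"
    using assms(2) by (rule aisoE)
  note t = amorD[OF f(1)] amorD[OF f(2)] amorD[OF g(1)] amorD[OF g(2)]
  show ?thesis
    by (rule aisoI[of _ _ _ "f' \<cdot> g'"])
      (use t in \<open>simp_all add: amor_def precomp[OF g(3)] precomp[OF f(4)] f(3) g(4)\<close>)
qed

lemma aiso_two_sided:
  assumes f: "amor X Y f" and g: "amor Y X g" and gf: "aiso X X (g \<cdot> f)" and fg: "aiso Y Y (f \<cdot> g)"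
  shows "aiso X Y f"
proof -
  obtain l where l: "amor X X l" "l \<cdot> (g \<cdot> f) = aid X" using gf by (rule aisoE)
  obtain r where r: "amor Y Y r" "(f \<cdot> g) \<cdot> r = aid Y" using fg by (rule aisoE)
  note t = amorD[OF f] amorD[OF g] amorD[OF l(1)] amorD[OF r(1)]
  have "l \<cdot> g = l \<cdot> g \<cdot> ((f \<cdot> g) \<cdot> r)" unfolding r(2) using t by simp
  also have "\<dots> = (l \<cdot> (g \<cdot> f)) \<cdot> (g \<cdot> r)" using t by simp
  also have "\<dots> = g \<cdot> r" unfolding l(2) using t by simp
  finally have e: "l \<cdot> g = g \<cdot> r" .
  have "f \<cdot> l \<cdot> g = aid Y" unfolding e using r(2) t by simp
  moreover have "(l \<cdot> g) \<cdot> f = aid X" using l(2) t by simp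
  ultimately show ?thesis
    by (intro aisoI[of _ _ _ "l \<cdot> g"]) (use t in \<open>simp_all add: amor_def\<close>)
qed

end

text \<open>A triangulation is determined by its cones. The axioms below speak only about standard
  triangles \<open>u\<close>, \<open>i\<close>, \<open>p\<close>, which in a dg-category come with explicit contracting data: existence,
  functoriality, \<open>p\<close> is a weak cokernel of \<open>i\<close>, the cone of an identity vanishes, and the rotated
  triangle and the octahedron are again standard up to an isomorphism of the third vertex.\<close>

locale standard_triangles = graded_category Ob hm cmp idn
  for Ob :: "'o set"
    and hm :: "'o \<Rightarrow> 'o \<Rightarrow> 'd::comm_monoid_add \<Rightarrow> ('m, 'h) ring_scheme"
    and cmp :: "'o \<Rightarrow> 'o \<Rightarrow> 'o \<Rightarrow> 'd \<Rightarrow> 'd \<Rightarrow> 'm \<Rightarrow> 'm \<Rightarrow> 'm"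
    and idn :: "'o \<Rightarrow> 'm" +
  fixes T :: "'o \<Rightarrow> 'o"
    and TM :: "('o, 'd, 'm) arr \<Rightarrow> ('o, 'd, 'm) arr"
    and Std :: "('o, 'd, 'm) arr \<Rightarrow> ('o, 'd, 'm) arr \<Rightarrow> ('o, 'd, 'm) arr \<Rightarrow> bool"
  assumes T_bij: "bij_betw T Ob Ob"
    and TM_mor: "amor X Y f \<Longrightarrow> amor (T X) (T Y) (TM f)"
    and TM_inj: "\<lbrakk>amor X Y f; amor X Y g; TM f = TM g\<rbrakk> \<Longrightarrow> f = g"
    and TM_surj: "\<lbrakk>X \<in> Ob; Y \<in> Ob; amor (T X) (T Y) g\<rbrakk> \<Longrightarrow> \<exists>f. amor X Y f \<and> TM f = g"
    and TM_add: "\<lbrakk>amor X Y f; amor X Y g\<rbrakk> \<Longrightarrow> TM (f \<^bold>+ g) = TM f \<^bold>+ TM g"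
    and TM_id: "X \<in> Ob \<Longrightarrow> TM (aid X) = aid (T X)"
    and TM_comp: "\<lbrakk>amor X Y f; amor Y Z g\<rbrakk> \<Longrightarrow> TM (g \<cdot> f) = TM g \<cdot> TM f"
    and zero_exists: "\<exists>Z\<in>Ob. aid Z = azero Z Z 0"
    and biproduct_exists: "\<lbrakk>X \<in> Ob; Y \<in> Ob\<rbrakk> \<Longrightarrow> \<exists>P jX jY pX pY.
      amor X P jX \<and> amor Y P jY \<and> amor P X pX \<and> amor P Y pY \<and>
      pX \<cdot> jX = aid X \<and> pY \<cdot> jY = aid Y \<and> pY \<cdot> jX = azero X Y 0 \<and> pX \<cdot> jY = azero Y X 0 \<and>
      jX \<cdot> pX \<^bold>+ jY \<cdot> pY = aid P"
    and Std_typed: "Std u i p \<Longrightarrow> \<exists>X Y C. amor X Y u \<and> amor Y C i \<and> amor C (T X) p"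
    and Std_exists: "amor X Y u \<Longrightarrow> \<exists>i p. Std u i p"
    and Std_map:
      "\<lbrakk>Std u i p; Std u' i' p'; amor (src u) (src u') a; amor (tgt u) (tgt u') b; b \<cdot> u = u' \<cdot> a\<rbrakk> \<Longrightarrow>
       \<exists>c. amor (tgt i) (tgt i') c \<and> c \<cdot> i = i' \<cdot> b \<and> p' \<cdot> c = TM a \<cdot> p"
    and Std_factor:
      "\<lbrakk>Std u i p; amor (tgt i) Z g; g \<cdot> i = azero (src i) Z 0\<rbrakk> \<Longrightarrow> \<exists>f. amor (tgt p) Z f \<and> g = f \<cdot> p"
    and Std_id: "Std (aid X) i p \<Longrightarrow> aid (tgt i) = azero (tgt i) (tgt i) 0"
    and Std_rotate: "Std u i p \<Longrightarrow>
      \<exists>i' p' c. Std i i' p' \<and> aiso (tgt p) (tgt i') c \<and> c \<cdot> p = i' \<and> p' \<cdot> c = \<^bold>- TM u"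
    and Std_octahedron:
      "\<lbrakk>Std u i1 p1; Std v i2 p2; Std (v \<cdot> u) i3 p3; src v = tgt u\<rbrakk> \<Longrightarrow>
       \<exists>f g i4 p4 c. amor (tgt i1) (tgt i3) f \<and> amor (tgt i3) (tgt i2) g \<and> Std f i4 p4 \<and>
         aiso (tgt i2) (tgt i4) c \<and> c \<cdot> g = i4 \<and> p4 \<cdot> c = TM i1 \<cdot> p2 \<and>
         f \<cdot> i1 = i3 \<cdot> v \<and> p3 \<cdot> f = p1 \<and> g \<cdot> i3 = i2 \<and> p2 \<cdot> g = TM u \<cdot> p3"
begin

text \<open>The isomorphism changes only the third vertex. Isomorphisms of the other vertices are absorbed by
  passing to the standard triangle of the changed morphism, see \<open>exact_iso\<close>.\<close>

definition exact :: "'o \<Rightarrow> 'o \<Rightarrow> 'o \<Rightarrow> ('o, 'd, 'm) arr \<Rightarrow> ('o, 'd, 'm) arr \<Rightarrow> ('o, 'd, 'm) arr \<Rightarrow> bool" where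
  "exact X Y Z u v w \<longleftrightarrow> amor X Y u \<and> amor Y Z v \<and> amor Z (T X) w \<and>
     (\<exists>i p c. Std u i p \<and> aiso Z (tgt i) c \<and> c \<cdot> v = i \<and> p \<cdot> c = w)"

lemma StdE:
  assumes "Std u i p" "amor X Y u"
  obtains C where "tgt i = C" "amor Y C i" "amor C (T X) p"
  using Std_typed[OF assms(1)] assms(2) by (auto simp: amor_def)

text \<open>If \<open>e\<close> is compatible with \<open>i\<close> and \<open>p\<close>, then \<open>e - 1\<close> factors through \<open>p\<close> and is killed by
  \<open>p\<close>. So it squares to zero, and \<open>e\<close> is invertible.\<close>

lemma Std_endo_iso:
  assumes S: "Std u i p" and e: "amor C C e" "e \<cdot> i = i" "p \<cdot> e = p" and C: "tgt i = C"
  shows "aiso C C e"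
proof -
  obtain X Y where "amor X Y u" using Std_typed[OF S] by auto
  then have i: "amor Y C i" and p: "amor C (T X) p" using S C by (auto elim: StdE)
  note t = amorD[OF i] amorD[OF p] amorD[OF e(1)]
  define n where "n = e \<^bold>+ \<^bold>- aid C"
  have n: "amor C C n" using t by (simp add: amor_def n_def)
  have "n \<cdot> i = azero (src i) C 0" using t by (simp add: n_def e(2))
  with S n C obtain f where f: "amor (T X) C f" "n = f \<cdot> p"
    using Std_factor[of u i p C n] p by (auto simp: amorD)
  have pn: "p \<cdot> n = azero C (T X) 0" using t by (simp add: n_def e(3))
  have "n \<cdot> n = f \<cdot> (p \<cdot> n)" using f(2) amorD[OF f(1)] t amorD[OF n] by simp
  then have nn: "n \<cdot> n = azero C C 0" using f(1) t pn by (simp add: amorD)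
  have en: "e = aid C \<^bold>+ n" using t by (simp add: n_def)
  show ?thesis
    by (rule aisoI[of _ _ _ "aid C \<^bold>+ \<^bold>- n"])
      (use amorD[OF n] t(11) in \<open>simp_all add: amor_def en nn\<close>)
qed

text \<open>The maps that functoriality gives in both directions compose to endomorphisms of \<open>C\<close> and \<open>C'\<close>
  that are compatible with \<open>i\<close> and \<open>p\<close>.\<close>

lemma Std_map_iso:
  assumes S: "Std u i p" and S': "Std u' i' p'" and a: "aiso (src u) (src u') a" and b: "aiso (tgt u) (tgt u') b"
    and e: "b \<cdot> u = u' \<cdot> a"
  shows "\<exists>c. aiso (tgt i) (tgt i') c \<and> c \<cdot> i = i' \<cdot> b \<and> p' \<cdot> c = TM a \<cdot> p"
proof -
  obtain X Y C where t: "amor X Y u" "amor Y C i" "amor C (T X) p" using Std_typed[OF S] by auto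
  obtain X' Y' C' where t': "amor X' Y' u'" "amor Y' C' i'" "amor C' (T X') p'" using Std_typed[OF S'] by auto
  note d = amorD[OF t(1)] amorD[OF t(2)] amorD[OF t(3)] amorD[OF t'(1)] amorD[OF t'(2)] amorD[OF t'(3)]
  obtain a' where a': "amor X X' a" "amor X' X a'" "a' \<cdot> a = aid X" "a \<cdot> a' = aid X'"
    using a unfolding d by (rule aisoE)
  obtain b' where b': "amor Y Y' b" "amor Y' Y b'" "b' \<cdot> b = aid Y" "b \<cdot> b' = aid Y'"
    using b unfolding d by (rule aisoE)
  note d' = amorD[OF a'(1)] amorD[OF a'(2)] amorD[OF b'(1)] amorD[OF b'(2)]
  have "b' \<cdot> u' = b' \<cdot> (u' \<cdot> a) \<cdot> a'" using d d' a' by simp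
  also have "\<dots> = u \<cdot> a'" unfolding e[symmetric] using d d' by (simp add: precomp[OF b'(3)])
  finally have e': "u \<cdot> a' = b' \<cdot> u'" ..
  obtain c where c: "amor C C' c" "c \<cdot> i = i' \<cdot> b" "p' \<cdot> c = TM a \<cdot> p"
    using Std_map[OF S S', of a b] a'(1) b'(1) e unfolding d by auto
  obtain c' where c': "amor C' C c'" "c' \<cdot> i' = i \<cdot> b'" "p \<cdot> c' = TM a' \<cdot> p'"
    using Std_map[OF S' S, of a' b'] a'(2) b'(2) e' unfolding d by auto
  note dc = amorD[OF c(1)] amorD[OF c'(1)] amorD[OF TM_mor[OF a'(1)]] amorD[OF TM_mor[OF a'(2)]]
  have TT: "TM a' \<cdot> TM a = aid (T X)" "TM a \<cdot> TM a' = aid (T X')"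
    using TM_comp[OF a'(1,2)] TM_comp[OF a'(2,1)] a' d by (simp_all add: TM_id)
  have "aiso C C (c' \<cdot> c)"
    by (rule Std_endo_iso[OF S])
      (use d d' dc in \<open>simp_all add: amor_comp[OF c(1) c'(1)] c(2) precomp[OF c'(2)] b'(3)
        precomp[OF c'(3)] c(3) precomp[OF TT(1)]\<close>)
  moreover have "aiso C' C' (c \<cdot> c')"
    by (rule Std_endo_iso[OF S'])
      (use d d' dc in \<open>simp_all add: amor_comp[OF c'(1) c(1)] c'(2) precomp[OF c(2)] b'(4)
        precomp[OF c(3)] c'(3) precomp[OF TT(2)]\<close>)
  ultimately have "aiso C C' c" using c(1) c'(1) by (rule_tac aiso_two_sided)
  then show ?thesis using c d by auto
qed

lemma exactE:
  assumes "exact X Y Z u v w"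
  obtains i p C c where "amor X Y u" "amor Y Z v" "amor Z (T X) w" "Std u i p" "amor Y C i" "amor C (T X) p"
    "tgt i = C" "tgt p = T X" "aiso Z C c" "c \<cdot> v = i" "p \<cdot> c = w"
proof -
  obtain i p c where *: "amor X Y u" "amor Y Z v" "amor Z (T X) w" "Std u i p" "aiso Z (tgt i) c" "c \<cdot> v = i" "p \<cdot> c = w"
    using assms unfolding exact_def by auto
  from *(4,1) obtain C where "tgt i = C" "amor Y C i" "amor C (T X) p" by (rule StdE)
  with * that[where C=C and c=c and i=i and p=p] show ?thesis by (simp add: amorD)
qed

lemma exactI:
  "\<lbrakk>amor X Y u; amor Y Z v; amor Z (T X) w; Std u i p; aiso Z (tgt i) c; c \<cdot> v = i; p \<cdot> c = w\<rbrakk> \<Longrightarrow>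
   exact X Y Z u v w"
  by (auto simp: exact_def)

lemma Std_exact:
  assumes "Std u i p" "amor X Y u" shows "exact X Y (tgt i) u i p"
proof -
  from assms obtain C where "tgt i = C" "amor Y C i" "amor C (T X) p" by (rule StdE)
  then show ?thesis using assms by (intro exactI[where i=i and p=p and c="aid C"]) (auto simp: aiso_id amorD)
qed

text \<open>Functoriality of cones in one statement: the completion of a square, and the five lemma for it.\<close>

lemma exact_map_iso:
  assumes E: "exact X Y Z u v w" and E': "exact X' Y' Z' u' v' w'"
    and a: "amor X X' a" and b: "amor Y Y' b" and e: "b \<cdot> u = u' \<cdot> a"
  shows "\<exists>c. amor Z Z' c \<and> c \<cdot> v = v' \<cdot> b \<and> w' \<cdot> c = TM a \<cdot> w \<and>
    (aiso X X' a \<longrightarrow> aiso Y Y' b \<longrightarrow> aiso Z Z' c)"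
proof -
  obtain i p C c1 where t: "amor X Y u" "amor Y Z v" "amor Z (T X) w" and S: "Std u i p"
    and ip: "amor Y C i" "amor C (T X) p" "tgt i = C" "tgt p = T X"
    and c1: "aiso Z C c1" "c1 \<cdot> v = i" "p \<cdot> c1 = w"
    using E by (rule exactE)
  obtain i' p' C' c2 where t': "amor X' Y' u'" "amor Y' Z' v'" "amor Z' (T X') w'" and S': "Std u' i' p'"
    and ip': "amor Y' C' i'" "amor C' (T X') p'" "tgt i' = C'" "tgt p' = T X'"
    and c2: "aiso Z' C' c2" "c2 \<cdot> v' = i'" "p' \<cdot> c2 = w'"
    using E' by (rule exactE)
  obtain d2 where d2: "amor Z' C' c2" "amor C' Z' d2" "aiso C' Z' d2" "d2 \<cdot> c2 = aid Z'" "c2 \<cdot> d2 = aid C'"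
    using c2(1) by (rule aisoE)
  note c1m = aiso_mor[OF c1(1)]
  note d = amorD[OF t(1)] amorD[OF t(2)] amorD[OF t(3)] amorD[OF ip(1)] amorD[OF ip(2)]
    amorD[OF t'(1)] amorD[OF t'(2)] amorD[OF t'(3)] amorD[OF ip'(1)] amorD[OF ip'(2)]
    amorD[OF c1m] amorD[OF d2(1)] amorD[OF d2(2)] amorD[OF a] amorD[OF b] amorD[OF TM_mor[OF a]]
  have "\<exists>\<phi>. amor C C' \<phi> \<and> \<phi> \<cdot> i = i' \<cdot> b \<and> p' \<cdot> \<phi> = TM a \<cdot> p \<and> (aiso X X' a \<longrightarrow> aiso Y Y' b \<longrightarrow> aiso C C' \<phi>)"
  proof (cases "aiso X X' a \<and> aiso Y Y' b")
    case True
    then show ?thesis using Std_map_iso[OF S S', of a b] e unfolding d by (auto intro: aiso_mor)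
  next
    case False
    then show ?thesis using Std_map[OF S S', of a b] e a b unfolding d by auto
  qed
  then obtain \<phi> where \<phi>: "amor C C' \<phi>" "\<phi> \<cdot> i = i' \<cdot> b" "p' \<cdot> \<phi> = TM a \<cdot> p"
    "aiso X X' a \<Longrightarrow> aiso Y Y' b \<Longrightarrow> aiso C C' \<phi>" by auto
  note d = d amorD[OF \<phi>(1)]
  have v': "d2 \<cdot> i' = v'" unfolding c2(2)[symmetric] using d by (simp add: precomp[OF d2(4)])
  show ?thesis
  proof (intro exI[of _ "d2 \<cdot> \<phi> \<cdot> c1"] conjI impI)
    show "amor Z Z' (d2 \<cdot> \<phi> \<cdot> c1)" using d by (simp add: amor_def)
    show "(d2 \<cdot> \<phi> \<cdot> c1) \<cdot> v = v' \<cdot> b" using d by (simp add: c1(2) \<phi>(2) precomp[OF v'])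
    have "w' \<cdot> d2 = p'" unfolding c2(3)[symmetric] using d by (simp add: d2(5))
    then show "w' \<cdot> d2 \<cdot> \<phi> \<cdot> c1 = TM a \<cdot> w"
      using d by (simp add: precomp[OF \<open>w' \<cdot> d2 = p'\<close>] precomp[OF \<phi>(3)] c1(3))
    show "aiso Z Z' (d2 \<cdot> \<phi> \<cdot> c1)" if "aiso X X' a" "aiso Y Y' b"
      using that \<phi>(4) d2(3) c1(1) by (blast intro: aiso_comp)
  qed
qed

lemma exact_iso:
  assumes E: "exact X Y Z u v w" and t': "amor X' Y' u'" "amor Y' Z' v'" "amor Z' (T X') w'"
    and a: "aiso X X' a" and b: "aiso Y Y' b" and c: "aiso Z Z' c"
    and e: "b \<cdot> u = u' \<cdot> a" "c \<cdot> v = v' \<cdot> b" "TM a \<cdot> w = w' \<cdot> c"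
  shows "exact X' Y' Z' u' v' w'"
proof -
  note am = aiso_mor[OF a] note bm = aiso_mor[OF b] note cm = aiso_mor[OF c]
  obtain i p where S: "Std u' i p" using Std_exists t'(1) by blast
  from S t'(1) obtain C where ip: "tgt i = C" "amor Y' C i" "amor C (T X') p" by (rule StdE)
  obtain \<phi> where \<phi>: "amor Z C \<phi>" "\<phi> \<cdot> v = i \<cdot> b" "p \<cdot> \<phi> = TM a \<cdot> w" "aiso Z C \<phi>"
    using exact_map_iso[OF E Std_exact[OF S t'(1)] am bm e(1)] a b unfolding ip(1) by auto
  obtain d where d: "amor Z Z' c" "amor Z' Z d" "aiso Z' Z d" "d \<cdot> c = aid Z" "c \<cdot> d = aid Z'"
    using c by (rule aisoE)
  obtain b' where b': "amor Y Y' b" "amor Y' Y b'" "b' \<cdot> b = aid Y" "b \<cdot> b' = aid Y'"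
    using b by (rule aisoE)
  have t: "amor X Y u" "amor Y Z v" "amor Z (T X) w" using E by (auto simp: exact_def)
  note D = amorD[OF t(1)] amorD[OF t(2)] amorD[OF t(3)] amorD[OF t'(1)] amorD[OF t'(2)] amorD[OF t'(3)]
    amorD[OF am] amorD[OF bm] amorD[OF cm] amorD[OF ip(2)] amorD[OF ip(3)] amorD[OF \<phi>(1)] amorD[OF d(2)]
    amorD[OF b'(2)] amorD[OF TM_mor[OF am]]
  have "d \<cdot> v' = d \<cdot> (v' \<cdot> b) \<cdot> b'" using D by (simp add: b'(4))
  also have "\<dots> = v \<cdot> b'" unfolding e(2)[symmetric] using D by (simp add: precomp[OF d(4)])
  finally have 1: "d \<cdot> v' = v \<cdot> b'" .
  have "(\<phi> \<cdot> d) \<cdot> v' = i" using D by (simp add: 1 precomp[OF \<phi>(2)] b'(4))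
  moreover have "p \<cdot> \<phi> \<cdot> d = w'"
    using D by (simp add: precomp[OF \<phi>(3)] precomp[OF e(3)] d(5))
  ultimately show ?thesis
    using exactI[OF t' S, of "\<phi> \<cdot> d"] aiso_comp[OF d(3) \<phi>(4)] ip by simp
qed

lemma exact_id:
  assumes X: "X \<in> Ob" and Z: "Z \<in> Ob" "aid Z = azero Z Z 0"
  shows "exact X X Z (aid X) (azero X Z 0) (azero Z (T X) 0)"
proof -
  have TX: "T X \<in> Ob" using T_bij X by (auto simp: bij_betw_def)
  obtain i p where S: "Std (aid X) i p" using Std_exists amor_id[OF X] by blast
  from S amor_id[OF X] obtain C where ip: "tgt i = C" "amor X C i" "amor C (T X) p" by (rule StdE)
  have C: "aid C = azero C C 0" using Std_id[OF S] ip by simp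
  have "i = aid C \<cdot> i" using id_left[OF ip(2)] by simp
  then have i: "azero X C 0 = i" using ip(2) X by (simp add: C amorD)
  have "p = p \<cdot> aid C" using id_right[OF ip(3)] by simp
  then have p: "p = azero C (T X) 0" using ip(3) X by (simp add: C amorD)
  have CO: "C \<in> Ob" using ip(2) by (simp add: amorD)
  have iso: "aiso Z C (azero Z C 0)"
    by (rule aisoI[of _ _ _ "azero C Z 0"]) (use Z CO in \<open>simp_all add: amor_zero C\<close>)
  have "azero Z C 0 \<cdot> azero X Z 0 = i" using X Z(1) CO unfolding i[symmetric] by simp
  moreover have "p \<cdot> azero Z C 0 = azero Z (T X) 0" using TX Z(1) CO unfolding p by simp
  ultimately show ?thesis
    using exactI[OF amor_id[OF X] amor_zero[OF X Z(1)] amor_zero[OF Z(1) TX] S] iso ip(1) by simp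
qed

lemma exact_rotate:
  assumes E: "exact X Y Z u v w"
  shows "exact Y Z (T X) v w (\<^bold>- TM u)"
proof -
  obtain i p C c where t: "amor X Y u" "amor Y Z v" "amor Z (T X) w" and S: "Std u i p"
    and ip: "amor Y C i" "amor C (T X) p" "tgt i = C" "tgt p = T X"
    and c: "aiso Z C c" "c \<cdot> v = i" "p \<cdot> c = w"
    using E by (rule exactE)
  obtain i' p' \<psi> where S': "Std i i' p'" and \<psi>: "aiso (T X) (tgt i') \<psi>" "\<psi> \<cdot> p = i'" "p' \<cdot> \<psi> = \<^bold>- TM u"
    using Std_rotate[OF S] unfolding ip by auto
  obtain d where d: "amor Z C c" "amor C Z d" "aiso C Z d" "d \<cdot> c = aid Z" "c \<cdot> d = aid C"
    using c(1) by (rule aisoE)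
  note Tu = amor_neg[OF TM_mor[OF t(1)]]
  note D = amorD[OF t(1)] amorD[OF t(2)] amorD[OF t(3)] amorD[OF ip(1)] amorD[OF ip(2)] amorD[OF d(1)]
    amorD[OF d(2)] amorD[OF Tu]
  have E': "exact Y C (T X) i p (\<^bold>- TM u)"
    by (rule exactI[OF ip(1,2) Tu S' \<psi>])
  show ?thesis
  proof (rule exact_iso[OF E' t(2,3) Tu aiso_id d(3) aiso_id])
    show "d \<cdot> i = v \<cdot> aid Y" unfolding c(2)[symmetric] using D by (simp add: precomp[OF d(4)])
    show "aid (T X) \<cdot> p = w \<cdot> d" unfolding c(3)[symmetric] using D by (simp add: d(5))
    show "TM (aid Y) \<cdot> \<^bold>- TM u = \<^bold>- TM u \<cdot> aid (T X)" using D Tu by (simp add: TM_id id_left id_right)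
  qed (use D in auto)
qed

text \<open>Three rotations give back the triangle up to \<open>T\<close> and signs, and \<open>T\<close> is fully faithful.\<close>

lemma exact_rotate_back:
  assumes t: "amor X Y u" "amor Y Z v" "amor Z (T X) w" and E: "exact Y Z (T X) v w (\<^bold>- TM u)"
  shows "exact X Y Z u v w"
proof -
  obtain i p where S: "Std u i p" using Std_exists t(1) by blast
  from S t(1) obtain C where ip: "tgt i = C" "amor Y C i" "amor C (T X) p" by (rule StdE)
  have 1: "exact (T X) (T Y) (T C) (\<^bold>- TM u) (\<^bold>- TM i) (\<^bold>- TM p)"
    using exact_rotate[OF exact_rotate[OF exact_rotate[OF Std_exact[OF S t(1)]]]] ip by simp
  have 2: "exact (T X) (T Y) (T Z) (\<^bold>- TM u) (\<^bold>- TM v) (\<^bold>- TM w)"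
    using exact_rotate[OF exact_rotate[OF E]] .
  note Tm = TM_mor[OF t(1)] TM_mor[OF t(2)] TM_mor[OF t(3)] TM_mor[OF ip(2)] TM_mor[OF ip(3)]
  note D = amorD[OF t(1)] amorD[OF t(2)] amorD[OF t(3)] amorD[OF ip(2)] amorD[OF ip(3)]
    amorD[OF Tm(1)] amorD[OF Tm(2)] amorD[OF Tm(3)] amorD[OF Tm(4)] amorD[OF Tm(5)]
  obtain c where c: "amor (T Z) (T C) c" "c \<cdot> \<^bold>- TM v = \<^bold>- TM i \<cdot> aid (T Y)"
    "\<^bold>- TM p \<cdot> c = TM (aid (T X)) \<cdot> \<^bold>- TM w" "aiso (T Z) (T C) c"
    using exact_map_iso[OF 2 1 amor_id amor_id] aiso_id[of "T X"] aiso_id[of "T Y"] D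
    by (auto simp: id_left id_right)
  obtain d where d: "amor (T C) (T Z) d" "d \<cdot> c = aid (T Z)" "c \<cdot> d = aid (T C)"
    using c(4) by (rule aisoE)
  obtain c' where c': "amor Z C c'" "TM c' = c" using TM_surj[of Z C c] D c(1) by auto
  obtain d' where d': "amor C Z d'" "TM d' = d" using TM_surj[of C Z d] D d(1) by auto
  have "d' \<cdot> c' = aid Z"
    by (rule TM_inj[OF amor_comp[OF c'(1) d'(1)]])
      (use D c' d' d in \<open>simp_all add: amor_id TM_id TM_comp[OF c'(1) d'(1)]\<close>)
  moreover have "c' \<cdot> d' = aid C"
    by (rule TM_inj[OF amor_comp[OF d'(1) c'(1)]])
      (use D c' d' d in \<open>simp_all add: amor_id TM_id TM_comp[OF d'(1) c'(1)]\<close>)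
  ultimately have iso: "aiso Z C c'" using c' d' by (auto intro: aisoI)
  have neg: "f = g" if "\<^bold>- f = \<^bold>- g" "arrow f" "arrow g" for f g
    using arg_cong[OF that(1), of aneg] that(2,3) by simp
  have "TM (c' \<cdot> v) = TM i"
    using c(2) D amorD[OF c(1)] by (rule_tac neg) (simp_all add: TM_comp[OF t(2) c'(1)] c'(2))
  then have 3: "c' \<cdot> v = i" by (rule TM_inj[OF amor_comp[OF t(2) c'(1)] ip(2)])
  have "TM (p \<cdot> c') = TM w"
    using c(3) D amorD[OF c(1)] by (rule_tac neg) (simp_all add: TM_comp[OF c'(1) ip(3)] c'(2) TM_id)
  then have 4: "p \<cdot> c' = w" by (rule TM_inj[OF amor_comp[OF c'(1) ip(3)] t(3)])
  show ?thesis using exactI[OF t S, of c'] iso 3 4 ip by simp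
qed

text \<open>All three triangles may be replaced by standard ones, since only their third vertices change.\<close>

lemma exact_octahedron:
  assumes E1: "exact X Y Z' u i i'" and E2: "exact Y Z X' v j j'" and E3: "exact X Z Y' (v \<cdot> u) k k'"
  shows "\<exists>f g. amor Z' Y' f \<and> amor Y' X' g \<and> exact Z' Y' X' f g (TM i \<cdot> j') \<and>
    f \<cdot> i = k \<cdot> v \<and> k' \<cdot> f = i' \<and> g \<cdot> k = j \<and> j' \<cdot> g = TM u \<cdot> k'"
proof -
  obtain i1 p1 C1 c1 where t1: "amor X Y u" "amor Y Z' i" "amor Z' (T X) i'" and S1: "Std u i1 p1"
    and ip1: "amor Y C1 i1" "amor C1 (T X) p1" "tgt i1 = C1" "tgt p1 = T X"
    and c1: "aiso Z' C1 c1" "c1 \<cdot> i = i1" "p1 \<cdot> c1 = i'"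
    using E1 by (rule exactE)
  obtain i2 p2 C2 c2 where t2: "amor Y Z v" "amor Z X' j" "amor X' (T Y) j'" and S2: "Std v i2 p2"
    and ip2: "amor Z C2 i2" "amor C2 (T Y) p2" "tgt i2 = C2" "tgt p2 = T Y"
    and c2: "aiso X' C2 c2" "c2 \<cdot> j = i2" "p2 \<cdot> c2 = j'"
    using E2 by (rule exactE)
  obtain i3 p3 C3 c3 where t3: "amor X Z (v \<cdot> u)" "amor Z Y' k" "amor Y' (T X) k'" and S3: "Std (v \<cdot> u) i3 p3"
    and ip3: "amor Z C3 i3" "amor C3 (T X) p3" "tgt i3 = C3" "tgt p3 = T X"
    and c3: "aiso Y' C3 c3" "c3 \<cdot> k = i3" "p3 \<cdot> c3 = k'"
    using E3 by (rule exactE)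
  obtain d1 where d1: "amor Z' C1 c1" "amor C1 Z' d1" "aiso C1 Z' d1" "d1 \<cdot> c1 = aid Z'" "c1 \<cdot> d1 = aid C1"
    using c1(1) by (rule aisoE)
  obtain d2 where d2: "amor X' C2 c2" "amor C2 X' d2" "aiso C2 X' d2" "d2 \<cdot> c2 = aid X'" "c2 \<cdot> d2 = aid C2"
    using c2(1) by (rule aisoE)
  obtain d3 where d3: "amor Y' C3 c3" "amor C3 Y' d3" "aiso C3 Y' d3" "d3 \<cdot> c3 = aid Y'" "c3 \<cdot> d3 = aid C3"
    using c3(1) by (rule aisoE)
  obtain f g i4 p4 c where fg: "amor C1 C3 f" "amor C3 C2 g" and S4: "Std f i4 p4"
    and c: "aiso C2 (tgt i4) c" "c \<cdot> g = i4" "p4 \<cdot> c = TM i1 \<cdot> p2"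
    and e: "f \<cdot> i1 = i3 \<cdot> v" "p3 \<cdot> f = p1" "g \<cdot> i3 = i2" "p2 \<cdot> g = TM u \<cdot> p3"
    using Std_octahedron[OF S1 S2 S3] t1(1) t2(1) ip1 ip2 ip3 by (auto simp: amorD)
  note Tm = TM_mor[OF t1(2)] TM_mor[OF ip1(1)] TM_mor[OF t1(1)] TM_mor[OF d1(2)]
  note D = amorD[OF t1(1)] amorD[OF t1(2)] amorD[OF t1(3)] amorD[OF t2(1)] amorD[OF t2(2)] amorD[OF t2(3)]
    amorD[OF t3(2)] amorD[OF t3(3)] amorD[OF ip1(1)] amorD[OF ip1(2)] amorD[OF ip2(1)] amorD[OF ip2(2)]
    amorD[OF ip3(1)] amorD[OF ip3(2)] amorD[OF d1(1)] amorD[OF d1(2)] amorD[OF d2(1)] amorD[OF d2(2)]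
    amorD[OF d3(1)] amorD[OF d3(2)] amorD[OF fg(1)] amorD[OF fg(2)] amorD[OF Tm(1)] amorD[OF Tm(2)]
    amorD[OF Tm(3)] amorD[OF Tm(4)]
  have Ti1: "amor C2 (T C1) (TM i1 \<cdot> p2)" using amor_comp[OF ip2(2) Tm(2)] .
  have Ti: "amor X' (T Z') (TM i \<cdot> j')" using amor_comp[OF t2(3) Tm(1)] .
  have E4: "exact C1 C3 C2 f g (TM i1 \<cdot> p2)" by (rule exactI[OF fg Ti1 S4 c])
  have i_eq: "d1 \<cdot> i1 = i" unfolding c1(2)[symmetric] using D by (simp add: precomp[OF d1(4)])
  have j_eq: "d2 \<cdot> i2 = j" unfolding c2(2)[symmetric] using D by (simp add: precomp[OF d2(4)])
  have k_eq: "d3 \<cdot> i3 = k" unfolding c3(2)[symmetric] using D by (simp add: precomp[OF d3(4)])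
  have j'_eq: "j' \<cdot> d2 = p2" unfolding c2(3)[symmetric] using D by (simp add: d2(5))
  have k'_eq: "k' \<cdot> d3 = p3" unfolding c3(3)[symmetric] using D by (simp add: d3(5))
  let ?f = "d3 \<cdot> f \<cdot> c1" and ?g = "d2 \<cdot> g \<cdot> c3"
  have f: "amor Z' Y' ?f" and g: "amor Y' X' ?g" using D by (simp_all add: amor_def)
  have "exact Z' Y' X' ?f ?g (TM i \<cdot> j')"
  proof (rule exact_iso[OF E4 f g Ti d1(3) d3(3) d2(3)])
    show "d3 \<cdot> f = ?f \<cdot> d1" using D by (simp add: d1(5))
    show "d2 \<cdot> g = ?g \<cdot> d3" using D by (simp add: d3(5))
    have "TM d1 \<cdot> TM i1 = TM i" using TM_comp[OF ip1(1) d1(2)] i_eq by simp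
    then show "TM d1 \<cdot> TM i1 \<cdot> p2 = (TM i \<cdot> j') \<cdot> d2" using D by (simp add: precomp[of "TM d1" "TM i1"] j'_eq)
  qed
  moreover have "?f \<cdot> i = k \<cdot> v" using D by (simp add: c1(2) e(1) precomp[OF k_eq])
  moreover have "k' \<cdot> ?f = i'" using D by (simp add: precomp[OF k'_eq] precomp[OF e(2)] c1(3))
  moreover have "?g \<cdot> k = j" using D by (simp add: c3(2) e(3) j_eq)
  moreover have "j' \<cdot> ?g = TM u \<cdot> k'" using D by (simp add: precomp[OF j'_eq] precomp[OF e(4)] c3(3))
  ultimately show ?thesis using f g by blast
qed

end

context graded_category begin

lemma acomp_Arr: "Arr Y Z j g \<cdot> Arr X Y i f = Arr X Z (j + i) (cmp X Y Z j i g f)"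
  by (simp add: acomp_def)

lemma amor_Arr: "amor X Y (Arr X Y 0 f) \<longleftrightarrow> X \<in> Ob \<and> Y \<in> Ob \<and> f \<in> carrier (hm X Y 0)"
  by (auto simp: amor_def arrow_Arr)

lemma amor_eq_Arr: "amor X Y f \<Longrightarrow> f = Arr X Y 0 (elt f) \<and> elt f \<in> carrier (hm X Y 0)"
  by (auto simp: amor_def arrow_def arr.expand simp del: arrow_ends)

lemma aiso_Arr:
  "\<lbrakk>isomorphism degree_zero X Y f; X \<in> Ob; Y \<in> Ob\<rbrakk> \<Longrightarrow> aiso X Y (Arr X Y 0 f)"
  by (auto simp: isomorphism_def degree_zero_def amor_Arr acomp_Arr aid_def
      intro!: aisoI[of _ _ _ "Arr Y X 0 g" for g])

lemma zero_object_degree_zero: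
  "zero_object degree_zero Z \<longleftrightarrow> Z \<in> Ob \<and> aid Z = azero Z Z 0"
proof
  assume "zero_object degree_zero Z"
  then have Z: "Z \<in> Ob" and "carrier (hm Z Z 0) = {\<zero>\<^bsub>hm Z Z 0\<^esub>}"
    by (auto simp: zero_object_def degree_zero_def)
  then have "idn Z = \<zero>\<^bsub>hm Z Z 0\<^esub>" using idn_closed[OF Z] by simp
  with Z show "Z \<in> Ob \<and> aid Z = azero Z Z 0" by (simp add: aid_def azero_def)
next
  assume Z: "Z \<in> Ob \<and> aid Z = azero Z Z 0"
  have "f = \<zero>\<^bsub>hm X Z 0\<^esub>" if "X \<in> Ob" "f \<in> carrier (hm X Z 0)" for X f
  proof -
    have "Arr X Z 0 f = azero Z Z 0 \<cdot> Arr X Z 0 f"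
      using acomp_id(2)[of "Arr X Z 0 f" Z] that Z by (simp add: arrow_Arr)
    also have "\<dots> = azero X Z 0" using that Z by (simp add: arrow_Arr)
    finally show ?thesis by (simp add: azero_def)
  qed
  moreover have "f = \<zero>\<^bsub>hm Z X 0\<^esub>" if "X \<in> Ob" "f \<in> carrier (hm Z X 0)" for X f
  proof -
    have "Arr Z X 0 f = Arr Z X 0 f \<cdot> azero Z Z 0"
      using acomp_id(1)[of "Arr Z X 0 f" Z] that Z by (simp add: arrow_Arr)
    also have "\<dots> = azero Z X 0" using that Z by (simp add: arrow_Arr)
    finally show ?thesis by (simp add: azero_def)
  qed
  moreover have "\<zero>\<^bsub>hm X Y 0\<^esub> \<in> carrier (hm X Y 0)" if "X \<in> Ob" "Y \<in> Ob" for X Y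
    using arrow_intros(4)[OF that, of 0] that by (simp add: azero_def arrow_Arr)
  ultimately show "zero_object degree_zero Z"
    using Z by (auto simp: zero_object_def degree_zero_def)
qed

lemma biproduct_degree_zero:
  "biproduct degree_zero X Y P jX jY pX pY \<longleftrightarrow>
    amor X P (Arr X P 0 jX) \<and> amor Y P (Arr Y P 0 jY) \<and> amor P X (Arr P X 0 pX) \<and> amor P Y (Arr P Y 0 pY) \<and>
    Arr P X 0 pX \<cdot> Arr X P 0 jX = aid X \<and> Arr P Y 0 pY \<cdot> Arr Y P 0 jY = aid Y \<and>
    Arr P Y 0 pY \<cdot> Arr X P 0 jX = azero X Y 0 \<and> Arr P X 0 pX \<cdot> Arr Y P 0 jY = azero Y X 0 \<and>
    Arr X P 0 jX \<cdot> Arr P X 0 pX \<^bold>+ Arr Y P 0 jY \<cdot> Arr P Y 0 pY = aid P"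
  by (auto simp: biproduct_def degree_zero_def amor_Arr acomp_Arr aid_def azero_def aadd_def)

lemma preadditive_degree_zero: "preadditive_category degree_zero"
proof (rule preadditive_category.intro)
qed (auto simp: degree_zero_def intro: hm_group idn_closed cmp_closed[of _ _ _ _ 0 _ 0, simplified]
    cmp_add_left[of _ _ _ _ 0 _ 0, simplified] cmp_add_right[of _ _ _ _ 0 _ _ 0, simplified]
    cmp_assoc[of _ _ _ _ _ 0 _ 0 _ 0, simplified] cmp_idn_left cmp_idn_right)

end

context standard_triangles begin

definition translation :: "'o \<Rightarrow> 'o \<Rightarrow> 'm \<Rightarrow> 'm" where
  "translation X Y f = elt (TM (Arr X Y 0 f))"

definition exact_triangle :: "'o \<Rightarrow> 'o \<Rightarrow> 'o \<Rightarrow> 'm \<Rightarrow> 'm \<Rightarrow> 'm \<Rightarrow> bool" where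
  "exact_triangle X Y Z u v w \<longleftrightarrow> exact X Y Z (Arr X Y 0 u) (Arr Y Z 0 v) (Arr Z (T X) 0 w)"

lemma T_Ob: "X \<in> Ob \<Longrightarrow> T X \<in> Ob"
  using T_bij by (auto simp: bij_betw_def)

lemma Arr_translation:
  "\<lbrakk>X \<in> Ob; Y \<in> Ob; f \<in> carrier (hm X Y 0)\<rbrakk> \<Longrightarrow> Arr (T X) (T Y) 0 (translation X Y f) = TM (Arr X Y 0 f)"
  "\<lbrakk>X \<in> Ob; Y \<in> Ob; f \<in> carrier (hm X Y 0)\<rbrakk> \<Longrightarrow> translation X Y f \<in> carrier (hm (T X) (T Y) 0)"
  using amor_eq_Arr[OF TM_mor, of X Y "Arr X Y 0 f"] by (auto simp: amor_Arr translation_def)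

theorem triangulated: "triangulated_category degree_zero T translation exact_triangle"
proof (intro triangulated_category.intro additive_category.intro additive_category_axioms.intro
    triangulated_category_axioms.intro preadditive_degree_zero)
  show "\<exists>Z. zero_object degree_zero Z" using zero_exists by (auto simp: zero_object_degree_zero)
next
  fix X Y assume "X \<in> cobj degree_zero" "Y \<in> cobj degree_zero"
  then have "X \<in> Ob" "Y \<in> Ob" by (simp_all add: degree_zero_def)
  from biproduct_exists[OF this] obtain P jX jY pX pY where
    t: "amor X P jX" "amor Y P jY" "amor P X pX" "amor P Y pY" and
    e: "pX \<cdot> jX = aid X \<and> pY \<cdot> jY = aid Y \<and> pY \<cdot> jX = azero X Y 0 \<and> pX \<cdot> jY = azero Y X 0 \<and>
      jX \<cdot> pX \<^bold>+ jY \<cdot> pY = aid P" by blast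
  obtain jX' jY' pX' pY' where "jX = Arr X P 0 jX'" "jY = Arr Y P 0 jY'" "pX = Arr P X 0 pX'" "pY = Arr P Y 0 pY'"
    using t amor_eq_Arr by metis
  with t e have "biproduct degree_zero X Y P jX' jY' pX' pY'" unfolding biproduct_degree_zero by blast
  then show "\<exists>P jX jY pX pY. biproduct degree_zero X Y P jX jY pX pY" by blast
next
  show "bij_betw T (cobj degree_zero) (cobj degree_zero)" using T_bij by (simp add: degree_zero_def)
next
  fix X Y assume "X \<in> cobj degree_zero" "Y \<in> cobj degree_zero"
  then have XY: "X \<in> Ob" "Y \<in> Ob" by (simp_all add: degree_zero_def)
  have "inj_on (translation X Y) (carrier (hm X Y 0))"
  proof (rule inj_onI)
    fix f g assume fg: "f \<in> carrier (hm X Y 0)" "g \<in> carrier (hm X Y 0)" "translation X Y f = translation X Y g"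
    then have "TM (Arr X Y 0 f) = TM (Arr X Y 0 g)"
      using Arr_translation(1)[OF XY fg(1)] Arr_translation(1)[OF XY fg(2)] by simp
    then show "f = g" using TM_inj[of X Y "Arr X Y 0 f" "Arr X Y 0 g"] fg XY by (simp add: amor_Arr)
  qed
  moreover have "\<exists>f\<in>carrier (hm X Y 0). g = translation X Y f" if g: "g \<in> carrier (hm (T X) (T Y) 0)" for g
  proof -
    obtain f where f: "amor X Y f" "TM f = Arr (T X) (T Y) 0 g"
      using TM_surj[OF XY, of "Arr (T X) (T Y) 0 g"] g XY by (auto simp: amor_Arr T_Ob)
    then show ?thesis using amor_eq_Arr[OF f(1)] by (metis arr.sel(4) translation_def)
  qed
  ultimately show "bij_betw (translation X Y) (carrier (chom degree_zero X Y)) (carrier (chom degree_zero (T X) (T Y)))"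
    using Arr_translation(2)[OF XY] by (auto simp: bij_betw_def degree_zero_def)
next
  fix X Y f f' assume *: "X \<in> cobj degree_zero" "Y \<in> cobj degree_zero"
    "f \<in> carrier (chom degree_zero X Y)" "f' \<in> carrier (chom degree_zero X Y)"
  then have XY: "X \<in> Ob" "Y \<in> Ob" "f \<in> carrier (hm X Y 0)" "f' \<in> carrier (hm X Y 0)"
    by (simp_all add: degree_zero_def)
  have "TM (Arr X Y 0 f \<^bold>+ Arr X Y 0 f')
      = Arr (T X) (T Y) 0 (translation X Y f) \<^bold>+ Arr (T X) (T Y) 0 (translation X Y f')"
    using XY TM_add[of X Y "Arr X Y 0 f" "Arr X Y 0 f'"] by (simp add: Arr_translation amor_Arr)
  from arg_cong[OF this, of elt]
  show "translation X Y (f \<oplus>\<^bsub>chom degree_zero X Y\<^esub> f')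
      = translation X Y f \<oplus>\<^bsub>chom degree_zero (T X) (T Y)\<^esub> translation X Y f'"
    by (simp add: translation_def[of X Y "_ \<oplus>\<^bsub>_\<^esub> _"] degree_zero_def aadd_def)
next
  show "translation X X (cid degree_zero X) = cid degree_zero (T X)" if "X \<in> cobj degree_zero" for X
    using TM_id[of X] that by (simp add: translation_def degree_zero_def aid_def)
next
  fix X Y Z f g assume "X \<in> cobj degree_zero" "Y \<in> cobj degree_zero" "Z \<in> cobj degree_zero"
    "f \<in> carrier (chom degree_zero X Y)" "g \<in> carrier (chom degree_zero Y Z)"
  then have *: "X \<in> Ob" "Y \<in> Ob" "Z \<in> Ob" "f \<in> carrier (hm X Y 0)" "g \<in> carrier (hm Y Z 0)"
    by (simp_all add: degree_zero_def)
  have "TM (Arr Y Z 0 g \<cdot> Arr X Y 0 f) = Arr (T Y) (T Z) 0 (translation Y Z g) \<cdot> Arr (T X) (T Y) 0 (translation X Y f)"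
    using * TM_comp[of X Y "Arr X Y 0 f" Z "Arr Y Z 0 g"] by (simp add: Arr_translation amor_Arr)
  from arg_cong[OF this, of elt]
  show "translation X Z (ccomp degree_zero X Y Z g f)
      = ccomp degree_zero (T X) (T Y) (T Z) (translation Y Z g) (translation X Y f)"
    by (simp add: acomp_Arr translation_def[of X Z] degree_zero_def)
next
  fix X Y Z u v w assume "exact_triangle X Y Z u v w"
  then show "X \<in> cobj degree_zero \<and> Y \<in> cobj degree_zero \<and> Z \<in> cobj degree_zero \<and>
    u \<in> carrier (chom degree_zero X Y) \<and> v \<in> carrier (chom degree_zero Y Z) \<and> w \<in> carrier (chom degree_zero Z (T X))"
    by (auto simp: exact_triangle_def exact_def amor_Arr degree_zero_def)
next
  fix X Y Z u v w X' Y' Z' u' v' w' a b c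
  assume E: "exact_triangle X Y Z u v w"
    and O: "X' \<in> cobj degree_zero" "Y' \<in> cobj degree_zero" "Z' \<in> cobj degree_zero"
    and m: "u' \<in> carrier (chom degree_zero X' Y')" "v' \<in> carrier (chom degree_zero Y' Z')"
      "w' \<in> carrier (chom degree_zero Z' (T X'))"
    and i: "isomorphism degree_zero X X' a" "isomorphism degree_zero Y Y' b" "isomorphism degree_zero Z Z' c"
    and e: "ccomp degree_zero X Y Y' b u = ccomp degree_zero X X' Y' u' a"
      "ccomp degree_zero Y Z Z' c v = ccomp degree_zero Y Y' Z' v' b"
      "ccomp degree_zero Z (T X) (T X') (translation X X' a) w = ccomp degree_zero Z Z' (T X') w' c"
  have O': "X \<in> Ob" "Y \<in> Ob" "Z \<in> Ob" using E by (auto simp: exact_triangle_def exact_def amor_Arr)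
  have "a \<in> carrier (hm X X' 0)" using i(1) by (simp add: isomorphism_def degree_zero_def)
  then have TMa: "TM (Arr X X' 0 a) = Arr (T X) (T X') 0 (translation X X' a)"
    using O O' by (simp add: Arr_translation degree_zero_def)
  show "exact_triangle X' Y' Z' u' v' w'" unfolding exact_triangle_def
  proof (rule exact_iso[OF E[unfolded exact_triangle_def] _ _ _ aiso_Arr[OF i(1)] aiso_Arr[OF i(2)] aiso_Arr[OF i(3)]])
    show "amor X' Y' (Arr X' Y' 0 u')" "amor Y' Z' (Arr Y' Z' 0 v')" "amor Z' (T X') (Arr Z' (T X') 0 w')"
      using O m by (auto simp: amor_Arr degree_zero_def T_Ob)
  qed (use e O O' in \<open>simp_all add: TMa acomp_Arr degree_zero_def\<close>)
next
  fix X Z assume "X \<in> cobj degree_zero" "zero_object degree_zero Z"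
  then show "exact_triangle X X Z (cid degree_zero X) \<zero>\<^bsub>chom degree_zero X Z\<^esub> \<zero>\<^bsub>chom degree_zero Z (T X)\<^esub>"
    using exact_id[of X Z]
    by (simp add: exact_triangle_def zero_object_degree_zero aid_def azero_def) (simp add: degree_zero_def)
next
  fix X Y u assume "X \<in> cobj degree_zero" "Y \<in> cobj degree_zero" "u \<in> carrier (chom degree_zero X Y)"
  then have u: "amor X Y (Arr X Y 0 u)" by (simp add: amor_Arr degree_zero_def)
  then obtain i p where S: "Std (Arr X Y 0 u) i p" using Std_exists by blast
  from S u obtain C where C: "tgt i = C" "amor Y C i" "amor C (T X) p" by (rule StdE)
  have "exact_triangle X Y C u (elt i) (elt p)"
    using Std_exact[OF S u] C amor_eq_Arr by (simp add: exact_triangle_def flip: amor_eq_Arr[THEN conjunct1])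
  then show "\<exists>Z v w. exact_triangle X Y Z u v w" by blast
next
  fix X Y Z u v w assume "X \<in> cobj degree_zero" "Y \<in> cobj degree_zero" "Z \<in> cobj degree_zero"
    "u \<in> carrier (chom degree_zero X Y)" "v \<in> carrier (chom degree_zero Y Z)" "w \<in> carrier (chom degree_zero Z (T X))"
  then have m: "X \<in> Ob" "Y \<in> Ob" "u \<in> carrier (hm X Y 0)" "amor X Y (Arr X Y 0 u)" "amor Y Z (Arr Y Z 0 v)" "amor Z (T X) (Arr Z (T X) 0 w)"
    by (auto simp: degree_zero_def amor_Arr T_Ob)
  have "\<^bold>- TM (Arr X Y 0 u) = Arr (T X) (T Y) 0 (\<ominus>\<^bsub>hm (T X) (T Y) 0\<^esub> translation X Y u)"
    unfolding Arr_translation(1)[OF m(1,2,3), symmetric] by (simp add: aneg_def)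
  then show "exact_triangle X Y Z u v w
      \<longleftrightarrow> exact_triangle Y Z (T X) v w (\<ominus>\<^bsub>chom degree_zero (T X) (T Y)\<^esub> translation X Y u)"
    using exact_rotate[of X Y Z "Arr X Y 0 u" "Arr Y Z 0 v" "Arr Z (T X) 0 w"] exact_rotate_back[OF m(4,5,6)]
    by (auto simp: exact_triangle_def degree_zero_def)
next
  fix X Y Z u v w X' Y' Z' u' v' w' a b
  assume E: "exact_triangle X Y Z u v w" and E': "exact_triangle X' Y' Z' u' v' w'"
    and a: "a \<in> carrier (chom degree_zero X X')" and b: "b \<in> carrier (chom degree_zero Y Y')"
    and e: "ccomp degree_zero X Y Y' b u = ccomp degree_zero X X' Y' u' a"
  have O: "X \<in> Ob" "Y \<in> Ob" "Z \<in> Ob" "X' \<in> Ob" "Y' \<in> Ob" "Z' \<in> Ob"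
    using E E' by (auto simp: exact_triangle_def exact_def amor_Arr)
  have a': "a \<in> carrier (hm X X' 0)" using a by (simp add: degree_zero_def)
  note TMa = Arr_translation(1)[OF O(1,4) a', symmetric]
  obtain c where c: "amor Z Z' c" "c \<cdot> Arr Y Z 0 v = Arr Y' Z' 0 v' \<cdot> Arr Y Y' 0 b"
    "Arr Z' (T X') 0 w' \<cdot> c = TM (Arr X X' 0 a) \<cdot> Arr Z (T X) 0 w"
    using exact_map_iso[OF E[unfolded exact_triangle_def] E'[unfolded exact_triangle_def],
        of "Arr X X' 0 a" "Arr Y Y' 0 b"] a b e O
    by (auto simp: amor_Arr degree_zero_def acomp_Arr)
  obtain c' where c': "c = Arr Z Z' 0 c'" "c' \<in> carrier (hm Z Z' 0)" using amor_eq_Arr[OF c(1)] by blast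
  show "\<exists>c\<in>carrier (chom degree_zero Z Z').
      ccomp degree_zero Y Z Z' c v = ccomp degree_zero Y Y' Z' v' b \<and>
      ccomp degree_zero Z (T X) (T X') (translation X X' a) w = ccomp degree_zero Z Z' (T X') w' c"
    by (rule bexI[of _ c']) (use c c' in \<open>simp_all add: degree_zero_def acomp_Arr TMa\<close>)
next
  fix X Y Z Z' X' Y' u i i' v j j' k k'
  assume E: "exact_triangle X Y Z' u i i'" "exact_triangle Y Z X' v j j'"
    "exact_triangle X Z Y' (ccomp degree_zero X Y Z v u) k k'"
  have O: "X \<in> Ob" "Y \<in> Ob" "Z \<in> Ob" "X' \<in> Ob" "Y' \<in> Ob" "Z' \<in> Ob" and u: "u \<in> carrier (hm X Y 0)"
    and i: "i \<in> carrier (hm Y Z' 0)"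
    using E by (auto simp: exact_triangle_def exact_def amor_Arr)
  note Tu = Arr_translation(1)[OF O(1,2) u, symmetric]
  note Ti = Arr_translation(1)[OF O(2,6) i, symmetric]
  have E3: "exact X Z Y' (Arr Y Z 0 v \<cdot> Arr X Y 0 u) (Arr Z Y' 0 k) (Arr Y' (T X) 0 k')"
    using E(3) by (simp add: exact_triangle_def degree_zero_def acomp_Arr)
  obtain f g where fg: "amor Z' Y' f" "amor Y' X' g"
    and ex: "exact Z' Y' X' f g (TM (Arr Y Z' 0 i) \<cdot> Arr X' (T Y) 0 j')"
    and e: "f \<cdot> Arr Y Z' 0 i = Arr Z Y' 0 k \<cdot> Arr Y Z 0 v" "Arr Y' (T X) 0 k' \<cdot> f = Arr Z' (T X) 0 i'"
      "g \<cdot> Arr Z Y' 0 k = Arr Z X' 0 j" "Arr X' (T Y) 0 j' \<cdot> g = TM (Arr X Y 0 u) \<cdot> Arr Y' (T X) 0 k'"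
    using exact_octahedron[OF E(1,2)[unfolded exact_triangle_def] E3] by blast
  obtain f' where f': "f = Arr Z' Y' 0 f'" "f' \<in> carrier (hm Z' Y' 0)" using amor_eq_Arr[OF fg(1)] by blast
  obtain g' where g': "g = Arr Y' X' 0 g'" "g' \<in> carrier (hm Y' X' 0)" using amor_eq_Arr[OF fg(2)] by blast
  show "\<exists>f\<in>carrier (chom degree_zero Z' Y'). \<exists>g\<in>carrier (chom degree_zero Y' X').
     exact_triangle Z' Y' X' f g (ccomp degree_zero X' (T Y) (T Z') (translation Y Z' i) j') \<and>
     ccomp degree_zero Y Z' Y' f i = ccomp degree_zero Y Z Y' k v \<and>
     ccomp degree_zero Z' Y' (T X) k' f = i' \<and>
     ccomp degree_zero Z Y' X' g k = j \<and>
     ccomp degree_zero Y' X' (T Y) j' g = ccomp degree_zero Y' (T X) (T Y) (translation X Y u) k'"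
    by (rule bexI[of _ f'], rule bexI[of _ g'])
      (use ex e f' g' in \<open>simp_all add: exact_triangle_def degree_zero_def acomp_Arr Tu Ti\<close>)
qed

end

section \<open>Cones in dg-categories\<close>

context level_dg_category begin

text \<open>\<open>C = tgt i\<close> is, as a graded object, the sum of \<open>Y\<close> and a shift of \<open>X\<close>, where \<open>u : X \<rightarrow> Y\<close>; the shift is hidden
  in the degrees \<open>1\<close> and \<open>-1\<close> of \<open>p : C \<rightarrow> X\<close> and \<open>j : X \<rightarrow> C\<close>. The differential twists the sum by \<open>u\<close>,
  which is the equation \<open>\<delta> j = i \<cdot> u\<close>.\<close>

definition cone ::
  "('o, int, 'm) arr \<Rightarrow> ('o, int, 'm) arr \<Rightarrow> ('o, int, 'm) arr \<Rightarrow> ('o, int, 'm) arr \<Rightarrow> ('o, int, 'm) arr \<Rightarrow> bool"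
  where
  "cone u i p j s \<longleftrightarrow> cocycle 0 u \<and>
     arrow i \<and> src i = tgt u \<and> deg i = 0 \<and> level i \<le> 0 \<and>
     arrow p \<and> src p = tgt i \<and> tgt p = src u \<and> deg p = 1 \<and> level p \<le> 0 \<and>
     arrow j \<and> src j = src u \<and> tgt j = tgt i \<and> deg j = -1 \<and> level j \<le> 0 \<and>
     arrow s \<and> src s = tgt i \<and> tgt s = tgt u \<and> deg s = 0 \<and> level s \<le> 0 \<and>
     s \<cdot> i = aid (tgt u) \<and> p \<cdot> j = aid (src u) \<and> p \<cdot> i = azero (tgt u) (src u) 1 \<and>
     s \<cdot> j = azero (src u) (tgt u) (-1) \<and> i \<cdot> s \<^bold>+ j \<cdot> p = aid (tgt i) \<and>
     \<delta> i = azero (tgt u) (tgt i) 1 \<and> \<delta> p = azero (tgt i) (src u) 2 \<and> \<delta> j = i \<cdot> u"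

lemma cone_typed:
  assumes "cone u i p j s"
  shows "cocycle 0 u" "arrow u" "deg u = 0" "level u \<le> 0" "\<delta> u = azero (src u) (tgt u) 1"
    "arrow i" "src i = tgt u" "deg i = 0" "level i \<le> 0"
    "arrow p" "src p = tgt i" "tgt p = src u" "deg p = 1" "level p \<le> 0"
    "arrow j" "src j = src u" "tgt j = tgt i" "deg j = -1" "level j \<le> 0"
    "arrow s" "src s = tgt i" "tgt s = tgt u" "deg s = 0" "level s \<le> 0"
    "src u \<in> Ob" "tgt u \<in> Ob" "tgt i \<in> Ob"
  using assms cocycleD[of 0 u] by (auto simp: cone_def zero_ereal_def)

lemma cone_eqs:
  assumes "cone u i p j s"
  shows "s \<cdot> i = aid (tgt u)" "p \<cdot> j = aid (src u)" "p \<cdot> i = azero (tgt u) (src u) 1"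
    "s \<cdot> j = azero (src u) (tgt u) (-1)" "j \<cdot> p = aid (tgt i) \<^bold>+ \<^bold>- (i \<cdot> s)"
    "\<delta> i = azero (tgt u) (tgt i) 1" "\<delta> p = azero (tgt i) (src u) 2" "\<delta> j = i \<cdot> u" "\<delta> s = \<^bold>- (u \<cdot> p)"
proof -
  have *: "s \<cdot> i = aid (tgt u)" "p \<cdot> j = aid (src u)" "p \<cdot> i = azero (tgt u) (src u) 1"
    "s \<cdot> j = azero (src u) (tgt u) (-1)" "i \<cdot> s \<^bold>+ j \<cdot> p = aid (tgt i)"
    "\<delta> i = azero (tgt u) (tgt i) 1" "\<delta> p = azero (tgt i) (src u) 2" "\<delta> j = i \<cdot> u"
    using assms by (simp_all add: cone_def)
  then show "s \<cdot> i = aid (tgt u)" "p \<cdot> j = aid (src u)" "p \<cdot> i = azero (tgt u) (src u) 1"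
    "s \<cdot> j = azero (src u) (tgt u) (-1)"
    "\<delta> i = azero (tgt u) (tgt i) 1" "\<delta> p = azero (tgt i) (src u) 2" "\<delta> j = i \<cdot> u" by simp_all
  note t = cone_typed[OF assms]
  have "j \<cdot> p \<^bold>+ i \<cdot> s = aid (tgt i)" using *(5) aadd_comm[of "j \<cdot> p" "i \<cdot> s"] t by simp
  then show "j \<cdot> p = aid (tgt i) \<^bold>+ \<^bold>- (i \<cdot> s)"
    using move_neg[of "aid (tgt i)" "i \<cdot> s" "j \<cdot> p"] t by simp
  (* differentiate 1 = i s + j p and compose with s *)
  have "\<delta> (i \<cdot> s \<^bold>+ j \<cdot> p) = azero (tgt i) (tgt i) 1" using *(5) t by simp
  then have "i \<cdot> \<delta> s \<^bold>+ i \<cdot> u \<cdot> p = azero (tgt i) (tgt i) 1" using t by (simp add: *(1-4,6-8))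
  from arg_cong[OF this, of "\<lambda>x. s \<cdot> x"] have "\<delta> s \<^bold>+ u \<cdot> p = azero (tgt i) (tgt u) 1"
    using t by (simp add: precomp[OF *(1)])
  then have "u \<cdot> p \<^bold>+ \<delta> s = azero (tgt i) (tgt u) 1" using aadd_comm[of "u \<cdot> p" "\<delta> s"] t by simp
  then show "\<delta> s = \<^bold>- (u \<cdot> p)" using t by (intro aneg_unique) simp_all
qed

lemma cone_eqs_assoc:
  assumes "cone u i p j s" "arrow x"
  shows "tgt x = tgt u \<Longrightarrow> s \<cdot> i \<cdot> x = x" "tgt x = src u \<Longrightarrow> p \<cdot> j \<cdot> x = x"
    "tgt x = tgt u \<Longrightarrow> p \<cdot> i \<cdot> x = azero (src x) (src u) (1 + deg x)"
    "tgt x = src u \<Longrightarrow> s \<cdot> j \<cdot> x = azero (src x) (tgt u) (-1 + deg x)"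
    "tgt x = tgt i \<Longrightarrow> j \<cdot> p \<cdot> x = x \<^bold>+ \<^bold>- (i \<cdot> s \<cdot> x)"
  using assms(2) cone_typed[OF assms(1)]
  by (simp_all add: precomp[OF cone_eqs(1)[OF assms(1)]] precomp[OF cone_eqs(2)[OF assms(1)]]
      precomp[OF cone_eqs(3)[OF assms(1)]] precomp[OF cone_eqs(4)[OF assms(1)]] precomp[OF cone_eqs(5)[OF assms(1)]])

lemma cocycle0I:
  "\<lbrakk>arrow f; deg f = 0; level f \<le> 0; \<delta> f = azero (src f) (tgt f) 1\<rbrakk> \<Longrightarrow> cocycle 0 f"
  by (rule cocycleI) (auto simp: zero_ereal_def)

lemma cocycle_level0: "cocycle 0 f \<Longrightarrow> level f \<le> 0"
  using cocycleD(3)[of 0 f] by (simp add: zero_ereal_def)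

lemma cone_inclusion: "cone u i p j s \<Longrightarrow> cocycle 0 i"
  by (rule cocycle0I) (simp_all add: cone_typed cone_eqs)

text \<open>A square that commutes up to the homotopy \<open>h\<close> induces a strict morphism of cones.\<close>

lemma cone_map:
  assumes c: "cone u i p j s" and c': "cone u' i' p' j' s'"
    and a: "cocycle 0 a" "src a = src u" "tgt a = src u'"
    and b: "cocycle 0 b" "src b = tgt u" "tgt b = tgt u'"
    and h: "arrow h" "src h = src u" "tgt h = tgt u'" "deg h = -1" "level h \<le> 0"
    and e: "b \<cdot> u = u' \<cdot> a \<^bold>+ \<delta> h"
  defines "\<phi> \<equiv> i' \<cdot> b \<cdot> s \<^bold>+ j' \<cdot> a \<cdot> p \<^bold>+ i' \<cdot> h \<cdot> p"
  shows "cocycle 0 \<phi>" "src \<phi> = tgt i" "tgt \<phi> = tgt i'" "\<phi> \<cdot> i = i' \<cdot> b" "p' \<cdot> \<phi> = a \<cdot> p"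
proof -
  note C = cone_typed[OF c] cone_typed[OF c'] cone_eqs[OF c] cone_eqs[OF c']
  note A = cone_eqs_assoc[OF c] cone_eqs_assoc[OF c']
  note ab = cocycleD[OF a(1)] a(2,3) cocycleD[OF b(1)] b(2,3) cocycle_level0[OF a(1)] cocycle_level0[OF b(1)]
  show \<phi>: "src \<phi> = tgt i" "tgt \<phi> = tgt i'" using C by (simp_all add: \<phi>_def)
  show "\<phi> \<cdot> i = i' \<cdot> b" "p' \<cdot> \<phi> = a \<cdot> p" using ab h by (simp_all add: \<phi>_def C A)
  show "cocycle 0 \<phi>"
  proof (rule cocycle0I)
    show "arrow \<phi>" "deg \<phi> = 0" using ab h by (simp_all add: \<phi>_def C)
    show "level \<phi> \<le> 0" unfolding \<phi>_def using ab h
      by (intro level_add level_comp) (simp_all add: C)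
    show "\<delta> \<phi> = azero (src \<phi>) (tgt \<phi>) 1" using ab h
      by (simp add: \<phi>_def C A precomp[OF e])
  qed
qed

text \<open>If \<open>g i\<close> is the coboundary of \<open>h\<close>, then \<open>h s\<close> extends the homotopy to the cone. The difference
  \<open>g - \<delta> (h s)\<close> vanishes on \<open>i\<close>, and by \<open>i s + j p = 1\<close> it factors through \<open>p\<close>.\<close>

lemma cone_factor:
  assumes c: "cone u i p j s" and g: "cocycle 0 g" "src g = tgt i"
    and h: "arrow h" "src h = tgt u" "tgt h = tgt g" "deg h = -1" "level h \<le> 0" and e: "g \<cdot> i = \<delta> h"
  defines "f \<equiv> (g \<^bold>+ \<^bold>- \<delta> (h \<cdot> s)) \<cdot> j"
  shows "arrow f" "src f = src u" "tgt f = tgt g" "deg f = -1" "level f \<le> 0" "\<delta> f = azero (src u) (tgt g) 0"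
    "g \<^bold>+ \<^bold>- \<delta> (h \<cdot> s) = f \<cdot> p"
proof -
  note C = cone_typed[OF c] cone_eqs[OF c]
  note A = cone_eqs_assoc[OF c]
  note G = cocycleD[OF g(1)] g(2) cocycle_level0[OF g(1)]
  show "arrow f" "src f = src u" "tgt f = tgt g" "deg f = -1" using G h by (simp_all add: f_def C)
  show "level f \<le> 0" unfolding f_def using G h
    by (intro level_add level_comp level_neg level_abd) (simp_all add: C)
  show "\<delta> f = azero (src u) (tgt g) 0" using G h by (simp add: f_def C A e precomp[OF e])
  show "g \<^bold>+ \<^bold>- \<delta> (h \<cdot> s) = f \<cdot> p" using G h by (simp add: f_def C A precomp[OF e])
qed

lemma level_comp_left: "\<lbrakk>arrow f; arrow g; src g = tgt f; level g \<le> 0; level f \<le> ereal r\<rbrakk> \<Longrightarrow> level (g \<cdot> f) \<le> ereal r"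
  using level_comp_sum[of f g 0 r] by (simp add: zero_ereal_def)

lemma level_comp_right: "\<lbrakk>arrow f; arrow g; src g = tgt f; level g \<le> ereal r; level f \<le> 0\<rbrakk> \<Longrightarrow> level (g \<cdot> f) \<le> ereal r"
  using level_comp_sum[of f g r 0] by (simp add: zero_ereal_def)

text \<open>Replacing \<open>u\<close> by a homotopic cocycle changes only the non-closed data \<open>j\<close> and \<open>s\<close>. So the
  standard triangle of \<open>u\<close> depends only on the class of \<open>u\<close>.\<close>

lemma cone_homotopic:
  assumes c: "cone u i p j s" and h: "arrow h" "src h = src u" "tgt h = tgt u" "deg h = -1" "level h \<le> 0"
    and u': "cocycle 0 u'" "src u' = src u" "tgt u' = tgt u" and e: "u' \<^bold>+ \<delta> h = u"
  shows "cone u' i p (j \<^bold>+ \<^bold>- (i \<cdot> h)) (s \<^bold>+ h \<cdot> p)"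
proof -
  note C = cone_typed[OF c] cone_eqs[OF c]
  note A = cone_eqs_assoc[OF c]
  note U = cocycleD[OF u'(1)] u'(2,3)
  have u: "i \<cdot> u = i \<cdot> u' \<^bold>+ i \<cdot> \<delta> h" unfolding e[symmetric] using U h by (simp add: C)
  show ?thesis unfolding cone_def
    using h U u'(1) by (simp add: C A u aadd_ac level_add level_neg level_comp)
qed

text \<open>If \<open>w\<close> is inverse to \<open>u\<close>, then \<open>j w s\<close> contracts the cone; its level is at most that of \<open>w\<close>.\<close>

lemma cone_contractible:
  assumes c: "cone u i p j s" and w: "cocycle r w" "src w = tgt u" "tgt w = src u" "u \<cdot> w = aid (tgt u)" "w \<cdot> u = aid (src u)"
    and r: "r \<ge> 0"
  shows "hcl r (aid (tgt i)) = H.azero (tgt i) (tgt i) r"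
proof -
  note C = cone_typed[OF c] cone_eqs[OF c]
  note A = cone_eqs_assoc[OF c]
  note W = cocycleD[OF w(1)] w(2,3)
  let ?h = "j \<cdot> w \<cdot> s"
  have "\<delta> ?h = aid (tgt i)" using W by (simp add: C A precomp[OF w(4)] precomp[OF w(5)])
  moreover have "level ?h \<le> ereal r" using W by (intro level_comp_left level_comp_right) (simp_all add: C)
  ultimately have "hcl r (azero (tgt i) (tgt i) 0) = hcl r (aid (tgt i))"
    using W by (intro hcl_eqI[of _ _ ?h]) (simp_all add: C cocycle_zero)
  then show ?thesis by (simp add: hcl_zero C)
qed

end

text \<open>The translation \<open>T\<close> comes with closed invertible morphisms \<open>X \<rightarrow> T X\<close> of degree \<open>-1\<close>. This turns the
  projection \<open>p\<close> of a cone, which has degree \<open>1\<close>, into a cocycle \<open>C \<rightarrow> T X\<close> of degree \<open>0\<close>.\<close>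

locale suspended_dg_category = level_dg_category K D
  for K :: "('a, 'e) ring_scheme" (structure) and D :: "('o, 'a, 'm) fdg_category" +
  fixes T :: "'o \<Rightarrow> 'o" and sg sg' :: "'o \<Rightarrow> 'm"
  assumes T_bij: "bij_betw T (dgobj D) (dgobj D)"
    and sg_arrow: "X \<in> dgobj D \<Longrightarrow> arrow (Arr X (T X) (-1) (sg X)) \<and> arrow (Arr (T X) X 1 (sg' X))"
    and sg_level: "X \<in> dgobj D \<Longrightarrow> level (Arr X (T X) (-1) (sg X)) \<le> 0 \<and> level (Arr (T X) X 1 (sg' X)) \<le> 0"
    and sg_closed: "X \<in> dgobj D \<Longrightarrow> abd (Arr X (T X) (-1) (sg X)) = azero X (T X) 0 \<and>
      abd (Arr (T X) X 1 (sg' X)) = azero (T X) X 2"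
    and sg_inverse: "X \<in> dgobj D \<Longrightarrow> acomp (Arr (T X) X 1 (sg' X)) (Arr X (T X) (-1) (sg X)) = aid X \<and>
      acomp (Arr X (T X) (-1) (sg X)) (Arr (T X) X 1 (sg' X)) = aid (T X)"
    and cone_exists: "cocycle 0 u \<Longrightarrow> \<exists>i p j s. cone u i p j s"
    and zero_object_exists: "\<exists>Z\<in>dgobj D. aid Z = azero Z Z 0"
begin

notation acomp (infixr "\<cdot>" 75) and aadd (infixr "\<^bold>+" 65) and aneg ("\<^bold>- _" [80] 80)
  and asmult (infixr "\<^bold>*" 75) and abd ("\<delta>")
notation H.acomp (infixr "\<circ>\<^sub>H" 75) and H.aadd (infixr "+\<^sub>H" 65) and H.aneg ("-\<^sub>H _" [80] 80)

definition \<sigma> :: "'o \<Rightarrow> ('o, int, 'm) arr" where "\<sigma> X = Arr X (T X) (-1) (sg X)"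
definition \<tau> :: "'o \<Rightarrow> ('o, int, 'm) arr" where "\<tau> X = Arr (T X) X 1 (sg' X)"

lemma T_closed [simp]: "X \<in> Ob \<Longrightarrow> T X \<in> Ob"
  using T_bij by (auto simp: bij_betw_def)

lemma sigma_tau [simp]:
  "src (\<sigma> X) = X" "tgt (\<sigma> X) = T X" "deg (\<sigma> X) = -1" "src (\<tau> X) = T X" "tgt (\<tau> X) = X" "deg (\<tau> X) = 1"
  "X \<in> Ob \<Longrightarrow> arrow (\<sigma> X)" "X \<in> Ob \<Longrightarrow> arrow (\<tau> X)"
  "X \<in> Ob \<Longrightarrow> level (\<sigma> X) \<le> 0" "X \<in> Ob \<Longrightarrow> level (\<tau> X) \<le> 0"
  "X \<in> Ob \<Longrightarrow> \<delta> (\<sigma> X) = azero X (T X) 0" "X \<in> Ob \<Longrightarrow> \<delta> (\<tau> X) = azero (T X) X 2"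
  "X \<in> Ob \<Longrightarrow> \<tau> X \<cdot> \<sigma> X = aid X" "X \<in> Ob \<Longrightarrow> \<sigma> X \<cdot> \<tau> X = aid (T X)"
  using sg_arrow sg_level sg_closed sg_inverse by (simp_all add: \<sigma>_def \<tau>_def)

lemma sigma_tau_assoc [simp]:
  "\<lbrakk>X \<in> Ob; arrow f; tgt f = X\<rbrakk> \<Longrightarrow> \<tau> X \<cdot> \<sigma> X \<cdot> f = f"
  "\<lbrakk>X \<in> Ob; arrow f; tgt f = T X\<rbrakk> \<Longrightarrow> \<sigma> X \<cdot> \<tau> X \<cdot> f = f"
  using precomp[OF sigma_tau(13), of X f] precomp[OF sigma_tau(14), of X f] by simp_all

definition susp :: "('o, int, 'm) arr \<Rightarrow> ('o, int, 'm) arr" where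
  "susp f = \<sigma> (tgt f) \<cdot> f \<cdot> \<tau> (src f)"

lemma susp_dom [simp]: "src (susp f) = T (src f)" "tgt (susp f) = T (tgt f)" "deg (susp f) = deg f"
  by (simp_all add: susp_def)

lemma susp_cocycle: "cocycle 0 f \<Longrightarrow> cocycle 0 (susp f)"
  unfolding susp_def
  by (rule cocycle0I) (auto intro!: level_comp simp: cocycle_level0)

lemma susp_homotopic:
  assumes "homotopic 0 f g" "cocycle 0 f"
  shows "homotopic 0 (susp f) (susp g)"
proof -
  obtain h where h: "arrow h" "src h = src f" "tgt h = tgt f" "deg h = -1" "level h \<le> ereal 0"
    and g: "g = f \<^bold>+ \<delta> h" using assms(1) unfolding homotopic_def by auto
  then show ?thesis unfolding homotopic_def
    using cocycleD[OF assms(2)]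
    by (intro exI[of _ "\<^bold>- (\<sigma> (tgt f) \<cdot> h \<cdot> \<tau> (src f))"])
      (simp add: susp_def level_neg level_comp zero_ereal_def[symmetric])
qed

definition Tmap :: "'o \<Rightarrow> 'o \<Rightarrow> 'm set \<Rightarrow> 'm set" where
  "Tmap X Y U = (\<Union>x\<in>U. cclass (dghom D (T X) (T Y)) 0 (elt (susp (Arr X Y 0 x))))"

lemma Tmap_cls:
  assumes "cocycle 0 f" "src f = X" "tgt f = Y"
  shows "Tmap X Y (cls 0 f) = cls 0 (susp f)"
proof -
  have "cclass (dghom D (T X) (T Y)) 0 (elt (susp (Arr X Y 0 (elt g)))) = cls 0 (susp f)" if "homotopic 0 f g" for g
  proof -
    have "Arr X Y 0 (elt g) = g"
      using homotopic_typed[OF that] assms by (auto intro: arr.expand)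
    then show ?thesis
      using cls_eqI[OF susp_homotopic[OF that assms(1)]] susp_cocycle[OF assms(1)] assms
        homotopic_typed[OF that] by (simp add: cls_def)
  qed
  then show ?thesis unfolding Tmap_def using assms by - (rule Union_cls, auto)
qed

definition THom :: "('o, real, 'm set) arr \<Rightarrow> ('o, real, 'm set) arr" where
  "THom a = Arr (T (src a)) (T (tgt a)) (deg a) (Tmap (src a) (tgt a) (elt a))"

lemma THom_hcl [simp]: "cocycle 0 f \<Longrightarrow> THom (hcl 0 f) = hcl 0 (susp f)"
  by (simp add: THom_def Tmap_cls) (simp add: hcl_def)

definition cone_triangle ::
  "('o, real, 'm set) arr \<Rightarrow> ('o, real, 'm set) arr \<Rightarrow> ('o, real, 'm set) arr \<Rightarrow> bool" where
  "cone_triangle U I P \<longleftrightarrow> (\<exists>u i p j s. cone u i p j s \<and> U = hcl 0 u \<and> I = hcl 0 i \<and> P = hcl 0 (\<sigma> (src u) \<cdot> p))"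

lemma cone_projection: "cone u i p j s \<Longrightarrow> cocycle 0 (\<sigma> (src u) \<cdot> p)"
  by (rule cocycle0I) (simp_all add: cone_typed cone_eqs level_comp)

lemma cone_triangle_rep:
  assumes "cone_triangle (hcl 0 u) I P" "cocycle 0 u"
  obtains i p j s where "cone u i p j s" "I = hcl 0 i" "P = hcl 0 (\<sigma> (src u) \<cdot> p)"
proof -
  obtain v i p j s where c: "cone v i p j s" and v: "hcl 0 u = hcl 0 v" and IP: "I = hcl 0 i" "P = hcl 0 (\<sigma> (src v) \<cdot> p)"
    using assms(1) unfolding cone_triangle_def by blast
  obtain h where h: "arrow h" "src h = src u" "tgt h = tgt u" "deg h = -1" "level h \<le> ereal 0" "v = u \<^bold>+ \<delta> h"
    using hcl_eqD[OF v assms(2) cone_typed(1)[OF c]] .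
  have e: "src v = src u" "tgt v = tgt u" using h by simp_all
  have "cone u i p (j \<^bold>+ \<^bold>- (i \<cdot> h)) (s \<^bold>+ h \<cdot> p)"
    by (rule cone_homotopic[OF c _ _ _ _ _ assms(2)]) (use h e in \<open>simp_all add: zero_ereal_def\<close>)
  then show ?thesis using that IP e by simp
qed

text \<open>The cone of \<open>i : Y \<rightarrow> C\<close> has the graded parts \<open>Y\<close>, \<open>X\<close> and \<open>Y\<close>, where the two copies of \<open>Y\<close> form a
  cone of an identity. So the projection \<open>\<theta>\<close> to \<open>T X\<close> is a homotopy equivalence, with homotopy \<open>j' s s'\<close>; the
  inclusion of \<open>X\<close> is closed only after the correction by \<open>j' u\<close>.\<close>

lemma cone_rotate:
  assumes c: "cone u i p j s" and c': "cone i i' p' j' s'"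
  shows "\<exists>\<psi>. H.aiso (T (src u)) (tgt i') \<psi> \<and> \<psi> \<circ>\<^sub>H hcl 0 (\<sigma> (src u) \<cdot> p) = hcl 0 i' \<and>
    hcl 0 (\<sigma> (src i) \<cdot> p') \<circ>\<^sub>H \<psi> = -\<^sub>H hcl 0 (susp u)"
proof -
  note C = cone_typed[OF c] cone_typed[OF c'] cone_eqs[OF c] cone_eqs[OF c']
  note A = cone_eqs_assoc[OF c] cone_eqs_assoc[OF c']
  let ?X = "src u"
  define \<psi> where "\<psi> = (i' \<cdot> j \<^bold>+ \<^bold>- (j' \<cdot> u)) \<cdot> \<tau> ?X"
  define \<theta> where "\<theta> = \<sigma> ?X \<cdot> p \<cdot> s'"
  have \<psi>: "cocycle 0 \<psi>" unfolding \<psi>_def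
    by (rule cocycle0I) (auto intro!: level_add level_comp level_neg simp: C A)
  have \<theta>: "cocycle 0 \<theta>" unfolding \<theta>_def
    by (rule cocycle0I) (auto intro!: level_comp simp: C A)
  have ends: "src \<psi> = T ?X" "tgt \<psi> = tgt i'" "src \<theta> = tgt i'" "tgt \<theta> = T ?X"
    by (simp_all add: \<psi>_def \<theta>_def C)
  have P: "cocycle 0 (\<sigma> ?X \<cdot> p)" "cocycle 0 (\<sigma> (src i) \<cdot> p')" "cocycle 0 i'"
    using cone_projection[OF c] cone_projection[OF c'] cone_inclusion[OF c'] by auto
  have 1: "hcl 0 \<theta> \<circ>\<^sub>H hcl 0 \<psi> = H.aid (T ?X)"
    using \<psi> \<theta> ends by (simp add: \<psi>_def \<theta>_def C A hcl_id)
  have 2: "hcl 0 \<psi> \<circ>\<^sub>H hcl 0 \<theta> = H.aid (tgt i')"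
  proof -
    have "hcl 0 (\<psi> \<cdot> \<theta>) = hcl 0 (aid (tgt i'))"
    proof (rule hcl_eqI[where h = "j' \<cdot> s \<cdot> s'"])
      show "cocycle 0 (\<psi> \<cdot> \<theta>)" using \<theta> \<psi> by (rule cocycle_comp0) (simp add: ends)
      show "level (j' \<cdot> s \<cdot> s') \<le> ereal 0" using C by (simp add: zero_ereal_def[symmetric] level_comp)
      show "aid (tgt i') = \<psi> \<cdot> \<theta> \<^bold>+ \<delta> (j' \<cdot> s \<cdot> s')" by (simp add: \<psi>_def \<theta>_def C A aadd_ac)
    qed (simp_all add: C ends)
    then show ?thesis using \<psi> \<theta> ends by (simp add: hcl_id)
  qed
  have 3: "hcl 0 \<psi> \<circ>\<^sub>H hcl 0 (\<sigma> ?X \<cdot> p) = hcl 0 i'"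
  proof -
    have "hcl 0 (\<psi> \<cdot> \<sigma> ?X \<cdot> p) = hcl 0 i'"
    proof (rule hcl_eqI[where h = "j' \<cdot> s"])
      show "cocycle 0 (\<psi> \<cdot> \<sigma> ?X \<cdot> p)" using P(1) \<psi> by (rule cocycle_comp0) (simp add: ends C)
      show "level (j' \<cdot> s) \<le> ereal 0" using C by (simp add: zero_ereal_def[symmetric] level_comp)
      show "i' = (\<psi> \<cdot> \<sigma> ?X \<cdot> p) \<^bold>+ \<delta> (j' \<cdot> s)" by (simp add: \<psi>_def C A aadd_ac)
    qed (simp_all add: C ends)
    then show ?thesis using \<psi> P ends by (simp add: C)
  qed
  have "(\<sigma> (src i) \<cdot> p') \<cdot> \<psi> = \<^bold>- susp u" by (simp add: \<psi>_def susp_def C A)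
  then have 4: "hcl 0 (\<sigma> (src i) \<cdot> p') \<circ>\<^sub>H hcl 0 \<psi> = -\<^sub>H hcl 0 (susp u)"
    using \<psi> P ends susp_cocycle[OF C(1)] hcl_neg[OF susp_cocycle[OF C(1)]] by (simp add: C)
  have "H.aiso (T ?X) (tgt i') (hcl 0 \<psi>)"
    by (rule H.aisoI[OF _ _ 1 2]) (use \<psi> \<theta> ends in \<open>simp_all add: H.amor_def\<close>)
  then show ?thesis using 3 4 by blast
qed

text \<open>The map \<open>f\<close> between the cones is \<open>v\<close> on \<open>Y\<close> and the identity on \<open>X\<close>, and \<open>g\<close> is the identity on
  \<open>Z = tgt v\<close> and \<open>u\<close> on \<open>X\<close>. The cone of \<open>f\<close> has the graded parts \<open>Z\<close>, \<open>X\<close>, \<open>Y\<close> and \<open>X\<close>. The two copies of \<open>X\<close>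
  form a cone of an identity, contracted by \<open>j4 j1 p3 s4\<close>, and the cone of \<open>v\<close> remains.\<close>

lemma cone_octahedron:
  assumes c1: "cone u i1 p1 j1 s1" and c2: "cone v i2 p2 j2 s2" and c3: "cone (v \<cdot> u) i3 p3 j3 s3"
    and vu: "src v = tgt u"
  shows "\<exists>f g i4 p4 j4 s4 c. cocycle 0 f \<and> src f = tgt i1 \<and> tgt f = tgt i3 \<and>
    cocycle 0 g \<and> src g = tgt i3 \<and> tgt g = tgt i2 \<and> cone f i4 p4 j4 s4 \<and>
    H.aiso (tgt i2) (tgt i4) c \<and> c \<circ>\<^sub>H hcl 0 g = hcl 0 i4 \<and>
    hcl 0 (\<sigma> (src f) \<cdot> p4) \<circ>\<^sub>H c = hcl 0 (susp i1) \<circ>\<^sub>H hcl 0 (\<sigma> (src v) \<cdot> p2) \<and>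
    f \<cdot> i1 = i3 \<cdot> v \<and> p3 \<cdot> f = p1 \<and> g \<cdot> i3 = i2 \<and> p2 \<cdot> g = u \<cdot> p3"
proof -
  note C = cone_typed[OF c1] cone_typed[OF c2] cone_typed[OF c3] cone_eqs[OF c1] cone_eqs[OF c2] cone_eqs[OF c3]
  note A = cone_eqs_assoc[OF c1] cone_eqs_assoc[OF c2] cone_eqs_assoc[OF c3]
  define f where "f = i3 \<cdot> v \<cdot> s1 \<^bold>+ j3 \<cdot> p1"
  define g where "g = i2 \<cdot> s3 \<^bold>+ j2 \<cdot> u \<cdot> p3"
  have f: "cocycle 0 f" unfolding f_def
    by (rule cocycle0I) (auto intro!: level_add level_comp simp: C A vu)
  have g: "cocycle 0 g" unfolding g_def
    by (rule cocycle0I) (auto intro!: level_add level_comp simp: C A vu)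
  have fg: "src f = tgt i1" "tgt f = tgt i3" "src g = tgt i3" "tgt g = tgt i2"
    by (simp_all add: f_def g_def C vu)
  have e: "f \<cdot> i1 = i3 \<cdot> v" "p3 \<cdot> f = p1" "g \<cdot> i3 = i2" "p2 \<cdot> g = u \<cdot> p3" "s2 \<cdot> g = s3" "f \<cdot> j1 = j3"
    by (simp_all add: f_def g_def C A vu)
  note F = cocycleD[OF f] cocycleD[OF g] fg cocycle_level0[OF f] cocycle_level0[OF g]
  have ea: "f \<cdot> i1 \<cdot> x = i3 \<cdot> v \<cdot> x" if "arrow x" "tgt x = tgt u" for x
    using that precomp[OF e(1), of x] F by (simp add: C vu)
  have eb: "p3 \<cdot> f \<cdot> x = p1 \<cdot> x" if "arrow x" "tgt x = tgt i1" for x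
    using that precomp[OF e(2), of x] F by (simp add: C vu)
  have ec: "g \<cdot> i3 \<cdot> x = i2 \<cdot> x" if "arrow x" "tgt x = tgt v" for x
    using that precomp[OF e(3), of x] F by (simp add: C vu)
  have ed: "p2 \<cdot> g \<cdot> x = u \<cdot> p3 \<cdot> x" if "arrow x" "tgt x = tgt i3" for x
    using that precomp[OF e(4), of x] F by (simp add: C vu)
  have ee: "s2 \<cdot> g \<cdot> x = s3 \<cdot> x" if "arrow x" "tgt x = tgt i3" for x
    using that precomp[OF e(5), of x] F by (simp add: C vu)
  have ef: "f \<cdot> j1 \<cdot> x = j3 \<cdot> x" if "arrow x" "tgt x = src u" for x
    using that precomp[OF e(6), of x] F by (simp add: C vu)
  have gf: "g \<cdot> f \<cdot> x = i2 \<cdot> v \<cdot> s1 \<cdot> x \<^bold>+ j2 \<cdot> u \<cdot> p1 \<cdot> x" if "arrow x" "tgt x = tgt i1" for x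
    using that by (simp add: f_def g_def C A vu)
  obtain i4 p4 j4 s4 where c4: "cone f i4 p4 j4 s4" using cone_exists[OF f] by blast
  note C4 = cone_typed[OF c4] cone_eqs[OF c4] cone_eqs_assoc[OF c4]
  define \<theta> where "\<theta> = i4 \<cdot> i3 \<cdot> s2 \<^bold>+ j4 \<cdot> i1 \<cdot> p2"
  define \<psi> where "\<psi> = g \<cdot> s4 \<^bold>+ j2 \<cdot> s1 \<cdot> p4"
  have \<theta>: "cocycle 0 \<theta>" unfolding \<theta>_def
    by (rule cocycle0I) (auto intro!: level_add level_comp simp: C A C4 F vu ea)
  have \<psi>: "cocycle 0 \<psi>" unfolding \<psi>_def
    by (rule cocycle0I) (auto intro!: level_add level_comp simp: C A C4 F vu gf)
  have ends: "src \<theta> = tgt i2" "tgt \<theta> = tgt i4" "src \<psi> = tgt i4" "tgt \<psi> = tgt i2"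
    by (simp_all add: \<theta>_def \<psi>_def C C4 F vu)
  have 1: "hcl 0 \<psi> \<circ>\<^sub>H hcl 0 \<theta> = H.aid (tgt i2)"
  proof -
    have "\<psi> \<cdot> \<theta> = aid (tgt i2)" by (simp add: \<theta>_def \<psi>_def C A C4 F vu ec aadd_ac)
    then show ?thesis using \<psi> \<theta> ends by (simp add: hcl_id)
  qed
  have 2: "hcl 0 \<theta> \<circ>\<^sub>H hcl 0 \<psi> = H.aid (tgt i4)"
  proof -
    have "hcl 0 (\<theta> \<cdot> \<psi>) = hcl 0 (aid (tgt i4))"
    proof (rule hcl_eqI[where h = "j4 \<cdot> j1 \<cdot> p3 \<cdot> s4"])
      show "cocycle 0 (\<theta> \<cdot> \<psi>)" using \<psi> \<theta> by (rule cocycle_comp0) (simp add: ends)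
      show "level (j4 \<cdot> j1 \<cdot> p3 \<cdot> s4) \<le> ereal 0"
        unfolding zero_ereal_def[symmetric] by (intro level_comp) (simp_all add: C C4 F vu)
      show "aid (tgt i4) = \<theta> \<cdot> \<psi> \<^bold>+ \<delta> (j4 \<cdot> j1 \<cdot> p3 \<cdot> s4)"
        by (simp add: \<theta>_def \<psi>_def C A C4 F vu ea eb ec ed ee ef aadd_ac)
    qed (simp_all add: C C4 F ends vu)
    then show ?thesis using \<psi> \<theta> ends by (simp add: hcl_id)
  qed
  have iso: "H.aiso (tgt i2) (tgt i4) (hcl 0 \<theta>)"
    by (rule H.aisoI[OF _ _ 1 2]) (use \<psi> \<theta> ends in \<open>simp_all add: H.amor_def\<close>)
  have 3: "hcl 0 \<theta> \<circ>\<^sub>H hcl 0 g = hcl 0 i4"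
  proof -
    have "\<psi> \<cdot> i4 = g" by (simp add: \<psi>_def C A C4 F vu)
    then have "hcl 0 \<psi> \<circ>\<^sub>H hcl 0 i4 = hcl 0 g"
      using \<psi> cone_inclusion[OF c4] ends F by (simp add: C4)
    from this[symmetric] show ?thesis
      using H.precomp[OF 2, of "hcl 0 i4"] \<psi> \<theta> ends cone_inclusion[OF c4] F by (simp add: C4)
  qed
  have 4: "hcl 0 (\<sigma> (src f) \<cdot> p4) \<circ>\<^sub>H hcl 0 \<theta> = hcl 0 (susp i1) \<circ>\<^sub>H hcl 0 (\<sigma> (src v) \<cdot> p2)"
  proof -
    have "(\<sigma> (src f) \<cdot> p4) \<cdot> \<theta> = susp i1 \<cdot> \<sigma> (src v) \<cdot> p2"
      by (simp add: susp_def \<theta>_def C A C4 F vu)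
    then show ?thesis
      using cone_projection[OF c4] cone_projection[OF c2] \<theta> ends susp_cocycle[OF cone_inclusion[OF c1]] F
      by (simp add: C C4 vu)
  qed
  show ?thesis
    using f g fg c4 iso 3 4 e(1-4) by blast
qed

lemma H_amor_hcl: "\<lbrakk>cocycle 0 f; src f = X; tgt f = Y\<rbrakk> \<Longrightarrow> H.amor X Y (hcl 0 f)"
  by (simp add: H.amor_def)

lemma H_amorE:
  assumes "H.amor X Y a"
  obtains f where "cocycle 0 f" "src f = X" "tgt f = Y" "a = hcl 0 f"
  using assms hclE[of a] by (auto simp: H.amor_def)

lemma susp_comp: "\<lbrakk>arrow f; arrow g; src g = tgt f\<rbrakk> \<Longrightarrow> susp (g \<cdot> f) = susp g \<cdot> susp f"
  by (simp add: susp_def)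

lemma susp_add: "\<lbrakk>arrow f; arrow g; src f = src g; tgt f = tgt g; deg f = deg g\<rbrakk> \<Longrightarrow>
  susp (f \<^bold>+ g) = susp f \<^bold>+ susp g"
  by (simp add: susp_def)

lemma susp_id: "X \<in> Ob \<Longrightarrow> susp (aid X) = aid (T X)"
  by (simp add: susp_def)

lemma desusp:
  assumes X: "X \<in> Ob" "Y \<in> Ob" and g: "cocycle 0 g" "src g = T X" "tgt g = T Y"
  defines "f \<equiv> \<tau> Y \<cdot> g \<cdot> \<sigma> X"
  shows "cocycle 0 f" "src f = X" "tgt f = Y" "susp f = g"
proof -
  note G = cocycleD[OF g(1)] g(2,3) cocycle_level0[OF g(1)]
  show "cocycle 0 f" unfolding f_def
    by (rule cocycle0I) (auto intro!: level_comp simp: G X)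
  show "src f = X" "tgt f = Y" "susp f = g" by (simp_all add: f_def susp_def G X)
qed

text \<open>A homotopy for the suspensions is conjugated back. The degree of \<open>\<tau>\<close> is odd, which gives it a
  sign.\<close>

lemma hcl_susp_inj:
  assumes f: "cocycle 0 f" and g: "cocycle 0 g" and fg: "src f = src g" "tgt f = tgt g"
    and e: "hcl 0 (susp f) = hcl 0 (susp g)"
  shows "hcl 0 f = hcl 0 g"
proof -
  obtain h where h: "arrow h" "src h = T (src f)" "tgt h = T (tgt f)" "deg h = -1" "level h \<le> ereal 0"
    and sg: "susp g = susp f \<^bold>+ \<delta> h"
    using hcl_eqD[OF e susp_cocycle[OF f] susp_cocycle[OF g]] by auto
  note F = cocycleD[OF f] cocycleD[OF g] fg
  have "\<tau> (tgt g) \<cdot> susp g \<cdot> \<sigma> (src g) = g" using F by (simp add: susp_def)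
  then have "g = f \<^bold>+ \<delta> (\<^bold>- (\<tau> (tgt g) \<cdot> h \<cdot> \<sigma> (src g)))"
    unfolding sg using F h by (simp add: susp_def)
  then show ?thesis
    using F h f by (intro hcl_eqI[where h = "\<^bold>- (\<tau> (tgt g) \<cdot> h \<cdot> \<sigma> (src g))"])
      (simp_all add: level_neg level_comp zero_ereal_def[symmetric])
qed

text \<open>The differential of \<open>j\<close> and \<open>s\<close> is given by \<open>u\<close>, so the cone of a zero morphism splits.\<close>

lemma H_biproduct:
  assumes X: "X \<in> Ob" and Y: "Y \<in> Ob"
  shows "\<exists>P jX jY pX pY.
      H.amor X P jX \<and> H.amor Y P jY \<and> H.amor P X pX \<and> H.amor P Y pY \<and>
      pX \<circ>\<^sub>H jX = H.aid X \<and> pY \<circ>\<^sub>H jY = H.aid Y \<and> pY \<circ>\<^sub>H jX = H.azero X Y 0 \<and> pX \<circ>\<^sub>H jY = H.azero Y X 0 \<and>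
      jX \<circ>\<^sub>H pX +\<^sub>H jY \<circ>\<^sub>H pY = H.aid P"
proof -
  obtain X' where X': "X' \<in> Ob" "X = T X'" using T_bij X by (auto simp: bij_betw_def)
  (* the cone of the zero morphism out of the desuspension of X *)
  obtain i p j s where c: "cone (azero X' Y 0) i p j s"
    using cone_exists[OF cocycle_zero] X' Y by blast
  note C = cone_typed[OF c] cone_eqs[OF c] cone_eqs_assoc[OF c]
  let ?P = "tgt i" and ?jX = "j \<cdot> \<tau> X'" and ?pX = "\<sigma> X' \<cdot> p"
  have cc: "cocycle 0 ?jX" "cocycle 0 i" "cocycle 0 ?pX" "cocycle 0 s"
    using C X' Y by (auto intro!: cocycle0I level_comp)
  have "?pX \<cdot> ?jX = aid X" "s \<cdot> i = aid Y" "s \<cdot> ?jX = azero X Y 0" "?pX \<cdot> i = azero Y X 0"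
    "?jX \<cdot> ?pX \<^bold>+ i \<cdot> s = aid ?P"
    using C X' Y by (simp_all add: aadd_ac)
  note e = this
  have "hcl 0 ?pX \<circ>\<^sub>H hcl 0 ?jX = H.aid X" "hcl 0 s \<circ>\<^sub>H hcl 0 i = H.aid Y"
    "hcl 0 s \<circ>\<^sub>H hcl 0 ?jX = H.azero X Y 0" "hcl 0 ?pX \<circ>\<^sub>H hcl 0 i = H.azero Y X 0"
    "hcl 0 ?jX \<circ>\<^sub>H hcl 0 ?pX +\<^sub>H hcl 0 i \<circ>\<^sub>H hcl 0 s = H.aid ?P"
    using cc C X' Y X e
    by (simp_all del: acomp_assoc add: hcl_add hcl_id hcl_zero cocycle_comp0)
  moreover have "H.amor X ?P (hcl 0 ?jX)" "H.amor Y ?P (hcl 0 i)" "H.amor ?P X (hcl 0 ?pX)" "H.amor ?P Y (hcl 0 s)"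
    using cc C X' by (simp_all add: H_amor_hcl)
  ultimately show ?thesis by blast
qed

text \<open>The factor through \<open>p\<close> has degree \<open>-1\<close>; composed with \<open>\<tau>\<close> it becomes a cocycle on \<open>T X\<close>.\<close>

lemma H_Std_factor:
  assumes c: "cone u i p j s" and g: "cocycle 0 g" "src g = tgt i" and e: "hcl 0 g \<circ>\<^sub>H hcl 0 i = H.azero (src i) (tgt g) 0"
  shows "\<exists>f. cocycle 0 f \<and> src f = T (src u) \<and> tgt f = tgt g \<and> hcl 0 g = hcl 0 f \<circ>\<^sub>H hcl 0 (\<sigma> (src u) \<cdot> p)"
proof -
  note C = cone_typed[OF c] cone_eqs[OF c] cone_eqs_assoc[OF c]
  note G = cocycleD[OF g(1)] g(2)
  have "hcl 0 (azero (tgt u) (tgt g) 0) = hcl 0 (g \<cdot> i)"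
    using e g cone_inclusion[OF c] G by (simp add: hcl_zero C)
  then obtain h where h: "arrow h" "src h = tgt u" "tgt h = tgt g" "deg h = -1" "level h \<le> ereal 0"
    and gi: "g \<cdot> i = azero (tgt u) (tgt g) 0 \<^bold>+ \<delta> h"
    using hcl_eqD[of 0 "azero (tgt u) (tgt g) 0" "g \<cdot> i"] cocycle_comp0[OF cone_inclusion[OF c] g(1)] G
    by (auto simp: C cocycle_zero)
  have gi': "g \<cdot> i = \<delta> h" using gi h by simp
  have h0: "level h \<le> 0" using h by (simp add: zero_ereal_def)
  define f where "f = (g \<^bold>+ \<^bold>- \<delta> (h \<cdot> s)) \<cdot> j"
  note f = cone_factor[OF c g h(1-4) h0 gi', folded f_def]
  let ?f = "f \<cdot> \<tau> (src u)"
  have cf: "cocycle 0 ?f" by (rule cocycle0I) (auto intro!: level_comp simp: f C G)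
  have "hcl 0 g = hcl 0 (g \<^bold>+ \<^bold>- \<delta> (h \<cdot> s))"
    using g h h0 C G by (intro hcl_eqI[where h = "\<^bold>- (h \<cdot> s)"])
      (simp_all add: level_neg level_comp zero_ereal_def[symmetric])
  also have "g \<^bold>+ \<^bold>- \<delta> (h \<cdot> s) = ?f \<cdot> (\<sigma> (src u) \<cdot> p)"
    unfolding f(7) using f(1-4) by (simp add: C)
  also have "hcl 0 \<dots> = hcl 0 ?f \<circ>\<^sub>H hcl 0 (\<sigma> (src u) \<cdot> p)"
    using cf cone_projection[OF c] by (subst hcl_comp0) (simp_all add: f C)
  finally show ?thesis using cf f(1-4) by (intro exI[of _ ?f]) (simp add: C)
qed

text \<open>The commutative squares are given only up to homotopy, which \<open>cone_map\<close> accounts for, and a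
  morphism may be replaced by a homotopic one without changing its triangle (\<open>cone_triangle_rep\<close>).\<close>

sublocale H: standard_triangles Ob "\<lambda>X Y r. Mor r X Y" "pcomp (H0 D)" "pid (H0 D)" T THom cone_triangle
proof
  show "bij_betw T Ob Ob" by (rule T_bij)
  show "\<exists>Z\<in>Ob. H.aid Z = H.azero Z Z 0"
    using zero_object_exists by (metis hcl_id hcl_zero)
next
  fix X Y a assume "H.amor X Y a"
  then obtain f where "cocycle 0 f" "src f = X" "tgt f = Y" "a = hcl 0 f" by (rule H_amorE)
  then show "H.amor (T X) (T Y) (THom a)" by (auto intro!: H_amor_hcl susp_cocycle)
  fix b assume "H.amor X Y b"
  then obtain g where g: "cocycle 0 g" "src g = X" "tgt g = Y" "b = hcl 0 g" by (rule H_amorE)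
  note fg = \<open>cocycle 0 f\<close> \<open>src f = X\<close> \<open>tgt f = Y\<close> \<open>a = hcl 0 f\<close> g
  show "a = b" if "THom a = THom b" using that fg hcl_susp_inj[of f g] by simp
  show "THom (a +\<^sub>H b) = THom a +\<^sub>H THom b"
    using fg by (simp add: hcl_add cocycle_add susp_add susp_cocycle)
next
  fix X Y b assume XY: "X \<in> Ob" "Y \<in> Ob" and "H.amor (T X) (T Y) b"
  then obtain g where g: "cocycle 0 g" "src g = T X" "tgt g = T Y" "b = hcl 0 g" by (auto elim: H_amorE)
  show "\<exists>a. H.amor X Y a \<and> THom a = b"
    using desusp[OF XY g(1-3)] g(4) by (intro exI[of _ "hcl 0 (\<tau> Y \<cdot> g \<cdot> \<sigma> X)"]) (simp add: H_amor_hcl)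
next
  show "THom (H.aid X) = H.aid (T X)" if "X \<in> Ob" for X
    using that by (simp add: hcl_id[symmetric] cocycle_id susp_id)
next
  fix X Y Z a b assume "H.amor X Y a" "H.amor Y Z b"
  then obtain f g where fg: "cocycle 0 f" "src f = X" "tgt f = Y" "a = hcl 0 f"
    "cocycle 0 g" "src g = Y" "tgt g = Z" "b = hcl 0 g" by (elim H_amorE) auto
  then show "THom (b \<circ>\<^sub>H a) = THom b \<circ>\<^sub>H THom a" by (simp add: cocycle_comp0 susp_comp susp_cocycle)
next
  fix X Y assume "X \<in> Ob" "Y \<in> Ob"
  then show "\<exists>P jX jY pX pY.
      H.amor X P jX \<and> H.amor Y P jY \<and> H.amor P X pX \<and> H.amor P Y pY \<and>
      pX \<circ>\<^sub>H jX = H.aid X \<and> pY \<circ>\<^sub>H jY = H.aid Y \<and> pY \<circ>\<^sub>H jX = H.azero X Y 0 \<and> pX \<circ>\<^sub>H jY = H.azero Y X 0 \<and>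
      jX \<circ>\<^sub>H pX +\<^sub>H jY \<circ>\<^sub>H pY = H.aid P" by (rule H_biproduct)
next
  fix U I P assume "cone_triangle U I P"
  then obtain u i p j s where c: "cone u i p j s" "U = hcl 0 u" "I = hcl 0 i" "P = hcl 0 (\<sigma> (src u) \<cdot> p)"
    unfolding cone_triangle_def by blast
  note C = cone_typed[OF c(1)]
  have "H.amor (src u) (tgt u) U" "H.amor (tgt u) (tgt i) I" "H.amor (tgt i) (T (src u)) P"
    unfolding c(2-4) using cone_inclusion[OF c(1)] cone_projection[OF c(1)]
    by (auto intro!: H_amor_hcl simp: C)
  then show "\<exists>X Y C. H.amor X Y U \<and> H.amor Y C I \<and> H.amor C (T X) P" by blast
next
  fix X Y U assume "H.amor X Y U"
  then obtain u where u: "cocycle 0 u" "U = hcl 0 u" by (rule H_amorE)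
  show "\<exists>I P. cone_triangle U I P"
    using cone_exists[OF u(1)] u(2) unfolding cone_triangle_def by blast
next
  fix U I P U' I' P' a b
  assume "cone_triangle U I P" "cone_triangle U' I' P'"
    and ab: "H.amor (src U) (src U') a" "H.amor (tgt U) (tgt U') b" and e: "b \<circ>\<^sub>H U = U' \<circ>\<^sub>H a"
  then obtain u i p j s u' i' p' j' s' where
    c: "cone u i p j s" "U = hcl 0 u" "I = hcl 0 i" "P = hcl 0 (\<sigma> (src u) \<cdot> p)" and
    c': "cone u' i' p' j' s'" "U' = hcl 0 u'" "I' = hcl 0 i'" "P' = hcl 0 (\<sigma> (src u') \<cdot> p')"
    unfolding cone_triangle_def by blast
  obtain a0 where a: "cocycle 0 a0" "src a0 = src u" "tgt a0 = src u'" "a = hcl 0 a0"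
    using ab(1) c(2) c'(2) by (auto elim: H_amorE)
  obtain b0 where b: "cocycle 0 b0" "src b0 = tgt u" "tgt b0 = tgt u'" "b = hcl 0 b0"
    using ab(2) c(2) c'(2) by (auto elim: H_amorE)
  note C = cone_typed[OF c(1)] cone_typed[OF c'(1)]
  note AB = cocycleD[OF a(1)] a(2,3) cocycleD[OF b(1)] b(2,3)
  have "hcl 0 (u' \<cdot> a0) = hcl 0 (b0 \<cdot> u)" using e a b c(2) c'(2) C by simp
  then obtain h where h: "arrow h" "src h = src u" "tgt h = tgt u'" "deg h = -1" "level h \<le> ereal 0"
    and e': "b0 \<cdot> u = u' \<cdot> a0 \<^bold>+ \<delta> h"
    using hcl_eqD[of 0 "u' \<cdot> a0" "b0 \<cdot> u"] cocycle_comp0[of a0 u'] cocycle_comp0[of u b0] a b C by auto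
  have h0: "level h \<le> 0" using h by (simp add: zero_ereal_def)
  define \<phi> where "\<phi> = i' \<cdot> b0 \<cdot> s \<^bold>+ j' \<cdot> a0 \<cdot> p \<^bold>+ i' \<cdot> h \<cdot> p"
  note \<phi> = cone_map[OF c(1) c'(1) a(1-3) b(1-3) h(1-4) h0 e', folded \<phi>_def]
  show "\<exists>c. H.amor (tgt I) (tgt I') c \<and> c \<circ>\<^sub>H I = I' \<circ>\<^sub>H b \<and> P' \<circ>\<^sub>H c = THom a \<circ>\<^sub>H P"
  proof (intro exI[of _ "hcl 0 \<phi>"] conjI)
    show "H.amor (tgt I) (tgt I') (hcl 0 \<phi>)" using \<phi> c(3) c'(3) by (simp add: H_amor_hcl)
    show "hcl 0 \<phi> \<circ>\<^sub>H I = I' \<circ>\<^sub>H b"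
      using \<phi> cone_inclusion[OF c(1)] cone_inclusion[OF c'(1)] b by (simp add: c(3) c'(3) C)
    have "(\<sigma> (src u') \<cdot> p') \<cdot> \<phi> = susp a0 \<cdot> (\<sigma> (src u) \<cdot> p)"
      using \<phi> AB by (simp add: C susp_def)
    then show "P' \<circ>\<^sub>H hcl 0 \<phi> = THom a \<circ>\<^sub>H P"
      using \<phi> cone_projection[OF c(1)] cone_projection[OF c'(1)] a susp_cocycle[OF a(1)]
      by (simp add: c(4) c'(4) C del: acomp_assoc)
  qed
next
  fix U I P Z b assume "cone_triangle U I P"
    and b: "H.amor (tgt I) Z b" and e: "b \<circ>\<^sub>H I = H.azero (src I) Z 0"
  then obtain u i p j s where c: "cone u i p j s" "U = hcl 0 u" "I = hcl 0 i" "P = hcl 0 (\<sigma> (src u) \<cdot> p)"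
    unfolding cone_triangle_def by blast
  obtain g where g: "cocycle 0 g" "src g = tgt i" "tgt g = Z" "b = hcl 0 g"
    using b c(3) by (auto elim: H_amorE)
  obtain f where "cocycle 0 f" "src f = T (src u)" "tgt f = tgt g" "hcl 0 g = hcl 0 f \<circ>\<^sub>H hcl 0 (\<sigma> (src u) \<cdot> p)"
    using H_Std_factor[OF c(1) g(1,2)] e c(3) g by auto
  then show "\<exists>f. H.amor (tgt P) Z f \<and> b = f \<circ>\<^sub>H P"
    using g c by (intro exI[of _ "hcl 0 f"]) (simp add: H_amor_hcl)
next
  fix X I P assume S: "cone_triangle (H.aid X) I P"
  then obtain u i p j s where u: "cone u i p j s" "H.aid X = hcl 0 u"
    unfolding cone_triangle_def by blast
  have "src u = X" using arg_cong[OF u(2), of src] by simp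
  with cone_typed(25)[OF u(1)] have "X \<in> Ob" by simp
  note X = this cocycle_id[OF this]
  have "cone_triangle (hcl 0 (aid X)) I P" using S by (simp add: hcl_id)
  then obtain i p j s where c: "cone (aid X) i p j s" "I = hcl 0 i" "P = hcl 0 (\<sigma> (src (aid X)) \<cdot> p)"
    using X(2) by (rule cone_triangle_rep)
  have "hcl 0 (aid (tgt i)) = H.azero (tgt i) (tgt i) 0"
    by (rule cone_contractible[OF c(1) X(2)]) (use X in simp_all)
  then show "H.aid (tgt I) = H.azero (tgt I) (tgt I) 0" by (simp add: c(2) hcl_id)
next
  fix U I P assume "cone_triangle U I P"
  then obtain u i p j s where c: "cone u i p j s" "U = hcl 0 u" "I = hcl 0 i" "P = hcl 0 (\<sigma> (src u) \<cdot> p)"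
    unfolding cone_triangle_def by blast
  obtain i' p' j' s' where c': "cone i i' p' j' s'" using cone_exists[OF cone_inclusion[OF c(1)]] by blast
  have "cone_triangle I (hcl 0 i') (hcl 0 (\<sigma> (src i) \<cdot> p'))"
    unfolding cone_triangle_def using c' c(3) by blast
  moreover obtain \<psi> where "H.aiso (T (src u)) (tgt i') \<psi>" "\<psi> \<circ>\<^sub>H hcl 0 (\<sigma> (src u) \<cdot> p) = hcl 0 i'"
    "hcl 0 (\<sigma> (src i) \<cdot> p') \<circ>\<^sub>H \<psi> = -\<^sub>H hcl 0 (susp u)"
    using cone_rotate[OF c(1) c'] by blast
  ultimately show "\<exists>I' P' c. cone_triangle I I' P' \<and> H.aiso (tgt P) (tgt I') c \<and> c \<circ>\<^sub>H P = I' \<and> P' \<circ>\<^sub>H c = -\<^sub>H THom U"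
    using cone_typed(1)[OF c(1)] c(2,4)
    by (intro exI[of _ "hcl 0 i'"] exI[of _ "hcl 0 (\<sigma> (src i) \<cdot> p')"] exI[of _ \<psi>]) simp
next
  fix U I1 P1 V I2 P2 I3 P3
  assume S: "cone_triangle U I1 P1" "cone_triangle V I2 P2" "cone_triangle (V \<circ>\<^sub>H U) I3 P3" and VU: "src V = tgt U"
  obtain u i1 p1 j1 s1 where c1: "cone u i1 p1 j1 s1" "U = hcl 0 u" "I1 = hcl 0 i1" "P1 = hcl 0 (\<sigma> (src u) \<cdot> p1)"
    using S(1) unfolding cone_triangle_def by blast
  obtain v i2 p2 j2 s2 where c2: "cone v i2 p2 j2 s2" "V = hcl 0 v" "I2 = hcl 0 i2" "P2 = hcl 0 (\<sigma> (src v) \<cdot> p2)"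
    using S(2) unfolding cone_triangle_def by blast
  note uv = cone_typed(1)[OF c1(1)] cone_typed(1)[OF c2(1)]
  have vu: "src v = tgt u" using VU c1(2) c2(2) by simp
  have cvu: "cocycle 0 (v \<cdot> u)" "V \<circ>\<^sub>H U = hcl 0 (v \<cdot> u)"
    using uv vu c1(2) c2(2) by (simp_all add: cocycle_comp0)
  obtain i3 p3 j3 s3 where c3: "cone (v \<cdot> u) i3 p3 j3 s3" "I3 = hcl 0 i3" "P3 = hcl 0 (\<sigma> (src (v \<cdot> u)) \<cdot> p3)"
    using S(3) unfolding cvu(2) using cvu(1) by (rule cone_triangle_rep)
  obtain f g i4 p4 j4 s4 c where f: "cocycle 0 f" "src f = tgt i1" "tgt f = tgt i3"
    and g: "cocycle 0 g" "src g = tgt i3" "tgt g = tgt i2" and c4: "cone f i4 p4 j4 s4"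
    and c: "H.aiso (tgt i2) (tgt i4) c" "c \<circ>\<^sub>H hcl 0 g = hcl 0 i4"
      "hcl 0 (\<sigma> (src f) \<cdot> p4) \<circ>\<^sub>H c = hcl 0 (susp i1) \<circ>\<^sub>H hcl 0 (\<sigma> (src v) \<cdot> p2)"
    and e: "f \<cdot> i1 = i3 \<cdot> v" "p3 \<cdot> f = p1" "g \<cdot> i3 = i2" "p2 \<cdot> g = u \<cdot> p3"
    using cone_octahedron[OF c1(1) c2(1) c3(1) vu] by blast
  note C = cone_typed[OF c1(1)] cone_typed[OF c2(1)] cone_typed[OF c3(1)]
  note inc = cone_inclusion[OF c1(1)] cone_inclusion[OF c2(1)] cone_inclusion[OF c3(1)]
  note prj = cone_projection[OF c1(1)] cone_projection[OF c2(1)] cone_projection[OF c3(1)]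
  note F = cocycleD[OF f(1)] f(2,3) cocycleD[OF g(1)] g(2,3)
  have 1: "(\<sigma> (src u) \<cdot> p3) \<cdot> f = \<sigma> (src u) \<cdot> p1" using F vu by (simp add: C e(2))
  have 2: "(\<sigma> (src v) \<cdot> p2) \<cdot> g = susp u \<cdot> (\<sigma> (src u) \<cdot> p3)" using F vu by (simp add: C e(4) susp_def)
  show "\<exists>f g I4 P4 c. H.amor (tgt I1) (tgt I3) f \<and> H.amor (tgt I3) (tgt I2) g \<and> cone_triangle f I4 P4 \<and>
         H.aiso (tgt I2) (tgt I4) c \<and> c \<circ>\<^sub>H g = I4 \<and> P4 \<circ>\<^sub>H c = THom I1 \<circ>\<^sub>H P2 \<and>
         f \<circ>\<^sub>H I1 = I3 \<circ>\<^sub>H V \<and> P3 \<circ>\<^sub>H f = P1 \<and> g \<circ>\<^sub>H I3 = I2 \<and> P2 \<circ>\<^sub>H g = THom U \<circ>\<^sub>H P3"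
  proof (intro exI conjI)
    show "cone_triangle (hcl 0 f) (hcl 0 i4) (hcl 0 (\<sigma> (src f) \<cdot> p4))"
      unfolding cone_triangle_def using c4 by blast
    show "H.aiso (tgt I2) (tgt (hcl 0 i4)) c" using c c2(3) by simp
    show "c \<circ>\<^sub>H hcl 0 g = hcl 0 i4" by (rule c(2))
    show "H.amor (tgt I1) (tgt I3) (hcl 0 f)" "H.amor (tgt I3) (tgt I2) (hcl 0 g)"
      using f g c1(3) c2(3) c3(2) by (simp_all add: H_amor_hcl)
    show "hcl 0 (\<sigma> (src f) \<cdot> p4) \<circ>\<^sub>H c = THom I1 \<circ>\<^sub>H P2" using c(3) inc by (simp add: c1(3) c2(4))
    show "hcl 0 f \<circ>\<^sub>H I1 = I3 \<circ>\<^sub>H V" using f inc uv vu by (simp add: c1(3) c3(2) c2(2) C e)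
    show "P3 \<circ>\<^sub>H hcl 0 f = P1" using f prj vu by (simp add: c1(4) c3(3) C 1 del: acomp_assoc)
    show "hcl 0 g \<circ>\<^sub>H I3 = I2" using g inc vu by (simp add: c3(2) c2(3) C e)
    show "P2 \<circ>\<^sub>H hcl 0 g = THom U \<circ>\<^sub>H P3"
      using g prj vu uv susp_cocycle[OF uv(1)] by (simp add: c2(4) c1(2) c3(3) C 2[unfolded vu] del: acomp_assoc)
  qed
qed

end

section \<open>Triangulated persistence structure\<close>

context graded_category begin

lemma biproduct_hom_left:
  assumes P: "biproduct degree_zero X Y P jX jY pX pY" and Z: "Z \<in> Ob"
  shows "bij_betw (\<lambda>h. (cmp X P Z r 0 h jX, cmp Y P Z r 0 h jY))
    (carrier (hm P Z r)) (carrier (hm X Z r) \<times> carrier (hm Y Z r))"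
proof -
  let ?jX = "Arr X P 0 jX" and ?jY = "Arr Y P 0 jY" and ?pX = "Arr P X 0 pX" and ?pY = "Arr P Y 0 pY"
  have O: "X \<in> Ob" "Y \<in> Ob" "P \<in> Ob" using P by (auto simp: biproduct_def degree_zero_def)
  have t: "arrow ?jX" "arrow ?jY" "arrow ?pX" "arrow ?pY"
    and e: "?pX \<cdot> ?jX = aid X" "?pY \<cdot> ?jY = aid Y" "?pY \<cdot> ?jX = azero X Y 0" "?pX \<cdot> ?jY = azero Y X 0"
      "?jX \<cdot> ?pX \<^bold>+ ?jY \<cdot> ?pY = aid P"
    using P unfolding biproduct_degree_zero by (auto simp: amor_def)
  show ?thesis
  proof (rule bij_betw_byWitness[where f' = "\<lambda>(a, b). elt (Arr X Z r a \<cdot> ?pX \<^bold>+ Arr Y Z r b \<cdot> ?pY)"])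
    show "\<forall>h\<in>carrier (hm P Z r). (\<lambda>(a, b). elt (Arr X Z r a \<cdot> ?pX \<^bold>+ Arr Y Z r b \<cdot> ?pY))
        (cmp X P Z r 0 h jX, cmp Y P Z r 0 h jY) = h"
    proof
      fix h assume h: "h \<in> carrier (hm P Z r)"
      have "Arr X Z r (cmp X P Z r 0 h jX) = Arr P Z r h \<cdot> ?jX" "Arr Y Z r (cmp Y P Z r 0 h jY) = Arr P Z r h \<cdot> ?jY"
        by (simp_all add: acomp_Arr)
      moreover have "(Arr P Z r h \<cdot> ?jX) \<cdot> ?pX \<^bold>+ (Arr P Z r h \<cdot> ?jY) \<cdot> ?pY
          = Arr P Z r h \<cdot> (?jX \<cdot> ?pX \<^bold>+ ?jY \<cdot> ?pY)"
        using t h O Z by (simp add: arrow_Arr)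
      moreover have "\<dots> = Arr P Z r h" unfolding e(5) using h O Z by (simp add: arrow_Arr)
      ultimately show "(\<lambda>(a, b). elt (Arr X Z r a \<cdot> ?pX \<^bold>+ Arr Y Z r b \<cdot> ?pY))
        (cmp X P Z r 0 h jX, cmp Y P Z r 0 h jY) = h" by simp
    qed
    show "\<forall>a'\<in>carrier (hm X Z r) \<times> carrier (hm Y Z r).
        (\<lambda>h. (cmp X P Z r 0 h jX, cmp Y P Z r 0 h jY))
          ((\<lambda>(a, b). elt (Arr X Z r a \<cdot> ?pX \<^bold>+ Arr Y Z r b \<cdot> ?pY)) a') = a'"
    proof clarify
      fix a b assume ab: "a \<in> carrier (hm X Z r)" "b \<in> carrier (hm Y Z r)"
      let ?h = "Arr X Z r a \<cdot> ?pX \<^bold>+ Arr Y Z r b \<cdot> ?pY"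
      have h: "?h = Arr P Z r (elt ?h)" by (simp add: aadd_def acomp_def)
      have "?h \<cdot> ?jX = Arr X Z r a" "?h \<cdot> ?jY = Arr Y Z r b"
        using t ab O Z by (simp_all add: arrow_Arr e)
      then have "Arr P Z r (elt ?h) \<cdot> ?jX = Arr X Z r a" "Arr P Z r (elt ?h) \<cdot> ?jY = Arr Y Z r b"
        using h by simp_all
      then show "cmp X P Z r 0 (elt ?h) jX = a \<and> cmp Y P Z r 0 (elt ?h) jY = b"
        by (simp add: acomp_Arr)
    qed
    show "(\<lambda>h. (cmp X P Z r 0 h jX, cmp Y P Z r 0 h jY)) ` carrier (hm P Z r)
        \<subseteq> carrier (hm X Z r) \<times> carrier (hm Y Z r)"
      using t O Z cmp_closed[of X P Z jX 0 _ r] cmp_closed[of Y P Z jY 0 _ r] by (auto simp: arrow_Arr)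
    show "(\<lambda>(a, b). elt (Arr X Z r a \<cdot> ?pX \<^bold>+ Arr Y Z r b \<cdot> ?pY)) ` (carrier (hm X Z r) \<times> carrier (hm Y Z r))
        \<subseteq> carrier (hm P Z r)"
    proof clarify
      fix a b assume ab: "a \<in> carrier (hm X Z r)" "b \<in> carrier (hm Y Z r)"
      have "arrow (Arr X Z r a \<cdot> ?pX \<^bold>+ Arr Y Z r b \<cdot> ?pY)" using t ab O Z by (simp add: arrow_Arr)
      then show "elt (Arr X Z r a \<cdot> ?pX \<^bold>+ Arr Y Z r b \<cdot> ?pY) \<in> carrier (hm P Z r)"
        by (simp add: arrow_def del: arrow_ends)
    qed
  qed
qed

lemma biproduct_hom_right:
  assumes P: "biproduct degree_zero X Y P jX jY pX pY" and Z: "Z \<in> Ob"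
  shows "bij_betw (\<lambda>h. (cmp Z P X 0 r pX h, cmp Z P Y 0 r pY h))
    (carrier (hm Z P r)) (carrier (hm Z X r) \<times> carrier (hm Z Y r))"
proof -
  let ?jX = "Arr X P 0 jX" and ?jY = "Arr Y P 0 jY" and ?pX = "Arr P X 0 pX" and ?pY = "Arr P Y 0 pY"
  have O: "X \<in> Ob" "Y \<in> Ob" "P \<in> Ob" using P by (auto simp: biproduct_def degree_zero_def)
  have t: "arrow ?jX" "arrow ?jY" "arrow ?pX" "arrow ?pY"
    and e: "?pX \<cdot> ?jX = aid X" "?pY \<cdot> ?jY = aid Y" "?pY \<cdot> ?jX = azero X Y 0" "?pX \<cdot> ?jY = azero Y X 0"
      "?jX \<cdot> ?pX \<^bold>+ ?jY \<cdot> ?pY = aid P"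
    using P unfolding biproduct_degree_zero by (auto simp: amor_def)
  have ea: "?pX \<cdot> ?jX \<cdot> x = x" "?pY \<cdot> ?jX \<cdot> x = azero (src x) Y (deg x)" if "arrow x" "tgt x = X" for x
    using that t O precomp[OF e(1), of x] precomp[OF e(3), of x] by simp_all
  have eb: "?pY \<cdot> ?jY \<cdot> x = x" "?pX \<cdot> ?jY \<cdot> x = azero (src x) X (deg x)" if "arrow x" "tgt x = Y" for x
    using that t O precomp[OF e(2), of x] precomp[OF e(4), of x] by simp_all
  let ?f' = "\<lambda>(a, b). elt (?jX \<cdot> Arr Z X r a \<^bold>+ ?jY \<cdot> Arr Z Y r b)"
  show ?thesis
  proof (rule bij_betw_byWitness[where f' = ?f'])
    show "\<forall>h\<in>carrier (hm Z P r). ?f' (cmp Z P X 0 r pX h, cmp Z P Y 0 r pY h) = h"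
    proof
      fix h assume h: "h \<in> carrier (hm Z P r)"
      have "Arr Z X r (cmp Z P X 0 r pX h) = ?pX \<cdot> Arr Z P r h" "Arr Z Y r (cmp Z P Y 0 r pY h) = ?pY \<cdot> Arr Z P r h"
        by (simp_all add: acomp_Arr)
      moreover have "?jX \<cdot> ?pX \<cdot> Arr Z P r h \<^bold>+ ?jY \<cdot> ?pY \<cdot> Arr Z P r h
          = (?jX \<cdot> ?pX \<^bold>+ ?jY \<cdot> ?pY) \<cdot> Arr Z P r h"
        using t h O Z by (simp add: arrow_Arr)
      moreover have "\<dots> = Arr Z P r h" unfolding e(5) using h O Z by (simp add: arrow_Arr)
      ultimately show "?f' (cmp Z P X 0 r pX h, cmp Z P Y 0 r pY h) = h" by simp
    qed
    show "\<forall>a'\<in>carrier (hm Z X r) \<times> carrier (hm Z Y r).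
        (\<lambda>h. (cmp Z P X 0 r pX h, cmp Z P Y 0 r pY h)) (?f' a') = a'"
    proof clarify
      fix a b assume ab: "a \<in> carrier (hm Z X r)" "b \<in> carrier (hm Z Y r)"
      let ?h = "?jX \<cdot> Arr Z X r a \<^bold>+ ?jY \<cdot> Arr Z Y r b"
      have h: "?h = Arr Z P r (elt ?h)" by (simp add: aadd_def acomp_def)
      have "?pX \<cdot> ?h = Arr Z X r a" "?pY \<cdot> ?h = Arr Z Y r b"
        using t ab O Z by (simp_all add: arrow_Arr ea eb)
      then have "?pX \<cdot> Arr Z P r (elt ?h) = Arr Z X r a" "?pY \<cdot> Arr Z P r (elt ?h) = Arr Z Y r b"
        using h by simp_all
      then show "cmp Z P X 0 r pX (elt ?h) = a \<and> cmp Z P Y 0 r pY (elt ?h) = b"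
        by (simp add: acomp_Arr)
    qed
    show "(\<lambda>h. (cmp Z P X 0 r pX h, cmp Z P Y 0 r pY h)) ` carrier (hm Z P r)
        \<subseteq> carrier (hm Z X r) \<times> carrier (hm Z Y r)"
      using t O Z cmp_closed[of Z P X _ r pX 0] cmp_closed[of Z P Y _ r pY 0] by (auto simp: arrow_Arr)
    show "?f' ` (carrier (hm Z X r) \<times> carrier (hm Z Y r)) \<subseteq> carrier (hm Z P r)"
    proof clarify
      fix a b assume ab: "a \<in> carrier (hm Z X r)" "b \<in> carrier (hm Z Y r)"
      have "arrow (?jX \<cdot> Arr Z X r a \<^bold>+ ?jY \<cdot> Arr Z Y r b)" using t ab O Z by (simp add: arrow_Arr)
      then show "elt (?jX \<cdot> Arr Z X r a \<^bold>+ ?jY \<cdot> Arr Z Y r b) \<in> carrier (hm Z P r)"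
        by (simp add: arrow_def del: arrow_ends)
    qed
  qed
qed

end

text \<open>The shift functor of the cohomology category acts identically on classes, which requires that the
  hom-complexes of shifted objects agree up to their levels.\<close>

locale shifted_dg_category = suspended_dg_category K D T sg sg'
  for K :: "('a, 'e) ring_scheme" (structure) and D :: "('o, 'a, 'm) fdg_category"
    and T :: "'o \<Rightarrow> 'o" and sg sg' :: "'o \<Rightarrow> 'm" +
  fixes Sh :: "real \<Rightarrow> 'o \<Rightarrow> 'o"
  assumes Sh_closed: "X \<in> dgobj D \<Longrightarrow> Sh t X \<in> dgobj D"
    and Sh_zero: "X \<in> dgobj D \<Longrightarrow> Sh 0 X = X"
    and Sh_add: "X \<in> dgobj D \<Longrightarrow> Sh t (Sh s X) = Sh (t + s) X"
    and Sh_T: "X \<in> dgobj D \<Longrightarrow> Sh t (T X) = T (Sh t X)"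
    and Sh_gpart: "\<lbrakk>X \<in> dgobj D; Y \<in> dgobj D\<rbrakk> \<Longrightarrow> gpart (dghom D (Sh r X) (Sh s Y)) i = gpart (dghom D X Y) i"
    and Sh_bdry: "\<lbrakk>X \<in> dgobj D; Y \<in> dgobj D; f \<in> carrier (gpart (dghom D X Y) i)\<rbrakk> \<Longrightarrow>
      bdry (dghom D (Sh r X) (Sh s Y)) i f = bdry (dghom D X Y) i f"
    and Sh_flev: "\<lbrakk>X \<in> dgobj D; Y \<in> dgobj D; f \<in> carrier (gpart (dghom D X Y) i)\<rbrakk> \<Longrightarrow>
      flev (dghom D (Sh r X) (Sh s Y)) i f = flev (dghom D X Y) i f + ereal (s - r)"
    and Sh_comp: "\<lbrakk>X \<in> dgobj D; Y \<in> dgobj D; Z \<in> dgobj D;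
      f \<in> carrier (gpart (dghom D X Y) i); g \<in> carrier (gpart (dghom D Y Z) j)\<rbrakk> \<Longrightarrow>
      dgcomp D (Sh r X) (Sh s Y) (Sh t Z) j i g f = dgcomp D X Y Z j i g f"
    and Sh_id: "X \<in> dgobj D \<Longrightarrow> dgid D (Sh t X) = dgid D X"
    and Sh_sg: "X \<in> dgobj D \<Longrightarrow> sg (Sh t X) = sg X" "X \<in> dgobj D \<Longrightarrow> sg' (Sh t X) = sg' X"
begin

notation acomp (infixr "\<cdot>" 75) and aadd (infixr "\<^bold>+" 65) and aneg ("\<^bold>- _" [80] 80)
  and asmult (infixr "\<^bold>*" 75) and abd ("\<delta>")
notation H.acomp (infixr "\<circ>\<^sub>H" 75) and H.aadd (infixr "+\<^sub>H" 65) and H.aneg ("-\<^sub>H _" [80] 80)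

text \<open>Shifts do not change the elements of hom-complexes; \<open>shf r s f\<close> is \<open>f\<close> regarded as a morphism from \<open>\<Sigma>\<^sup>r X\<close> to \<open>\<Sigma>\<^sup>s Y\<close>.\<close>

definition shf :: "real \<Rightarrow> real \<Rightarrow> ('o, int, 'm) arr \<Rightarrow> ('o, int, 'm) arr" where
  "shf r s f = Arr (Sh r (src f)) (Sh s (tgt f)) (deg f) (elt f)"

lemma shf_dom [simp]: "src (shf r s f) = Sh r (src f)" "tgt (shf r s f) = Sh s (tgt f)" "deg (shf r s f) = deg f"
  by (simp_all add: shf_def)

lemma shf_arrow [simp]: "arrow f \<Longrightarrow> arrow (shf r s f)"
  by (simp add: arrow_def shf_def Sh_gpart Sh_closed del: arrow_ends)

lemma shf_comp: "\<lbrakk>arrow f; arrow g; src g = tgt f\<rbrakk> \<Longrightarrow> shf s t g \<cdot> shf r s f = shf r t (g \<cdot> f)"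
  by (simp add: arrow_def shf_def acomp_def Sh_comp del: arrow_ends)

lemma shf_add: "\<lbrakk>arrow f; arrow g; src f = src g; tgt f = tgt g; deg f = deg g\<rbrakk> \<Longrightarrow> shf r s f \<^bold>+ shf r s g = shf r s (f \<^bold>+ g)"
  by (simp add: arrow_def shf_def aadd_def Sh_gpart del: arrow_ends)

lemma shf_zero: "\<lbrakk>X \<in> Ob; Y \<in> Ob\<rbrakk> \<Longrightarrow> shf r s (azero X Y i) = azero (Sh r X) (Sh s Y) i"
  by (simp add: shf_def azero_def Sh_gpart)

lemma shf_id: "X \<in> Ob \<Longrightarrow> shf r r (aid X) = aid (Sh r X)"
  by (simp add: shf_def aid_def Sh_id)

lemma shf_abd: "arrow f \<Longrightarrow> \<delta> (shf r s f) = shf r s (\<delta> f)"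
  by (simp add: arrow_def shf_def abd_def Sh_bdry del: arrow_ends)

lemma shf_level: "arrow f \<Longrightarrow> level (shf r s f) = level f + ereal (s - r)"
  by (simp add: arrow_def shf_def level_def Sh_flev del: arrow_ends)

lemma shf_level0: "arrow f \<Longrightarrow> level (shf r r f) = level f"
  using shf_level[of f r r] by (cases "level f") (auto simp: zero_ereal_def)

lemma shf_cocycle: assumes "cocycle t f" shows "cocycle (t + (s - r)) (shf r s f)"
proof (rule cocycleI)
  have "level f + ereal (s - r) \<le> ereal t + ereal (s - r)"
    by (rule add_right_mono) (simp add: assms)
  then show "level (shf r s f) \<le> ereal (t + (s - r))" using assms by (simp add: shf_level)
qed (use assms in \<open>simp_all add: shf_abd shf_zero\<close>)

lemma shf_cocycle0 [simp]: "cocycle t f \<Longrightarrow> cocycle t (shf r r f)"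
  using shf_cocycle[of t f r r] by simp

lemma shf_shf: "arrow f \<Longrightarrow> shf r s (shf r' s' f) = shf (r + r') (s + s') f"
  by (simp add: shf_def Sh_add)

lemma shf_coboundaries:
  assumes "X \<in> Ob" "Y \<in> Ob"
  shows "coboundaries (dghom D (Sh t X) (Sh t Y)) r = coboundaries (dghom D X Y) r"
proof -
  have "{h \<in> carrier (gpart (dghom D (Sh t X) (Sh t Y)) (-1)). flev (dghom D (Sh t X) (Sh t Y)) (-1) h \<le> ereal r}
    = {h \<in> carrier (gpart (dghom D X Y) (-1)). flev (dghom D X Y) (-1) h \<le> ereal r}"
    using assms by (auto simp: Sh_gpart Sh_flev)
  then show ?thesis
    unfolding coboundaries_def using assms by (auto simp: Sh_bdry intro!: image_cong)
qed

lemma cls_shf: "arrow f \<Longrightarrow> deg f = 0 \<Longrightarrow> cls r (shf t t f) = cls r f"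
  by (simp add: cls_def shf_def cclass_def shf_coboundaries Sh_gpart)

lemma Mor_Sh: "\<lbrakk>X \<in> Ob; Y \<in> Ob\<rbrakk> \<Longrightarrow> Mor r (Sh t X) (Sh t Y) = Mor r X Y"
proof -
  assume XY: "X \<in> Ob" "Y \<in> Ob"
  have "cocycles (dghom D (Sh t X) (Sh t Y)) r = cocycles (dghom D X Y) r"
    using XY by (auto simp: cocycles_def Sh_gpart Sh_flev Sh_bdry)
  moreover have "cclass (dghom D (Sh t X) (Sh t Y)) r = cclass (dghom D X Y) r"
    using XY by (auto simp: cclass_def fun_eq_iff shf_coboundaries Sh_gpart)
  ultimately show ?thesis
    using XY by (simp add: H0_def H0_module_def shf_coboundaries Sh_gpart)
qed

definition shift_functor :: "('o, 'm set) pshift" where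
  "shift_functor = \<lparr> shobj = Sh, shmor = (\<lambda>t r X Y U. U),
     sheta = (\<lambda>r s X. cclass (dghom D (Sh r X) (Sh s X)) (s - r) (dgid D X)) \<rparr>"

definition eta :: "real \<Rightarrow> real \<Rightarrow> 'o \<Rightarrow> ('o, int, 'm) arr" where
  "eta r s X = shf r s (aid X)"

lemma eta_dom [simp]: "src (eta r s X) = Sh r X" "tgt (eta r s X) = Sh s X" "deg (eta r s X) = 0"
  "X \<in> Ob \<Longrightarrow> arrow (eta r s X)"
  by (simp_all add: eta_def)

lemma eta_cocycle [simp]: "X \<in> Ob \<Longrightarrow> cocycle (s - r) (eta r s X)"
  using shf_cocycle[OF cocycle_id, of X s r] by (simp add: eta_def)

lemma shift_simps [simp]: "shobj shift_functor = Sh" "shmor shift_functor t r X Y U = U"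
  "sheta shift_functor r s X = cls (s - r) (eta r s X)"
  by (simp_all add: shift_functor_def cls_def eta_def shf_def aid_def)

text \<open>Both sides are \<open>f\<close>, regarded as a morphism from \<open>\<Sigma>\<^sup>r X\<close> to \<open>\<Sigma>\<^sup>s Y\<close>.\<close>

lemma eta_natural: "arrow f \<Longrightarrow> eta r s (tgt f) \<cdot> shf r r f = shf s s f \<cdot> eta r s (src f)"
  by (simp add: eta_def shf_comp)

lemma shifted_persistence: "shifted_persistence_category K (H0 D) shift_functor"
proof (intro shifted_persistence_category.intro shifted_persistence_category_axioms.intro persistence_category_H0)
  fix t
  have comp: "pcomp (H0 D) (Sh t X) (Sh t Y) (Sh t Z) s r g f = pcomp (H0 D) X Y Z s r g f"
    if O: "X \<in> Ob" "Y \<in> Ob" "Z \<in> Ob" and f: "f \<in> carrier (Mor r X Y)" and g: "g \<in> carrier (Mor s Y Z)"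
    for X Y Z r s f g
  proof -
    obtain a where a: "cocycle r a" "src a = X" "tgt a = Y" "f = cls r a" using f O(1,2) by (rule MorE)
    obtain b where b: "cocycle s b" "src b = Y" "tgt b = Z" "g = cls s b" using g O(2,3) by (rule MorE)
    have "pcomp (H0 D) (Sh t X) (Sh t Y) (Sh t Z) s r (cls s (shf t t b)) (cls r (shf t t a))
      = cls (s + r) (shf t t (b \<cdot> a))"
      using a b by (subst pcomp_cls) (simp_all add: shf_comp)
    then show ?thesis using a b by (simp add: cls_shf pcomp_cls)
  qed
  have str: "pstr (H0 D) r s (Sh t X) (Sh t Y) f = pstr (H0 D) r s X Y f"
    if O: "X \<in> Ob" "Y \<in> Ob" and f: "f \<in> carrier (Mor r X Y)" and rs: "r \<le> s" for X Y r s f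
  proof -
    obtain a where a: "cocycle r a" "src a = X" "tgt a = Y" "f = cls r a" using f O by (rule MorE)
    have "pstr (H0 D) r s (Sh t X) (Sh t Y) (cls r (shf t t a)) = cls s (shf t t a)"
      using a rs by (intro pstr_cls) simp_all
    then show ?thesis using a rs by (simp add: cls_shf pstr_cls)
  qed
  show "persistence_endofunctor K (H0 D) (shobj shift_functor t) (shmor shift_functor t)"
    unfolding persistence_endofunctor_def
    using cls_shf[of "aid X" 0 t for X]
    by (auto simp: Sh_closed Mor_Sh linear_map_def comp str simp flip: shf_id)
next
  fix X :: 'o and Y f r s t u assume X: "X \<in> pobj (H0 D)"
  then have XO: "X \<in> Ob" by simp
  show "shobj shift_functor 0 X = X" using XO by (simp add: Sh_zero)
  show "shobj shift_functor t (shobj shift_functor u X) = shobj shift_functor (t + u) X"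
    using XO by (simp add: Sh_add)
  show "sheta shift_functor r s X \<in> carrier (Mor (s - r) (shobj shift_functor r X) (shobj shift_functor s X))"
    using XO by simp
  show "sheta shift_functor r r X = pid (H0 D) (shobj shift_functor r X)"
    using XO by (simp add: eta_def shf_id)
  show "pcomp (H0 D) (shobj shift_functor r X) (shobj shift_functor s X) (shobj shift_functor t X) (t - s) (s - r)
      (sheta shift_functor s t X) (sheta shift_functor r s X) = sheta shift_functor r t X"
  proof -
    have "eta s t X \<cdot> eta r s X = eta r t X" using XO by (simp add: eta_def shf_comp)
    then show ?thesis using XO by (simp add: pcomp_cls)
  qed
  { fix r s s'
    have "eta (r + s) (r + s') X = shf r r (eta s s' X)" using XO by (simp add: eta_def shf_shf)
    then show "shmor shift_functor r (s' - s) (shobj shift_functor s X) (shobj shift_functor s' X)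
      (sheta shift_functor s s' X) = sheta shift_functor (r + s) (r + s') X"
      using XO by (simp add: cls_shf)
    have "eta s s' (Sh r X) = eta (r + s) (r + s') X"
      unfolding eta_def shf_id[OF XO, symmetric] using XO by (simp add: shf_shf add.commute)
    then show "sheta shift_functor s s' (shobj shift_functor r X) = sheta shift_functor (r + s) (r + s') X"
      by simp }
  { fix Y f assume "Y \<in> pobj (H0 D)" "f \<in> carrier (Mor t X Y)"
    then have Y: "Y \<in> Ob" "f \<in> carrier (Mor t X Y)" by simp_all
    obtain a where a: "cocycle t a" "src a = X" "tgt a = Y" "f = cls t a" using Y(2) XO Y(1) by (rule MorE)
    have "pcomp (H0 D) (Sh r X) (Sh r Y) (Sh s Y) (s - r) t (cls (s - r) (eta r s Y)) (cls t (shf r r a))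
      = cls (s - r + t) (eta r s Y \<cdot> shf r r a)"
      using a Y by (intro pcomp_cls) simp_all
    moreover have "pcomp (H0 D) (Sh r X) (Sh s X) (Sh s Y) t (s - r) (cls t (shf s s a)) (cls (s - r) (eta r s X))
      = cls (t + (s - r)) (shf s s a \<cdot> eta r s X)"
      using a XO by (intro pcomp_cls) simp_all
    ultimately show "pcomp (H0 D) (shobj shift_functor r X) (shobj shift_functor r Y) (shobj shift_functor s Y) (s - r) t
        (sheta shift_functor r s Y) (shmor shift_functor r t X Y f)
      = pcomp (H0 D) (shobj shift_functor r X) (shobj shift_functor s X) (shobj shift_functor s Y) t (s - r)
        (shmor shift_functor s t X Y f) (sheta shift_functor r s X)"
      using a eta_natural[of a r s] by (simp add: cls_shf add.commute) }
qed (auto)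

lemma zero_level_H0: "zero_level (H0 D) = H.degree_zero"
  by (simp add: zero_level_def H.degree_zero_def fun_eq_iff)

definition HSh :: "real \<Rightarrow> ('o, real, 'm set) arr \<Rightarrow> ('o, real, 'm set) arr" where
  "HSh t a = Arr (Sh t (src a)) (Sh t (tgt a)) (deg a) (elt a)"

lemma HSh_hcl: "cocycle r f \<Longrightarrow> HSh t (hcl r f) = hcl r (shf t t f)"
  by (simp add: HSh_def hcl_def cls_shf)

lemma HSh_amor: "H.amor X Y a \<Longrightarrow> H.amor (Sh t X) (Sh t Y) (HSh t a)"
  by (auto elim!: H_amorE simp: HSh_hcl intro!: H_amor_hcl)

lemma HSh_comp: "\<lbrakk>H.amor X Y a; H.amor Y Z b\<rbrakk> \<Longrightarrow> HSh t (b \<circ>\<^sub>H a) = HSh t b \<circ>\<^sub>H HSh t a"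
  by (auto elim!: H_amorE simp: HSh_hcl cocycle_comp0 shf_comp)

lemma HSh_id: "X \<in> Ob \<Longrightarrow> HSh t (H.aid X) = H.aid (Sh t X)"
  by (simp add: HSh_hcl cocycle_id shf_id flip: hcl_id)

lemma HSh_add: "\<lbrakk>H.amor X Y a; H.amor X Y b\<rbrakk> \<Longrightarrow> HSh t (a +\<^sub>H b) = HSh t a +\<^sub>H HSh t b"
  by (auto elim!: H_amorE simp: HSh_hcl cocycle_add hcl_add shf_add)

lemma HSh_zero: "\<lbrakk>X \<in> Ob; Y \<in> Ob\<rbrakk> \<Longrightarrow> HSh t (H.azero X Y 0) = H.azero (Sh t X) (Sh t Y) 0"
  by (simp add: HSh_hcl cocycle_zero shf_zero Sh_closed flip: hcl_zero)

lemma HSh_aiso: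
  assumes "H.aiso X Y a" shows "H.aiso (Sh t X) (Sh t Y) (HSh t a)"
proof -
  obtain b where b: "H.amor X Y a" "H.amor Y X b" "b \<circ>\<^sub>H a = H.aid X" "a \<circ>\<^sub>H b = H.aid Y"
    using assms by (rule H.aisoE)
  show ?thesis
    by (rule H.aisoI[OF HSh_amor[OF b(1)] HSh_amor[OF b(2)]])
      (use b H.amorD[OF b(1)] in \<open>simp_all add: HSh_comp[OF b(1,2), symmetric] HSh_comp[OF b(2,1), symmetric] HSh_id\<close>)
qed

lemma shf_sigma: "X \<in> Ob \<Longrightarrow> shf t t (\<sigma> X) = \<sigma> (Sh t X)" "X \<in> Ob \<Longrightarrow> shf t t (\<tau> X) = \<tau> (Sh t X)"
  by (simp_all add: \<sigma>_def \<tau>_def shf_def Sh_T Sh_sg)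

lemma shf_susp: "arrow f \<Longrightarrow> susp (shf t t f) = shf t t (susp f)"
  by (simp add: susp_def shf_comp flip: shf_sigma)

text \<open>Source and target are shifted equally, so the levels are unchanged.\<close>

lemma cone_shf:
  assumes c: "cone u i p j s"
  shows "cone (shf t t u) (shf t t i) (shf t t p) (shf t t j) (shf t t s)"
proof -
  note C = cone_typed[OF c] cone_eqs[OF c]
  have "i \<cdot> s \<^bold>+ j \<cdot> p = aid (tgt i)" using c by (simp add: cone_def)
  then show ?thesis unfolding cone_def
    by (simp add: C shf_comp shf_add shf_id shf_zero shf_abd shf_level0)
qed

lemma HSh_cone_triangle:
  assumes "cone_triangle U I P" shows "cone_triangle (HSh t U) (HSh t I) (HSh t P)"
proof -
  obtain u i p j s where c: "cone u i p j s" "U = hcl 0 u" "I = hcl 0 i" "P = hcl 0 (\<sigma> (src u) \<cdot> p)"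
    using assms unfolding cone_triangle_def by blast
  note C = cone_typed[OF c(1)]
  have "HSh t P = hcl 0 (\<sigma> (src (shf t t u)) \<cdot> shf t t p)"
    using cone_projection[OF c(1)] C by (simp add: c(4) HSh_hcl shf_comp flip: shf_sigma)
  then show ?thesis
    unfolding cone_triangle_def using cone_shf[OF c(1)] cone_inclusion[OF c(1)] C(1)
    by (intro exI conjI) (auto simp: c(2,3) HSh_hcl)
qed

lemma HSh_exact:
  assumes "H.exact X Y Z u v w"
  shows "H.exact (Sh t X) (Sh t Y) (Sh t Z) (HSh t u) (HSh t v) (HSh t w)"
proof -
  obtain i p C c where m: "H.amor X Y u" "H.amor Y Z v" "H.amor Z (T X) w" and S: "cone_triangle u i p"
    and ip: "H.amor Y C i" "H.amor C (T X) p" "tgt i = C" and c: "H.aiso Z C c" "c \<circ>\<^sub>H v = i" "p \<circ>\<^sub>H c = w"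
    using assms by (rule H.exactE)
  have X: "X \<in> Ob" using H.amorD[OF m(1)] by simp
  show ?thesis
  proof (rule H.exactI[OF HSh_amor[OF m(1)] HSh_amor[OF m(2)] _ HSh_cone_triangle[OF S]])
    show "H.amor (Sh t Z) (T (Sh t X)) (HSh t w)" using HSh_amor[OF m(3)] X by (simp add: Sh_T)
    show "H.aiso (Sh t Z) (tgt (HSh t i)) (HSh t c)" using HSh_aiso[OF c(1)] ip by (simp add: HSh_def)
    show "HSh t c \<circ>\<^sub>H HSh t v = HSh t i" using HSh_comp[OF m(2) H.aiso_mor[OF c(1)]] c(2) by simp
    show "HSh t p \<circ>\<^sub>H HSh t c = HSh t w" using HSh_comp[OF H.aiso_mor[OF c(1)] ip(2)] c(3) by simp
  qed
qed

lemma biproduct_H0D: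
  assumes "biproduct (zero_level (H0 D)) X Y P jX jY pX pY"
  shows "X \<in> Ob" "Y \<in> Ob" "P \<in> Ob" "jX \<in> carrier (Mor 0 X P)" "jY \<in> carrier (Mor 0 Y P)"
    "pX \<in> carrier (Mor 0 P X)" "pY \<in> carrier (Mor 0 P Y)"
  using assms by (auto simp: biproduct_def zero_level_def)

lemma HSh_Arr: "HSh t (Arr X Y r f) = Arr (Sh t X) (Sh t Y) r f"
  by (simp add: HSh_def)

lemma shift_biproduct_H0:
  assumes B: "biproduct (zero_level (H0 D)) X Y P jX jY pX pY"
  shows "biproduct (zero_level (H0 D)) (Sh t X) (Sh t Y) (Sh t P) jX jY pX pY"
proof -
  let ?jX = "Arr X P 0 jX" and ?jY = "Arr Y P 0 jY" and ?pX = "Arr P X 0 pX" and ?pY = "Arr P Y 0 pY"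
  note O = biproduct_H0D(1-3)[OF B]
  have m: "H.amor X P ?jX" "H.amor Y P ?jY" "H.amor P X ?pX" "H.amor P Y ?pY"
    and e: "?pX \<circ>\<^sub>H ?jX = H.aid X" "?pY \<circ>\<^sub>H ?jY = H.aid Y" "?pY \<circ>\<^sub>H ?jX = H.azero X Y 0" "?pX \<circ>\<^sub>H ?jY = H.azero Y X 0"
      "?jX \<circ>\<^sub>H ?pX +\<^sub>H ?jY \<circ>\<^sub>H ?pY = H.aid P"
    using B unfolding zero_level_H0 H.biproduct_degree_zero by auto
  have "HSh t ?pX \<circ>\<^sub>H HSh t ?jX = H.aid (Sh t X)" "HSh t ?pY \<circ>\<^sub>H HSh t ?jY = H.aid (Sh t Y)"
    "HSh t ?pY \<circ>\<^sub>H HSh t ?jX = H.azero (Sh t X) (Sh t Y) 0" "HSh t ?pX \<circ>\<^sub>H HSh t ?jY = H.azero (Sh t Y) (Sh t X) 0"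
    using e O by (simp_all add: HSh_comp[OF m(1,3), symmetric] HSh_comp[OF m(2,4), symmetric]
      HSh_comp[OF m(1,4), symmetric] HSh_comp[OF m(2,3), symmetric] HSh_id HSh_zero)
  moreover have "HSh t ?jX \<circ>\<^sub>H HSh t ?pX +\<^sub>H HSh t ?jY \<circ>\<^sub>H HSh t ?pY = H.aid (Sh t P)"
    using e(5) O
    by (simp add: HSh_comp[OF m(3,1), symmetric] HSh_comp[OF m(4,2), symmetric] HSh_id
        HSh_add[OF H.amor_comp[OF m(3,1)] H.amor_comp[OF m(4,2)], symmetric])
  ultimately show ?thesis
    unfolding zero_level_H0 H.biproduct_degree_zero
    using HSh_amor[OF m(1), of t] HSh_amor[OF m(2), of t] HSh_amor[OF m(3), of t] HSh_amor[OF m(4), of t]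
    unfolding HSh_Arr by blast
qed

text \<open>This is naturality of \<open>\<eta>\<close>, after decomposing the identity of the biproduct.\<close>

lemma sheta_biproduct:
  assumes B: "biproduct (zero_level (H0 D)) X Y P jX jY pX pY"
  shows "cls (s - r) (eta r s P) =
      pcomp (H0 D) (Sh r P) (Sh s X) (Sh s P) 0 (s - r) jX
        (pcomp (H0 D) (Sh r P) (Sh r X) (Sh s X) (s - r) 0 (cls (s - r) (eta r s X)) pX)
      \<oplus>\<^bsub>Mor (s - r) (Sh r P) (Sh s P)\<^esub>
      pcomp (H0 D) (Sh r P) (Sh s Y) (Sh s P) 0 (s - r) jY
        (pcomp (H0 D) (Sh r P) (Sh r Y) (Sh s Y) (s - r) 0 (cls (s - r) (eta r s Y)) pY)"
proof -
  note O = biproduct_H0D(1-3)[OF B]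
  obtain a where a: "cocycle 0 a" "src a = X" "tgt a = P" "jX = cls 0 a" using biproduct_H0D(4)[OF B] O(1,3) by (rule MorE)
  obtain b where b: "cocycle 0 b" "src b = Y" "tgt b = P" "jY = cls 0 b" using biproduct_H0D(5)[OF B] O(2,3) by (rule MorE)
  obtain c where c: "cocycle 0 c" "src c = P" "tgt c = X" "pX = cls 0 c" using biproduct_H0D(6)[OF B] O(3,1) by (rule MorE)
  obtain d where d: "cocycle 0 d" "src d = P" "tgt d = Y" "pY = cls 0 d" using biproduct_H0D(7)[OF B] O(3,2) by (rule MorE)
  note t = cocycleD[OF a(1)] a(2,3) cocycleD[OF b(1)] b(2,3) cocycleD[OF c(1)] c(2,3) cocycleD[OF d(1)] d(2,3)
  have summand: "pcomp (H0 D) (Sh r P) (Sh s Z) (Sh s P) 0 (s - r) (cls 0 f)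
        (pcomp (H0 D) (Sh r P) (Sh r Z) (Sh s Z) (s - r) 0 (cls (s - r) (eta r s Z)) (cls 0 g))
      = cls (s - r) (shf s s (f \<cdot> g) \<cdot> eta r s P)"
    if f: "cocycle 0 f" "src f = Z" "tgt f = P" and g: "cocycle 0 g" "src g = P" "tgt g = Z" and Z: "Z \<in> Ob" for Z f g
  proof -
    have ee: "eta r s Z \<cdot> shf r r g = shf s s g \<cdot> eta r s P" using eta_natural[of g r s] g by simp
    have "cocycle (s - r + 0) (eta r s Z \<cdot> shf r r g)"
      using f g Z by (intro cocycle_comp) simp_all
    then have "pcomp (H0 D) (Sh r P) (Sh s Z) (Sh s P) 0 (s - r) (cls 0 (shf s s f))
        (pcomp (H0 D) (Sh r P) (Sh r Z) (Sh s Z) (s - r) 0 (cls (s - r) (eta r s Z)) (cls 0 (shf r r g)))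
      = cls (0 + (s - r)) (shf s s f \<cdot> (eta r s Z \<cdot> shf r r g))"
      using f g Z by (simp add: pcomp_cls)
    moreover have "shf s s f \<cdot> shf s s g \<cdot> eta r s P = shf s s (f \<cdot> g) \<cdot> eta r s P"
      using f g O by (intro precomp shf_comp) simp_all
    ultimately show ?thesis using f g by (simp add: cls_shf ee)
  qed
  let ?e = "eta r s P" and ?id = "a \<cdot> c \<^bold>+ b \<cdot> d"
  have id: "cocycle 0 ?id" using a b c d by (simp add: cocycle_add cocycle_comp0)
  have "cls 0 ?id = cls 0 (aid P)"
  proof -
    have "pcomp (H0 D) P X P 0 0 jX pX \<oplus>\<^bsub>Mor 0 P P\<^esub> pcomp (H0 D) P Y P 0 0 jY pY = pid (H0 D) P"
      using B by (simp add: biproduct_def zero_level_def)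
    then show ?thesis
      using a b c d by (simp add: pcomp_cls Mor_add cocycle_comp0)
  qed
  then have "cls 0 (shf s s ?id) = cls 0 (aid (Sh s P))"
    using id t O cls_shf[of ?id 0 s] cls_shf[of "aid P" 0 s] by (simp add: shf_id)
  moreover have "pcomp (H0 D) (Sh r P) (Sh s P) (Sh s P) 0 (s - r) (cls 0 (aid (Sh s P))) (cls (s - r) ?e)
      = cls (0 + (s - r)) (aid (Sh s P) \<cdot> ?e)"
    using O by (intro pcomp_cls) (simp_all add: cocycle_id Sh_closed)
  ultimately have "cls (s - r) ?e
      = pcomp (H0 D) (Sh r P) (Sh s P) (Sh s P) 0 (s - r) (cls 0 (shf s s ?id)) (cls (s - r) ?e)"
    using O by simp
  also have "\<dots> = cls (0 + (s - r)) (shf s s ?id \<cdot> ?e)"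
    using id O t by (intro pcomp_cls) simp_all
  also have "shf s s ?id \<cdot> ?e = shf s s (a \<cdot> c) \<cdot> ?e \<^bold>+ shf s s (b \<cdot> d) \<cdot> ?e"
    using t O by (simp flip: shf_add)
  also have "cls (0 + (s - r)) \<dots> = cls (s - r) (shf s s (a \<cdot> c) \<cdot> ?e) \<oplus>\<^bsub>Mor (s - r) (Sh r P) (Sh s P)\<^esub>
      cls (s - r) (shf s s (b \<cdot> d) \<cdot> ?e)"
  proof -
    have "cocycle (0 + (s - r)) (shf s s (a \<cdot> c) \<cdot> ?e)" "cocycle (0 + (s - r)) (shf s s (b \<cdot> d) \<cdot> ?e)"
      using a b c d O by (intro cocycle_comp; simp add: cocycle_comp0)+
    then show ?thesis using t O by (simp add: Mor_add)
  qed
  finally show ?thesis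
    unfolding a(4) b(4) c(4) d(4)
    using summand[OF a(1-3) c(1-3) O(1)] summand[OF b(1-3) d(1-3) O(2)] by simp
qed

text \<open>The two morphisms \<open>\<Sigma>\<^sup>r X \<rightarrow> X\<close> and \<open>X \<rightarrow> \<Sigma>\<^sup>r X\<close> given by the identity are inverse to each other and
  have the levels \<open>-r\<close> and \<open>r\<close>. So the cone is contracted at level \<open>r\<close>.\<close>

lemma eta_triangle_H0:
  assumes X: "X \<in> Ob" and r: "r \<ge> 0"
  shows "\<exists>Z v w. H.exact_triangle (Sh r X) X Z (eta_obj (H0 D) shift_functor r X) v w \<and> acyclic_object (H0 D) r Z"
proof -
  let ?u = "eta r 0 X" and ?w = "eta 0 r X"
  have X0: "Sh 0 X = X" using X by (simp add: Sh_zero)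
  have cu: "cocycle (- r) ?u" using eta_cocycle[OF X, of 0 r] by simp
  then have cu0: "cocycle 0 ?u" using r by (auto intro: cocycle_mono)
  have cw: "cocycle r ?w" using eta_cocycle[OF X, of r 0] by simp
  obtain i p j s where c: "cone ?u i p j s" using cone_exists[OF cu0] by blast
  note C = cone_typed[OF c]
  have uw: "?u \<cdot> ?w = aid X" "?w \<cdot> ?u = aid (Sh r X)"
    using X by (simp_all add: eta_def shf_comp shf_id X0)
  have "hcl r (aid (tgt i)) = H.azero (tgt i) (tgt i) r"
    by (rule cone_contractible[OF c cw]) (use uw X0 X r in \<open>simp_all\<close>)
  from arg_cong[OF this, of elt] have acyc: "acyclic_object (H0 D) r (tgt i)"
    using C r by (simp add: acyclic_object_def pstr_cls cocycle_id H.azero_def)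
  have "eta_obj (H0 D) shift_functor r X = cls 0 ?u"
    using pstr_cls[OF cu, of "Sh r X" X 0] r X0 by (simp add: eta_obj_def)
  moreover have "H.exact (Sh r X) X (tgt i) (hcl 0 ?u) (hcl 0 i) (hcl 0 (\<sigma> (src ?u) \<cdot> p))"
  proof -
    have "cone_triangle (hcl 0 ?u) (hcl 0 i) (hcl 0 (\<sigma> (src ?u) \<cdot> p))"
      unfolding cone_triangle_def using c by blast
    moreover have "H.amor (Sh r X) X (hcl 0 ?u)" using cu0 X0 by (simp add: H_amor_hcl)
    ultimately show ?thesis using H.Std_exact by fastforce
  qed
  moreover have "hcl 0 ?u = Arr (Sh r X) X 0 (cls 0 ?u)" "hcl 0 i = Arr X (tgt i) 0 (cls 0 i)"
    "hcl 0 (\<sigma> (src ?u) \<cdot> p) = Arr (tgt i) (T (Sh r X)) 0 (cls 0 (\<sigma> (src ?u) \<cdot> p))"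
    using C X0 by (simp_all add: hcl_def)
  ultimately show ?thesis
    using acyc by (intro exI[of _ "tgt i"] exI[of _ "cls 0 i"] exI[of _ "cls 0 (\<sigma> (src ?u) \<cdot> p)"])
      (simp add: H.exact_triangle_def)
qed

theorem tpc_H0: "tpc_structure K (H0 D) shift_functor T H.translation H.exact_triangle"
proof -
  interpret PC: persistence_category K "H0 D" by (rule persistence_category_H0)
  show ?thesis
  proof (intro tpc_structure.intro tpc_structure_axioms.intro shifted_persistence)
    show "triangulated_category (zero_level (H0 D)) T H.translation H.exact_triangle"
      unfolding zero_level_H0 by (rule H.triangulated)
  next
    fix X Y P jX jY pX pY Z and r :: real
    assume B: "biproduct (zero_level (H0 D)) X Y P jX jY pX pY" and "Z \<in> pobj (H0 D)"
    then have Z: "Z \<in> Ob" by simp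
    note B' = B[unfolded zero_level_H0]
    show "bij_betw (\<lambda>h. (pcomp (H0 D) X P Z r 0 h jX, pcomp (H0 D) Y P Z r 0 h jY))
         (carrier (Mor r P Z)) (carrier (Mor r X Z) \<times> carrier (Mor r Y Z))"
      by (rule H.biproduct_hom_left[OF B' Z])
    show "bij_betw (\<lambda>h. (pcomp (H0 D) Z P X 0 r pX h, pcomp (H0 D) Z P Y 0 r pY h))
         (carrier (Mor r Z P)) (carrier (Mor r Z X) \<times> carrier (Mor r Z Y))"
      by (rule H.biproduct_hom_right[OF B' Z])
    fix s h assume rs: "r \<le> s"
    note O = biproduct_H0D[OF B] Z
    show "pcomp (H0 D) X P Z s 0 (pstr (H0 D) r s P Z h) jX = pstr (H0 D) r s X Z (pcomp (H0 D) X P Z r 0 h jX) \<and>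
       pcomp (H0 D) Y P Z s 0 (pstr (H0 D) r s P Z h) jY = pstr (H0 D) r s Y Z (pcomp (H0 D) Y P Z r 0 h jY)"
      if "h \<in> carrier (Mor r P Z)"
      using PC.pcomp_pstr[of X P Z 0 0 r s jX h] PC.pcomp_pstr[of Y P Z 0 0 r s jY h] O rs that
      by (simp add: PC.pstr_refl)
    show "pcomp (H0 D) Z P X 0 s pX (pstr (H0 D) r s Z P h) = pstr (H0 D) r s Z X (pcomp (H0 D) Z P X 0 r pX h) \<and>
       pcomp (H0 D) Z P Y 0 s pY (pstr (H0 D) r s Z P h) = pstr (H0 D) r s Z Y (pcomp (H0 D) Z P Y 0 r pY h)"
      if "h \<in> carrier (Mor r Z P)"
      using PC.pcomp_pstr[of Z P X r s 0 0 h pX] PC.pcomp_pstr[of Z P Y r s 0 0 h pY] O rs that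
      by (simp add: PC.pstr_refl)
  next
    show "shobj shift_functor t (T X) = T (shobj shift_functor t X)" if "X \<in> pobj (H0 D)" for X t
      using that by (simp add: Sh_T)
  next
    fix X Y f t assume "X \<in> pobj (H0 D)" "Y \<in> pobj (H0 D)" and f: "f \<in> carrier (Mor 0 X Y)"
    then have XY: "X \<in> Ob" "Y \<in> Ob" by simp_all
    obtain a where a: "cocycle 0 a" "src a = X" "tgt a = Y" "f = cls 0 a" using f XY by (rule MorE)
    have "Tmap (Sh t X) (Sh t Y) (cls 0 (shf t t a)) = cls 0 (susp a)"
      using a susp_cocycle[OF a(1)] by (subst Tmap_cls) (simp_all add: shf_susp cls_shf)
    then show "shmor shift_functor t 0 (T X) (T Y) (H.translation X Y f)
      = H.translation (shobj shift_functor t X) (shobj shift_functor t Y) (shmor shift_functor t 0 X Y f)"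
      using a by (simp add: H.translation_def THom_def Tmap_cls cls_shf)
  next
    fix X Y Z u v w t assume E: "H.exact_triangle X Y Z u v w"
    then have "X \<in> Ob" by (auto simp: H.exact_triangle_def H.exact_def H.amor_Arr)
    then show "H.exact_triangle (shobj shift_functor t X) (shobj shift_functor t Y) (shobj shift_functor t Z)
       (shmor shift_functor t 0 X Y u) (shmor shift_functor t 0 Y Z v) (shmor shift_functor t 0 Z (T X) w)"
      using HSh_exact[OF E[unfolded H.exact_triangle_def], of t] by (simp add: H.exact_triangle_def HSh_Arr Sh_T)
  next
    fix X Y P jX jY pX pY t r s assume B: "biproduct (zero_level (H0 D)) X Y P jX jY pX pY"
    show "biproduct (zero_level (H0 D)) (shobj shift_functor t X) (shobj shift_functor t Y) (shobj shift_functor t P)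
        (shmor shift_functor t 0 X P jX) (shmor shift_functor t 0 Y P jY)
        (shmor shift_functor t 0 P X pX) (shmor shift_functor t 0 P Y pY)"
      using shift_biproduct_H0[OF B] by simp
    show "sheta shift_functor r s P =
        pcomp (H0 D) (shobj shift_functor r P) (shobj shift_functor s X) (shobj shift_functor s P) 0 (s - r)
          (shmor shift_functor s 0 X P jX)
          (pcomp (H0 D) (shobj shift_functor r P) (shobj shift_functor r X) (shobj shift_functor s X) (s - r) 0
            (sheta shift_functor r s X) (shmor shift_functor r 0 P X pX))
        \<oplus>\<^bsub>Mor (s - r) (shobj shift_functor r P) (shobj shift_functor s P)\<^esub>
        pcomp (H0 D) (shobj shift_functor r P) (shobj shift_functor s Y) (shobj shift_functor s P) 0 (s - r)
          (shmor shift_functor s 0 Y P jY)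
          (pcomp (H0 D) (shobj shift_functor r P) (shobj shift_functor r Y) (shobj shift_functor s Y) (s - r) 0
            (sheta shift_functor r s Y) (shmor shift_functor r 0 P Y pY))"
      using sheta_biproduct[OF B, of s r] by simp
  next
    show "\<exists>Z v w. H.exact_triangle (shobj shift_functor r X) X Z (eta_obj (H0 D) shift_functor r X) v w \<and>
        acyclic_object (H0 D) r Z" if "X \<in> pobj (H0 D)" "0 \<le> r" for X r
      using that eta_triangle_H0 by simp
  qed
qed

end

section \<open>The shift completion\<close>

lemma level_dg_of_filtered:
  assumes "filtered_dg_category K (A :: ('o, 'a, 'm) fdg_category)"
  shows "level_dg_category K A"
proof -
  interpret filtered_dg_category K A by (rule assms)
  note fc = dghom_complex
  have mod: "module K (gpart (dghom A X Y) i)" if "X \<in> dgobj A" "Y \<in> dgobj A" for X Y i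
    using filtered_complex.gpart_module[OF fc[OF that]] .
  have grp: "abelian_group (gpart (dghom A X Y) i)" if "X \<in> dgobj A" "Y \<in> dgobj A" for X Y i
    using mod[OF that] by (rule module.axioms(2))
  note right = dgcomp_linear_right[unfolded linear_map_def, THEN conjunct1, THEN funcset_mem]
    dgcomp_linear_right[unfolded linear_map_def, THEN conjunct2, THEN conjunct1, rule_format]
    dgcomp_linear_right[unfolded linear_map_def, THEN conjunct2, THEN conjunct2, rule_format]
  note left = dgcomp_linear_left[unfolded linear_map_def, THEN conjunct2, THEN conjunct1, rule_format]
    dgcomp_linear_left[unfolded linear_map_def, THEN conjunct2, THEN conjunct2, rule_format]
  show ?thesis
  proof (intro level_dg_category.intro level_dg.intro level_dg_axioms.intro graded_category.intro field_axioms)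
    show "flev (dghom A X Y) i \<zero>\<^bsub>gpart (dghom A X Y) i\<^esub> = -\<infinity>"
      if "X \<in> dgobj A" "Y \<in> dgobj A" for X Y i
      using filtered_complex.flev_eq_minf[OF fc[OF that]] abelian_monoid.zero_closed[OF abelian_group.axioms(1)[OF grp[OF that]]]
      by simp
    show "flev (dghom A X X) 0 (dgid A X) \<le> 0" if "X \<in> dgobj A" for X
      using flev_dgid[OF that] by simp
    show "bdry (dghom A X Y) (i + 1) (bdry (dghom A X Y) i f) = \<zero>\<^bsub>gpart (dghom A X Y) (i + 1 + 1)\<^esub>"
      "flev (dghom A X Y) (i + 1) (bdry (dghom A X Y) i f) \<le> flev (dghom A X Y) i f"
      if "X \<in> dgobj A" "Y \<in> dgobj A" "f \<in> carrier (gpart (dghom A X Y) i)" for X Y f i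
      using that filtered_complex.bdry_bdry[OF fc] filtered_complex.flev_bdry[OF fc] by blast+
    show "linear_map K (gpart (dghom A X Y) i) (gpart (dghom A X Y) (i + 1)) (bdry (dghom A X Y) i)"
      if "X \<in> dgobj A" "Y \<in> dgobj A" for X Y i
      by (rule filtered_complex.bdry_linear[OF fc[OF that]])
    show "flev (dghom A X Y) i (a \<odot>\<^bsub>gpart (dghom A X Y) i\<^esub> f \<oplus>\<^bsub>gpart (dghom A X Y) i\<^esub> g)
        \<le> max (flev (dghom A X Y) i f) (flev (dghom A X Y) i g)"
      if "X \<in> dgobj A" "Y \<in> dgobj A" "a \<in> carrier K - {\<zero>\<^bsub>K\<^esub>}" "f \<in> carrier (gpart (dghom A X Y) i)"
        "g \<in> carrier (gpart (dghom A X Y) i)" for X Y a f g i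
      using that filtered_complex.flev_lincomb[OF fc] by blast
  qed (fact mod grp dgid_closed right left dgcomp_assoc dgcomp_id_left dgcomp_id_right bdry_dgid leibniz flev_dgcomp
    | (rule right left; assumption))+
qed

context level_dg_category begin

lemma shift_completion_simps:
  "dgobj (shift_completion D) = {S. base S \<in> Ob}"
  "gpart (dghom (shift_completion D) S T) i = gpart (dghom D (base S) (base T)) (i - (dshift T - dshift S))"
  "bdry (dghom (shift_completion D) S T) i f =
    alt_sign (gpart (dghom D (base S) (base T)) (i - (dshift T - dshift S) + 1)) (dshift T)
      (bdry (dghom D (base S) (base T)) (i - (dshift T - dshift S)) f)"
  "flev (dghom (shift_completion D) S T) i f =
    flev (dghom D (base S) (base T)) (i - (dshift T - dshift S)) f + ereal (rshift T - rshift S)"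
  "dgcomp (shift_completion D) S T U j i g f =
    dgcomp D (base S) (base T) (base U) (j - (dshift U - dshift T)) (i - (dshift T - dshift S)) g f"
  "dgid (shift_completion D) S = dgid D (base S)"
  by (simp_all add: shift_completion_def Let_def)

text \<open>The morphism of the given category underlying a morphism of the shift completion.\<close>

definition unshift :: "'o shifted \<Rightarrow> 'o shifted \<Rightarrow> int \<Rightarrow> 'm \<Rightarrow> ('o, int, 'm) arr" where
  "unshift S T i f = Arr (base S) (base T) (i - (dshift T - dshift S)) f"

lemma unshift_dom [simp]:
  "src (unshift S T i f) = base S" "tgt (unshift S T i f) = base T"
  "deg (unshift S T i f) = i - (dshift T - dshift S)" "elt (unshift S T i f) = f"
  by (simp_all add: unshift_def)

lemma arrow_unshift:
  "arrow (unshift S T i f) \<longleftrightarrow> base S \<in> Ob \<and> base T \<in> Ob \<and> f \<in> carrier (gpart (dghom (shift_completion D) S T) i)"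
  by (auto simp: unshift_def arrow_Arr shift_completion_simps)

lemma elt_unshift_bdry:
  "bdry (dghom (shift_completion D) S T) i f = elt (asign (dshift T) (\<delta> (unshift S T i f)))"
  by (simp add: shift_completion_simps abd_def asign_def alt_sign_def aneg_def unshift_def)

lemma unshift_comp:
  "unshift S U (j + i) (dgcomp (shift_completion D) S T U j i g f) = unshift T U j g \<cdot> unshift S T i f"
  by (simp add: unshift_def acomp_def shift_completion_simps)

lemma unshift_bdry:
  "unshift S T (i + 1) (bdry (dghom (shift_completion D) S T) i f) = asign (dshift T) (\<delta> (unshift S T i f))"
  by (rule arr.expand) (simp add: elt_unshift_bdry)

lemma unshift_add:
  "unshift S T i (f \<oplus>\<^bsub>gpart (dghom (shift_completion D) S T) i\<^esub> g) = unshift S T i f \<^bold>+ unshift S T i g"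
  by (simp add: unshift_def aadd_def shift_completion_simps)

lemma unshift_neg:
  "unshift S T i (\<ominus>\<^bsub>gpart (dghom (shift_completion D) S T) i\<^esub> f) = \<^bold>- unshift S T i f"
  by (simp add: unshift_def aneg_def shift_completion_simps)

lemma unshift_smult:
  "unshift S T i (a \<odot>\<^bsub>gpart (dghom (shift_completion D) S T) i\<^esub> f) = a \<^bold>* unshift S T i f"
  by (simp add: unshift_def asmult_def shift_completion_simps)

lemma unshift_zero:
  "unshift S T i \<zero>\<^bsub>gpart (dghom (shift_completion D) S T) i\<^esub> = azero (base S) (base T) (i - (dshift T - dshift S))"
  by (simp add: unshift_def azero_def shift_completion_simps)

lemma unshift_id: "unshift S S 0 (dgid (shift_completion D) S) = aid (base S)"
  by (simp add: unshift_def aid_def shift_completion_simps)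

lemma unshift_level:
  "flev (dghom (shift_completion D) S T) i f = level (unshift S T i f) + ereal (rshift T - rshift S)"
  by (simp add: unshift_def level_def shift_completion_simps)

lemma unshift_inj: "unshift S T i f = unshift S T i g \<longleftrightarrow> f = g"
  by (simp add: unshift_def)

text \<open>Composition is unchanged and \<open>\<delta>\<close> is multiplied by \<open>(-1)\<^sup>d\<close> for a target of shift \<open>d\<close>. In the
  Leibniz rule for \<open>S \<rightarrow> T \<rightarrow> U\<close> the two signs of \<open>\<delta> f\<close> and \<open>\<delta> (g f)\<close> differ by \<open>(-1)\<close> to the power
  \<open>dshift U - dshift T\<close>, which is also the change of the degree of \<open>g\<close>.\<close>

theorem level_dg_category_shift_completion: "level_dg_category K (shift_completion D)"
proof -
  let ?B = "shift_completion D"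
  let ?h = "\<lambda>S T i. gpart (dghom ?B S T) i"
  have Ob: "S \<in> dgobj ?B \<longleftrightarrow> base S \<in> Ob" for S by (simp add: shift_completion_simps)
  have mod: "module K (?h S T i)" if "S \<in> dgobj ?B" "T \<in> dgobj ?B" for S T i
    using that by (simp add: shift_completion_simps hm_module)
  have grp: "abelian_group (?h S T i)" if "S \<in> dgobj ?B" "T \<in> dgobj ?B" for S T i
    using that by (simp add: shift_completion_simps hm_group)
  have ar: "arrow (unshift S T i f)" if "S \<in> dgobj ?B" "T \<in> dgobj ?B" "f \<in> carrier (?h S T i)" for S T i f
    using that by (simp add: arrow_unshift Ob)
  have car: "f \<in> carrier (?h S T i)" if "arrow (unshift S T i f)" for S T i f
    using that by (simp add: arrow_unshift)
  show ?thesis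
  proof (intro level_dg_category.intro level_dg.intro level_dg_axioms.intro graded_category.intro field_axioms mod grp)
    show "dgid ?B S \<in> carrier (?h S S 0)" if "S \<in> dgobj ?B" for S
      using that by (intro car) (simp add: unshift_id Ob)
  next
    fix S T U f i g j assume O: "S \<in> dgobj ?B" "T \<in> dgobj ?B" "U \<in> dgobj ?B"
      and f: "f \<in> carrier (?h S T i)" and g: "g \<in> carrier (?h T U j)"
    note a = ar[OF O(1,2) f] ar[OF O(2,3) g]
    show "dgcomp ?B S T U j i g f \<in> carrier (?h S U (j + i))"
      using a by (intro car) (simp add: unshift_comp)
    show "bdry (dghom ?B S U) (j + i) (dgcomp ?B S T U j i g f)
       = dgcomp ?B S T U (j + 1) i (bdry (dghom ?B T U) j g) f
         \<oplus>\<^bsub>?h S U (j + i + 1)\<^esub> alt_sign (?h S U (j + i + 1)) j (dgcomp ?B S T U j (i + 1) g (bdry (dghom ?B S T) i f))"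
    proof -
      (* shifting T changes the degree of g and the sign of the differential of f together *)
      have "asign (dshift U) (\<delta> (unshift T U j g \<cdot> unshift S T i f))
        = asign (dshift U) (\<delta> (unshift T U j g)) \<cdot> unshift S T i f
          \<^bold>+ asign j (unshift T U j g \<cdot> asign (dshift T) (\<delta> (unshift S T i f)))"
        using a by (cases "even j"; cases "even (dshift U)"; cases "even (dshift T)") simp_all
      moreover have "unshift S U (j + i + 1) (alt_sign (?h S U (j + i + 1)) j x) = asign j (unshift S U (j + i + 1) x)" for x
        by (simp add: alt_sign_def asign_def unshift_neg)
      moreover have "unshift S U (j + i + 1) (dgcomp ?B S T U (j + 1) i x f) = unshift T U (j + 1) x \<cdot> unshift S T i f" for x
        using unshift_comp[of S U "j + 1" i T x f] by (simp add: ac_simps)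
      moreover have "unshift S U (j + i + 1) (dgcomp ?B S T U j (i + 1) g x) = unshift T U j g \<cdot> unshift S T (i + 1) x" for x
        using unshift_comp[of S U j "i + 1" T g x] by (simp add: ac_simps)
      ultimately have "unshift S U (j + i + 1) (bdry (dghom ?B S U) (j + i) (dgcomp ?B S T U j i g f))
       = unshift S U (j + i + 1) (dgcomp ?B S T U (j + 1) i (bdry (dghom ?B T U) j g) f
         \<oplus>\<^bsub>?h S U (j + i + 1)\<^esub> alt_sign (?h S U (j + i + 1)) j (dgcomp ?B S T U j (i + 1) g (bdry (dghom ?B S T) i f)))"
        by (simp only: unshift_add unshift_bdry unshift_comp)
      then show ?thesis by (simp only: unshift_inj)
    qed
    have "flev (dghom ?B S U) (j + i) (dgcomp ?B S T U j i g f)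
      = level (unshift T U j g \<cdot> unshift S T i f) + ereal (rshift U - rshift S)"
      by (simp only: unshift_level unshift_comp)
    also have "\<dots> \<le> (level (unshift T U j g) + level (unshift S T i f)) + ereal (rshift U - rshift S)"
      using level_comp_add[OF a] by (intro add_right_mono) simp
    also have "ereal (rshift U - rshift S) = ereal (rshift U - rshift T) + ereal (rshift T - rshift S)" by simp
    also have "(level (unshift T U j g) + level (unshift S T i f)) + \<dots>
      = flev (dghom ?B T U) j g + flev (dghom ?B S T) i f"
      by (simp only: unshift_level add.assoc add.left_commute add.commute)
    finally show "flev (dghom ?B S U) (j + i) (dgcomp ?B S T U j i g f)
      \<le> flev (dghom ?B T U) j g + flev (dghom ?B S T) i f" .
    { fix f' assume "f' \<in> carrier (?h S T i)"
      note a' = a ar[OF O(1,2) this]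
      show "dgcomp ?B S T U j i g (f \<oplus>\<^bsub>?h S T i\<^esub> f')
        = dgcomp ?B S T U j i g f \<oplus>\<^bsub>?h S U (j + i)\<^esub> dgcomp ?B S T U j i g f'"
        using a' by (subst unshift_inj[of S U "j + i", symmetric]) (simp add: unshift_comp unshift_add) }
    { fix g' assume "g' \<in> carrier (?h T U j)"
      note a' = a ar[OF O(2,3) this]
      show "dgcomp ?B S T U j i (g \<oplus>\<^bsub>?h T U j\<^esub> g') f
        = dgcomp ?B S T U j i g f \<oplus>\<^bsub>?h S U (j + i)\<^esub> dgcomp ?B S T U j i g' f"
        using a' by (subst unshift_inj[of S U "j + i", symmetric]) (simp add: unshift_comp unshift_add) }
  next
    fix S T U a f i g j assume O: "S \<in> dgobj ?B" "T \<in> dgobj ?B" "U \<in> dgobj ?B" and k: "a \<in> carrier K"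
      and f: "f \<in> carrier (?h S T i)" and g: "g \<in> carrier (?h T U j)"
    note a = ar[OF O(1,2) f] ar[OF O(2,3) g]
    show "dgcomp ?B S T U j i g (a \<odot>\<^bsub>?h S T i\<^esub> f) = a \<odot>\<^bsub>?h S U (j + i)\<^esub> dgcomp ?B S T U j i g f"
      using a k by (subst unshift_inj[of S U "j + i", symmetric]) (simp add: unshift_comp unshift_smult)
    show "dgcomp ?B S T U j i (a \<odot>\<^bsub>?h T U j\<^esub> g) f = a \<odot>\<^bsub>?h S U (j + i)\<^esub> dgcomp ?B S T U j i g f"
      using a k by (subst unshift_inj[of S U "j + i", symmetric]) (simp add: unshift_comp unshift_smult)
  next
    fix R S T U f i g j h l assume O: "R \<in> dgobj ?B" "S \<in> dgobj ?B" "T \<in> dgobj ?B" "U \<in> dgobj ?B"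
      and f: "f \<in> carrier (?h R S i)" and g: "g \<in> carrier (?h S T j)" and h: "h \<in> carrier (?h T U l)"
    have "unshift R U (l + j + i) (dgcomp ?B R S U (l + j) i (dgcomp ?B S T U l j h g) f)
      = unshift R U (l + (j + i)) (dgcomp ?B R T U l (j + i) h (dgcomp ?B R S T j i g f))"
      unfolding unshift_comp using ar[OF O(1,2) f] ar[OF O(2,3) g] ar[OF O(3,4) h] by simp
    then show "dgcomp ?B R S U (l + j) i (dgcomp ?B S T U l j h g) f = dgcomp ?B R T U l (j + i) h (dgcomp ?B R S T j i g f)"
      by (simp add: unshift_def)
  next
    fix S T f i assume O: "S \<in> dgobj ?B" "T \<in> dgobj ?B" and f: "f \<in> carrier (?h S T i)"
    note a = ar[OF O f]
    show "dgcomp ?B S T T 0 i (dgid ?B T) f = f" "dgcomp ?B S S T i 0 f (dgid ?B S) = f"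
      using a unshift_comp[of S T 0 i T "dgid ?B T" f] unshift_comp[of S T i 0 S f "dgid ?B S"]
      by (simp_all add: unshift_id unshift_inj[of S T i, symmetric])
    have "unshift S T (i + 1 + 1) (bdry (dghom ?B S T) (i + 1) (bdry (dghom ?B S T) i f))
      = unshift S T (i + 1 + 1) \<zero>\<^bsub>?h S T (i + 1 + 1)\<^esub>"
      unfolding unshift_bdry unshift_zero using a O by (cases "even (dshift T)") (simp_all add: Ob algebra_simps)
    then show "bdry (dghom ?B S T) (i + 1) (bdry (dghom ?B S T) i f) = \<zero>\<^bsub>?h S T (i + 1 + 1)\<^esub>"
      by (simp only: unshift_inj)
    have "level (asign (dshift T) (\<delta> (unshift S T i f))) \<le> level (unshift S T i f)"
      using a by (intro level_sign level_abd) simp_all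
    then show "flev (dghom ?B S T) (i + 1) (bdry (dghom ?B S T) i f) \<le> flev (dghom ?B S T) i f"
      by (simp only: unshift_level unshift_bdry add_right_mono)
    fix g k assume g: "g \<in> carrier (?h S T i)" and k: "k \<in> carrier K - {\<zero>}"
    have "level (k \<^bold>* unshift S T i f \<^bold>+ unshift S T i g) \<le> max (level (unshift S T i f)) (level (unshift S T i g))"
      using a ar[OF O g] k by (intro level_lincomb) simp_all
    then have "level (k \<^bold>* unshift S T i f \<^bold>+ unshift S T i g) + ereal (rshift T - rshift S)
      \<le> max (level (unshift S T i f)) (level (unshift S T i g)) + ereal (rshift T - rshift S)"
      by (rule add_right_mono)
    also have "\<dots> = max (level (unshift S T i f) + ereal (rshift T - rshift S))
        (level (unshift S T i g) + ereal (rshift T - rshift S))"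
      by (rule max_of_mono[symmetric]) (auto intro!: monoI add_right_mono)
    finally show "flev (dghom ?B S T) i (k \<odot>\<^bsub>?h S T i\<^esub> f \<oplus>\<^bsub>?h S T i\<^esub> g)
      \<le> max (flev (dghom ?B S T) i f) (flev (dghom ?B S T) i g)"
      by (simp only: unshift_level unshift_add unshift_smult)
  next
    fix S T i assume O: "S \<in> dgobj ?B" "T \<in> dgobj ?B"
    show "flev (dghom ?B S T) i \<zero>\<^bsub>?h S T i\<^esub> = -\<infinity>"
      using O by (simp add: unshift_level unshift_zero Ob)
    have c: "bdry (dghom ?B S T) i f \<in> carrier (?h S T (i + 1))" if "f \<in> carrier (?h S T i)" for f
      using ar[OF O that] by (intro car) (simp add: unshift_bdry)
    have "bdry (dghom ?B S T) i (f \<oplus>\<^bsub>?h S T i\<^esub> g) = bdry (dghom ?B S T) i f \<oplus>\<^bsub>?h S T (i + 1)\<^esub> bdry (dghom ?B S T) i g"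
      if "f \<in> carrier (?h S T i)" "g \<in> carrier (?h S T i)" for f g
      using ar[OF O that(1)] ar[OF O that(2)]
      by (subst unshift_inj[of S T "i + 1", symmetric]) (simp add: unshift_bdry unshift_add asign_def)
    moreover have "bdry (dghom ?B S T) i (k \<odot>\<^bsub>?h S T i\<^esub> f) = k \<odot>\<^bsub>?h S T (i + 1)\<^esub> bdry (dghom ?B S T) i f"
      if "f \<in> carrier (?h S T i)" "k \<in> carrier K" for f k
      using ar[OF O that(1)] that(2)
      by (subst unshift_inj[of S T "i + 1", symmetric]) (simp add: unshift_bdry unshift_smult asign_def)
    ultimately show "linear_map K (?h S T i) (?h S T (i + 1)) (bdry (dghom ?B S T) i)"
      using c by (simp add: linear_map_def)
  next
    fix S assume S: "S \<in> dgobj ?B"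
    have "unshift S S (0 + 1) (bdry (dghom ?B S S) 0 (dgid ?B S)) = unshift S S 1 \<zero>\<^bsub>?h S S 1\<^esub>"
      unfolding unshift_bdry unshift_zero unshift_id using S by (simp add: Ob asign_def)
    then show "bdry (dghom ?B S S) 0 (dgid ?B S) = \<zero>\<^bsub>?h S S 1\<^esub>" by (simp add: unshift_inj)
    show "flev (dghom ?B S S) 0 (dgid ?B S) \<le> 0"
      using S level_id[of "base S"] by (simp add: unshift_level unshift_id Ob zero_ereal_def[symmetric])
  qed
qed

end

section \<open>Matrices\<close>

lemma linear_map_zero:
  assumes "module K M" "module K N" "linear_map K M N h"
  shows "h \<zero>\<^bsub>M\<^esub> = \<zero>\<^bsub>N\<^esub>"
proof -
  interpret M: module K M by fact
  interpret N: module K N by fact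
  have h: "\<And>x. x \<in> carrier M \<Longrightarrow> h x \<in> carrier N"
    "\<And>a x. a \<in> carrier K \<Longrightarrow> x \<in> carrier M \<Longrightarrow> h (a \<odot>\<^bsub>M\<^esub> x) = a \<odot>\<^bsub>N\<^esub> h x"
    using assms(3) by (auto simp: linear_map_def)
  show ?thesis using h(2)[of "\<zero>\<^bsub>K\<^esub>" "\<zero>\<^bsub>M\<^esub>"] h(1)[of "\<zero>\<^bsub>M\<^esub>"] by simp
qed

lemma linear_map_finsum:
  assumes "module K M" "module K N" "linear_map K M N h" "finite I" "x \<in> I \<rightarrow> carrier M"
  shows "h (\<Oplus>\<^bsub>M\<^esub>k\<in>I. x k) = (\<Oplus>\<^bsub>N\<^esub>k\<in>I. h (x k))"
proof -
  interpret M: module K M by fact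
  interpret N: module K N by fact
  have h: "\<And>x. x \<in> carrier M \<Longrightarrow> h x \<in> carrier N"
    "\<And>x y. x \<in> carrier M \<Longrightarrow> y \<in> carrier M \<Longrightarrow> h (x \<oplus>\<^bsub>M\<^esub> y) = h x \<oplus>\<^bsub>N\<^esub> h y"
    using assms(3) by (auto simp: linear_map_def)
  show ?thesis
    using assms(4,5)
  proof (induction I rule: finite_induct)
    case empty
    then show ?case using linear_map_zero[OF assms(1-3)] by simp
  next
    case (insert k I)
    have x: "x k \<in> carrier M" "x \<in> I \<rightarrow> carrier M" "(\<lambda>k. h (x k)) \<in> I \<rightarrow> carrier N" "h (x k) \<in> carrier N"
      using insert.prems h(1) by auto
    then show ?case using insert by (simp add: h M.finsum_closed)
  qed
qed

lemma (in abelian_monoid) finsum_swap: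
  assumes "finite I" "finite J" "\<And>k l. k \<in> I \<Longrightarrow> l \<in> J \<Longrightarrow> x k l \<in> carrier G"
  shows "(\<Oplus>k\<in>I. \<Oplus>l\<in>J. x k l) = (\<Oplus>l\<in>J. \<Oplus>k\<in>I. x k l)"
  using assms(1,3)
proof (induction I rule: finite_induct)
  case empty
  then show ?case by (simp add: finsum_zero)
next
  case (insert k I)
  have "(\<Oplus>l\<in>J. \<Oplus>k\<in>insert k I. x k l) = (\<Oplus>l\<in>J. x k l \<oplus> (\<Oplus>k\<in>I. x k l))"
    using insert by (intro finsum_cong') (auto intro!: finsum_closed)
  also have "\<dots> = (\<Oplus>l\<in>J. x k l) \<oplus> (\<Oplus>l\<in>J. \<Oplus>k\<in>I. x k l)"
    using insert by (intro finsum_addf) (auto intro!: finsum_closed)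
  finally show ?case
    using insert by (subst finsum_insert) (auto intro!: finsum_closed)
qed

locale matrix_category = level_dg_category K "shift_completion A"
  for K :: "('a, 'e) ring_scheme" (structure) and A :: "('o, 'a, 'm) fdg_category"
begin

definition mat_obj :: "('o, 'm) twisted set" where
  "mat_obj = {X. set (summands X) \<subseteq> Ob}"

abbreviation E :: "('o, 'm) twisted \<Rightarrow> ('o, 'm) twisted \<Rightarrow> nat \<times> nat \<Rightarrow> int \<Rightarrow> ('a, 'm) module" where
  "E X Y p l \<equiv> gpart (entry_complex A X Y p) l"

definition mat_lev :: "('o, 'm) twisted \<Rightarrow> ('o, 'm) twisted \<Rightarrow> int \<Rightarrow> (nat \<times> nat \<Rightarrow> 'm) \<Rightarrow> ereal" where
  "mat_lev X Y l f = (SUP p \<in> mat_indices X Y. flev (entry_complex A X Y p) l (f p))"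

definition mat_id :: "('o, 'm) twisted \<Rightarrow> nat \<times> nat \<Rightarrow> 'm" where
  "mat_id X = dgid (Tw A) X"

lemma smd_Ob: "\<lbrakk>X \<in> mat_obj; j < nsum X\<rbrakk> \<Longrightarrow> smd X j \<in> Ob"
  using nth_mem by (auto simp: mat_obj_def)

lemma E_module: "\<lbrakk>X \<in> mat_obj; Y \<in> mat_obj; p \<in> mat_indices X Y\<rbrakk> \<Longrightarrow> module K (E X Y p l)"
  by (intro hm_module) (auto intro: smd_Ob)

lemma E_group: "\<lbrakk>X \<in> mat_obj; Y \<in> mat_obj; p \<in> mat_indices X Y\<rbrakk> \<Longrightarrow> abelian_group (E X Y p l)"
  by (intro hm_group) (auto intro: smd_Ob)

lemma E_monoid: "\<lbrakk>X \<in> mat_obj; Y \<in> mat_obj; p \<in> mat_indices X Y\<rbrakk> \<Longrightarrow> abelian_monoid (E X Y p l)"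
  using E_group by (blast intro: abelian_group.axioms(1))

lemma mat_module_simps:
  "carrier (mat_module A X Y l) = (\<Pi>\<^sub>E p \<in> mat_indices X Y. carrier (E X Y p l))"
  "\<zero>\<^bsub>mat_module A X Y l\<^esub> = (\<lambda>p \<in> mat_indices X Y. \<zero>\<^bsub>E X Y p l\<^esub>)"
  "f \<oplus>\<^bsub>mat_module A X Y l\<^esub> g = (\<lambda>p \<in> mat_indices X Y. f p \<oplus>\<^bsub>E X Y p l\<^esub> g p)"
  "a \<odot>\<^bsub>mat_module A X Y l\<^esub> f = (\<lambda>p \<in> mat_indices X Y. a \<odot>\<^bsub>E X Y p l\<^esub> f p)"
  by (simp_all add: mat_module_def)

lemma mat_entry: "\<lbrakk>f \<in> carrier (mat_module A X Y l); p \<in> mat_indices X Y\<rbrakk> \<Longrightarrow> f p \<in> carrier (E X Y p l)"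
  by (auto simp: mat_module_simps PiE_def Pi_def)

lemma mat_eqI:
  assumes "f \<in> carrier (mat_module A X Y l)" "g \<in> carrier (mat_module A X Y l)"
    "\<And>p. p \<in> mat_indices X Y \<Longrightarrow> f p = g p"
  shows "f = g"
  using assms unfolding mat_module_simps by (rule PiE_ext)

lemma mat_module_group:
  assumes "X \<in> mat_obj" "Y \<in> mat_obj" shows "abelian_group (mat_module A X Y l)"
proof (rule abelian_groupI)
  note m = E_monoid[OF assms] and g = E_group[OF assms]
  fix f h k assume f: "f \<in> carrier (mat_module A X Y l)" and h: "h \<in> carrier (mat_module A X Y l)"
    and k: "k \<in> carrier (mat_module A X Y l)"
  note e = mat_entry[OF f] mat_entry[OF h] mat_entry[OF k]
  show "f \<oplus>\<^bsub>mat_module A X Y l\<^esub> h \<in> carrier (mat_module A X Y l)"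
    using e abelian_monoid.a_closed[OF m] by (auto simp: mat_module_simps)
  show "f \<oplus>\<^bsub>mat_module A X Y l\<^esub> h \<oplus>\<^bsub>mat_module A X Y l\<^esub> k = f \<oplus>\<^bsub>mat_module A X Y l\<^esub> (h \<oplus>\<^bsub>mat_module A X Y l\<^esub> k)"
    using e abelian_monoid.a_assoc[OF m] by (auto simp: mat_module_simps intro!: restrict_ext)
  show "f \<oplus>\<^bsub>mat_module A X Y l\<^esub> h = h \<oplus>\<^bsub>mat_module A X Y l\<^esub> f"
    using e abelian_monoid.a_comm[OF m] by (auto simp: mat_module_simps intro!: restrict_ext)
next
  note m = E_monoid[OF assms] and g = E_group[OF assms]
  show "\<zero>\<^bsub>mat_module A X Y l\<^esub> \<in> carrier (mat_module A X Y l)"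
    using abelian_monoid.zero_closed[OF m] by (auto simp: mat_module_simps)
  fix f assume f: "f \<in> carrier (mat_module A X Y l)"
  note e = mat_entry[OF f]
  have "(\<lambda>p \<in> mat_indices X Y. \<zero>\<^bsub>E X Y p l\<^esub> \<oplus>\<^bsub>E X Y p l\<^esub> f p) = f"
    using e abelian_monoid.l_zero[OF m] f
    by (intro mat_eqI[OF _ f]) (auto simp: mat_module_simps)
  then show "\<zero>\<^bsub>mat_module A X Y l\<^esub> \<oplus>\<^bsub>mat_module A X Y l\<^esub> f = f"
    by (simp add: mat_module_simps cong: restrict_cong)
  show "\<exists>h\<in>carrier (mat_module A X Y l). h \<oplus>\<^bsub>mat_module A X Y l\<^esub> f = \<zero>\<^bsub>mat_module A X Y l\<^esub>"
    by (rule bexI[of _ "\<lambda>p \<in> mat_indices X Y. \<ominus>\<^bsub>E X Y p l\<^esub> f p"])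
      (use e abelian_group.l_neg[OF g] abelian_group.a_inv_closed[OF g] in
        \<open>auto simp: mat_module_simps intro!: restrict_ext\<close>)
qed

lemma mat_module_module:
  assumes "X \<in> mat_obj" "Y \<in> mat_obj" shows "module K (mat_module A X Y l)"
proof (rule moduleI[OF is_cring mat_module_group[OF assms]])
  note m = E_module[OF assms]
  fix a b f h assume f: "f \<in> carrier (mat_module A X Y l)" and ab: "a \<in> carrier K"
  note e = mat_entry[OF f]
  show "a \<odot>\<^bsub>mat_module A X Y l\<^esub> f \<in> carrier (mat_module A X Y l)"
    using e ab module.smult_closed[OF m] by (auto simp: mat_module_simps)
  { assume b: "b \<in> carrier K"
    show "(a \<oplus> b) \<odot>\<^bsub>mat_module A X Y l\<^esub> f = a \<odot>\<^bsub>mat_module A X Y l\<^esub> f \<oplus>\<^bsub>mat_module A X Y l\<^esub> b \<odot>\<^bsub>mat_module A X Y l\<^esub> f"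
      using e ab b module.smult_l_distr[OF m] by (auto simp: mat_module_simps intro!: restrict_ext)
    show "(a \<otimes> b) \<odot>\<^bsub>mat_module A X Y l\<^esub> f = a \<odot>\<^bsub>mat_module A X Y l\<^esub> (b \<odot>\<^bsub>mat_module A X Y l\<^esub> f)"
      using e ab b module.smult_assoc1[OF m] by (auto simp: mat_module_simps intro!: restrict_ext) }
  { assume h: "h \<in> carrier (mat_module A X Y l)"
    show "a \<odot>\<^bsub>mat_module A X Y l\<^esub> (f \<oplus>\<^bsub>mat_module A X Y l\<^esub> h)
      = a \<odot>\<^bsub>mat_module A X Y l\<^esub> f \<oplus>\<^bsub>mat_module A X Y l\<^esub> a \<odot>\<^bsub>mat_module A X Y l\<^esub> h"
      using e mat_entry[OF h] ab module.smult_r_distr[OF m] by (auto simp: mat_module_simps intro!: restrict_ext) }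
next
  fix f assume f: "f \<in> carrier (mat_module A X Y l)"
  have "(\<lambda>p \<in> mat_indices X Y. \<one> \<odot>\<^bsub>E X Y p l\<^esub> f p) = f"
    using mat_entry[OF f] module.smult_one[OF E_module[OF assms]]
    by (intro mat_eqI[OF _ f]) (auto simp: mat_module_simps)
  then show "\<one> \<odot>\<^bsub>mat_module A X Y l\<^esub> f = f" by (simp add: mat_module_simps cong: restrict_cong)
qed

lemma mat_neg:
  assumes XY: "X \<in> mat_obj" "Y \<in> mat_obj" and f: "f \<in> carrier (mat_module A X Y l)"
  shows "\<ominus>\<^bsub>mat_module A X Y l\<^esub> f = (\<lambda>p \<in> mat_indices X Y. \<ominus>\<^bsub>E X Y p l\<^esub> f p)"
proof -
  interpret M: abelian_group "mat_module A X Y l" using mat_module_group[OF XY] .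
  note e = mat_entry[OF f] and g = E_group[OF XY]
  show ?thesis
  proof (rule M.minus_equality)
    show "(\<lambda>p \<in> mat_indices X Y. \<ominus>\<^bsub>E X Y p l\<^esub> f p) \<oplus>\<^bsub>mat_module A X Y l\<^esub> f = \<zero>\<^bsub>mat_module A X Y l\<^esub>"
      using e abelian_group.l_neg[OF g] by (auto simp: mat_module_simps intro!: restrict_ext)
  qed (use f e abelian_group.a_inv_closed[OF g] in \<open>auto simp: mat_module_simps\<close>)
qed

lemma mat_comp_summand:
  assumes "X \<in> mat_obj" "Y \<in> mat_obj" "Z \<in> mat_obj" "f \<in> carrier (mat_module A X Y l)"
    "g \<in> carrier (mat_module A Y Z m)" "i < nsum Z" "j < nsum X" "k < nsum Y"
  shows "scomp A (smd X j) (smd Y k) (smd Z i) m l (g (i, k)) (f (k, j)) \<in> carrier (E X Z (i, j) (m + l))"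
  using assms mat_entry[OF assms(4), of "(k, j)"] mat_entry[OF assms(5), of "(i, k)"]
    cmp_closed[of "smd X j" "smd Y k" "smd Z i"] by (simp add: smd_Ob)

lemma mat_comp_closed:
  assumes "X \<in> mat_obj" "Y \<in> mat_obj" "Z \<in> mat_obj" "f \<in> carrier (mat_module A X Y l)"
    "g \<in> carrier (mat_module A Y Z m)"
  shows "mat_comp A X Y Z m l g f \<in> carrier (mat_module A X Z (m + l))"
  unfolding mat_module_simps mat_comp_def
  using mat_comp_summand[OF assms] E_monoid[OF assms(1,3)]
  by (auto intro!: abelian_monoid.finsum_closed)

lemma mat_comp_entry:
  "\<lbrakk>i < nsum Z; j < nsum X\<rbrakk> \<Longrightarrow> mat_comp A X Y Z m l g f (i, j) =
    (\<Oplus>\<^bsub>E X Z (i, j) (m + l)\<^esub> k \<in> {..<nsum Y}. scomp A (smd X j) (smd Y k) (smd Z i) m l (g (i, k)) (f (k, j)))"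
  by (simp add: mat_comp_def)

lemma mat_comp_eqI:
  assumes "X \<in> mat_obj" "Y \<in> mat_obj" "Z \<in> mat_obj" "f \<in> carrier (mat_module A X Y l)"
    "g \<in> carrier (mat_module A Y Z m)" "h \<in> carrier (mat_module A X Z (m + l))"
    "\<And>i j. \<lbrakk>i < nsum Z; j < nsum X\<rbrakk> \<Longrightarrow>
      (\<Oplus>\<^bsub>E X Z (i, j) (m + l)\<^esub> k \<in> {..<nsum Y}. scomp A (smd X j) (smd Y k) (smd Z i) m l (g (i, k)) (f (k, j))) = h (i, j)"
  shows "mat_comp A X Y Z m l g f = h"
  using assms by (intro mat_eqI[OF mat_comp_closed[OF assms(1-5)] assms(6)]) (auto simp: mat_comp_entry)

lemma cmp_linear_left:
  assumes "X \<in> Ob" "Y \<in> Ob" "Z \<in> Ob" "f \<in> carrier (gpart (shom A X Y) i)"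
  shows "linear_map K (gpart (shom A Y Z) j) (gpart (shom A X Z) (j + i)) (\<lambda>g. scomp A X Y Z j i g f)"
  using assms by (auto simp: linear_map_def cmp_closed cmp_add_left cmp_smult_left)

lemma cmp_linear_right:
  assumes "X \<in> Ob" "Y \<in> Ob" "Z \<in> Ob" "g \<in> carrier (gpart (shom A Y Z) j)"
  shows "linear_map K (gpart (shom A X Y) i) (gpart (shom A X Z) (j + i)) (\<lambda>f. scomp A X Y Z j i g f)"
  using assms by (auto simp: linear_map_def cmp_closed cmp_add_right cmp_smult_right)

lemma smult_linear: "\<lbrakk>module K M; a \<in> carrier K\<rbrakk> \<Longrightarrow> linear_map K M M (\<lambda>x. a \<odot>\<^bsub>M\<^esub> x)"
  by (auto simp: linear_map_def module.smult_closed module.smult_r_distr m_comm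
      simp flip: module.smult_assoc1)

lemma neg_linear: "module K M \<Longrightarrow> linear_map K M M (\<lambda>x. \<ominus>\<^bsub>M\<^esub> x)"
proof -
  assume "module K M"
  then interpret M: module K M .
  show ?thesis by (auto simp: linear_map_def M.minus_add M.smult_r_minus)
qed

text \<open>Composition is linear, so both sides are double sums; they differ in the order of summation.\<close>

lemma mat_comp_assoc:
  assumes W: "W \<in> mat_obj" and X: "X \<in> mat_obj" and Y: "Y \<in> mat_obj" and Z: "Z \<in> mat_obj"
    and f: "f \<in> carrier (mat_module A W X i)" and g: "g \<in> carrier (mat_module A X Y j)"
    and h: "h \<in> carrier (mat_module A Y Z l)"
  shows "mat_comp A W X Z (l + j) i (mat_comp A X Y Z l j h g) f = mat_comp A W Y Z l (j + i) h (mat_comp A W X Y j i g f)"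
proof (rule mat_comp_eqI[OF W X Z f mat_comp_closed[OF X Y Z g h]])
  note gf = mat_comp_closed[OF W X Y f g]
  show "mat_comp A W Y Z l (j + i) h (mat_comp A W X Y j i g f) \<in> carrier (mat_module A W Z (l + j + i))"
    using mat_comp_closed[OF W Y Z gf h] by (simp add: add.assoc)
  fix a d assume ad: "a < nsum Z" "d < nsum W"
  let ?w = "smd W d" and ?z = "smd Z a"
  have O: "?w \<in> Ob" "?z \<in> Ob" "\<And>b. b < nsum Y \<Longrightarrow> smd Y b \<in> Ob" "\<And>c. c < nsum X \<Longrightarrow> smd X c \<in> Ob"
    using ad W X Y Z by (auto intro: smd_Ob)
  have ef: "f (c, d) \<in> carrier (gpart (shom A ?w (smd X c)) i)" if "c < nsum X" for c
    using mat_entry[OF f, of "(c, d)"] that ad by simp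
  have eg: "g (b, c) \<in> carrier (gpart (shom A (smd X c) (smd Y b)) j)" if "c < nsum X" "b < nsum Y" for b c
    using mat_entry[OF g, of "(b, c)"] that by simp
  have eh: "h (a, b) \<in> carrier (gpart (shom A (smd Y b) ?z) l)" if "b < nsum Y" for b
    using mat_entry[OF h, of "(a, b)"] that ad by simp
  let ?M = "gpart (shom A ?w ?z) (l + j + i)"
  interpret M: abelian_group ?M using O by (intro hm_group)
  let ?t = "\<lambda>b c. scomp A ?w (smd X c) ?z (l + j) i (scomp A (smd X c) (smd Y b) ?z l j (h (a, b)) (g (b, c))) (f (c, d))"
  have t: "?t b c \<in> carrier ?M" if "b < nsum Y" "c < nsum X" for b c
    using that O ef eg eh by (auto intro!: cmp_closed)
  have "(\<Oplus>\<^bsub>?M\<^esub>c\<in>{..<nsum X}. scomp A ?w (smd X c) ?z (l + j) i (mat_comp A X Y Z l j h g (a, c)) (f (c, d)))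
    = (\<Oplus>\<^bsub>?M\<^esub>c\<in>{..<nsum X}. \<Oplus>\<^bsub>?M\<^esub>b\<in>{..<nsum Y}. ?t b c)"
  proof (rule M.finsum_cong'[OF refl])
    fix c assume "c \<in> {..<nsum X}"
    then have c: "c < nsum X" by simp
    show "scomp A ?w (smd X c) ?z (l + j) i (mat_comp A X Y Z l j h g (a, c)) (f (c, d)) = (\<Oplus>\<^bsub>?M\<^esub>b\<in>{..<nsum Y}. ?t b c)"
      using linear_map_finsum[OF _ _ cmp_linear_left[OF O(1) O(4)[OF c] O(2) ef[OF c]], of "l + j" "{..<nsum Y}"
          "\<lambda>b. scomp A (smd X c) (smd Y b) ?z l j (h (a, b)) (g (b, c))"] c ad O eg eh
      by (simp add: mat_comp_entry hm_module cmp_closed)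
  qed (use t in \<open>auto intro!: M.finsum_closed\<close>)
  also have "\<dots> = (\<Oplus>\<^bsub>?M\<^esub>b\<in>{..<nsum Y}. \<Oplus>\<^bsub>?M\<^esub>c\<in>{..<nsum X}. ?t b c)"
    using t by (intro M.finsum_swap) auto
  also have "\<dots> = (\<Oplus>\<^bsub>?M\<^esub>b\<in>{..<nsum Y}. scomp A ?w (smd Y b) ?z l (j + i) (h (a, b)) (mat_comp A W X Y j i g f (b, d)))"
  proof (rule M.finsum_cong'[OF refl])
    fix b assume "b \<in> {..<nsum Y}"
    then have b: "b < nsum Y" by simp
    have "scomp A ?w (smd Y b) ?z l (j + i) (h (a, b)) (mat_comp A W X Y j i g f (b, d))
      = (\<Oplus>\<^bsub>?M\<^esub>c\<in>{..<nsum X}. scomp A ?w (smd Y b) ?z l (j + i) (h (a, b)) (scomp A ?w (smd X c) (smd Y b) j i (g (b, c)) (f (c, d))))"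
      using linear_map_finsum[OF _ _ cmp_linear_right[OF O(1) O(3)[OF b] O(2) eh[OF b]], of "j + i" "{..<nsum X}"
          "\<lambda>c. scomp A ?w (smd X c) (smd Y b) j i (g (b, c)) (f (c, d))"] b ad O ef eg
      by (simp add: mat_comp_entry hm_module cmp_closed add.assoc)
    also have "\<dots> = (\<Oplus>\<^bsub>?M\<^esub>c\<in>{..<nsum X}. ?t b c)"
      by (rule M.finsum_cong'[OF refl]) (use b O ef eg eh t in \<open>auto simp: cmp_assoc\<close>)
    finally show "(\<Oplus>\<^bsub>?M\<^esub>c\<in>{..<nsum X}. ?t b c) = scomp A ?w (smd Y b) ?z l (j + i) (h (a, b)) (mat_comp A W X Y j i g f (b, d))" ..
  next
    show "(\<lambda>b. scomp A ?w (smd Y b) ?z l (j + i) (h (a, b)) (mat_comp A W X Y j i g f (b, d))) \<in> {..<nsum Y} \<rightarrow> carrier ?M"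
      using mat_comp_summand[OF W Y Z gf h ad(1,2)] by (auto simp: add.assoc)
  qed
  finally show "(\<Oplus>\<^bsub>E W Z (a, d) (l + j + i)\<^esub>c\<in>{..<nsum X}.
      scomp A ?w (smd X c) ?z (l + j) i (mat_comp A X Y Z l j h g (a, c)) (f (c, d)))
    = mat_comp A W Y Z l (j + i) h (mat_comp A W X Y j i g f) (a, d)"
    using ad by (simp add: mat_comp_entry add.assoc)
qed

text \<open>An identity between the summands of matrix entries that is linear passes to the matrix
  product. This covers linearity of the product in both arguments.\<close>

lemma mat_comp_add_summands:
  assumes X: "X \<in> mat_obj" and Y: "Y \<in> mat_obj" and Z: "Z \<in> mat_obj"
    and f: "f \<in> carrier (mat_module A X Y l)" and g: "g \<in> carrier (mat_module A Y Z m)"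
    and f': "f' \<in> carrier (mat_module A X Y l)" and g': "g' \<in> carrier (mat_module A Y Z m)"
    and f'': "f'' \<in> carrier (mat_module A X Y l)" and g'': "g'' \<in> carrier (mat_module A Y Z m)"
    and e: "\<And>i j k. \<lbrakk>i < nsum Z; j < nsum X; k < nsum Y\<rbrakk> \<Longrightarrow>
      scomp A (smd X j) (smd Y k) (smd Z i) m l (g'' (i, k)) (f'' (k, j))
      = scomp A (smd X j) (smd Y k) (smd Z i) m l (g (i, k)) (f (k, j))
        \<oplus>\<^bsub>E X Z (i, j) (m + l)\<^esub> scomp A (smd X j) (smd Y k) (smd Z i) m l (g' (i, k)) (f' (k, j))"
  shows "mat_comp A X Y Z m l g'' f'' = mat_comp A X Y Z m l g f \<oplus>\<^bsub>mat_module A X Z (m + l)\<^esub> mat_comp A X Y Z m l g' f'"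
proof (rule mat_comp_eqI[OF X Y Z f'' g''])
  interpret N: abelian_group "mat_module A X Z (m + l)" using mat_module_group[OF X Z] .
  show "mat_comp A X Y Z m l g f \<oplus>\<^bsub>mat_module A X Z (m + l)\<^esub> mat_comp A X Y Z m l g' f' \<in> carrier (mat_module A X Z (m + l))"
    using mat_comp_closed[OF X Y Z f g] mat_comp_closed[OF X Y Z f' g'] by simp
  fix i j assume ij: "i < nsum Z" "j < nsum X"
  let ?G = "gpart (shom A (smd X j) (smd Z i)) (m + l)"
  let ?s = "\<lambda>g f k. scomp A (smd X j) (smd Y k) (smd Z i) m l (g (i, k)) (f (k, j))"
  interpret E: abelian_group ?G using X Z ij by (intro hm_group smd_Ob) auto
  have c: "?s g f k \<in> carrier ?G" "?s g' f' k \<in> carrier ?G" if "k < nsum Y" for k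
    using mat_comp_summand[OF X Y Z f g ij that] mat_comp_summand[OF X Y Z f' g' ij that] by simp_all
  have "(\<Oplus>\<^bsub>?G\<^esub>k\<in>{..<nsum Y}. ?s g'' f'' k) = (\<Oplus>\<^bsub>?G\<^esub>k\<in>{..<nsum Y}. ?s g f k \<oplus>\<^bsub>?G\<^esub> ?s g' f' k)"
    by (rule E.finsum_cong'[OF refl]) (use c e[OF ij] in auto)
  also have "\<dots> = (\<Oplus>\<^bsub>?G\<^esub>k\<in>{..<nsum Y}. ?s g f k) \<oplus>\<^bsub>?G\<^esub> (\<Oplus>\<^bsub>?G\<^esub>k\<in>{..<nsum Y}. ?s g' f' k)"
    by (rule E.finsum_addf) (use c in auto)
  finally show "(\<Oplus>\<^bsub>E X Z (i, j) (m + l)\<^esub>k\<in>{..<nsum Y}. scomp A (smd X j) (smd Y k) (smd Z i) m l (g'' (i, k)) (f'' (k, j)))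
    = (mat_comp A X Y Z m l g f \<oplus>\<^bsub>mat_module A X Z (m + l)\<^esub> mat_comp A X Y Z m l g' f') (i, j)"
    using ij by (simp add: mat_module_simps mat_comp_entry)
qed

lemma mat_comp_smult_summands:
  assumes X: "X \<in> mat_obj" and Y: "Y \<in> mat_obj" and Z: "Z \<in> mat_obj"
    and f: "f \<in> carrier (mat_module A X Y l)" and g: "g \<in> carrier (mat_module A Y Z m)"
    and f'': "f'' \<in> carrier (mat_module A X Y l)" and g'': "g'' \<in> carrier (mat_module A Y Z m)"
    and a: "a \<in> carrier K"
    and e: "\<And>i j k. \<lbrakk>i < nsum Z; j < nsum X; k < nsum Y\<rbrakk> \<Longrightarrow>
      scomp A (smd X j) (smd Y k) (smd Z i) m l (g'' (i, k)) (f'' (k, j))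
      = a \<odot>\<^bsub>E X Z (i, j) (m + l)\<^esub> scomp A (smd X j) (smd Y k) (smd Z i) m l (g (i, k)) (f (k, j))"
  shows "mat_comp A X Y Z m l g'' f'' = a \<odot>\<^bsub>mat_module A X Z (m + l)\<^esub> mat_comp A X Y Z m l g f"
proof (rule mat_comp_eqI[OF X Y Z f'' g''])
  interpret N: module K "mat_module A X Z (m + l)" using mat_module_module[OF X Z] .
  show "a \<odot>\<^bsub>mat_module A X Z (m + l)\<^esub> mat_comp A X Y Z m l g f \<in> carrier (mat_module A X Z (m + l))"
    using mat_comp_closed[OF X Y Z f g] a by simp
  fix i j assume ij: "i < nsum Z" "j < nsum X"
  let ?G = "gpart (shom A (smd X j) (smd Z i)) (m + l)"
  let ?s = "\<lambda>g f k. scomp A (smd X j) (smd Y k) (smd Z i) m l (g (i, k)) (f (k, j))"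
  have mod: "module K ?G" using X Z ij by (intro hm_module smd_Ob) auto
  interpret E: module K ?G by (rule mod)
  have c: "?s g f k \<in> carrier ?G" if "k < nsum Y" for k
    using mat_comp_summand[OF X Y Z f g ij that] by simp
  have "(\<Oplus>\<^bsub>?G\<^esub>k\<in>{..<nsum Y}. ?s g'' f'' k) = (\<Oplus>\<^bsub>?G\<^esub>k\<in>{..<nsum Y}. a \<odot>\<^bsub>?G\<^esub> ?s g f k)"
    by (rule E.finsum_cong'[OF refl]) (use c e[OF ij] a in auto)
  also have "\<dots> = a \<odot>\<^bsub>?G\<^esub> (\<Oplus>\<^bsub>?G\<^esub>k\<in>{..<nsum Y}. ?s g f k)"
    by (rule linear_map_finsum[OF mod mod smult_linear[OF mod a], symmetric]) (use c in auto)
  finally show "(\<Oplus>\<^bsub>E X Z (i, j) (m + l)\<^esub>k\<in>{..<nsum Y}. scomp A (smd X j) (smd Y k) (smd Z i) m l (g'' (i, k)) (f'' (k, j)))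
    = (a \<odot>\<^bsub>mat_module A X Z (m + l)\<^esub> mat_comp A X Y Z m l g f) (i, j)"
    using ij by (simp add: mat_module_simps mat_comp_entry)
qed

lemma mat_comp_linear:
  assumes X: "X \<in> mat_obj" and Y: "Y \<in> mat_obj" and Z: "Z \<in> mat_obj"
    and g: "g \<in> carrier (mat_module A Y Z m)" and f: "f \<in> carrier (mat_module A X Y l)"
  shows "f' \<in> carrier (mat_module A X Y l) \<Longrightarrow>
      mat_comp A X Y Z m l g (f \<oplus>\<^bsub>mat_module A X Y l\<^esub> f')
      = mat_comp A X Y Z m l g f \<oplus>\<^bsub>mat_module A X Z (m + l)\<^esub> mat_comp A X Y Z m l g f'"
    and "g' \<in> carrier (mat_module A Y Z m) \<Longrightarrow>
      mat_comp A X Y Z m l (g \<oplus>\<^bsub>mat_module A Y Z m\<^esub> g') f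
      = mat_comp A X Y Z m l g f \<oplus>\<^bsub>mat_module A X Z (m + l)\<^esub> mat_comp A X Y Z m l g' f"
    and "a \<in> carrier K \<Longrightarrow> mat_comp A X Y Z m l g (a \<odot>\<^bsub>mat_module A X Y l\<^esub> f)
      = a \<odot>\<^bsub>mat_module A X Z (m + l)\<^esub> mat_comp A X Y Z m l g f"
    and "a \<in> carrier K \<Longrightarrow> mat_comp A X Y Z m l (a \<odot>\<^bsub>mat_module A Y Z m\<^esub> g) f
      = a \<odot>\<^bsub>mat_module A X Z (m + l)\<^esub> mat_comp A X Y Z m l g f"
proof -
  interpret XY: module K "mat_module A X Y l" using mat_module_module[OF X Y] .
  interpret YZ: module K "mat_module A Y Z m" using mat_module_module[OF Y Z] .
  have O: "i < nsum Z \<Longrightarrow> smd Z i \<in> Ob" "j < nsum X \<Longrightarrow> smd X j \<in> Ob" "k < nsum Y \<Longrightarrow> smd Y k \<in> Ob" for i j k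
    using X Y Z by (auto intro: smd_Ob)
  have e: "(i, j) \<in> mat_indices U V \<Longrightarrow> h \<in> carrier (mat_module A U V n) \<Longrightarrow>
      h (i, j) \<in> carrier (gpart (shom A (smd U j) (smd V i)) n)" for U V h n i j
    using mat_entry[of h U V n "(i, j)"] by simp
  show "mat_comp A X Y Z m l g (f \<oplus>\<^bsub>mat_module A X Y l\<^esub> f')
      = mat_comp A X Y Z m l g f \<oplus>\<^bsub>mat_module A X Z (m + l)\<^esub> mat_comp A X Y Z m l g f'"
    if "f' \<in> carrier (mat_module A X Y l)"
    by (rule mat_comp_add_summands[OF X Y Z f g that g XY.a_closed[OF f that] g])
      (use f g that in \<open>auto simp: mat_module_simps(3) O e cmp_add_right\<close>)
  show "mat_comp A X Y Z m l (g \<oplus>\<^bsub>mat_module A Y Z m\<^esub> g') f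
      = mat_comp A X Y Z m l g f \<oplus>\<^bsub>mat_module A X Z (m + l)\<^esub> mat_comp A X Y Z m l g' f"
    if "g' \<in> carrier (mat_module A Y Z m)"
    by (rule mat_comp_add_summands[OF X Y Z f g f that f YZ.a_closed[OF g that]])
      (use f g that in \<open>auto simp: mat_module_simps(3) O e cmp_add_left\<close>)
  assume a: "a \<in> carrier K"
  show "mat_comp A X Y Z m l g (a \<odot>\<^bsub>mat_module A X Y l\<^esub> f)
      = a \<odot>\<^bsub>mat_module A X Z (m + l)\<^esub> mat_comp A X Y Z m l g f"
    by (rule mat_comp_smult_summands[OF X Y Z f g XY.smult_closed[OF a f] g a])
      (use f g a in \<open>auto simp: mat_module_simps(4) O e cmp_smult_right\<close>)
  show "mat_comp A X Y Z m l (a \<odot>\<^bsub>mat_module A Y Z m\<^esub> g) f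
      = a \<odot>\<^bsub>mat_module A X Z (m + l)\<^esub> mat_comp A X Y Z m l g f"
    by (rule mat_comp_smult_summands[OF X Y Z f g f YZ.smult_closed[OF a g] a])
      (use f g a in \<open>auto simp: mat_module_simps(4) O e cmp_smult_left\<close>)
qed

lemma mat_bdry_linear:
  assumes X: "X \<in> mat_obj" and Y: "Y \<in> mat_obj"
  shows "linear_map K (mat_module A X Y l) (mat_module A X Y (l + 1)) (mat_bdry A X Y l)"
proof -
  have b: "linear_map K (E X Y p l) (E X Y p (l + 1)) (bdry (entry_complex A X Y p) l)" if "p \<in> mat_indices X Y" for p
    using that X Y by (intro bd_linear) (auto intro: smd_Ob)
  show ?thesis unfolding linear_map_def
  proof (intro conjI ballI)
    show "mat_bdry A X Y l \<in> carrier (mat_module A X Y l) \<rightarrow> carrier (mat_module A X Y (l + 1))"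
      using b by (fastforce simp: linear_map_def mat_bdry_def mat_module_simps)
    fix f assume f: "f \<in> carrier (mat_module A X Y l)"
    { fix g assume g: "g \<in> carrier (mat_module A X Y l)"
      show "mat_bdry A X Y l (f \<oplus>\<^bsub>mat_module A X Y l\<^esub> g) = mat_bdry A X Y l f \<oplus>\<^bsub>mat_module A X Y (l + 1)\<^esub> mat_bdry A X Y l g"
        using b mat_entry[OF f] mat_entry[OF g]
        by (auto simp: linear_map_def mat_bdry_def mat_module_simps intro!: restrict_ext) }
    { fix a assume a: "a \<in> carrier K"
      show "mat_bdry A X Y l (a \<odot>\<^bsub>mat_module A X Y l\<^esub> f) = a \<odot>\<^bsub>mat_module A X Y (l + 1)\<^esub> mat_bdry A X Y l f"
        using b mat_entry[OF f] a
        by (auto simp: linear_map_def mat_bdry_def mat_module_simps intro!: restrict_ext) }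
  qed
qed

lemma shom_simps:
  "gpart (shom A S T) i = gpart (dghom A (base S) (base T)) (i - (dshift T - dshift S))"
  "bdry (shom A S T) i f =
    alt_sign (gpart (dghom A (base S) (base T)) (i - (dshift T - dshift S) + 1)) (dshift T)
      (bdry (dghom A (base S) (base T)) (i - (dshift T - dshift S)) f)"
  "flev (shom A S T) i f = flev (dghom A (base S) (base T)) (i - (dshift T - dshift S)) f + ereal (rshift T - rshift S)"
  "scomp A S T U j i g f =
    dgcomp A (base S) (base T) (base U) (j - (dshift U - dshift T)) (i - (dshift T - dshift S)) g f"
  "dgid (shift_completion A) S = dgid A (base S)"
  "S \<in> dgobj (shift_completion A) \<longleftrightarrow> base S \<in> dgobj A"
  by (simp_all add: shift_completion_def Let_def)

text \<open>An identity of the given category is also a morphism between different shifts of an object, in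
  the degree and of the level by which the shifts differ.\<close>

abbreviation sid :: "'o shifted \<Rightarrow> 'm" where "sid \<equiv> dgid (shift_completion A)"

lemma sid_closed:
  "\<lbrakk>S \<in> Ob; base T = base S; l = dshift T - dshift S\<rbrakk> \<Longrightarrow> sid S \<in> carrier (gpart (shom A S T) l)"
  using idn_closed[of S] by (simp add: shom_simps)

lemma sid_left:
  assumes "S \<in> Ob" "T \<in> Ob" "base U = base T" "m = dshift U - dshift T" "f \<in> carrier (gpart (shom A S T) l)"
  shows "scomp A S T U m l (sid T) f = f"
  using cmp_idn_left[OF assms(1,2,5)] assms(3,4) by (simp add: shom_simps)

lemma sid_right:
  assumes "T \<in> Ob" "U \<in> Ob" "base T = base S" "l = dshift T - dshift S" "f \<in> carrier (gpart (shom A T U) m)"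
  shows "scomp A S T U m l f (sid S) = f"
  using cmp_idn_right[OF assms(1,2,5)] assms(3,4) by (simp add: shom_simps)

lemma sid_bdry:
  assumes "S \<in> Ob" "base T = base S" "l = dshift T - dshift S"
  shows "bdry (shom A S T) l (sid S) = \<zero>\<^bsub>gpart (shom A S T) (l + 1)\<^esub>"
proof -
  have "gpart (shom A S S) 1 = gpart (dghom A (base S) (base S)) 1" by (simp add: shom_simps)
  then interpret G: abelian_group "gpart (dghom A (base S) (base S)) 1" using hm_group[of S S 1] assms by simp
  have "bdry (dghom A (base S) (base S)) 0 (dgid A (base S)) \<in> carrier (gpart (dghom A (base S) (base S)) 1)"
  proof (cases "even (dshift S)")
    case True
    then show ?thesis using bd_idn[of S] assms by (simp add: shom_simps alt_sign_def)
  next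
    case False
    (* the shift by one degree changes the parity of the sign *)
    let ?S = "Shift (rshift S) (base S) (dshift S + 1)"
    have "bdry (shom A ?S ?S) 0 (sid ?S) = \<zero>\<^bsub>gpart (shom A ?S ?S) 1\<^esub>"
      using bd_idn[of ?S] assms by (simp add: shom_simps(6))
    then show ?thesis using False by (simp add: shom_simps alt_sign_def)
  qed
  then have "bdry (dghom A (base S) (base S)) 0 (dgid A (base S)) = \<zero>\<^bsub>gpart (dghom A (base S) (base S)) 1\<^esub>"
    using bd_idn[of S] assms G.minus_minus[of "bdry (dghom A (base S) (base S)) 0 (dgid A (base S))"]
    by (auto simp: shom_simps alt_sign_def split: if_splits)
  then show ?thesis using assms by (simp add: shom_simps alt_sign_def)
qed

lemma sid_level:
  assumes "S \<in> Ob" "base T = base S" "l = dshift T - dshift S"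
  shows "flev (shom A S T) l (sid S) \<le> ereal (rshift T - rshift S)"
proof -
  have "flev (dghom A (base S) (base S)) 0 (dgid A (base S)) \<le> 0"
    using lev_idn[OF assms(1)] by (simp add: shom_simps zero_ereal_def[symmetric])
  from add_right_mono[OF this, of "ereal (rshift T - rshift S)"] show ?thesis
    using assms by (simp add: shom_simps)
qed

text \<open>\<open>band X Y l a b\<close> has identities at the entries \<open>(i, k)\<close> with \<open>i + b = k + a\<close>. The identities, the
  inclusions and projections of summands and the comparison maps of shifts are of this form.\<close>

definition band :: "('o, 'm) twisted \<Rightarrow> ('o, 'm) twisted \<Rightarrow> int \<Rightarrow> nat \<Rightarrow> nat \<Rightarrow> nat \<times> nat \<Rightarrow> 'm" where
  "band X Y l a b = (\<lambda>(i, k) \<in> mat_indices X Y.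
     if i + b = k + a then sid (smd X k) else \<zero>\<^bsub>E X Y (i, k) l\<^esub>)"

definition band_typed :: "('o, 'm) twisted \<Rightarrow> ('o, 'm) twisted \<Rightarrow> int \<Rightarrow> nat \<Rightarrow> nat \<Rightarrow> bool" where
  "band_typed X Y l a b \<longleftrightarrow> (\<forall>i<nsum Y. \<forall>k<nsum X. i + b = k + a \<longrightarrow>
     base (smd Y i) = base (smd X k) \<and> dshift (smd Y i) - dshift (smd X k) = l)"

lemma band_typedD:
  assumes "band_typed X Y l a b" "i < nsum Y" "k < nsum X" "i + b = k + a"
  shows "base (smd Y i) = base (smd X k)" "l = dshift (smd Y i) - dshift (smd X k)"
  using assms by (auto simp: band_typed_def)

lemma band_entry: "\<lbrakk>i < nsum Y; k < nsum X\<rbrakk> \<Longrightarrow>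
  band X Y l a b (i, k) = (if i + b = k + a then sid (smd X k) else \<zero>\<^bsub>gpart (shom A (smd X k) (smd Y i)) l\<^esub>)"
  by (simp add: band_def)

lemma hm_zero_closed: "\<lbrakk>S \<in> Ob; T \<in> Ob\<rbrakk> \<Longrightarrow> \<zero>\<^bsub>gpart (shom A S T) l\<^esub> \<in> carrier (gpart (shom A S T) l)"
  using abelian_monoid.zero_closed[OF abelian_group.axioms(1)[OF hm_group]] .

lemma band_closed:
  assumes "X \<in> mat_obj" "Y \<in> mat_obj" "band_typed X Y l a b"
  shows "band X Y l a b \<in> carrier (mat_module A X Y l)"
proof -
  have "band X Y l a b (i, k) \<in> carrier (gpart (shom A (smd X k) (smd Y i)) l)" if "i < nsum Y" "k < nsum X" for i k
    using that assms band_typedD[OF assms(3) that] by (simp add: band_entry smd_Ob hm_zero_closed sid_closed)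
  then show ?thesis
    by (auto simp: mat_module_simps band_def split: if_splits)
qed

lemma cmp_zero_left: "\<lbrakk>X \<in> Ob; Y \<in> Ob; Z \<in> Ob; f \<in> carrier (gpart (shom A X Y) i)\<rbrakk> \<Longrightarrow>
    scomp A X Y Z j i \<zero>\<^bsub>gpart (shom A Y Z) j\<^esub> f = \<zero>\<^bsub>gpart (shom A X Z) (j + i)\<^esub>"
  using linear_map_zero[OF _ _ cmp_linear_left] by (simp add: hm_module)

lemma cmp_zero_right: "\<lbrakk>X \<in> Ob; Y \<in> Ob; Z \<in> Ob; g \<in> carrier (gpart (shom A Y Z) j)\<rbrakk> \<Longrightarrow>
    scomp A X Y Z j i g \<zero>\<^bsub>gpart (shom A X Y) i\<^esub> = \<zero>\<^bsub>gpart (shom A X Z) (j + i)\<^esub>"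
  using linear_map_zero[OF _ _ cmp_linear_right] by (simp add: hm_module)

lemma finsum_single:
  assumes "abelian_group G" "\<And>k. k < n \<Longrightarrow> k \<noteq> k0 \<Longrightarrow> x k = \<zero>\<^bsub>G\<^esub>" "k0 < n \<Longrightarrow> x k0 \<in> carrier G"
  shows "(\<Oplus>\<^bsub>G\<^esub>k\<in>{..<n::nat}. x k) = (if k0 < n then x k0 else \<zero>\<^bsub>G\<^esub>)"
proof -
  interpret G: abelian_group G by fact
  have "(\<Oplus>\<^bsub>G\<^esub>k\<in>{..<n}. x k) = (\<Oplus>\<^bsub>G\<^esub>k\<in>{..<n}. if k0 = k then x k else \<zero>\<^bsub>G\<^esub>)"
    by (rule G.finsum_cong'[OF refl]) (use assms in auto)
  also have "\<dots> = (if k0 < n then x k0 else \<zero>\<^bsub>G\<^esub>)"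
  proof (cases "k0 < n")
    case True
    have "(\<Oplus>\<^bsub>G\<^esub>k\<in>{..<n}. if k0 = k then x k else \<zero>\<^bsub>G\<^esub>) = (\<Oplus>\<^bsub>G\<^esub>k\<in>{..<n}. if k0 = k then x k0 else \<zero>\<^bsub>G\<^esub>)"
      by (rule G.finsum_cong'[OF refl]) (use assms(3) True in auto)
    then show ?thesis using G.finsum_singleton[of k0 "{..<n}" "\<lambda>_. x k0"] assms(3) True by simp
  next
    case False
    have "(\<Oplus>\<^bsub>G\<^esub>k\<in>{..<n}. if k0 = k then x k else \<zero>\<^bsub>G\<^esub>) = (\<Oplus>\<^bsub>G\<^esub>k\<in>{..<n}. \<zero>\<^bsub>G\<^esub>)"
      by (rule G.finsum_cong'[OF refl]) (use False in auto)
    then show ?thesis using False by (simp add: G.finsum_zero)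
  qed
  finally show ?thesis .
qed

lemma band_comp_left:
  assumes X: "X \<in> mat_obj" and Y: "Y \<in> mat_obj" and Z: "Z \<in> mat_obj" and t: "band_typed Y Z m a b"
    and f: "f \<in> carrier (mat_module A X Y l)" and ij: "i < nsum Z" "j < nsum X"
  shows "mat_comp A X Y Z m l (band Y Z m a b) f (i, j)
    = (if a \<le> i + b \<and> i + b - a < nsum Y then f (i + b - a, j) else \<zero>\<^bsub>gpart (shom A (smd X j) (smd Z i)) (m + l)\<^esub>)"
proof -
  let ?G = "gpart (shom A (smd X j) (smd Z i)) (m + l)"
  let ?x = "\<lambda>k. scomp A (smd X j) (smd Y k) (smd Z i) m l (band Y Z m a b (i, k)) (f (k, j))"
  have O: "smd X j \<in> Ob" "smd Z i \<in> Ob" "\<And>k. k < nsum Y \<Longrightarrow> smd Y k \<in> Ob" using X Y Z ij by (auto intro: smd_Ob)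
  have ef: "f (k, j) \<in> carrier (gpart (shom A (smd X j) (smd Y k)) l)" if "k < nsum Y" for k
    using mat_entry[OF f, of "(k, j)"] that ij by simp
  have grp: "abelian_group ?G" using O by (simp add: hm_group)
  have x: "?x k = (if i + b = k + a then f (k, j) else \<zero>\<^bsub>?G\<^esub>)" if "k < nsum Y" for k
    using that O ef[OF that] ij band_typedD[OF t ij(1) that]
    by (auto simp: band_entry cmp_zero_left intro!: sid_left)
  have xc: "?x k \<in> carrier ?G" if "k < nsum Y" for k
    using mat_comp_summand[OF X Y Z f band_closed[OF Y Z t] ij that] by simp
  have fc: "f (k, j) \<in> carrier ?G" if "k < nsum Y" "i + b = k + a" for k
    using xc[OF that(1)] x[OF that(1)] that(2) by simp
  have "(\<Oplus>\<^bsub>?G\<^esub>k\<in>{..<nsum Y}. ?x k) = (if i + b - a < nsum Y then ?x (i + b - a) else \<zero>\<^bsub>?G\<^esub>)" if "a \<le> i + b"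
    using that by (intro finsum_single[OF grp]) (auto simp: x intro!: fc)
  moreover have "(\<Oplus>\<^bsub>?G\<^esub>k\<in>{..<nsum Y}. ?x k) = \<zero>\<^bsub>?G\<^esub>" if "\<not> a \<le> i + b"
    using finsum_single[OF grp, of "nsum Y" "nsum Y" ?x] that by (simp add: x)
  ultimately show ?thesis using ij by (cases "a \<le> i + b") (simp_all add: mat_comp_entry x)
qed

lemma band_comp_right:
  assumes X: "X \<in> mat_obj" and Y: "Y \<in> mat_obj" and Z: "Z \<in> mat_obj" and t: "band_typed X Y l a b"
    and g: "g \<in> carrier (mat_module A Y Z m)" and ij: "i < nsum Z" "j < nsum X"
  shows "mat_comp A X Y Z m l g (band X Y l a b) (i, j)
    = (if b \<le> j + a \<and> j + a - b < nsum Y then g (i, j + a - b) else \<zero>\<^bsub>gpart (shom A (smd X j) (smd Z i)) (m + l)\<^esub>)"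
proof -
  let ?G = "gpart (shom A (smd X j) (smd Z i)) (m + l)"
  let ?x = "\<lambda>k. scomp A (smd X j) (smd Y k) (smd Z i) m l (g (i, k)) (band X Y l a b (k, j))"
  have O: "smd X j \<in> Ob" "smd Z i \<in> Ob" "\<And>k. k < nsum Y \<Longrightarrow> smd Y k \<in> Ob" using X Y Z ij by (auto intro: smd_Ob)
  have eg: "g (i, k) \<in> carrier (gpart (shom A (smd Y k) (smd Z i)) m)" if "k < nsum Y" for k
    using mat_entry[OF g, of "(i, k)"] that ij by simp
  have grp: "abelian_group ?G" using O by (simp add: hm_group)
  have x: "?x k = (if k + b = j + a then g (i, k) else \<zero>\<^bsub>?G\<^esub>)" if "k < nsum Y" for k
    using that O eg[OF that] ij band_typedD[OF t that ij(2)]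
    by (auto simp: band_entry cmp_zero_right intro!: sid_right)
  have xc: "?x k \<in> carrier ?G" if "k < nsum Y" for k
    using mat_comp_summand[OF X Y Z band_closed[OF X Y t] g ij that] by simp
  have gc: "g (i, k) \<in> carrier ?G" if "k < nsum Y" "k + b = j + a" for k
    using xc[OF that(1)] x[OF that(1)] that(2) by simp
  have "(\<Oplus>\<^bsub>?G\<^esub>k\<in>{..<nsum Y}. ?x k) = (if j + a - b < nsum Y then ?x (j + a - b) else \<zero>\<^bsub>?G\<^esub>)" if "b \<le> j + a"
    using that by (intro finsum_single[OF grp]) (auto simp: x intro!: gc)
  moreover have "(\<Oplus>\<^bsub>?G\<^esub>k\<in>{..<nsum Y}. ?x k) = \<zero>\<^bsub>?G\<^esub>" if "\<not> b \<le> j + a"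
    using finsum_single[OF grp, of "nsum Y" "nsum Y" ?x] that by (simp add: x)
  ultimately show ?thesis using ij by (cases "b \<le> j + a") (simp_all add: mat_comp_entry x)
qed

lemma band_bdry:
  assumes "X \<in> mat_obj" "Y \<in> mat_obj" "band_typed X Y l a b"
  shows "mat_bdry A X Y l (band X Y l a b) = \<zero>\<^bsub>mat_module A X Y (l + 1)\<^esub>"
proof -
  have "bdry (shom A (smd X k) (smd Y i)) l (band X Y l a b (i, k)) = \<zero>\<^bsub>gpart (shom A (smd X k) (smd Y i)) (l + 1)\<^esub>"
    if "i < nsum Y" "k < nsum X" for i k
    using that assms band_typedD[OF assms(3) that] linear_map_zero[OF _ _ bd_linear, of "smd X k" "smd Y i" l]
    by (simp add: band_entry smd_Ob sid_bdry hm_module)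
  then show ?thesis by (auto simp: mat_bdry_def mat_module_simps intro!: restrict_ext)
qed

lemma band_level:
  assumes "X \<in> mat_obj" "Y \<in> mat_obj" "band_typed X Y l a b"
    and "\<And>i k. \<lbrakk>i < nsum Y; k < nsum X; i + b = k + a\<rbrakk> \<Longrightarrow> rshift (smd Y i) - rshift (smd X k) \<le> t"
  shows "mat_lev X Y l (band X Y l a b) \<le> ereal t"
proof -
  have "flev (shom A (smd X k) (smd Y i)) l (band X Y l a b (i, k)) \<le> ereal t"
    if "i < nsum Y" "k < nsum X" for i k
  proof (cases "i + b = k + a")
    case True
    have "flev (shom A (smd X k) (smd Y i)) l (sid (smd X k)) \<le> ereal (rshift (smd Y i) - rshift (smd X k))"
      using that assms band_typedD[OF assms(3) that True] by (intro sid_level) (auto simp: smd_Ob)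
    also have "\<dots> \<le> ereal t" using assms(4)[OF that True] by simp
    finally show ?thesis using that True by (simp add: band_entry)
  next
    case False
    then show ?thesis using that assms by (simp add: band_entry smd_Ob lev_zero)
  qed
  then show ?thesis unfolding mat_lev_def by (intro SUP_least) auto
qed

lemma mat_id_band: "mat_id X = band X X 0 0 0"
  by (auto simp: mat_id_def band_def Tw_def intro!: restrict_ext)

lemma band_typed_id: "band_typed X X 0 0 0"
  by (simp add: band_typed_def)

lemma mat_id_closed: "X \<in> mat_obj \<Longrightarrow> mat_id X \<in> carrier (mat_module A X X 0)"
  unfolding mat_id_band by (intro band_closed band_typed_id)

lemma mat_id_left:
  assumes "X \<in> mat_obj" "Y \<in> mat_obj" "f \<in> carrier (mat_module A X Y l)"
  shows "mat_comp A X Y Y 0 l (mat_id Y) f = f"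
proof (rule mat_eqI)
  show "mat_comp A X Y Y 0 l (mat_id Y) f \<in> carrier (mat_module A X Y l)"
    using mat_comp_closed[OF assms(1,2,2,3) mat_id_closed[OF assms(2)]] by simp
  fix p assume "p \<in> mat_indices X Y"
  then show "mat_comp A X Y Y 0 l (mat_id Y) f p = f p"
    using band_comp_left[OF assms(1,2,2) band_typed_id assms(3), of "fst p" "snd p"]
    by (auto simp: mat_id_band)
qed fact

lemma mat_id_right:
  assumes "X \<in> mat_obj" "Y \<in> mat_obj" "f \<in> carrier (mat_module A X Y l)"
  shows "mat_comp A X X Y l 0 f (mat_id X) = f"
proof (rule mat_eqI)
  show "mat_comp A X X Y l 0 f (mat_id X) \<in> carrier (mat_module A X Y l)"
    using mat_comp_closed[OF assms(1,1,2) mat_id_closed[OF assms(1)] assms(3)] by simp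
  fix p assume "p \<in> mat_indices X Y"
  then show "mat_comp A X X Y l 0 f (mat_id X) p = f p"
    using band_comp_right[OF assms(1,1,2) band_typed_id assms(3), of "fst p" "snd p"]
    by (auto simp: mat_id_band)
qed fact

lemma mat_bdry_closed:
  assumes "X \<in> mat_obj" "Y \<in> mat_obj" "f \<in> carrier (mat_module A X Y l)"
  shows "mat_bdry A X Y l f \<in> carrier (mat_module A X Y (l + 1))"
  using mat_bdry_linear[OF assms(1,2), of l] assms(3) by (auto simp: linear_map_def)

text \<open>The rule holds for the summands of each entry, and the differential is linear.\<close>

lemma mat_leibniz:
  assumes X: "X \<in> mat_obj" and Y: "Y \<in> mat_obj" and Z: "Z \<in> mat_obj"
    and f: "f \<in> carrier (mat_module A X Y l)" and g: "g \<in> carrier (mat_module A Y Z m)"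
  shows "mat_bdry A X Z (m + l) (mat_comp A X Y Z m l g f)
    = mat_comp A X Y Z (m + 1) l (mat_bdry A Y Z m g) f
      \<oplus>\<^bsub>mat_module A X Z (m + l + 1)\<^esub>
      alt_sign (mat_module A X Z (m + l + 1)) m (mat_comp A X Y Z m (l + 1) g (mat_bdry A X Y l f))"
proof -
  have deg: "m + 1 + l = m + l + 1" "m + (l + 1) = m + l + 1" by simp_all
  have bf: "mat_bdry A X Y l f \<in> carrier (mat_module A X Y (l + 1))"
    by (rule mat_bdry_closed[OF X Y f])
  have bg: "mat_bdry A Y Z m g \<in> carrier (mat_module A Y Z (m + 1))"
    by (rule mat_bdry_closed[OF Y Z g])
  have gf: "mat_comp A X Y Z m l g f \<in> carrier (mat_module A X Z (m + l))" by (rule mat_comp_closed[OF X Y Z f g])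
  have bgf: "mat_comp A X Y Z (m + 1) l (mat_bdry A Y Z m g) f \<in> carrier (mat_module A X Z (m + l + 1))"
    using mat_comp_closed[OF X Y Z f bg] unfolding deg .
  have gbf: "mat_comp A X Y Z m (l + 1) g (mat_bdry A X Y l f) \<in> carrier (mat_module A X Z (m + l + 1))"
    using mat_comp_closed[OF X Y Z bf g] unfolding deg .
  interpret N: abelian_group "mat_module A X Z (m + l + 1)" using mat_module_group[OF X Z] .
  show ?thesis
  proof (rule mat_eqI)
    show "mat_bdry A X Z (m + l) (mat_comp A X Y Z m l g f) \<in> carrier (mat_module A X Z (m + l + 1))"
      by (rule mat_bdry_closed[OF X Z gf])
    show "mat_comp A X Y Z (m + 1) l (mat_bdry A Y Z m g) f
      \<oplus>\<^bsub>mat_module A X Z (m + l + 1)\<^esub>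
      alt_sign (mat_module A X Z (m + l + 1)) m (mat_comp A X Y Z m (l + 1) g (mat_bdry A X Y l f))
      \<in> carrier (mat_module A X Z (m + l + 1))"
      using bgf gbf by (simp add: alt_sign_def)
    fix p assume p: "p \<in> mat_indices X Z"
    then obtain i j where ij: "i < nsum Z" "j < nsum X" "p = (i, j)" by auto
    let ?x = "smd X j" and ?z = "smd Z i" and ?y = "\<lambda>k. smd Y k"
    have O: "?x \<in> Ob" "?z \<in> Ob" "k < nsum Y \<Longrightarrow> ?y k \<in> Ob" for k using X Y Z ij by (auto intro: smd_Ob)
    let ?G = "gpart (shom A ?x ?z) (m + l)" and ?H = "gpart (shom A ?x ?z) (m + l + 1)"
    have G: "module K ?G" and H: "module K ?H" using O by (simp_all add: hm_module)
    interpret H: module K ?H by (rule H)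
    have ef: "f (k, j) \<in> carrier (gpart (shom A ?x (?y k)) l)" if "k < nsum Y" for k
      using mat_entry[OF f, of "(k, j)"] that ij by simp
    have eg: "g (i, k) \<in> carrier (gpart (shom A (?y k) ?z) m)" if "k < nsum Y" for k
      using mat_entry[OF g, of "(i, k)"] that ij by simp
    let ?s = "\<lambda>k. scomp A ?x (?y k) ?z m l (g (i, k)) (f (k, j))"
    let ?u = "\<lambda>k. scomp A ?x (?y k) ?z (m + 1) l (bdry (shom A (?y k) ?z) m (g (i, k))) (f (k, j))"
    let ?v = "\<lambda>k. scomp A ?x (?y k) ?z m (l + 1) (g (i, k)) (bdry (shom A ?x (?y k)) l (f (k, j)))"
    have s: "?s k \<in> carrier ?G" if "k < nsum Y" for k using mat_comp_summand[OF X Y Z f g ij(1,2) that] by simp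
    have u: "?u k \<in> carrier ?H" if "k < nsum Y" for k
      using mat_comp_summand[OF X Y Z f bg ij(1,2) that] that ij unfolding deg by (simp add: mat_bdry_def)
    have v: "?v k \<in> carrier ?H" if "k < nsum Y" for k
      using mat_comp_summand[OF X Y Z bf g ij(1,2) that] that ij unfolding deg by (simp add: mat_bdry_def)
    have alt: "linear_map K ?H ?H (alt_sign ?H m)"
      using neg_linear[OF H] by (auto simp: alt_sign_def linear_map_def)
    have av: "alt_sign ?H m (?v k) \<in> carrier ?H" if "k < nsum Y" for k
      using v[OF that] by (simp add: alt_sign_def)
    have "mat_bdry A X Z (m + l) (mat_comp A X Y Z m l g f) p = bdry (shom A ?x ?z) (m + l) (\<Oplus>\<^bsub>?G\<^esub>k\<in>{..<nsum Y}. ?s k)"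
      using ij by (simp add: mat_bdry_def mat_comp_entry)
    also have "\<dots> = (\<Oplus>\<^bsub>?H\<^esub>k\<in>{..<nsum Y}. bdry (shom A ?x ?z) (m + l) (?s k))"
      by (rule linear_map_finsum[OF G H bd_linear]) (use O s in auto)
    also have "\<dots> = (\<Oplus>\<^bsub>?H\<^esub>k\<in>{..<nsum Y}. ?u k \<oplus>\<^bsub>?H\<^esub> alt_sign ?H m (?v k))"
      by (rule H.finsum_cong'[OF refl]) (use O ef eg u av in \<open>auto simp: bd_cmp\<close>)
    also have "\<dots> = (\<Oplus>\<^bsub>?H\<^esub>k\<in>{..<nsum Y}. ?u k) \<oplus>\<^bsub>?H\<^esub> (\<Oplus>\<^bsub>?H\<^esub>k\<in>{..<nsum Y}. alt_sign ?H m (?v k))"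
      by (rule H.finsum_addf) (use u av in auto)
    also have "(\<Oplus>\<^bsub>?H\<^esub>k\<in>{..<nsum Y}. alt_sign ?H m (?v k)) = alt_sign ?H m (\<Oplus>\<^bsub>?H\<^esub>k\<in>{..<nsum Y}. ?v k)"
      by (rule linear_map_finsum[OF H H alt, symmetric]) (use v in auto)
    also have "(\<Oplus>\<^bsub>?H\<^esub>k\<in>{..<nsum Y}. ?u k) = mat_comp A X Y Z (m + 1) l (mat_bdry A Y Z m g) f p"
      unfolding ij(3) mat_comp_entry[OF ij(1,2)] deg fst_conv snd_conv
      by (rule H.finsum_cong'[OF refl]) (use u ij in \<open>auto simp: mat_bdry_def deg\<close>)
    also have "(\<Oplus>\<^bsub>?H\<^esub>k\<in>{..<nsum Y}. ?v k) = mat_comp A X Y Z m (l + 1) g (mat_bdry A X Y l f) p"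
      unfolding ij(3) mat_comp_entry[OF ij(1,2)] deg fst_conv snd_conv
      by (rule H.finsum_cong'[OF refl]) (use v ij in \<open>auto simp: mat_bdry_def deg\<close>)
    finally show "mat_bdry A X Z (m + l) (mat_comp A X Y Z m l g f) p
      = (mat_comp A X Y Z (m + 1) l (mat_bdry A Y Z m g) f
        \<oplus>\<^bsub>mat_module A X Z (m + l + 1)\<^esub>
        alt_sign (mat_module A X Z (m + l + 1)) m (mat_comp A X Y Z m (l + 1) g (mat_bdry A X Y l f))) p"
      using ij p by (simp add: mat_module_simps alt_sign_def mat_neg[OF X Z gbf])
  qed
qed

lemma mat_lev_comp:
  assumes X: "X \<in> mat_obj" and Y: "Y \<in> mat_obj" and Z: "Z \<in> mat_obj"
    and f: "f \<in> carrier (mat_module A X Y l)" and g: "g \<in> carrier (mat_module A Y Z m)"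
  shows "mat_lev X Z (m + l) (mat_comp A X Y Z m l g f) \<le> mat_lev Y Z m g + mat_lev X Y l f"
  unfolding mat_lev_def[of X Z]
proof (rule SUP_least)
  fix p assume "p \<in> mat_indices X Z"
  then obtain i j where ij: "i < nsum Z" "j < nsum X" "p = (i, j)" by auto
  let ?L = "mat_lev Y Z m g + mat_lev X Y l f"
  let ?G = "gpart (shom A (smd X j) (smd Z i)) (m + l)"
  let ?s = "\<lambda>k. scomp A (smd X j) (smd Y k) (smd Z i) m l (g (i, k)) (f (k, j))"
  have O: "smd X j \<in> Ob" "smd Z i \<in> Ob" "k < nsum Y \<Longrightarrow> smd Y k \<in> Ob" for k using X Y Z ij by (auto intro: smd_Ob)
  interpret G: module K ?G using O by (simp add: hm_module)
  have s: "?s k \<in> carrier ?G" if "k < nsum Y" for k using mat_comp_summand[OF X Y Z f g ij(1,2) that] by simp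
  have le: "flev (shom A (smd X j) (smd Z i)) (m + l) (?s k) \<le> ?L" if k: "k < nsum Y" for k
  proof -
    have "flev (shom A (smd X j) (smd Z i)) (m + l) (?s k)
      \<le> flev (shom A (smd Y k) (smd Z i)) m (g (i, k)) + flev (shom A (smd X j) (smd Y k)) l (f (k, j))"
      using mat_entry[OF f, of "(k, j)"] mat_entry[OF g, of "(i, k)"] ij k O by (intro lev_cmp) simp_all
    also have "\<dots> \<le> ?L"
      unfolding mat_lev_def using k ij
      by (intro add_mono SUP_upper2[of "(i, k)"] SUP_upper2[of "(k, j)"]) auto
    finally show ?thesis .
  qed
  have "n \<le> nsum Y \<Longrightarrow> (\<Oplus>\<^bsub>?G\<^esub>k\<in>{..<n}. ?s k) \<in> carrier ?G \<and>
      flev (shom A (smd X j) (smd Z i)) (m + l) (\<Oplus>\<^bsub>?G\<^esub>k\<in>{..<n}. ?s k) \<le> ?L" for n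
  proof (induction n)
    case 0
    then show ?case using O by (simp add: lev_zero)
  next
    case (Suc n)
    let ?t = "\<Oplus>\<^bsub>?G\<^esub>k\<in>{..<n}. ?s k"
    have e: "(\<Oplus>\<^bsub>?G\<^esub>k\<in>{..<Suc n}. ?s k) = ?s n \<oplus>\<^bsub>?G\<^esub> ?t"
      using Suc.prems s by (subst lessThan_Suc, subst G.finsum_insert) auto
    have "flev (shom A (smd X j) (smd Z i)) (m + l) (\<one> \<odot>\<^bsub>?G\<^esub> ?s n \<oplus>\<^bsub>?G\<^esub> ?t)
      \<le> max (flev (shom A (smd X j) (smd Z i)) (m + l) (?s n)) (flev (shom A (smd X j) (smd Z i)) (m + l) ?t)"
      using Suc s[of n] O by (intro lev_lincomb) auto
    also have "\<dots> \<le> ?L" using Suc le[of n] by simp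
    finally show ?case using Suc s[of n] by (simp add: e)
  qed
  from this[of "nsum Y"] show "flev (entry_complex A X Z p) (m + l) (mat_comp A X Y Z m l g f p) \<le> ?L"
    using ij by (simp add: mat_comp_entry)
qed

theorem level_dg_matrices: "level_dg K mat_obj (mat_module A) (mat_comp A) mat_id (mat_bdry A) mat_lev"
proof (intro level_dg.intro level_dg_axioms.intro graded_category.intro field_axioms
    mat_module_group mat_module_module mat_id_closed mat_comp_closed mat_comp_linear mat_comp_assoc
    mat_id_left mat_id_right mat_bdry_linear mat_leibniz mat_lev_comp)
  fix X Y i assume XY: "X \<in> mat_obj" "Y \<in> mat_obj"
  have O: "p \<in> mat_indices X Y \<Longrightarrow> smd X (snd p) \<in> Ob" "p \<in> mat_indices X Y \<Longrightarrow> smd Y (fst p) \<in> Ob" for p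
    using XY by (auto intro: smd_Ob)
  show "mat_lev X Y i \<zero>\<^bsub>mat_module A X Y i\<^esub> = -\<infinity>"
  proof -
    have "mat_lev X Y i \<zero>\<^bsub>mat_module A X Y i\<^esub> \<le> -\<infinity>"
      unfolding mat_lev_def using O by (intro SUP_least) (simp add: mat_module_simps lev_zero)
    then show ?thesis by simp
  qed
  fix f assume f: "f \<in> carrier (mat_module A X Y i)"
  note e = mat_entry[OF f]
  show "mat_bdry A X Y (i + 1) (mat_bdry A X Y i f) = \<zero>\<^bsub>mat_module A X Y (i + 1 + 1)\<^esub>"
    using e O bd_bd by (auto simp: mat_bdry_def mat_module_simps intro!: restrict_ext)
  show "mat_lev X Y (i + 1) (mat_bdry A X Y i f) \<le> mat_lev X Y i f"
    unfolding mat_lev_def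
  proof (rule SUP_mono)
    fix p assume p: "p \<in> mat_indices X Y"
    then show "\<exists>p'\<in>mat_indices X Y. flev (entry_complex A X Y p) (i + 1) (mat_bdry A X Y i f p)
        \<le> flev (entry_complex A X Y p') i (f p')"
      using lev_bd[OF O[OF p] e[OF p]] by (intro bexI[of _ p]) (simp_all add: mat_bdry_def)
  qed
  fix a g assume a: "a \<in> carrier K - {\<zero>}" and g: "g \<in> carrier (mat_module A X Y i)"
  note eg = mat_entry[OF g]
  show "mat_lev X Y i (a \<odot>\<^bsub>mat_module A X Y i\<^esub> f \<oplus>\<^bsub>mat_module A X Y i\<^esub> g) \<le> max (mat_lev X Y i f) (mat_lev X Y i g)"
    unfolding mat_lev_def[of X Y i "_ \<oplus>\<^bsub>_\<^esub> _"]
  proof (rule SUP_least)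
    fix p assume p: "p \<in> mat_indices X Y"
    have "flev (entry_complex A X Y p) i (a \<odot>\<^bsub>E X Y p i\<^esub> f p \<oplus>\<^bsub>E X Y p i\<^esub> g p)
      \<le> max (flev (entry_complex A X Y p) i (f p)) (flev (entry_complex A X Y p) i (g p))"
      using e[OF p] eg[OF p] O[OF p] a by (intro lev_lincomb) auto
    also have "\<dots> \<le> max (mat_lev X Y i f) (mat_lev X Y i g)"
      unfolding mat_lev_def using p by (intro max.mono SUP_upper) auto
    finally show "flev (entry_complex A X Y p) i ((a \<odot>\<^bsub>mat_module A X Y i\<^esub> f \<oplus>\<^bsub>mat_module A X Y i\<^esub> g) p)
      \<le> max (mat_lev X Y i f) (mat_lev X Y i g)"
      using p by (simp add: mat_module_simps)
  qed
next
  fix X assume X: "X \<in> mat_obj"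
  show "mat_bdry A X X 0 (mat_id X) = \<zero>\<^bsub>mat_module A X X 1\<^esub>"
    using band_bdry[OF X X band_typed_id] by (simp add: mat_id_band)
  show "mat_lev X X 0 (mat_id X) \<le> 0"
    using band_level[OF X X band_typed_id, of 0] by (simp add: mat_id_band zero_ereal_def)
qed

sublocale M: level_dg K mat_obj "mat_module A" "mat_comp A" mat_id "mat_bdry A" mat_lev
  by (rule level_dg_matrices)

lemma Tw_simps:
  "dgobj (Tw A) = {X. twisted_complex A X}"
  "gpart (dghom (Tw A) X Y) = mat_module A X Y"
  "bdry (dghom (Tw A) X Y) = M.twisted_bd tmat X Y"
  "flev (dghom (Tw A) X Y) = mat_lev X Y"
  "dgcomp (Tw A) = mat_comp A"
  "dgid (Tw A) = mat_id"
  by (simp_all add: Tw_def M.twisted_bd_def mat_lev_def mat_id_def fun_eq_iff)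

lemma twisted_complex_iff:
  "twisted_complex A X \<longleftrightarrow> X \<in> mat_obj \<and> M.arrow (Arr X X 1 (tmat X)) \<and> M.level (Arr X X 1 (tmat X)) \<le> 0 \<and>
    (\<forall>i<nsum X. \<forall>j<nsum X. j \<le> i \<longrightarrow> tmat X (i, j) = \<zero>\<^bsub>E X X (i, j) 1\<^esub>) \<and>
    M.aadd (M.abd (Arr X X 1 (tmat X))) (M.acomp (Arr X X 1 (tmat X)) (Arr X X 1 (tmat X))) = M.azero X X 2"
proof -
  have "mat_lev X X 1 (tmat X) \<le> 0 \<longleftrightarrow> (\<forall>p\<in>mat_indices X X. flev (entry_complex A X X p) 1 (tmat X p) \<le> 0)"
    unfolding mat_lev_def by (simp only: SUP_le_iff)
  moreover have "set (summands X) \<subseteq> Ob \<longleftrightarrow> X \<in> mat_obj" by (simp add: mat_obj_def)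
  ultimately show ?thesis
    unfolding twisted_complex_def
    by (auto simp: M.arrow_Arr M.level_def M.aadd_def M.abd_def M.acomp_def M.azero_def simp del: SUP_le_iff)
qed

text \<open>The Maurer-Cartan condition in \<open>twisted_complex\<close> is the one of \<open>level_dg_twisted\<close>.\<close>

theorem level_dg_category_Tw: "level_dg_category K (Tw A)"
  unfolding level_dg_category_def Tw_simps
proof (rule M.level_dg_twisted)
  show "{X. twisted_complex A X} \<subseteq> mat_obj" by (auto simp: twisted_complex_iff)
qed (auto simp: twisted_complex_iff M.arrow_Arr)

end

context level_dg begin

lemma twisted_bd_arrow:
  assumes f: "arrow f" "src f = X" "tgt f = Y" and q: "q X \<in> carrier (hm X X 1)" "q Y \<in> carrier (hm Y Y 1)"
  shows "Arr X Y (deg f + 1) (twisted_bd q X Y (deg f) (elt f))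
    = \<delta> f \<^bold>+ Arr Y Y 1 (q Y) \<cdot> f \<^bold>+ asign (deg f + 1) (f \<cdot> Arr X X 1 (q X))"
proof -
  have XY: "X \<in> Ob" "Y \<in> Ob" and e: "elt f \<in> carrier (hm X Y (deg f))" using f by (auto simp: arrow_def simp del: arrow_ends)
  interpret G: abelian_group "hm X Y (1 + deg f)" using XY by (simp add: hm_group)
  have "cmp X Y Y 1 (deg f) (q Y) (elt f) \<in> carrier (hm X Y (1 + deg f))"
    using cmp_closed[of X Y Y "elt f" "deg f" "q Y" 1] XY e q by simp
  moreover have "cmp X X Y (deg f) 1 (elt f) (q X) \<in> carrier (hm X Y (1 + deg f))"
    using cmp_closed[of X X Y "q X" 1 "elt f" "deg f"] XY e q by (simp add: add.commute)
  moreover have "bd X Y (deg f) (elt f) \<in> carrier (hm X Y (1 + deg f))"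
    using bd_linear[OF XY, of "deg f"] e by (auto simp: linear_map_def add.commute)
  ultimately show ?thesis
    using f by (simp add: twisted_bd_def abd_def aadd_def acomp_def asign_def alt_sign_def aneg_def
          a_minus_def add.commute G.a_assoc)
qed

end

context matrix_category begin

sublocale TW: level_dg_category K "Tw A" by (rule level_dg_category_Tw)

notation M.acomp (infixr "\<cdot>" 75) and M.aadd (infixr "\<^bold>+" 65) and M.aneg ("\<^bold>- _" [80] 80) and M.abd ("\<delta>")

text \<open>The Maurer-Cartan element as an arrow, so that identities in \<open>Tw A\<close> are proved by rewriting with
  arrows of matrices.\<close>

definition Q :: "('o, 'm) twisted \<Rightarrow> (('o, 'm) twisted, int, nat \<times> nat \<Rightarrow> 'm) arr" where
  "Q X = Arr X X 1 (tmat X)"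

lemma Q_dom [simp]: "src (Q X) = X" "tgt (Q X) = X" "deg (Q X) = 1" "elt (Q X) = tmat X"
  by (simp_all add: Q_def)

lemma twistedD:
  assumes "twisted_complex A X"
  shows "X \<in> mat_obj" "M.arrow (Q X)" "M.level (Q X) \<le> 0" "Q X \<cdot> Q X = \<^bold>- \<delta> (Q X)"
    "\<lbrakk>M.arrow f; tgt f = X\<rbrakk> \<Longrightarrow> Q X \<cdot> Q X \<cdot> f = \<^bold>- (\<delta> (Q X) \<cdot> f)"
    "\<lbrakk>i < nsum X; j < nsum X; j \<le> i\<rbrakk> \<Longrightarrow> tmat X (i, j) = \<zero>\<^bsub>gpart (shom A (smd X j) (smd X i)) 1\<^esub>"
proof -
  show X: "X \<in> mat_obj" "M.arrow (Q X)" "M.level (Q X) \<le> 0"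
    "\<lbrakk>i < nsum X; j < nsum X; j \<le> i\<rbrakk> \<Longrightarrow> tmat X (i, j) = \<zero>\<^bsub>gpart (shom A (smd X j) (smd X i)) 1\<^esub>"
    using assms by (auto simp: twisted_complex_iff Q_def)
  have MC: "\<delta> (Q X) \<^bold>+ Q X \<cdot> Q X = M.azero X X 2"
    using assms unfolding twisted_complex_iff Q_def by blast
  show "Q X \<cdot> Q X = \<^bold>- \<delta> (Q X)"
    using MC X(1,2) by (intro M.aneg_unique) simp_all
  then show "Q X \<cdot> Q X \<cdot> f = \<^bold>- (\<delta> (Q X) \<cdot> f)" if "M.arrow f" "tgt f = X"
    using M.precomp[of "Q X" "Q X" "\<^bold>- \<delta> (Q X)" f] that X(1,2) by simp
qed

lemma twistedI:
  assumes "X \<in> mat_obj" "M.arrow (Q X)" "M.level (Q X) \<le> 0" "\<delta> (Q X) \<^bold>+ Q X \<cdot> Q X = M.azero X X 2"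
    "\<And>i j. \<lbrakk>i < nsum X; j < nsum X; j \<le> i\<rbrakk> \<Longrightarrow> tmat X (i, j) = \<zero>\<^bsub>gpart (shom A (smd X j) (smd X i)) 1\<^esub>"
  shows "twisted_complex A X"
  using assms by (auto simp: twisted_complex_iff Q_def)

lemma TW_simps:
  "TW.acomp = M.acomp" "TW.aadd = M.aadd" "TW.aneg = M.aneg" "TW.azero = M.azero" "TW.aid = M.aid" "TW.level = M.level"
  by (simp_all add: fun_eq_iff TW.acomp_def M.acomp_def TW.aadd_def M.aadd_def TW.aneg_def M.aneg_def
      TW.azero_def M.azero_def TW.aid_def M.aid_def TW.level_def M.level_def Tw_simps)

lemma TW_arrow: "TW.arrow f \<longleftrightarrow> twisted_complex A (src f) \<and> twisted_complex A (tgt f) \<and> M.arrow f"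
  unfolding TW.arrow_def M.arrow_def unfolding Tw_simps using twistedD(1) by blast

lemma TW_abd:
  assumes "TW.arrow f"
  shows "TW.abd f = \<delta> f \<^bold>+ Q (tgt f) \<cdot> f \<^bold>+ M.asign (deg f + 1) (f \<cdot> Q (src f))"
proof -
  have f: "M.arrow f" "twisted_complex A (src f)" "twisted_complex A (tgt f)" using assms by (auto simp: TW_arrow)
  have "tmat (src f) \<in> carrier (mat_module A (src f) (src f) 1)" "tmat (tgt f) \<in> carrier (mat_module A (tgt f) (tgt f) 1)"
    using twistedD(2)[OF f(2)] twistedD(2)[OF f(3)] by (simp_all add: Q_def M.arrow_Arr)
  from M.twisted_bd_arrow[OF f(1) refl refl this] show ?thesis
    unfolding TW.abd_def unfolding Tw_simps Q_def by simp
qed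

definition bnd :: "('o, 'm) twisted \<Rightarrow> ('o, 'm) twisted \<Rightarrow> int \<Rightarrow> nat \<Rightarrow> nat \<Rightarrow> (('o, 'm) twisted, int, nat \<times> nat \<Rightarrow> 'm) arr" where
  "bnd X Y l a b = Arr X Y l (band X Y l a b)"

lemma bnd_dom [simp]: "src (bnd X Y l a b) = X" "tgt (bnd X Y l a b) = Y" "deg (bnd X Y l a b) = l"
  "elt (bnd X Y l a b) = band X Y l a b"
  by (simp_all add: bnd_def)

lemma bnd_arrow: "\<lbrakk>X \<in> mat_obj; Y \<in> mat_obj; band_typed X Y l a b\<rbrakk> \<Longrightarrow>
    M.arrow (bnd X Y l a b) \<and> \<delta> (bnd X Y l a b) = M.azero X Y (l + 1)"
  by (simp add: bnd_def M.arrow_Arr band_closed M.abd_def M.azero_def band_bdry)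

lemma bnd_level:
  assumes "X \<in> mat_obj" "Y \<in> mat_obj" "band_typed X Y l a b"
    "\<And>i k. \<lbrakk>i < nsum Y; k < nsum X; i + b = k + a\<rbrakk> \<Longrightarrow> rshift (smd Y i) = rshift (smd X k)"
  shows "M.level (bnd X Y l a b) \<le> 0"
  using band_level[OF assms(1-3), of 0] assms(4) by (simp add: M.level_def zero_ereal_def)

lemma M_arr_eqI:
  assumes "M.arrow f" "M.arrow g" "src f = src g" "tgt f = tgt g" "deg f = deg g"
    "\<And>i j. \<lbrakk>i < nsum (tgt g); j < nsum (src g)\<rbrakk> \<Longrightarrow> elt f (i, j) = elt g (i, j)"
  shows "f = g"
proof -
  have "elt f = elt g"
    using assms by (intro mat_eqI[of _ "src g" "tgt g" "deg g"]) (auto simp: M.arrow_def simp del: M.arrow_ends)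
  then show ?thesis using assms by (auto intro: arr.expand)
qed

lemma bnd_comp_entry:
  assumes "X \<in> mat_obj" "Y \<in> mat_obj" "Z \<in> mat_obj" "band_typed X Y l a b" "band_typed Y Z m c d"
    "i < nsum Z" "j < nsum X"
  shows "elt (bnd Y Z m c d \<cdot> bnd X Y l a b) (i, j)
    = (if \<exists>k<nsum Y. i + d = k + c \<and> k + b = j + a then sid (smd X j) else \<zero>\<^bsub>gpart (shom A (smd X j) (smd Z i)) (m + l)\<^esub>)"
proof (cases "\<exists>k<nsum Y. i + d = k + c")
  case True
  then obtain k where k: "k < nsum Y" "i + d = k + c" by blast
  have t: "base (smd Z i) = base (smd Y k)" "m = dshift (smd Z i) - dshift (smd Y k)"
    using band_typedD[OF assms(5) assms(6) k] by auto
  have "gpart (shom A (smd X j) (smd Y k)) l = gpart (shom A (smd X j) (smd Z i)) (m + l)"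
  proof -
    have "l - (dshift (smd Y k) - dshift (smd X j)) = m + l - (dshift (smd Z i) - dshift (smd X j))"
      using t(2) by simp
    then show ?thesis by (simp only: shom_simps t(1))
  qed
  then show ?thesis
    using k assms band_comp_left[OF assms(1-3,5) band_closed[OF assms(1,2,4)] assms(6,7)]
    by (auto simp: M.acomp_def band_entry)
next
  case False
  then show ?thesis
    using assms band_comp_left[OF assms(1-3,5) band_closed[OF assms(1,2,4)] assms(6,7)]
    by (auto simp: M.acomp_def)
qed

lemma bnd_comp:
  assumes "X \<in> mat_obj" "Y \<in> mat_obj" "Z \<in> mat_obj" "band_typed X Y l a b" "band_typed Y Z m c d"
  shows "\<lbrakk>band_typed X Z (m + l) a' b';
      \<And>i j. \<lbrakk>i < nsum Z; j < nsum X\<rbrakk> \<Longrightarrow> (\<exists>k<nsum Y. i + d = k + c \<and> k + b = j + a) \<longleftrightarrow> i + b' = j + a'\<rbrakk> \<Longrightarrow>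
      bnd Y Z m c d \<cdot> bnd X Y l a b = bnd X Z (m + l) a' b'"
    and "\<lbrakk>\<And>i j k. \<lbrakk>i < nsum Z; j < nsum X; k < nsum Y; i + d = k + c; k + b = j + a\<rbrakk> \<Longrightarrow> False\<rbrakk> \<Longrightarrow>
      bnd Y Z m c d \<cdot> bnd X Y l a b = M.azero X Z (m + l)"
proof -
  note ar = bnd_arrow[OF assms(1,2,4)] bnd_arrow[OF assms(2,3,5)]
  show "bnd Y Z m c d \<cdot> bnd X Y l a b = bnd X Z (m + l) a' b'"
    if "band_typed X Z (m + l) a' b'"
      "\<And>i j. \<lbrakk>i < nsum Z; j < nsum X\<rbrakk> \<Longrightarrow> (\<exists>k<nsum Y. i + d = k + c \<and> k + b = j + a) \<longleftrightarrow> i + b' = j + a'"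
    using ar that bnd_arrow[OF assms(1,3) that(1)] bnd_comp_entry[OF assms]
    by (intro M_arr_eqI) (simp_all add: band_entry)
  show "bnd Y Z m c d \<cdot> bnd X Y l a b = M.azero X Z (m + l)"
    if "\<And>i j k. \<lbrakk>i < nsum Z; j < nsum X; k < nsum Y; i + d = k + c; k + b = j + a\<rbrakk> \<Longrightarrow> False"
  proof (rule M_arr_eqI)
    fix i j assume "i < nsum (tgt (M.azero X Z (m + l)))" "j < nsum (src (M.azero X Z (m + l)))"
    then have ij: "i < nsum Z" "j < nsum X" by simp_all
    have "\<not> (\<exists>k<nsum Y. i + d = k + c \<and> k + b = j + a)" using that ij by blast
    then show "elt (bnd Y Z m c d \<cdot> bnd X Y l a b) (i, j) = elt (M.azero X Z (m + l)) (i, j)"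
      unfolding bnd_comp_entry[OF assms ij] if_not_P[OF \<open>\<not> _\<close>]
      using ij by (simp add: M.azero_def mat_module_simps)
  qed (use ar assms in simp_all)
qed

end

section \<open>Shifts, translation and cones of twisted complexes\<close>

context matrix_category begin

text \<open>Shift by \<open>e\<close> in degree. The sign keeps the Maurer-Cartan equation, because the differential of the
  shift completion changes by \<open>(-1)\<^sup>e\<close> and composition does not.\<close>

definition deg_shift :: "int \<Rightarrow> ('o, 'm) twisted \<Rightarrow> ('o, 'm) twisted" where
  "deg_shift e X = \<lparr> summands = map (\<lambda>S. Shift (rshift S) (base S) (dshift S + e)) (summands X),
     tmat = (\<lambda>p \<in> mat_indices X X. alt_sign (E X X p 1) e (tmat X p)) \<rparr>"

lemma deg_shift_simps [simp]:
  "nsum (deg_shift e X) = nsum X"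
  "i < nsum X \<Longrightarrow> smd (deg_shift e X) i = Shift (rshift (smd X i)) (base (smd X i)) (dshift (smd X i) + e)"
  by (simp_all add: deg_shift_def)

lemma tmat_deg_shift: "\<lbrakk>i < nsum X; j < nsum X\<rbrakk> \<Longrightarrow>
  tmat (deg_shift e X) (i, j) = alt_sign (gpart (shom A (smd X j) (smd X i)) 1) e (tmat X (i, j))"
  by (simp add: deg_shift_def)

lemma deg_shift_obj: "X \<in> mat_obj \<Longrightarrow> deg_shift e X \<in> mat_obj"
  by (auto simp: mat_obj_def deg_shift_def shom_simps(6))

lemma deg_shift_typed: "band_typed X (deg_shift e X) e 0 0" "band_typed (deg_shift e X) X (- e) 0 0"
  by (auto simp: band_typed_def)

lemma deg_shift_bnd:
  assumes "X \<in> mat_obj"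
  shows "M.arrow (bnd X (deg_shift e X) e 0 0)" "M.arrow (bnd (deg_shift e X) X (- e) 0 0)"
    "\<delta> (bnd X (deg_shift e X) e 0 0) = M.azero X (deg_shift e X) (e + 1)"
    "\<delta> (bnd (deg_shift e X) X (- e) 0 0) = M.azero (deg_shift e X) X (- e + 1)"
    "M.level (bnd X (deg_shift e X) e 0 0) \<le> 0" "M.level (bnd (deg_shift e X) X (- e) 0 0) \<le> 0"
    "bnd X (deg_shift e X) e 0 0 \<cdot> bnd (deg_shift e X) X (- e) 0 0 = M.aid (deg_shift e X)"
    "bnd (deg_shift e X) X (- e) 0 0 \<cdot> bnd X (deg_shift e X) e 0 0 = M.aid X"
proof -
  note O = assms deg_shift_obj[OF assms, of e]
  note t = deg_shift_typed[where X = X and e = e]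
  show "M.arrow (bnd X (deg_shift e X) e 0 0)" "M.arrow (bnd (deg_shift e X) X (- e) 0 0)"
    "\<delta> (bnd X (deg_shift e X) e 0 0) = M.azero X (deg_shift e X) (e + 1)"
    "\<delta> (bnd (deg_shift e X) X (- e) 0 0) = M.azero (deg_shift e X) X (- e + 1)"
    using bnd_arrow[OF O t(1)] bnd_arrow[OF O(2,1) t(2)] by auto
  show "M.level (bnd X (deg_shift e X) e 0 0) \<le> 0" "M.level (bnd (deg_shift e X) X (- e) 0 0) \<le> 0"
    using O t by (auto intro!: bnd_level)
  show "bnd X (deg_shift e X) e 0 0 \<cdot> bnd (deg_shift e X) X (- e) 0 0 = M.aid (deg_shift e X)"
    using bnd_comp(1)[OF O(2,1,2) t(2,1), of 0 0] by (simp add: band_typed_id) (simp add: bnd_def M.aid_def mat_id_band)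
  show "bnd (deg_shift e X) X (- e) 0 0 \<cdot> bnd X (deg_shift e X) e 0 0 = M.aid X"
    using bnd_comp(1)[OF O(1,2,1) t(1,2), of 0 0] by (simp add: band_typed_id) (simp add: bnd_def M.aid_def mat_id_band)
qed

lemma deg_shift_gpart:
  "gpart (shom A (Shift r (base S) (dshift S + e)) (Shift s (base T) (dshift T + e))) l = gpart (shom A S T) l"
  by (simp add: shom_simps)

text \<open>The matrix of a shift, without reference to entries: conjugation by the comparison maps, with the
  sign of the shift. The Maurer-Cartan equation for the shift follows by rewriting.\<close>

lemma deg_shift_Q:
  assumes "X \<in> mat_obj" "M.arrow (Q X)"
  shows "M.arrow (Q (deg_shift e X))"
    "Q (deg_shift e X) = M.asign e (bnd X (deg_shift e X) e 0 0 \<cdot> Q X \<cdot> bnd (deg_shift e X) X (- e) 0 0)"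
proof -
  let ?Y = "deg_shift e X" and ?s = "bnd X (deg_shift e X) e 0 0" and ?t = "bnd (deg_shift e X) X (- e) 0 0"
  note O = assms(1) deg_shift_obj[OF assms(1), of e]
  note b = deg_shift_bnd[OF assms(1), of e]
  have q: "tmat X \<in> carrier (mat_module A X X 1)" using assms(2) by (simp add: Q_def M.arrow_Arr)
  have ent: "tmat X (i, j) \<in> carrier (gpart (shom A (smd X j) (smd X i)) 1)" if "i < nsum X" "j < nsum X" for i j
    using mat_entry[OF q, of "(i, j)"] that by simp
  have "tmat ?Y p \<in> carrier (E ?Y ?Y p 1)" if "p \<in> mat_indices ?Y ?Y" for p
  proof -
    have grp: "abelian_group (E X X p 1)" using E_group[OF assms(1,1)] that by auto
    have "tmat ?Y p \<in> carrier (E X X p 1)"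
      using that mat_entry[OF q, of p] abelian_group.a_inv_closed[OF grp] by (auto simp: deg_shift_def alt_sign_def)
    then show ?thesis using that by (auto simp: deg_shift_gpart)
  qed
  moreover have "tmat ?Y \<in> extensional (mat_indices ?Y ?Y)" by (auto simp: deg_shift_def)
  ultimately show aY: "M.arrow (Q ?Y)" using O by (simp add: Q_def M.arrow_Arr mat_module_simps PiE_iff)
  show "Q ?Y = M.asign e (?s \<cdot> Q X \<cdot> ?t)"
  proof (rule M_arr_eqI)
    fix i j assume "i < nsum (tgt (M.asign e (?s \<cdot> Q X \<cdot> ?t)))" "j < nsum (src (M.asign e (?s \<cdot> Q X \<cdot> ?t)))"
    then have ij: "i < nsum X" "j < nsum X" by simp_all
    have qt: "M.arrow (Q X \<cdot> ?t)" using assms(2) b by simp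
    have "elt (?s \<cdot> Q X \<cdot> ?t) (i, j) = elt (Q X \<cdot> ?t) (i, j)"
      using band_comp_left[OF O(2,1,2) deg_shift_typed(1), of "elt (Q X \<cdot> ?t)" "1 + - e" i j] qt ij
      by (simp add: M.acomp_def[of ?s] M.arrow_def del: M.arrow_ends)
    also have "\<dots> = tmat X (i, j)"
      using band_comp_right[OF O(2,1,1) deg_shift_typed(2) q, of i j] ij by (simp add: M.acomp_def)
    finally have e: "elt (?s \<cdot> Q X \<cdot> ?t) (i, j) = tmat X (i, j)" .
    have st: "M.arrow (?s \<cdot> Q X \<cdot> ?t)" using assms(2) b by simp
    then have "elt (?s \<cdot> Q X \<cdot> ?t) \<in> carrier (mat_module A ?Y ?Y 1)"
      by (simp add: M.arrow_def del: M.arrow_ends)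
    from mat_neg[OF O(2,2) this]
    have "elt (\<^bold>- (?s \<cdot> Q X \<cdot> ?t)) (i, j) = \<ominus>\<^bsub>gpart (shom A (smd X j) (smd X i)) 1\<^esub> tmat X (i, j)"
      using ij e by (simp add: M.aneg_def deg_shift_gpart)
    then show "elt (Q ?Y) (i, j) = elt (M.asign e (?s \<cdot> Q X \<cdot> ?t)) (i, j)"
      using e ij by (cases "even e") (simp_all add: tmat_deg_shift alt_sign_def)
  qed (use aY assms(2) b in simp_all)
qed

lemma deg_shift_twisted:
  assumes "twisted_complex A X" shows "twisted_complex A (deg_shift e X)"
proof (rule twistedI)
  note X = twistedD[OF assms]
  note b = deg_shift_bnd[OF X(1), of e]
  let ?s = "bnd X (deg_shift e X) e 0 0" and ?t = "bnd (deg_shift e X) X (- e) 0 0"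
  note q = deg_shift_Q[OF X(1,2), of e]
  show "deg_shift e X \<in> mat_obj" "M.arrow (Q (deg_shift e X))" using q deg_shift_obj[OF X(1)] by auto
  show "M.level (Q (deg_shift e X)) \<le> 0" unfolding q(2) using X b
    by (intro M.level_sign M.level_comp) simp_all
  have tsx: "?t \<cdot> ?s \<cdot> x = x" if "M.arrow x" "tgt x = X" for x
    using M.precomp[OF b(8), of x] that b X(1) by simp
  show "\<delta> (Q (deg_shift e X)) \<^bold>+ Q (deg_shift e X) \<cdot> Q (deg_shift e X) = M.azero (deg_shift e X) (deg_shift e X) 2"
    unfolding q(2) using X b deg_shift_obj[OF X(1), of e] by (cases "even e") (simp_all add: tsx)
  fix i j assume "i < nsum (deg_shift e X)" "j < nsum (deg_shift e X)" "j \<le> i"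
  then have ij: "i < nsum X" "j < nsum X" "j \<le> i" by simp_all
  interpret G: abelian_group "gpart (shom A (smd X j) (smd X i)) 1" using X(1) ij by (intro hm_group smd_Ob)
  show "tmat (deg_shift e X) (i, j) = \<zero>\<^bsub>gpart (shom A (smd (deg_shift e X) j) (smd (deg_shift e X) i)) 1\<^esub>"
    using ij X(6)[OF ij] by (simp add: deg_shift_gpart tmat_deg_shift alt_sign_def)
qed

lemma deg_shift_inverse:
  assumes "twisted_complex A X" shows "deg_shift (- e) (deg_shift e X) = X"
proof -
  note X = twistedD[OF assms]
  have q: "tmat X \<in> carrier (mat_module A X X 1)" using X(2) by (simp add: Q_def M.arrow_Arr)
  have "map (\<lambda>S. Shift (rshift S) (base S) (dshift S + - e)) (map (\<lambda>S. Shift (rshift S) (base S) (dshift S + e)) (summands X)) = summands X"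
    by (simp add: comp_def)
  moreover have "tmat (deg_shift (- e) (deg_shift e X)) = tmat X"
  proof (rule extensionalityI)
    fix p assume "p \<in> mat_indices X X"
    then obtain i j where ij: "i < nsum X" "j < nsum X" "p = (i, j)" by auto
    interpret G: abelian_group "gpart (shom A (smd X j) (smd X i)) 1" using X(1) ij by (intro hm_group smd_Ob)
    show "tmat (deg_shift (- e) (deg_shift e X)) p = tmat X p"
      using ij mat_entry[OF q, of p] by (simp add: tmat_deg_shift deg_shift_gpart alt_sign_def)
  qed (use q in \<open>auto simp: deg_shift_def mat_module_simps PiE_iff\<close>)
  ultimately show ?thesis by (simp add: deg_shift_def[of "- e"]) (simp add: deg_shift_def)
qed

text \<open>Composition with bands from both sides moves the entries of a matrix.\<close>

lemma sandwich_entry: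
  assumes O: "U \<in> mat_obj" "W \<in> mat_obj" "V \<in> mat_obj" "Z \<in> mat_obj"
    and t: "band_typed V Z m c d" "band_typed U W l a b"
    and f: "M.arrow f" "src f = W" "tgt f = V" and ij: "i < nsum Z" "j < nsum U"
  shows "elt (bnd V Z m c d \<cdot> f \<cdot> bnd U W l a b) (i, j)
    = (if c \<le> i + d \<and> i + d - c < nsum V \<and> b \<le> j + a \<and> j + a - b < nsum W
       then elt f (i + d - c, j + a - b) else \<zero>\<^bsub>gpart (shom A (smd U j) (smd Z i)) (m + (deg f + l))\<^esub>)"
proof -
  have ef: "elt f \<in> carrier (mat_module A W V (deg f))" using f by (auto simp: M.arrow_def simp del: M.arrow_ends)
  have efb: "mat_comp A U W V (deg f) l (elt f) (band U W l a b) \<in> carrier (mat_module A U V (deg f + l))"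
    by (rule mat_comp_closed[OF O(1,2,3) band_closed[OF O(1,2) t(2)] ef])
  have "gpart (shom A (smd U j) (smd V (i + d - c))) (deg f + l) = gpart (shom A (smd U j) (smd Z i)) (m + (deg f + l))"
    if "c \<le> i + d" "i + d - c < nsum V"
  proof -
    have t': "base (smd Z i) = base (smd V (i + d - c))" "m = dshift (smd Z i) - dshift (smd V (i + d - c))"
      using band_typedD[OF t(1) ij(1) that(2)] that by auto
    have "deg f + l - (dshift (smd V (i + d - c)) - dshift (smd U j)) = m + (deg f + l) - (dshift (smd Z i) - dshift (smd U j))"
      using t'(2) by simp
    then show ?thesis by (simp only: shom_simps t'(1))
  qed
  then show ?thesis
    using f band_comp_left[OF O(1,3,4) t(1) efb ij] band_comp_right[OF O(1,2,3) t(2) ef _ ij(2), of "i + d - c"]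
    by (simp add: M.acomp_def)
qed

text \<open>The cone of \<open>u\<close>: the sum of \<open>Y\<close> and a degree shift of \<open>X\<close>, in this order, with \<open>u\<close> above the
  diagonal.\<close>

definition cone_complex :: "('o, 'm) twisted \<Rightarrow> ('o, 'm) twisted \<Rightarrow> (nat \<times> nat \<Rightarrow> 'm) \<Rightarrow> ('o, 'm) twisted" where
  "cone_complex X Y u = \<lparr> summands = summands Y @ summands (deg_shift (- 1) X),
     tmat = (\<lambda>(a, b) \<in> {..<nsum Y + nsum X} \<times> {..<nsum Y + nsum X}.
       if a < nsum Y then (if b < nsum Y then tmat Y (a, b) else u (a, b - nsum Y))
       else if b < nsum Y then \<zero>\<^bsub>gpart (shom A (smd Y b) (smd (deg_shift (- 1) X) (a - nsum Y))) 1\<^esub>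
       else \<ominus>\<^bsub>gpart (shom A (smd X (b - nsum Y)) (smd X (a - nsum Y))) 1\<^esub> tmat X (a - nsum Y, b - nsum Y)) \<rparr>"

lemma cone_complex_simps [simp]:
  "nsum (cone_complex X Y u) = nsum Y + nsum X"
  "a < nsum Y \<Longrightarrow> smd (cone_complex X Y u) a = smd Y a"
  "\<lbrakk>\<not> a < nsum Y; a < nsum Y + nsum X\<rbrakk> \<Longrightarrow> smd (cone_complex X Y u) a =
    Shift (rshift (smd X (a - nsum Y))) (base (smd X (a - nsum Y))) (dshift (smd X (a - nsum Y)) + - 1)"
proof -
  show "nsum (cone_complex X Y u) = nsum Y + nsum X" by (simp add: cone_complex_def)
  show "a < nsum Y \<Longrightarrow> smd (cone_complex X Y u) a = smd Y a" by (simp add: cone_complex_def nth_append)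
  assume a: "\<not> a < nsum Y" "a < nsum Y + nsum X"
  then have "smd (cone_complex X Y u) a = smd (deg_shift (- 1) X) (a - nsum Y)"
    by (simp add: cone_complex_def nth_append)
  also have "\<dots> = Shift (rshift (smd X (a - nsum Y))) (base (smd X (a - nsum Y))) (dshift (smd X (a - nsum Y)) + - 1)"
    using a by (intro deg_shift_simps(2)) simp
  finally show "smd (cone_complex X Y u) a =
    Shift (rshift (smd X (a - nsum Y))) (base (smd X (a - nsum Y))) (dshift (smd X (a - nsum Y)) + - 1)" .
qed

lemma cone_complex_obj: "\<lbrakk>X \<in> mat_obj; Y \<in> mat_obj\<rbrakk> \<Longrightarrow> cone_complex X Y u \<in> mat_obj"
  using deg_shift_obj[of X "- 1"] by (auto simp: mat_obj_def cone_complex_def)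

text \<open>The maps \<open>i\<close>, \<open>p\<close>, \<open>j\<close>, \<open>s\<close> of the cone before twisting: inclusions and projections of the two
  parts, all closed.\<close>

lemma cone_bands:
  fixes X Y :: "('o, 'm) twisted" and u :: "nat \<times> nat \<Rightarrow> 'm"
  assumes X: "X \<in> mat_obj" and Y: "Y \<in> mat_obj"
  defines "C \<equiv> cone_complex X Y u"
  defines "i \<equiv> bnd Y C 0 0 0" and "s \<equiv> bnd C Y 0 0 0" and "j \<equiv> bnd X C (- 1) (nsum Y) 0" and "p \<equiv> bnd C X 1 0 (nsum Y)"
  shows "band_typed Y C 0 0 0" "band_typed C Y 0 0 0" "band_typed X C (- 1) (nsum Y) 0" "band_typed C X 1 0 (nsum Y)"
    and "M.arrow i" "M.arrow s" "M.arrow j" "M.arrow p"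
    and "\<delta> i = M.azero Y C 1" "\<delta> s = M.azero C Y 1" "\<delta> j = M.azero X C 0" "\<delta> p = M.azero C X 2"
    and "M.level i \<le> 0" "M.level s \<le> 0" "M.level j \<le> 0" "M.level p \<le> 0"
    and "s \<cdot> i = M.aid Y" "p \<cdot> j = M.aid X" "p \<cdot> i = M.azero Y X 1" "s \<cdot> j = M.azero X Y (- 1)"
    and "i \<cdot> s \<^bold>+ j \<cdot> p = M.aid C"
proof -
  note O = X Y cone_complex_obj[OF X Y, of u, folded C_def]
  have n: "nsum C = nsum Y + nsum X" by (simp add: C_def)
  show t: "band_typed Y C 0 0 0" "band_typed C Y 0 0 0" "band_typed X C (- 1) (nsum Y) 0" "band_typed C X 1 0 (nsum Y)"
    by (auto simp: band_typed_def C_def)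
  show ar: "M.arrow i" "M.arrow s" "M.arrow j" "M.arrow p"
    "\<delta> i = M.azero Y C 1" "\<delta> s = M.azero C Y 1" "\<delta> j = M.azero X C 0" "\<delta> p = M.azero C X 2"
    using bnd_arrow[OF O(2,3) t(1)] bnd_arrow[OF O(3,2) t(2)] bnd_arrow[OF O(1,3) t(3)] bnd_arrow[OF O(3,1) t(4)]
    by (auto simp: i_def s_def j_def p_def)
  show "M.level i \<le> 0" "M.level s \<le> 0" "M.level j \<le> 0" "M.level p \<le> 0"
    unfolding i_def s_def j_def p_def using O t by (auto intro!: bnd_level simp: C_def)
  show "s \<cdot> i = M.aid Y"
    using bnd_comp(1)[OF O(2,3,2) t(1,2), of 0 0] n
    by (simp add: band_typed_id s_def i_def) (simp add: bnd_def M.aid_def mat_id_band)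
  show "p \<cdot> j = M.aid X"
    using bnd_comp(1)[OF O(1,3,1) t(3,4), of 0 0] n
    by (simp add: band_typed_id p_def j_def) (simp add: bnd_def M.aid_def mat_id_band)
  show "p \<cdot> i = M.azero Y X 1" unfolding p_def i_def
    using bnd_comp(2)[OF O(2,3,1) t(1,4)] by simp
  show "s \<cdot> j = M.azero X Y (- 1)" unfolding s_def j_def
    using bnd_comp(2)[OF O(1,3,2) t(3,2)] by simp
  show "i \<cdot> s \<^bold>+ j \<cdot> p = M.aid C"
  proof (rule M_arr_eqI)
    fix a b assume "a < nsum (tgt (M.aid C))" "b < nsum (src (M.aid C))"
    then have ab: "a < nsum C" "b < nsum C" by simp_all
    let ?G = "gpart (shom A (smd C b) (smd C a)) 0"
    have oa: "smd C b \<in> Ob" "smd C a \<in> Ob" using O(3) ab by (auto intro: smd_Ob)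
    interpret G: abelian_group ?G using oa by (rule hm_group)
    have sid: "sid (smd C b) \<in> carrier ?G" if "a = b" using that oa by (simp add: sid_closed)
    have "elt (i \<cdot> s) (a, b) = (if a < nsum Y \<and> a = b then sid (smd C b) else \<zero>\<^bsub>?G\<^esub>)"
      using bnd_comp_entry[OF O(3,2,3) t(2,1) ab] by (auto simp: i_def s_def)
    moreover have "elt (j \<cdot> p) (a, b) = (if \<not> a < nsum Y \<and> a = b then sid (smd C b) else \<zero>\<^bsub>?G\<^esub>)"
    proof -
      have "(\<exists>k<nsum X. a + 0 = k + nsum Y \<and> k + nsum Y = b + 0) \<longleftrightarrow> \<not> a < nsum Y \<and> a = b"
        using ab n by (auto intro!: exI[of _ "a - nsum Y"])
      then show ?thesis using bnd_comp_entry[OF O(3,1,3) t(4,3) ab] by (simp add: j_def p_def)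
    qed
    moreover have "elt (M.aid C) (a, b) = (if a = b then sid (smd C b) else \<zero>\<^bsub>?G\<^esub>)"
      using ab by (simp add: M.aid_def mat_id_band band_entry)
    moreover have "elt (i \<cdot> s \<^bold>+ j \<cdot> p) (a, b) = elt (i \<cdot> s) (a, b) \<oplus>\<^bsub>?G\<^esub> elt (j \<cdot> p) (a, b)"
      using ab by (simp add: M.aadd_def mat_module_simps i_def s_def)
    ultimately show "elt (i \<cdot> s \<^bold>+ j \<cdot> p) (a, b) = elt (M.aid C) (a, b)"
      using G.l_zero[OF sid] G.r_zero[OF sid] G.l_zero[OF G.zero_closed] by auto
  qed (use ar O in \<open>simp_all add: i_def s_def j_def p_def\<close>)
qed

text \<open>Entries are compared here once and for all. With this formula for the Maurer-Cartan element its
  equation and the relations of a cone follow from those between \<open>i\<close>, \<open>p\<close>, \<open>j\<close> and \<open>s\<close>.\<close>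

lemma cone_complex_Q:
  assumes X: "X \<in> mat_obj" "M.arrow (Q X)" and Y: "Y \<in> mat_obj" "M.arrow (Q Y)"
    and u: "M.arrow f" "src f = X" "tgt f = Y" "deg f = 0"
  defines "C \<equiv> cone_complex X Y (elt f)"
  defines "i \<equiv> bnd Y C 0 0 0" and "s \<equiv> bnd C Y 0 0 0" and "j \<equiv> bnd X C (- 1) (nsum Y) 0" and "p \<equiv> bnd C X 1 0 (nsum Y)"
  shows "Q C = i \<cdot> Q Y \<cdot> s \<^bold>+ \<^bold>- (j \<cdot> Q X \<cdot> p) \<^bold>+ i \<cdot> f \<cdot> p"
proof -
  let ?R = "i \<cdot> Q Y \<cdot> s \<^bold>+ \<^bold>- (j \<cdot> Q X \<cdot> p) \<^bold>+ i \<cdot> f \<cdot> p"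
  note B = cone_bands[OF X(1) Y(1), of "elt f", folded C_def, folded i_def s_def j_def p_def]
  note ends = i_def s_def j_def p_def
  note O = X(1) Y(1) cone_complex_obj[OF X(1) Y(1), of "elt f", folded C_def]
  have n: "nsum C = nsum Y + nsum X" by (simp add: C_def)
  have d: "src i = Y" "tgt i = C" "deg i = 0" "src s = C" "tgt s = Y" "deg s = 0"
    "src j = X" "tgt j = C" "deg j = -1" "src p = C" "tgt p = X" "deg p = 1" by (simp_all add: ends)
  have ar: "M.arrow (i \<cdot> Q Y \<cdot> s)" "M.arrow (j \<cdot> Q X \<cdot> p)" "M.arrow (i \<cdot> f \<cdot> p)" "M.arrow ?R"
    using B(5-8) X Y u d by simp_all
  have "tmat C = elt ?R"
  proof (rule extensionalityI)
    show "tmat C \<in> extensional (mat_indices C C)" unfolding C_def by (auto simp: cone_complex_def)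
    have "elt ?R \<in> carrier (mat_module A C C 1)" using ar(4) d by (simp add: M.arrow_def del: M.arrow_ends)
    then show "elt ?R \<in> extensional (mat_indices C C)" by (simp add: mat_module_simps PiE_iff)
    fix q assume "q \<in> mat_indices C C"
    then obtain a b where ab: "a < nsum C" "b < nsum C" "q = (a, b)" by auto
    let ?G = "gpart (shom A (smd C b) (smd C a)) 1"
    interpret G: abelian_group ?G using O(3) ab by (intro hm_group smd_Ob)
    have car: "elt g (a, b) \<in> carrier ?G" if "M.arrow g" "src g = C" "tgt g = C" "deg g = 1" for g
      using mat_entry[of "elt g" C C 1 "(a, b)"] that ab by (simp add: M.arrow_def del: M.arrow_ends)
    have e1: "elt (i \<cdot> Q Y \<cdot> s) (a, b) = (if a < nsum Y \<and> b < nsum Y then tmat Y (a, b) else \<zero>\<^bsub>?G\<^esub>)"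
      using sandwich_entry[OF O(3,2,2,3) B(1,2) Y(2) _ _ ab(1,2)] by (simp add: ends)
    have e2: "elt (j \<cdot> Q X \<cdot> p) (a, b)
      = (if \<not> a < nsum Y \<and> \<not> b < nsum Y then tmat X (a - nsum Y, b - nsum Y) else \<zero>\<^bsub>?G\<^esub>)"
      using sandwich_entry[OF O(3,1,1,3) B(3,4) X(2) _ _ ab(1,2)] ab n by (auto simp: ends)
    have e3: "elt (i \<cdot> f \<cdot> p) (a, b) = (if a < nsum Y \<and> \<not> b < nsum Y then elt f (a, b - nsum Y) else \<zero>\<^bsub>?G\<^esub>)"
      using sandwich_entry[OF O(3,1,2,3) B(1,4) u(1-3) ab(1,2)] ab n u(4) by (auto simp: ends)
    have c: "elt (i \<cdot> Q Y \<cdot> s) (a, b) \<in> carrier ?G" "elt (j \<cdot> Q X \<cdot> p) (a, b) \<in> carrier ?G" "elt (i \<cdot> f \<cdot> p) (a, b) \<in> carrier ?G"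
      using ar d u(4) by (simp_all add: car)
    have "elt (j \<cdot> Q X \<cdot> p) \<in> carrier (mat_module A C C 1)" using ar(2) d by (simp add: M.arrow_def del: M.arrow_ends)
    from mat_neg[OF O(3,3) this] have "elt (\<^bold>- (j \<cdot> Q X \<cdot> p)) (a, b) = \<ominus>\<^bsub>?G\<^esub> elt (j \<cdot> Q X \<cdot> p) (a, b)"
      using ab d by (simp add: M.aneg_def)
    then have R: "elt ?R (a, b) = elt (i \<cdot> Q Y \<cdot> s) (a, b) \<oplus>\<^bsub>?G\<^esub> (\<ominus>\<^bsub>?G\<^esub> elt (j \<cdot> Q X \<cdot> p) (a, b) \<oplus>\<^bsub>?G\<^esub> elt (i \<cdot> f \<cdot> p) (a, b))"
      using ab d by (simp add: M.aadd_def[of "i \<cdot> Q Y \<cdot> s"] M.aadd_def[of "\<^bold>- (j \<cdot> Q X \<cdot> p)"] mat_module_simps)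
    have C: "tmat C (a, b) = (if a < nsum Y then (if b < nsum Y then tmat Y (a, b) else elt f (a, b - nsum Y))
       else if b < nsum Y then \<zero>\<^bsub>?G\<^esub> else \<ominus>\<^bsub>?G\<^esub> tmat X (a - nsum Y, b - nsum Y))"
    proof -
      have "gpart (shom A (smd Y b) (smd (deg_shift (- 1) X) (a - nsum Y))) 1 = ?G" if "\<not> a < nsum Y" "b < nsum Y"
        using that ab n by (simp add: C_def)
      moreover have "gpart (shom A (smd X (b - nsum Y)) (smd X (a - nsum Y))) 1 = ?G" if "\<not> a < nsum Y" "\<not> b < nsum Y"
        using that ab n unfolding C_def by (simp only: cone_complex_simps not_False_eq_True deg_shift_gpart)
      ultimately show ?thesis using ab n by (simp add: C_def) (simp add: cone_complex_def)
    qed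
    have zz: "\<ominus>\<^bsub>?G\<^esub> \<zero>\<^bsub>?G\<^esub> = \<zero>\<^bsub>?G\<^esub>" using G.l_neg[OF G.zero_closed] G.r_zero[OF G.a_inv_closed[OF G.zero_closed]] by simp
    have rl: "x \<oplus>\<^bsub>?G\<^esub> \<zero>\<^bsub>?G\<^esub> = x" "\<zero>\<^bsub>?G\<^esub> \<oplus>\<^bsub>?G\<^esub> x = x" if "x \<in> carrier ?G" for x
      using that by simp_all
    show "tmat C q = elt ?R q"
    proof (cases "a < nsum Y"; cases "b < nsum Y")
      assume "a < nsum Y" "b < nsum Y"
      then show ?thesis unfolding ab(3) C R using c G.zero_closed unfolding e1 e2 e3 by (simp only: zz rl if_True if_False simp_thms)
    next
      assume "a < nsum Y" "\<not> b < nsum Y"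
      then show ?thesis unfolding ab(3) C R using c G.zero_closed unfolding e1 e2 e3 by (simp only: zz rl if_True if_False simp_thms)
    next
      assume "\<not> a < nsum Y" "b < nsum Y"
      then show ?thesis unfolding ab(3) C R using c G.zero_closed unfolding e1 e2 e3 by (simp only: zz rl if_True if_False simp_thms)
    next
      assume "\<not> a < nsum Y" "\<not> b < nsum Y"
      then show ?thesis unfolding ab(3) C R using c G.zero_closed G.a_inv_closed unfolding e1 e2 e3 by (simp only: zz rl if_True if_False simp_thms)
    qed
  qed
  then show ?thesis using d by (intro arr.expand) simp
qed

text \<open>In \<open>\<delta> Q + Q Q\<close> the diagonal blocks are, up to sign, the equations for \<open>X\<close>
  and \<open>Y\<close>, and the block above the diagonal is the
  twisted differential of \<open>f\<close>. After twisting, \<open>i\<close> and \<open>p\<close> are still closed, and \<open>j\<close> has differential \<open>i f\<close>.\<close>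

lemma cone_complex_twisted:
  assumes X: "twisted_complex A X" and Y: "twisted_complex A Y" and f: "TW.cocycle 0 f" "src f = X" "tgt f = Y"
  defines "C \<equiv> cone_complex X Y (elt f)"
  defines "i \<equiv> bnd Y C 0 0 0" and "s \<equiv> bnd C Y 0 0 0" and "j \<equiv> bnd X C (- 1) (nsum Y) 0" and "p \<equiv> bnd C X 1 0 (nsum Y)"
  shows "twisted_complex A C" "TW.cone f i p j s"
proof -
  note X' = twistedD[OF X] and Y' = twistedD[OF Y]
  note B = cone_bands[OF X'(1) Y'(1), of "elt f", folded C_def, folded i_def s_def j_def p_def]
  have d: "src i = Y" "tgt i = C" "deg i = 0" "src s = C" "tgt s = Y" "deg s = 0"
    "src j = X" "tgt j = C" "deg j = -1" "src p = C" "tgt p = X" "deg p = 1"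
    by (simp_all add: i_def s_def j_def p_def)
  have f': "M.arrow f" "deg f = 0" "M.level f \<le> 0"
    using f TW.cocycleD[OF f(1)] TW.cocycle_level0[OF f(1)] by (auto simp: TW_arrow TW_simps)
  have O: "C \<in> mat_obj" using cone_complex_obj[OF X'(1) Y'(1)] by (simp add: C_def)
  have "\<delta> f \<^bold>+ Q Y \<cdot> f \<^bold>+ \<^bold>- (f \<cdot> Q X) = M.azero X Y 1"
    using TW.cocycleD(4)[OF f(1)] TW_abd[OF TW.cocycleD(1)[OF f(1)]] f f' by (simp add: TW_simps)
  then have "Q Y \<cdot> f \<^bold>+ \<^bold>- (f \<cdot> Q X) = \<^bold>- \<delta> f"
    using f f' X' Y' by (intro M.aneg_unique) simp_all
  from arg_cong[OF this, of M.aneg] have df: "\<delta> f = \<^bold>- (Q Y \<cdot> f) \<^bold>+ f \<cdot> Q X"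
    using f f' X' Y' by simp
  have QC: "Q C = i \<cdot> Q Y \<cdot> s \<^bold>+ \<^bold>- (j \<cdot> Q X \<cdot> p) \<^bold>+ i \<cdot> f \<cdot> p"
    using cone_complex_Q[OF X'(1,2) Y'(1,2) f'(1) f(2,3) f'(2)] by (simp add: C_def i_def s_def j_def p_def)
  have R: "s \<cdot> i \<cdot> x = x" if "M.arrow x" "tgt x = Y" for x using M.precomp[OF B(17), of x] that B d Y' by simp
  have R2: "p \<cdot> j \<cdot> x = x" if "M.arrow x" "tgt x = X" for x using M.precomp[OF B(18), of x] that B d X' by simp
  have R3: "p \<cdot> i \<cdot> x = M.azero (src x) X (1 + deg x)" if "M.arrow x" "tgt x = Y" for x
    using M.precomp[OF B(19), of x] that B d X' by simp
  have R4: "s \<cdot> j \<cdot> x = M.azero (src x) Y (- 1 + deg x)" if "M.arrow x" "tgt x = X" for x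
    using M.precomp[OF B(20), of x] that B d Y' by simp
  note S = B(5-20) d R R2 R3 R4 f f' X' Y' df O
  show C: "twisted_complex A C"
  proof (rule twistedI[OF O])
    show "M.arrow (Q C)" unfolding QC by (simp add: S)
    show "M.level (Q C) \<le> 0" unfolding QC by (intro M.level_add M.level_neg M.level_comp) (simp_all add: S)
    show "\<delta> (Q C) \<^bold>+ Q C \<cdot> Q C = M.azero C C 2" unfolding QC by (simp add: S)
    fix a b assume ab: "a < nsum C" "b < nsum C" "b \<le> a"
    then have ab': "a < nsum Y + nsum X" "b < nsum Y + nsum X" by (simp_all add: C_def)
    show "tmat C (a, b) = \<zero>\<^bsub>gpart (shom A (smd C b) (smd C a)) 1\<^esub>"
    proof (cases "b < nsum Y")
      case True
      have "tmat C (a, b) = (if a < nsum Y then tmat Y (a, b)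
          else \<zero>\<^bsub>gpart (shom A (smd Y b) (smd (deg_shift (- 1) X) (a - nsum Y))) 1\<^esub>)"
        using True ab' unfolding C_def cone_complex_def by simp
      moreover have "smd C a = (if a < nsum Y then smd Y a else smd (deg_shift (- 1) X) (a - nsum Y))" "smd C b = smd Y b"
        using True ab' unfolding C_def by simp_all
      ultimately show ?thesis using Y'(6)[of a b] True ab(3) by (cases "a < nsum Y") simp_all
    next
      case False
      then have k: "a - nsum Y < nsum X" "b - nsum Y < nsum X" "b - nsum Y \<le> a - nsum Y" "\<not> a < nsum Y" using ab ab' by auto
      interpret G: abelian_group "gpart (shom A (smd X (b - nsum Y)) (smd X (a - nsum Y))) 1"
        using X'(1) k by (intro hm_group smd_Ob)
      have "tmat C (a, b) = \<zero>\<^bsub>gpart (shom A (smd X (b - nsum Y)) (smd X (a - nsum Y))) 1\<^esub>"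
        using False k X'(6)[OF k(1-3)] ab' by (simp add: C_def cone_complex_def)
      also have "gpart (shom A (smd X (b - nsum Y)) (smd X (a - nsum Y))) 1 = gpart (shom A (smd C b) (smd C a)) 1"
        using False k ab' unfolding C_def by (simp only: cone_complex_simps not_False_eq_True deg_shift_gpart)
      finally show ?thesis .
    qed
  qed
  have ar: "TW.arrow i" "TW.arrow s" "TW.arrow j" "TW.arrow p" using C X Y by (simp_all add: TW_arrow S)
  have "TW.abd i = M.azero Y C 1" "TW.abd p = M.azero C X 2" "TW.abd j = i \<cdot> f"
    unfolding TW_abd[OF ar(1)] TW_abd[OF ar(3)] TW_abd[OF ar(4)] by (simp_all add: S QC)
  then show "TW.cone f i p j s" unfolding TW.cone_def TW_simps using ar B f d by simp
qed

lemma Tw_shift_simps [simp]: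
  "nsum (Tw_shift t X) = nsum X" "tmat (Tw_shift t X) = tmat X"
  "i < nsum X \<Longrightarrow> smd (Tw_shift t X) i = add_shift t (smd X i)"
  by (simp_all add: Tw_shift_def)

lemma add_shift_simps [simp]:
  "base (add_shift t S) = base S" "dshift (add_shift t S) = dshift S" "rshift (add_shift t S) = rshift S + t"
  by (simp_all add: add_shift_def)

text \<open>All statements on shifts of twisted complexes reduce to these: \<open>\<Sigma>\<close> changes neither degrees nor
  differentials nor composition, only levels.\<close>

lemma add_shift_shom:
  "gpart (shom A (add_shift r S) (add_shift s T)) i = gpart (shom A S T) i"
  "bdry (shom A (add_shift r S) (add_shift s T)) i f = bdry (shom A S T) i f"
  "flev (shom A (add_shift r S) (add_shift s T)) i f = flev (shom A S T) i f + ereal (s - r)"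
  "scomp A (add_shift r S) (add_shift s T) (add_shift t U) j i g f = scomp A S T U j i g f"
  proof -
  have "rshift T + s - (rshift S + r) = (rshift T - rshift S) + (s - r)" by simp
  then show "flev (shom A (add_shift r S) (add_shift s T)) i f = flev (shom A S T) i f + ereal (s - r)"
    by (simp only: shom_simps add_shift_simps plus_ereal.simps(1)[symmetric] add.assoc)
qed (simp_all add: shom_simps)

lemma Tw_shift_module: "mat_module A (Tw_shift r X) (Tw_shift s Y) l = mat_module A X Y l"
proof -
  have E: "E (Tw_shift r X) (Tw_shift s Y) p l = E X Y p l" if "p \<in> mat_indices X Y" for p
    using that by (auto simp: add_shift_shom)
  have I: "mat_indices (Tw_shift r X) (Tw_shift s Y) = mat_indices X Y" by simp
  have R: "(\<lambda>p \<in> mat_indices X Y. F (E (Tw_shift r X) (Tw_shift s Y) p l) p) = (\<lambda>p \<in> mat_indices X Y. F (E X Y p l) p)"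
    for F :: "('a, 'm) module \<Rightarrow> nat \<times> nat \<Rightarrow> 'm" by (rule restrict_ext) (simp only: E)
  show ?thesis unfolding mat_module_def I
    using R[of "\<lambda>M p. \<zero>\<^bsub>M\<^esub>"] R[of "\<lambda>M p. f p \<oplus>\<^bsub>M\<^esub> g p" for f g] R[of "\<lambda>M p. a \<odot>\<^bsub>M\<^esub> f p" for a f]
    by (simp only: E cong: PiE_cong)
qed

lemma Tw_shift_bdry: "mat_bdry A (Tw_shift r X) (Tw_shift s Y) l f = mat_bdry A X Y l f"
  by (auto simp: mat_bdry_def add_shift_shom intro!: restrict_ext)

lemma Tw_shift_comp:
  assumes "X \<in> mat_obj" "Y \<in> mat_obj" "Z \<in> mat_obj" "f \<in> carrier (mat_module A X Y l)" "g \<in> carrier (mat_module A Y Z m)"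
  shows "mat_comp A (Tw_shift r X) (Tw_shift s Y) (Tw_shift t Z) m l g f = mat_comp A X Y Z m l g f"
proof -
  have "mat_comp A (Tw_shift r X) (Tw_shift s Y) (Tw_shift t Z) m l g f (i, j) = mat_comp A X Y Z m l g f (i, j)"
    if ij: "i < nsum Z" "j < nsum X" for i j
  proof -
    let ?G = "gpart (shom A (smd X j) (smd Z i)) (m + l)"
    interpret G: abelian_group ?G using assms ij by (intro hm_group smd_Ob)
    have "(\<Oplus>\<^bsub>?G\<^esub>k\<in>{..<nsum Y}. scomp A (smd (Tw_shift r X) j) (smd (Tw_shift s Y) k) (smd (Tw_shift t Z) i) m l (g (i, k)) (f (k, j)))
      = (\<Oplus>\<^bsub>?G\<^esub>k\<in>{..<nsum Y}. scomp A (smd X j) (smd Y k) (smd Z i) m l (g (i, k)) (f (k, j)))"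
      by (rule G.finsum_cong'[OF refl]) (use ij mat_comp_summand[OF assms ij] in \<open>auto simp: add_shift_shom\<close>)
    then show ?thesis using ij by (simp add: mat_comp_entry add_shift_shom)
  qed
  then show ?thesis by (auto simp: mat_comp_def[of A] fun_eq_iff restrict_def)
qed

lemma Tw_shift_obj: "X \<in> mat_obj \<Longrightarrow> Tw_shift t X \<in> mat_obj"
  by (auto simp: mat_obj_def Tw_shift_def shom_simps(6))

lemma Tw_shift_lev:
  "mat_lev (Tw_shift r X) (Tw_shift s Y) l f = mat_lev X Y l f + ereal (s - r)"
proof -
  have "mat_lev (Tw_shift r X) (Tw_shift s Y) l f = (SUP p \<in> mat_indices X Y. flev (entry_complex A X Y p) l (f p) + ereal (s - r))"
    unfolding mat_lev_def by (rule SUP_cong) (auto simp: add_shift_shom)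
  also have "\<dots> = mat_lev X Y l f + ereal (s - r)"
  proof (cases "mat_indices X Y = {}")
    case True
    then show ?thesis unfolding mat_lev_def True by (simp add: bot_ereal_def)
  next
    case False
    then show ?thesis unfolding mat_lev_def by (intro SUP_ereal_add_left) simp_all
  qed
  finally show ?thesis .
qed

lemma twisted_mat: "twisted_complex A X \<Longrightarrow> tmat X \<in> carrier (mat_module A X X 1)"
  using twistedD(2)[of X] by (simp add: Q_def M.arrow_Arr)

lemma Tw_shift_twisted:
  assumes "twisted_complex A X" shows "twisted_complex A (Tw_shift t X)"
proof -
  note X = twistedD(1)[OF assms] and q = twisted_mat[OF assms]
  have "gpart (shom A (smd (Tw_shift t X) j) (smd (Tw_shift t X) i)) 1 = gpart (shom A (smd X j) (smd X i)) 1"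
    if "i < nsum X" "j < nsum X" for i j using that by (simp add: add_shift_shom)
  moreover have "flev (shom A (smd (Tw_shift t X) j) (smd (Tw_shift t X) i)) 1 x = flev (shom A (smd X j) (smd X i)) 1 x"
    if "i < nsum X" "j < nsum X" for i j x using that by (simp add: add_shift_shom zero_ereal_def[symmetric])
  moreover have "set (summands (Tw_shift t X)) \<subseteq> Ob" using Tw_shift_obj[OF X, of t] by (simp add: mat_obj_def)
  ultimately show ?thesis
    using assms unfolding twisted_complex_def
    by (simp add: Tw_shift_module Tw_shift_bdry Tw_shift_comp[OF X X X q q])
qed

lemma Tw_shift_band:
  "band (Tw_shift r X) (Tw_shift s Y) l a b = band X Y l a b"
  by (auto simp: band_def add_shift_shom shom_simps(5) intro!: restrict_ext)

lemma Tw_shift_deg_shift: "Tw_shift t (deg_shift e X) = deg_shift e (Tw_shift t X)"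
proof -
  have "tmat (deg_shift e X) = tmat (deg_shift e (Tw_shift t X))"
    by (auto simp: deg_shift_def add_shift_shom intro!: restrict_ext)
  moreover have "summands (Tw_shift t (deg_shift e X)) = summands (deg_shift e (Tw_shift t X))"
    by (simp add: deg_shift_def Tw_shift_def add_shift_def)
  ultimately show ?thesis by (simp add: Tw_shift_def deg_shift_def)
qed

lemma Tw_shift_add:
  fixes X :: "('x, 'y) twisted"
  shows "Tw_shift t (Tw_shift s X) = Tw_shift (t + s) X" "Tw_shift 0 X = X"
proof -
  have "add_shift t \<circ> add_shift s = (add_shift (t + s) :: 'x shifted \<Rightarrow> _)" for t s
    by (simp add: fun_eq_iff add_shift_def)
  then show "Tw_shift t (Tw_shift s X) = Tw_shift (t + s) X" unfolding Tw_shift_def by (simp only: twisted.simps map_map)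
  have "add_shift 0 = (id :: 'x shifted \<Rightarrow> _)" by (simp add: fun_eq_iff add_shift_def)
  then show "Tw_shift 0 X = X" by (simp add: Tw_shift_def)
qed

lemma zero_complex: "twisted_complex A \<lparr> summands = [], tmat = (\<lambda>_. undefined) \<rparr>"
  by (simp add: twisted_complex_def mat_module_def mat_bdry_def mat_comp_def restrict_def)

text \<open>The degree of a morphism grows with the shift of its target, so the translation, with comparison
  maps \<open>X \<rightarrow> T X\<close> of degree \<open>-1\<close>, is the shift by \<open>-1\<close>.\<close>

theorem shifted_dg_category_Tw:
  "shifted_dg_category K (Tw A) (deg_shift (- 1))
    (\<lambda>X. band X (deg_shift (- 1) X) (- 1) 0 0) (\<lambda>X. band (deg_shift (- 1) X) X 1 0 0) Tw_shift"
proof (intro shifted_dg_category.intro suspended_dg_category.intro suspended_dg_category_axioms.intro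
    shifted_dg_category_axioms.intro level_dg_category_Tw)
  let ?T = "deg_shift (- 1)"
  have inv: "?T (deg_shift 1 X) = X" "deg_shift 1 (?T X) = X" if "twisted_complex A X" for X
    using deg_shift_inverse[OF that, of 1] deg_shift_inverse[OF that, of "- 1"] by simp_all
  show "bij_betw ?T (dgobj (Tw A)) (dgobj (Tw A))"
    by (rule bij_betw_byWitness[where f' = "deg_shift 1"]) (auto simp: Tw_simps inv deg_shift_twisted)
next
  fix X assume "X \<in> dgobj (Tw A)"
  then have X: "twisted_complex A X" by (simp add: Tw_simps)
  note X' = twistedD[OF X] and TX = deg_shift_twisted[OF X, of "- 1"]
  let ?T = "deg_shift (- 1)" and ?s = "bnd X (deg_shift (- 1) X) (- 1) 0 0" and ?t = "bnd (deg_shift (- 1) X) X 1 0 0"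
  note b = deg_shift_bnd[OF X'(1), of "- 1", simplified]
  note q = deg_shift_Q[OF X'(1,2), of "- 1", simplified]
  have ar: "TW.arrow ?s" "TW.arrow ?t" using X TX b by (simp_all add: TW_arrow)
  have st: "?s = Arr X (?T X) (- 1) (band X (?T X) (- 1) 0 0)" "?t = Arr (?T X) X 1 (band (?T X) X 1 0 0)"
    by (simp_all add: bnd_def)
  have tsx: "?t \<cdot> ?s \<cdot> x = x" if "M.arrow x" "tgt x = X" for x
    using M.precomp[OF b(8), of x] that b X'(1) by simp
  show "TW.arrow (Arr X (?T X) (- 1) (band X (?T X) (- 1) 0 0)) \<and> TW.arrow (Arr (?T X) X 1 (band (?T X) X 1 0 0))"
    using ar unfolding st by blast
  show "TW.level (Arr X (?T X) (- 1) (band X (?T X) (- 1) 0 0)) \<le> 0 \<and> TW.level (Arr (?T X) X 1 (band (?T X) X 1 0 0)) \<le> 0"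
    using b unfolding st[symmetric] TW_simps by simp
  have "TW.abd ?s = TW.azero X (?T X) 0" "TW.abd ?t = TW.azero (?T X) X 2"
    unfolding TW_abd[OF ar(1)] TW_abd[OF ar(2)] TW_simps using b X' q(1) twistedD(1)[OF TX]
    by (simp_all add: q(2) tsx)
  then show "TW.abd (Arr X (?T X) (- 1) (band X (?T X) (- 1) 0 0)) = TW.azero X (?T X) 0 \<and>
      TW.abd (Arr (?T X) X 1 (band (?T X) X 1 0 0)) = TW.azero (?T X) X 2"
    unfolding st by blast
  show "TW.acomp (Arr (?T X) X 1 (band (?T X) X 1 0 0)) (Arr X (?T X) (- 1) (band X (?T X) (- 1) 0 0)) = TW.aid X \<and>
      TW.acomp (Arr X (?T X) (- 1) (band X (?T X) (- 1) 0 0)) (Arr (?T X) X 1 (band (?T X) X 1 0 0)) = TW.aid (?T X)"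
    using b(7,8) unfolding st[symmetric] TW_simps by simp
  fix t
  show "Tw_shift t X \<in> dgobj (Tw A)" using Tw_shift_twisted[OF X] by (simp add: Tw_simps)
  show "Tw_shift 0 X = X" "Tw_shift t (Tw_shift s X) = Tw_shift (t + s) X" for s by (rule Tw_shift_add)+
  show "Tw_shift t (?T X) = ?T (Tw_shift t X)" by (rule Tw_shift_deg_shift)
  show "dgid (Tw A) (Tw_shift t X) = dgid (Tw A) X" by (simp add: Tw_simps mat_id_band Tw_shift_band)
  show "band (Tw_shift t X) (?T (Tw_shift t X)) (- 1) 0 0 = band X (?T X) (- 1) 0 0"
    "band (?T (Tw_shift t X)) (Tw_shift t X) 1 0 0 = band (?T X) X 1 0 0"
    unfolding Tw_shift_deg_shift[symmetric] by (rule Tw_shift_band)+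
next
  fix f assume f: "TW.cocycle 0 f"
  then have "twisted_complex A (src f)" "twisted_complex A (tgt f)" using TW.cocycleD(1)[OF f] by (simp_all add: TW_arrow)
  from cone_complex_twisted(2)[OF this f refl refl] show "\<exists>i p j s. TW.cone f i p j s" by blast
next
  let ?Z = "\<lparr> summands = [], tmat = (\<lambda>_. undefined) \<rparr> :: ('o, 'm) twisted"
  show "\<exists>Z\<in>dgobj (Tw A). TW.aid Z = TW.azero Z Z 0"
    by (rule bexI[of _ ?Z])
      (use zero_complex in \<open>simp_all add: M.aid_def M.azero_def Tw_simps mat_id_band band_def mat_module_simps restrict_def\<close>)
next
  fix X Y r s i assume "X \<in> dgobj (Tw A)" "Y \<in> dgobj (Tw A)"
  then have X: "twisted_complex A X" and Y: "twisted_complex A Y" by (simp_all add: Tw_simps)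
  note O = twistedD(1)[OF X] twistedD(1)[OF Y] and q = twisted_mat[OF X] twisted_mat[OF Y]
  show "gpart (dghom (Tw A) (Tw_shift r X) (Tw_shift s Y)) i = gpart (dghom (Tw A) X Y) i"
    by (simp add: Tw_simps Tw_shift_module)
  fix f assume "f \<in> carrier (gpart (dghom (Tw A) X Y) i)"
  then have f: "f \<in> carrier (mat_module A X Y i)" by (simp add: Tw_simps)
  show "bdry (dghom (Tw A) (Tw_shift r X) (Tw_shift s Y)) i f = bdry (dghom (Tw A) X Y) i f"
    by (simp add: Tw_simps M.twisted_bd_def Tw_shift_module Tw_shift_bdry Tw_shift_comp[OF O(1,2,2) f q(2)]
        Tw_shift_comp[OF O(1,1,2) q(1) f])
  show "flev (dghom (Tw A) (Tw_shift r X) (Tw_shift s Y)) i f = flev (dghom (Tw A) X Y) i f + ereal (s - r)"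
    by (simp add: Tw_simps Tw_shift_lev)
next
  fix X Y Z f i g j r s t assume "X \<in> dgobj (Tw A)" "Y \<in> dgobj (Tw A)" "Z \<in> dgobj (Tw A)"
    "f \<in> carrier (gpart (dghom (Tw A) X Y) i)" "g \<in> carrier (gpart (dghom (Tw A) Y Z) j)"
  then show "dgcomp (Tw A) (Tw_shift r X) (Tw_shift s Y) (Tw_shift t Z) j i g f = dgcomp (Tw A) X Y Z j i g f"
    by (simp add: Tw_simps Tw_shift_comp twistedD(1))
qed

end

theorem proposition6p1p12:
  fixes K :: "('k, 'e) ring_scheme"
    and A :: "('o, 'k, 'm) fdg_category"
  assumes "filtered_dg_category K A"
  shows "triangulated_persistence_category K (H0 (Tw A)) (H0_Tw_shift A)"
proof -
  interpret A: level_dg_category K A by (rule level_dg_of_filtered[OF assms])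
  interpret B: matrix_category K A
    unfolding matrix_category_def by (rule A.level_dg_category_shift_completion)
  interpret S: shifted_dg_category K "Tw A" "B.deg_shift (- 1)"
    "\<lambda>X. B.band X (B.deg_shift (- 1) X) (- 1) 0 0" "\<lambda>X. B.band (B.deg_shift (- 1) X) X 1 0 0" Tw_shift
    by (rule B.shifted_dg_category_Tw)
  have "S.shift_functor = H0_Tw_shift A"
    by (simp add: S.shift_functor_def H0_Tw_shift_def)
  then show ?thesis
    using S.tpc_H0 unfolding triangulated_persistence_category_def by auto
qed

end
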